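(* Let $\mathcal T$ be a big tt-category with a good support--cosupport pair $(\mathrm s_\Gamma,\mathrm c_\Gamma)$ induced by $\Gamma\colon S\to\mathrm{Ob}(\mathcal T)$, and let $\mathcal K$ be a (compactly generated) $\mathcal T$-module. Let $\{\mathcal M_s\}_{s\in S}$ be a collection of smashing submodules of $\mathcal K$ such that $s\in S_{\mathcal M_s}$ for all $s\in S$. Then: (a) $\mathcal K$ satisfies cominimality if and only if $\mathcal K/\mathcal M_s$ satisfies cominimality, for all $s\in S$. (b) Suppose that $\mathcal K$ satisfies the colocal-to-global principle. Then $\mathcal K$ is costratified if and only if $\mathcal K/\mathcal M_s$ is costratified, for all $s\in S$.
   Context: A big tt-category is a rigidly-compactly generated tensor-triangulated category $\mathcal T=(\mathcal T,\otimes,1)$: a tensor-triangulated category with arbitrary coproducts (preserved by $\otimes$ in each variable), generated as a localizing subcategory by its compact objects, whose compact objects form an essentially small tensor-triangulated subcategory and coincide with the rigid objects. Its internal hom is $[-,-]$. A $\mathcal T$-module is a compactly generated triangulated category $\mathcal K$ with an action $\ast\colon\mathcal T\times\mathcal K\to\mathcal K$, a functor that is triangulated and coproduct-preserving in each variable, with natural isomorphisms $X\ast(Y\ast A)\cong(X\otimes Y)\ast A$ and $1\ast A\cong A$ satisfying the usual coherence conditions (Stevenson). $[X,-]_\ast$ denotes the right adjoint of $X\ast-$. A colocalizing $\hom$-submodule of $\mathcal K$ is a triangulated subcategory closed under products and under $[X,-]_\ast$ for all $X\in\mathcal T$; $\mathrm{Coloc}^{\hom}(\mathcal K)$ is the collection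 of these and $\mathrm{coloc}^{\hom}(\mathcal A)$ the smallest one containing $\mathcal A$. $I_{\mathcal K}$ is the product of the Brown--Comenetz duals of the compact objects of $\mathcal K$ (one for each object of a skeleton), the dual of $x$ being the object representing $\mathrm{Hom}_{\mathbb Z}(\mathrm{Hom}_{\mathcal K}(x,-),\mathbb Q/\mathbb Z)$; $\mathcal K$ is the smallest colocalizing subcategory containing $I_{\mathcal K}$. $S$ is a topological space, $\Gamma\colon S\to\mathrm{Ob}(\mathcal T)$ a map; $\mathrm s_\Gamma(X)=\{s\mid\Gamma_s\otimes X\neq0\}$, $\mathrm c_\Gamma(X)=\{s\mid[\Gamma_s,X]\neq0\}$. Good means $\Gamma_s\otimes\Gamma_r=0$ for $s\ne r$ and $\Gamma_s\otimes\Gamma_s\cong\Gamma_s\neq0$ for all $s$. For an object $A$ of a $\mathcal T$-module, $\mathrm c_\Gamma^\ast(A)=\{s\in S\mid[\Gamma_s,A]_\ast\neq0\}$. A smashing submodule $\mathcal M\subseteq\mathcal K$ is a localizing subcategory closed under $X\ast-$ for all $X\in\mathcal T$ that is smashing, i.e. the quotient functor $j_{\mathcal M}\colon\mathcal K\to\mathcal K/\mathcal M$ has a coproduct-preserving right adjoint $k_{\mathcal M}$. Then $k_{\mathcal M}$ has a right adjoint $\ell_{\mathcal M}\colon\mathcal K\to\mathcal K/\mathcal M$, and $\mathcal K/\mathcal M$ is a $\mathcal T$-module via $X\ast j_{\mathcal M}(B)=j_{\mathcal M}(X\ast B)$; its relative internal-hom is also denoted $[-,-]_\ast$, and for $\mathcal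 K/\mathcal M$ one uses $\ell_{\mathcal M}(I_{\mathcal K})$ (which cogenerates $\mathcal K/\mathcal M$ as a colocalizing subcategory) in the role of $I_{\mathcal K/\mathcal M}$. $\mathcal M^\perp=\{A\in\mathcal K\mid\mathrm{Hom}_{\mathcal K}(M,A)=0\ \forall M\in\mathcal M\}$ and $S_{\mathcal M}=\{s\in S\mid[\Gamma_s,I_{\mathcal K}]_\ast\in\mathcal M^\perp\}$. For a $\mathcal T$-module $\mathcal N$ (either $\mathcal K$, with $I=I_{\mathcal K}$, or $\mathcal K/\mathcal M$, with $I=\ell_{\mathcal M}(I_{\mathcal K})$): cominimality means that for all $s\in S$, $\mathrm{coloc}^{\hom}([\Gamma_s,I]_\ast)$ contains no colocalizing $\hom$-submodule of $\mathcal N$ other than $0$ and itself; the colocal-to-global principle means $\mathrm{coloc}^{\hom}(A)=\mathrm{coloc}^{\hom}([\Gamma_s,A]_\ast\mid s\in S)$ for all $A\in\mathcal N$; costratified means that $W\mapsto\{A\in\mathcal N\mid\mathrm c_\Gamma^\ast(A)\subseteq W\}$ and $\mathcal C\mapsto\bigcup_{A\in\mathcal C}\mathrm c_\Gamma^\ast(A)$ are mutually inverse bijections between the power set of $\mathrm c_\Gamma^\ast(I)$ and $\mathrm{Coloc}^{\hom}(\mathcal N)$. *)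

theory Defs
  imports
    "HOL-Algebra.Coset"
    "HOL-Algebra.FiniteProduct"
    "HOL-Library.Equipollence"
    "HOL-Analysis.Abstract_Topology"
begin

section \<open>Smallness\<close>

text \<open>
  Set-theoretic size is measured against a Grothendieck universe, i.e. a set \<open>U\<close> of uncountable
  strongly inaccessible cardinality; a set, of whatever type, is small if it has fewer elements
  than \<open>U\<close>. Objects of a category may form a set of any size. Small families are indexed by
  small subsets of the type of elements of \<open>U\<close>, which is no restriction up to reindexing.
\<close>

abbreviation small :: "'u set \<Rightarrow> 'a set \<Rightarrow> bool" where
  "small U A \<equiv> A \<prec> U"

definition grothendieck_universe :: "'u set \<Rightarrow> bool" where
  "grothendieck_universe U \<longleftrightarrow>
     small U (UNIV :: nat set) \<and>
     (\<forall>A\<subseteq>U. small U A \<longrightarrow> small U (Pow A)) \<and>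
     (\<forall>I F. I \<subseteq> U \<and> small U I \<and> (\<forall>i\<in>I. F i \<subseteq> U \<and> small U (F i)) \<longrightarrow> small U (\<Union>i\<in>I. F i))"


section \<open>Categories and functors\<close>

text \<open>\<open>Cmp g f\<close> is the composite ``\<open>f\<close> first, then \<open>g\<close>''.\<close>

record ('o, 'm) cat =
  Ob  :: "'o set"
  Arr :: "'m set"
  Dom :: "'m \<Rightarrow> 'o"
  Cod :: "'m \<Rightarrow> 'o"
  Ide :: "'o \<Rightarrow> 'm"
  Cmp :: "'m \<Rightarrow> 'm \<Rightarrow> 'm"  (infixl "\<cdot>\<index>" 70)

definition Hom :: "('o, 'm, 'x) cat_scheme \<Rightarrow> 'o \<Rightarrow> 'o \<Rightarrow> 'm set" where
  "Hom C x y = {f \<in> Arr C. Dom C f = x \<and> Cod C f = y}"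

locale category =
  fixes C :: "('o, 'm, 'x) cat_scheme" (structure)
  assumes dom_ob: "f \<in> Arr C \<Longrightarrow> Dom C f \<in> Ob C"
    and cod_ob: "f \<in> Arr C \<Longrightarrow> Cod C f \<in> Ob C"
    and ide_hom: "x \<in> Ob C \<Longrightarrow> Ide C x \<in> Hom C x x"
    and cmp_hom: "f \<in> Hom C x y \<Longrightarrow> g \<in> Hom C y z \<Longrightarrow> g \<cdot> f \<in> Hom C x z"
    and cmp_ide_right: "f \<in> Hom C x y \<Longrightarrow> f \<cdot> Ide C x = f"
    and cmp_ide_left: "f \<in> Hom C x y \<Longrightarrow> Ide C y \<cdot> f = f"
    and cmp_assoc: "f \<in> Hom C w x \<Longrightarrow> g \<in> Hom C x y \<Longrightarrow> h \<in> Hom C y z \<Longrightarrow>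
                      h \<cdot> (g \<cdot> f) = (h \<cdot> g) \<cdot> f"

definition locally_small :: "'u set \<Rightarrow> ('o, 'm, 'x) cat_scheme \<Rightarrow> bool" where
  "locally_small U C \<longleftrightarrow> (\<forall>x\<in>Ob C. \<forall>y\<in>Ob C. small U (Hom C x y))"

definition inverse_arrs :: "('o, 'm, 'x) cat_scheme \<Rightarrow> 'm \<Rightarrow> 'm \<Rightarrow> bool" where
  "inverse_arrs C f g \<longleftrightarrow>
     f \<in> Arr C \<and> g \<in> Hom C (Cod C f) (Dom C f) \<and>
     g \<cdot>\<^bsub>C\<^esub> f = Ide C (Dom C f) \<and> f \<cdot>\<^bsub>C\<^esub> g = Ide C (Cod C f)"

definition is_iso :: "('o, 'm, 'x) cat_scheme \<Rightarrow> 'm \<Rightarrow> bool" where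
  "is_iso C f \<longleftrightarrow> (\<exists>g. inverse_arrs C f g)"

definition inv_arr :: "('o, 'm, 'x) cat_scheme \<Rightarrow> 'm \<Rightarrow> 'm" where
  "inv_arr C f = (THE g. inverse_arrs C f g)"

definition isomorphic :: "('o, 'm, 'x) cat_scheme \<Rightarrow> 'o \<Rightarrow> 'o \<Rightarrow> bool" where
  "isomorphic C x y \<longleftrightarrow> (\<exists>f \<in> Hom C x y. is_iso C f)"

definition is_zero :: "('o, 'm, 'x) cat_scheme \<Rightarrow> 'o \<Rightarrow> bool" where
  "is_zero C z \<longleftrightarrow> z \<in> Ob C \<and> (\<forall>x\<in>Ob C. (\<exists>!f. f \<in> Hom C z x) \<and> (\<exists>!f. f \<in> Hom C x z))"

definition is_coproduct ::
  "('o, 'm, 'x) cat_scheme \<Rightarrow> 'i set \<Rightarrow> ('i \<Rightarrow> 'o) \<Rightarrow> 'o \<Rightarrow> ('i \<Rightarrow> 'm) \<Rightarrow> bool" where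
  "is_coproduct C I X P \<iota> \<longleftrightarrow>
     P \<in> Ob C \<and> (\<forall>i\<in>I. X i \<in> Ob C \<and> \<iota> i \<in> Hom C (X i) P) \<and>
     (\<forall>Y\<in>Ob C. \<forall>f. (\<forall>i\<in>I. f i \<in> Hom C (X i) Y) \<longrightarrow>
        (\<exists>!h. h \<in> Hom C P Y \<and> (\<forall>i\<in>I. h \<cdot>\<^bsub>C\<^esub> \<iota> i = f i)))"

definition is_product ::
  "('o, 'm, 'x) cat_scheme \<Rightarrow> 'i set \<Rightarrow> ('i \<Rightarrow> 'o) \<Rightarrow> 'o \<Rightarrow> ('i \<Rightarrow> 'm) \<Rightarrow> bool" where
  "is_product C I X P pr \<longleftrightarrow>
     P \<in> Ob C \<and> (\<forall>i\<in>I. X i \<in> Ob C \<and> pr i \<in> Hom C P (X i)) \<and>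
     (\<forall>Y\<in>Ob C. \<forall>f. (\<forall>i\<in>I. f i \<in> Hom C Y (X i)) \<longrightarrow>
        (\<exists>!h. h \<in> Hom C Y P \<and> (\<forall>i\<in>I. pr i \<cdot>\<^bsub>C\<^esub> h = f i)))"

definition has_small_coproducts :: "'u set \<Rightarrow> ('o, 'm, 'x) cat_scheme \<Rightarrow> bool" where
  "has_small_coproducts U C \<longleftrightarrow>
     (\<forall>(I :: 'u set) X. small U I \<and> X ` I \<subseteq> Ob C \<longrightarrow> (\<exists>P \<iota>. is_coproduct C I X P \<iota>))"

record ('o, 'm, 'p, 'n) func =
  fO :: "'o \<Rightarrow> 'p"
  fM :: "'m \<Rightarrow> 'n"

definition is_functor ::
  "('o, 'm, 'x) cat_scheme \<Rightarrow> ('p, 'n, 'y) cat_scheme \<Rightarrow> ('o, 'm, 'p, 'n) func \<Rightarrow> bool" where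
  "is_functor C D F \<longleftrightarrow>
     (\<forall>x\<in>Ob C. fO F x \<in> Ob D) \<and>
     (\<forall>f\<in>Arr C. fM F f \<in> Hom D (fO F (Dom C f)) (fO F (Cod C f))) \<and>
     (\<forall>x\<in>Ob C. fM F (Ide C x) = Ide D (fO F x)) \<and>
     (\<forall>f\<in>Arr C. \<forall>g\<in>Arr C. Cod C f = Dom C g \<longrightarrow> fM F (g \<cdot>\<^bsub>C\<^esub> f) = fM F g \<cdot>\<^bsub>D\<^esub> fM F f)"

definition prod_cat ::
  "('o, 'm, 'x) cat_scheme \<Rightarrow> ('p, 'n, 'y) cat_scheme \<Rightarrow> ('o \<times> 'p, 'm \<times> 'n) cat" where
  "prod_cat C D =
     \<lparr>Ob = Ob C \<times> Ob D, Arr = Arr C \<times> Arr D,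
      Dom = map_prod (Dom C) (Dom D), Cod = map_prod (Cod C) (Cod D),
      Ide = map_prod (Ide C) (Ide D),
      Cmp = (\<lambda>(g, g') (f, f'). (g \<cdot>\<^bsub>C\<^esub> f, g' \<cdot>\<^bsub>D\<^esub> f'))\<rparr>"

definition preserves_small_coproducts ::
  "'u set \<Rightarrow> ('o, 'm, 'x) cat_scheme \<Rightarrow> ('p, 'n, 'y) cat_scheme \<Rightarrow> ('o, 'm, 'p, 'n) func \<Rightarrow> bool" where
  "preserves_small_coproducts U C D F \<longleftrightarrow>
     (\<forall>(I :: 'u set) X P \<iota>. small U I \<and> is_coproduct C I X P \<iota> \<longrightarrow>
        is_coproduct D I (\<lambda>i. fO F (X i)) (fO F P) (\<lambda>i. fM F (\<iota> i)))"

definition right_adjoint ::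
  "('o, 'm, 'x) cat_scheme \<Rightarrow> ('p, 'n, 'y) cat_scheme \<Rightarrow>
     ('o, 'm, 'p, 'n) func \<Rightarrow> ('p, 'n, 'o, 'm) func \<Rightarrow> bool" where
  "right_adjoint C D F G \<longleftrightarrow>
     is_functor D C G \<and>
     (\<exists>\<phi>. (\<forall>x\<in>Ob C. \<forall>y\<in>Ob D. bij_betw (\<phi> x y) (Hom D (fO F x) y) (Hom C x (fO G y))) \<and>
          (\<forall>a\<in>Arr C. \<forall>b\<in>Arr D. \<forall>f\<in>Hom D (fO F (Cod C a)) (Dom D b).
             \<phi> (Dom C a) (Cod D b) (b \<cdot>\<^bsub>D\<^esub> f \<cdot>\<^bsub>D\<^esub> fM F a) =
             fM G b \<cdot>\<^bsub>C\<^esub> \<phi> (Cod C a) (Dom D b) f \<cdot>\<^bsub>C\<^esub> a))"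

text \<open>
  Right adjoints are only determined up to natural isomorphism; here and below one is chosen.
  Everything said about them later is invariant under isomorphism.
\<close>

definition radj ::
  "('o, 'm, 'x) cat_scheme \<Rightarrow> ('p, 'n, 'y) cat_scheme \<Rightarrow>
     ('o, 'm, 'p, 'n) func \<Rightarrow> ('p, 'n, 'o, 'm) func" where
  "radj C D F = (SOME G. right_adjoint C D F G)"


section \<open>Triangulated categories\<close>

text \<open>
  \<open>Zro x y\<close> is the zero morphism from \<open>x\<close> to \<open>y\<close>, \<open>Pls\<close> the addition of parallel morphisms,
  \<open>Sh\<close> the suspension functor; \<open>(f, g, h) \<in> Tri\<close> means that
  \<open>x \<rightarrow> y \<rightarrow> z \<rightarrow> \<Sigma> x\<close> with arrows \<open>f, g, h\<close> is distinguished.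
\<close>

record ('o, 'm) tricat = "('o, 'm) cat" +
  Zro :: "'o \<Rightarrow> 'o \<Rightarrow> 'm"
  Pls :: "'m \<Rightarrow> 'm \<Rightarrow> 'm"
  Sh  :: "('o, 'm, 'o, 'm) func"
  Tri :: "('m \<times> 'm \<times> 'm) set"

abbreviation ShO :: "('o, 'm, 'x) tricat_scheme \<Rightarrow> 'o \<Rightarrow> 'o" where
  "ShO C \<equiv> fO (Sh C)"

abbreviation ShM :: "('o, 'm, 'x) tricat_scheme \<Rightarrow> 'm \<Rightarrow> 'm" where
  "ShM C \<equiv> fM (Sh C)"

definition hom_group :: "('o, 'm, 'x) tricat_scheme \<Rightarrow> 'o \<Rightarrow> 'o \<Rightarrow> 'm monoid" where
  "hom_group C x y = \<lparr>carrier = Hom C x y, mult = Pls C, one = Zro C x y\<rparr>"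

definition neg :: "('o, 'm, 'x) tricat_scheme \<Rightarrow> 'm \<Rightarrow> 'm" where
  "neg C f = inv\<^bsub>hom_group C (Dom C f) (Cod C f)\<^esub> f"

definition is_additive_functor ::
  "('o, 'm, 'x) tricat_scheme \<Rightarrow> ('p, 'n, 'y) tricat_scheme \<Rightarrow> ('o, 'm, 'p, 'n) func \<Rightarrow> bool" where
  "is_additive_functor C D F \<longleftrightarrow> is_functor C D F \<and>
     (\<forall>x\<in>Ob C. \<forall>y\<in>Ob C. \<forall>f\<in>Hom C x y. \<forall>g\<in>Hom C x y.
        fM F (Pls C f g) = Pls D (fM F f) (fM F g))"

definition candidate_triangle :: "('o, 'm, 'x) tricat_scheme \<Rightarrow> 'm \<times> 'm \<times> 'm \<Rightarrow> bool" where
  "candidate_triangle C = (\<lambda>(f, g, h).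
     f \<in> Arr C \<and> g \<in> Arr C \<and> h \<in> Arr C \<and>
     Cod C f = Dom C g \<and> Cod C g = Dom C h \<and> Cod C h = ShO C (Dom C f))"

definition triangle_iso ::
  "('o, 'm, 'x) tricat_scheme \<Rightarrow> 'm \<times> 'm \<times> 'm \<Rightarrow> 'm \<times> 'm \<times> 'm \<Rightarrow> bool" where
  "triangle_iso C = (\<lambda>(f, g, h) (f', g', h').
     \<exists>a \<in> Hom C (Dom C f) (Dom C f'). \<exists>b \<in> Hom C (Dom C g) (Dom C g').
     \<exists>c \<in> Hom C (Dom C h) (Dom C h').
       is_iso C a \<and> is_iso C b \<and> is_iso C c \<and>
       b \<cdot>\<^bsub>C\<^esub> f = f' \<cdot>\<^bsub>C\<^esub> a \<and> c \<cdot>\<^bsub>C\<^esub> g = g' \<cdot>\<^bsub>C\<^esub> b \<and> ShM C a \<cdot>\<^bsub>C\<^esub> h = h' \<cdot>\<^bsub>C\<^esub> c)"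

locale additive_category = category C for C :: "('o, 'm, 'x) tricat_scheme" (structure) +
  assumes hom_comm_group: "x \<in> Ob C \<Longrightarrow> y \<in> Ob C \<Longrightarrow> comm_group (hom_group C x y)"
    and cmp_pls_left: "f \<in> Hom C x y \<Longrightarrow> g \<in> Hom C y z \<Longrightarrow> g' \<in> Hom C y z \<Longrightarrow>
           Pls C g g' \<cdot> f = Pls C (g \<cdot> f) (g' \<cdot> f)"
    and cmp_pls_right: "f \<in> Hom C x y \<Longrightarrow> f' \<in> Hom C x y \<Longrightarrow> g \<in> Hom C y z \<Longrightarrow>
           g \<cdot> Pls C f f' = Pls C (g \<cdot> f) (g \<cdot> f')"
    and zero_object: "\<exists>z. is_zero C z"
    and biproducts: "x \<in> Ob C \<Longrightarrow> y \<in> Ob C \<Longrightarrow>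
           \<exists>b\<in>Ob C. \<exists>i\<in>Hom C x b. \<exists>j\<in>Hom C y b. \<exists>p\<in>Hom C b x. \<exists>q\<in>Hom C b y.
             p \<cdot> i = Ide C x \<and> q \<cdot> j = Ide C y \<and> p \<cdot> j = Zro C y x \<and> q \<cdot> i = Zro C x y \<and>
             Pls C (i \<cdot> p) (j \<cdot> q) = Ide C b"

locale triangulated_category = additive_category C for C :: "('o, 'm, 'x) tricat_scheme" (structure) +
  assumes shift_additive: "is_additive_functor C C (Sh C)"
    and shift_fully_faithful: "x \<in> Ob C \<Longrightarrow> y \<in> Ob C \<Longrightarrow>
           bij_betw (ShM C) (Hom C x y) (Hom C (ShO C x) (ShO C y))"
    and shift_ess_surj: "y \<in> Ob C \<Longrightarrow> \<exists>x\<in>Ob C. isomorphic C (ShO C x) y"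
    and tri_candidate: "t \<in> Tri C \<Longrightarrow> candidate_triangle C t"
    and tri_iso: "t \<in> Tri C \<Longrightarrow> candidate_triangle C t' \<Longrightarrow> triangle_iso C t' t \<Longrightarrow> t' \<in> Tri C"
    and tri_ide: "x \<in> Ob C \<Longrightarrow> is_zero C z \<Longrightarrow> (Ide C x, Zro C x z, Zro C z (ShO C x)) \<in> Tri C"
    and tri_cone: "f \<in> Arr C \<Longrightarrow> \<exists>g h. (f, g, h) \<in> Tri C"
    and tri_rotate: "candidate_triangle C (f, g, h) \<Longrightarrow>
           (f, g, h) \<in> Tri C \<longleftrightarrow> (g, h, neg C (ShM C f)) \<in> Tri C"
    and tri_fill: "(f, g, h) \<in> Tri C \<Longrightarrow> (f', g', h') \<in> Tri C \<Longrightarrow>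
           a \<in> Hom C (Dom C f) (Dom C f') \<Longrightarrow> b \<in> Hom C (Cod C f) (Cod C f') \<Longrightarrow>
           b \<cdot> f = f' \<cdot> a \<Longrightarrow>
           \<exists>c \<in> Hom C (Cod C g) (Cod C g'). c \<cdot> g = g' \<cdot> b \<and> ShM C a \<cdot> h = h' \<cdot> c"
    and octahedral: "(f, f1, f2) \<in> Tri C \<Longrightarrow> (g, g1, g2) \<in> Tri C \<Longrightarrow> Cod C f = Dom C g \<Longrightarrow>
           (g \<cdot> f, h1, h2) \<in> Tri C \<Longrightarrow>
           \<exists>u v. (u, v, ShM C f1 \<cdot> g2) \<in> Tri C \<and>
             u \<cdot> f1 = h1 \<cdot> g \<and> h2 \<cdot> u = f2 \<and> v \<cdot> h1 = g1 \<and> g2 \<cdot> v = ShM C f \<cdot> h2"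

text \<open>A triangulated functor \<open>F\<close> comes with a natural isomorphism \<open>\<sigma> : F \<Sigma> \<rightarrow> \<Sigma> F\<close>.\<close>

definition is_triangulated_functor ::
  "('o, 'm, 'x) tricat_scheme \<Rightarrow> ('p, 'n, 'y) tricat_scheme \<Rightarrow>
     ('o, 'm, 'p, 'n) func \<Rightarrow> ('o \<Rightarrow> 'n) \<Rightarrow> bool" where
  "is_triangulated_functor C D F \<sigma> \<longleftrightarrow>
     is_additive_functor C D F \<and>
     (\<forall>x\<in>Ob C. \<sigma> x \<in> Hom D (fO F (ShO C x)) (ShO D (fO F x)) \<and> is_iso D (\<sigma> x)) \<and>
     (\<forall>f\<in>Arr C. \<sigma> (Cod C f) \<cdot>\<^bsub>D\<^esub> fM F (ShM C f) = ShM D (fM F f) \<cdot>\<^bsub>D\<^esub> \<sigma> (Dom C f)) \<and>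
     (\<forall>f g h. (f, g, h) \<in> Tri C \<longrightarrow> (fM F f, fM F g, \<sigma> (Dom C f) \<cdot>\<^bsub>D\<^esub> fM F h) \<in> Tri D)"

text \<open>All subcategories are full and replete, and are given by their sets of objects.\<close>

definition triangulated_subcategory :: "('o, 'm, 'x) tricat_scheme \<Rightarrow> 'o set \<Rightarrow> bool" where
  "triangulated_subcategory C A \<longleftrightarrow>
     A \<subseteq> Ob C \<and>
     (\<forall>x\<in>A. \<forall>y\<in>Ob C. isomorphic C x y \<longrightarrow> y \<in> A) \<and>
     (\<forall>z. is_zero C z \<longrightarrow> z \<in> A) \<and>
     (\<forall>x\<in>Ob C. ShO C x \<in> A \<longleftrightarrow> x \<in> A) \<and>
     (\<forall>f g h. (f, g, h) \<in> Tri C \<and> Dom C f \<in> A \<and> Cod C f \<in> A \<longrightarrow> Cod C g \<in> A)"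

definition localizing :: "'u set \<Rightarrow> ('o, 'm, 'x) tricat_scheme \<Rightarrow> 'o set \<Rightarrow> bool" where
  "localizing U C A \<longleftrightarrow> triangulated_subcategory C A \<and>
     (\<forall>(I :: 'u set) X P \<iota>. small U I \<and> X ` I \<subseteq> A \<and> is_coproduct C I X P \<iota> \<longrightarrow> P \<in> A)"

definition colocalizing :: "'u set \<Rightarrow> ('o, 'm, 'x) tricat_scheme \<Rightarrow> 'o set \<Rightarrow> bool" where
  "colocalizing U C A \<longleftrightarrow> triangulated_subcategory C A \<and>
     (\<forall>(I :: 'u set) X P pr. small U I \<and> X ` I \<subseteq> A \<and> is_product C I X P pr \<longrightarrow> P \<in> A)"

definition loc :: "'u set \<Rightarrow> ('o, 'm, 'x) tricat_scheme \<Rightarrow> 'o set \<Rightarrow> 'o set" where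
  "loc U C A = \<Inter> {L. localizing U C L \<and> A \<subseteq> L}"

definition finitely_supported_families ::
  "('o, 'm, 'x) tricat_scheme \<Rightarrow> 'o \<Rightarrow> 'i set \<Rightarrow> ('i \<Rightarrow> 'o) \<Rightarrow> ('i \<Rightarrow> 'm) set" where
  "finitely_supported_families C x I X =
     {g \<in> (\<Pi>\<^sub>E i\<in>I. Hom C x (X i)). finite {i \<in> I. g i \<noteq> Zro C x (X i)}}"

text \<open>
  \<open>x\<close> is compact if the canonical map from the direct sum of the groups \<open>Hom x (X i)\<close> to
  \<open>Hom x P\<close> is bijective for every small coproduct \<open>P\<close>. Since \<open>hom_group\<close> is
  written multiplicatively in the library, sums of morphisms are \<open>finprod\<close>s.
\<close>

definition compact_objects :: "'u set \<Rightarrow> ('o, 'm, 'x) tricat_scheme \<Rightarrow> 'o set" where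
  "compact_objects U C =
     {x \<in> Ob C. \<forall>(I :: 'u set) X P \<iota>. small U I \<and> is_coproduct C I X P \<iota> \<longrightarrow>
        bij_betw
          (\<lambda>g. finprod (hom_group C x P) (\<lambda>i. \<iota> i \<cdot>\<^bsub>C\<^esub> g i) {i \<in> I. g i \<noteq> Zro C x (X i)})
          (finitely_supported_families C x I X) (Hom C x P)}"

definition essentially_small :: "'u set \<Rightarrow> ('o, 'm, 'x) cat_scheme \<Rightarrow> 'o set \<Rightarrow> bool" where
  "essentially_small U C A \<longleftrightarrow> (\<exists>B\<subseteq>A. small U B \<and> (\<forall>x\<in>A. \<exists>y\<in>B. isomorphic C x y))"

locale compactly_generated = triangulated_category C
  for U :: "'u set" and C :: "('o, 'm, 'x) tricat_scheme" (structure) +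
  assumes loc_small: "locally_small U C"
    and coproducts: "has_small_coproducts U C"
    and generated: "\<exists>G \<subseteq> compact_objects U C. small U G \<and> loc U C G = Ob C"


section \<open>Brown--Comenetz duals\<close>

definition rat_group :: "rat monoid" where
  "rat_group = \<lparr>carrier = UNIV, mult = (+), one = 0\<rparr>"

definition QZ :: "rat set monoid" where
  "QZ = rat_group Mod \<int>"

definition characters :: "('o, 'm, 'x) tricat_scheme \<Rightarrow> 'o \<Rightarrow> 'o \<Rightarrow> ('m \<Rightarrow> rat set) set" where
  "characters C x y = hom (hom_group C x y) QZ \<inter> extensional (Hom C x y)"

definition is_BC_dual :: "('o, 'm, 'x) tricat_scheme \<Rightarrow> 'o \<Rightarrow> 'o \<Rightarrow> bool" where
  "is_BC_dual C x D \<longleftrightarrow> D \<in> Ob C \<and>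
     (\<exists>\<phi>. (\<forall>y\<in>Ob C. bij_betw (\<phi> y) (Hom C y D) (characters C x y)) \<and>
          (\<forall>h\<in>Arr C. \<forall>g\<in>Hom C (Cod C h) D. \<forall>f\<in>Hom C x (Dom C h).
             \<phi> (Dom C h) (g \<cdot>\<^bsub>C\<^esub> h) f = \<phi> (Cod C h) g (h \<cdot>\<^bsub>C\<^esub> f)))"

definition is_skeleton :: "('o, 'm, 'x) cat_scheme \<Rightarrow> 'o set \<Rightarrow> 'o set \<Rightarrow> bool" where
  "is_skeleton C A B \<longleftrightarrow> B \<subseteq> A \<and> (\<forall>x\<in>A. \<exists>!y. y \<in> B \<and> isomorphic C x y)"

definition BC_cogenerator :: "'u set \<Rightarrow> ('o, 'm, 'x) tricat_scheme \<Rightarrow> 'o" where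
  "BC_cogenerator U C =
     (SOME P. \<exists>B D pr. is_skeleton C (compact_objects U C) B \<and>
        (\<forall>x\<in>B. is_BC_dual C x (D x)) \<and> is_product C B D P pr)"


section \<open>Big tt-categories\<close>

text \<open>
  \<open>tsL x y : \<Sigma> x \<otimes> y \<rightarrow> \<Sigma> (x \<otimes> y)\<close> and \<open>tsR x y : x \<otimes> \<Sigma> y \<rightarrow> \<Sigma> (x \<otimes> y)\<close> are the
  isomorphisms making \<open>\<otimes>\<close> triangulated in each variable. The other structure isomorphisms are
  \<open>tassoc x y z : (x \<otimes> y) \<otimes> z \<rightarrow> x \<otimes> (y \<otimes> z)\<close>, \<open>tlunit x : 1 \<otimes> x \<rightarrow> x\<close>,
  \<open>trunit x : x \<otimes> 1 \<rightarrow> x\<close> and \<open>tbraid x y : x \<otimes> y \<rightarrow> y \<otimes> x\<close>.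
\<close>

record ('a, 'p) ttcat = "('a, 'p) tricat" +
  tens   :: "('a \<times> 'a, 'p \<times> 'p, 'a, 'p) func"
  tunit  :: 'a
  tassoc :: "'a \<Rightarrow> 'a \<Rightarrow> 'a \<Rightarrow> 'p"
  tlunit :: "'a \<Rightarrow> 'p"
  trunit :: "'a \<Rightarrow> 'p"
  tbraid :: "'a \<Rightarrow> 'a \<Rightarrow> 'p"
  tsL    :: "'a \<Rightarrow> 'a \<Rightarrow> 'p"
  tsR    :: "'a \<Rightarrow> 'a \<Rightarrow> 'p"

abbreviation tenO :: "'a \<Rightarrow> ('a, 'p, 'x) ttcat_scheme \<Rightarrow> 'a \<Rightarrow> 'a"  ("(_ \<otimes>o\<^bsub>_\<^esub>/ _)" [71, 0, 70] 70) where
  "x \<otimes>o\<^bsub>T\<^esub> y \<equiv> fO (tens T) (x, y)"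

abbreviation tenM :: "'p \<Rightarrow> ('a, 'p, 'x) ttcat_scheme \<Rightarrow> 'p \<Rightarrow> 'p"  ("(_ \<otimes>m\<^bsub>_\<^esub>/ _)" [72, 0, 73] 72) where
  "f \<otimes>m\<^bsub>T\<^esub> g \<equiv> fM (tens T) (f, g)"

definition tens_left :: "('a, 'p, 'x) ttcat_scheme \<Rightarrow> 'a \<Rightarrow> ('a, 'p, 'a, 'p) func" where
  "tens_left T x = \<lparr>fO = (\<lambda>y. x \<otimes>o\<^bsub>T\<^esub> y), fM = (\<lambda>f. Ide T x \<otimes>m\<^bsub>T\<^esub> f)\<rparr>"

definition tens_right :: "('a, 'p, 'x) ttcat_scheme \<Rightarrow> 'a \<Rightarrow> ('a, 'p, 'a, 'p) func" where
  "tens_right T y = \<lparr>fO = (\<lambda>x. x \<otimes>o\<^bsub>T\<^esub> y), fM = (\<lambda>f. f \<otimes>m\<^bsub>T\<^esub> Ide T y)\<rparr>"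

locale symmetric_monoidal = category T for T :: "('a, 'p, 'x) ttcat_scheme" (structure) +
  assumes tens_functor: "is_functor (prod_cat T T) T (tens T)"
    and unit_ob: "tunit T \<in> Ob T"
    and assoc_iso: "x \<in> Ob T \<Longrightarrow> y \<in> Ob T \<Longrightarrow> z \<in> Ob T \<Longrightarrow>
          tassoc T x y z \<in> Hom T ((x \<otimes>o\<^bsub>T\<^esub> y) \<otimes>o\<^bsub>T\<^esub> z) (x \<otimes>o\<^bsub>T\<^esub> (y \<otimes>o\<^bsub>T\<^esub> z)) \<and>
          is_iso T (tassoc T x y z)"
    and assoc_natural: "f \<in> Arr T \<Longrightarrow> g \<in> Arr T \<Longrightarrow> h \<in> Arr T \<Longrightarrow>
          tassoc T (Cod T f) (Cod T g) (Cod T h) \<cdot> ((f \<otimes>m\<^bsub>T\<^esub> g) \<otimes>m\<^bsub>T\<^esub> h) =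
          (f \<otimes>m\<^bsub>T\<^esub> (g \<otimes>m\<^bsub>T\<^esub> h)) \<cdot> tassoc T (Dom T f) (Dom T g) (Dom T h)"
    and lunit_iso: "x \<in> Ob T \<Longrightarrow> tlunit T x \<in> Hom T (tunit T \<otimes>o\<^bsub>T\<^esub> x) x \<and> is_iso T (tlunit T x)"
    and lunit_natural: "f \<in> Arr T \<Longrightarrow>
          tlunit T (Cod T f) \<cdot> (Ide T (tunit T) \<otimes>m\<^bsub>T\<^esub> f) = f \<cdot> tlunit T (Dom T f)"
    and runit_iso: "x \<in> Ob T \<Longrightarrow> trunit T x \<in> Hom T (x \<otimes>o\<^bsub>T\<^esub> tunit T) x \<and> is_iso T (trunit T x)"
    and runit_natural: "f \<in> Arr T \<Longrightarrow>
          trunit T (Cod T f) \<cdot> (f \<otimes>m\<^bsub>T\<^esub> Ide T (tunit T)) = f \<cdot> trunit T (Dom T f)"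
    and braid_hom: "x \<in> Ob T \<Longrightarrow> y \<in> Ob T \<Longrightarrow> tbraid T x y \<in> Hom T (x \<otimes>o\<^bsub>T\<^esub> y) (y \<otimes>o\<^bsub>T\<^esub> x)"
    and braid_natural: "f \<in> Arr T \<Longrightarrow> g \<in> Arr T \<Longrightarrow>
          tbraid T (Cod T f) (Cod T g) \<cdot> (f \<otimes>m\<^bsub>T\<^esub> g) = (g \<otimes>m\<^bsub>T\<^esub> f) \<cdot> tbraid T (Dom T f) (Dom T g)"
    and pentagon: "w \<in> Ob T \<Longrightarrow> x \<in> Ob T \<Longrightarrow> y \<in> Ob T \<Longrightarrow> z \<in> Ob T \<Longrightarrow>
          tassoc T w x (y \<otimes>o\<^bsub>T\<^esub> z) \<cdot> tassoc T (w \<otimes>o\<^bsub>T\<^esub> x) y z =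
          (Ide T w \<otimes>m\<^bsub>T\<^esub> tassoc T x y z) \<cdot> tassoc T w (x \<otimes>o\<^bsub>T\<^esub> y) z \<cdot> (tassoc T w x y \<otimes>m\<^bsub>T\<^esub> Ide T z)"
    and triangle: "x \<in> Ob T \<Longrightarrow> y \<in> Ob T \<Longrightarrow>
          (Ide T x \<otimes>m\<^bsub>T\<^esub> tlunit T y) \<cdot> tassoc T x (tunit T) y = trunit T x \<otimes>m\<^bsub>T\<^esub> Ide T y"
    and symmetry: "x \<in> Ob T \<Longrightarrow> y \<in> Ob T \<Longrightarrow>
          tbraid T y x \<cdot> tbraid T x y = Ide T (x \<otimes>o\<^bsub>T\<^esub> y)"
    and hexagon: "x \<in> Ob T \<Longrightarrow> y \<in> Ob T \<Longrightarrow> z \<in> Ob T \<Longrightarrow>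
          tassoc T y z x \<cdot> tbraid T x (y \<otimes>o\<^bsub>T\<^esub> z) \<cdot> tassoc T x y z =
          (Ide T y \<otimes>m\<^bsub>T\<^esub> tbraid T x z) \<cdot> tassoc T y x z \<cdot> (tbraid T x y \<otimes>m\<^bsub>T\<^esub> Ide T z)"

text \<open>
  As usual, the two isomorphisms \<open>\<Sigma> x \<otimes> \<Sigma> y \<rightarrow> \<Sigma> \<Sigma> (x \<otimes> y)\<close> are required to differ by a sign.
\<close>

locale tt_category = triangulated_category T + symmetric_monoidal T
  for T :: "('a, 'p, 'x) ttcat_scheme" (structure) +
  assumes tens_left_triangulated: "x \<in> Ob T \<Longrightarrow>
          is_triangulated_functor T T (tens_left T x) (tsR T x)"
    and tens_right_triangulated: "y \<in> Ob T \<Longrightarrow>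
          is_triangulated_functor T T (tens_right T y) (\<lambda>x. tsL T x y)"
    and tsL_natural: "f \<in> Arr T \<Longrightarrow> g \<in> Arr T \<Longrightarrow>
          tsL T (Cod T f) (Cod T g) \<cdot> (ShM T f \<otimes>m\<^bsub>T\<^esub> g) = ShM T (f \<otimes>m\<^bsub>T\<^esub> g) \<cdot> tsL T (Dom T f) (Dom T g)"
    and tsR_natural: "f \<in> Arr T \<Longrightarrow> g \<in> Arr T \<Longrightarrow>
          tsR T (Cod T f) (Cod T g) \<cdot> (f \<otimes>m\<^bsub>T\<^esub> ShM T g) = ShM T (f \<otimes>m\<^bsub>T\<^esub> g) \<cdot> tsR T (Dom T f) (Dom T g)"
    and tens_shift_sign: "x \<in> Ob T \<Longrightarrow> y \<in> Ob T \<Longrightarrow>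
          ShM T (tsR T x y) \<cdot> tsL T x (ShO T y) = neg T (ShM T (tsL T x y) \<cdot> tsR T (ShO T x) y)"

definition rigid_objects :: "('a, 'p, 'x) ttcat_scheme \<Rightarrow> 'a set" where
  "rigid_objects T = {x \<in> Ob T.
     \<exists>y\<in>Ob T. \<exists>ev \<in> Hom T (y \<otimes>o\<^bsub>T\<^esub> x) (tunit T). \<exists>coev \<in> Hom T (tunit T) (x \<otimes>o\<^bsub>T\<^esub> y).
       trunit T x \<cdot>\<^bsub>T\<^esub> (Ide T x \<otimes>m\<^bsub>T\<^esub> ev) \<cdot>\<^bsub>T\<^esub> tassoc T x y x \<cdot>\<^bsub>T\<^esub> (coev \<otimes>m\<^bsub>T\<^esub> Ide T x) = tlunit T x \<and>
       tlunit T y \<cdot>\<^bsub>T\<^esub> (ev \<otimes>m\<^bsub>T\<^esub> Ide T y) \<cdot>\<^bsub>T\<^esub> inv_arr T (tassoc T y x y) \<cdot>\<^bsub>T\<^esub> (Ide T y \<otimes>m\<^bsub>T\<^esub> coev) = trunit T y}"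

locale big_tt_category = tt_category T
  for U :: "'u set" and T :: "('a, 'p, 'x) ttcat_scheme" (structure) +
  assumes loc_small: "locally_small U T"
    and coproducts: "has_small_coproducts U T"
    and tens_left_coproducts: "x \<in> Ob T \<Longrightarrow> preserves_small_coproducts U T T (tens_left T x)"
    and tens_right_coproducts: "y \<in> Ob T \<Longrightarrow> preserves_small_coproducts U T T (tens_right T y)"
    and generated: "loc U T (compact_objects U T) = Ob T"
    and compact_ess_small: "essentially_small U T (compact_objects U T)"
    and compact_triangulated: "triangulated_subcategory T (compact_objects U T)"
    and compact_unit: "tunit T \<in> compact_objects U T"
    and compact_tens: "x \<in> compact_objects U T \<Longrightarrow> y \<in> compact_objects U T \<Longrightarrow>
          x \<otimes>o\<^bsub>T\<^esub> y \<in> compact_objects U T"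
    and compact_rigid: "compact_objects U T = rigid_objects T"


section \<open>Modules over a big tt-category\<close>

text \<open>
  The structure isomorphisms are \<open>massoc X Y A : X * (Y * A) \<rightarrow> (X \<otimes> Y) * A\<close>,
  \<open>munit A : 1 * A \<rightarrow> A\<close>, \<open>msL X A : \<Sigma> X * A \<rightarrow> \<Sigma> (X * A)\<close> and
  \<open>msR X A : X * \<Sigma> A \<rightarrow> \<Sigma> (X * A)\<close>.
\<close>

record ('o, 'm, 'a, 'p) tmod = "('o, 'm) tricat" +
  act    :: "('a \<times> 'o, 'p \<times> 'm, 'o, 'm) func"
  massoc :: "'a \<Rightarrow> 'a \<Rightarrow> 'o \<Rightarrow> 'm"
  munit  :: "'o \<Rightarrow> 'm"
  msL    :: "'a \<Rightarrow> 'o \<Rightarrow> 'm"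
  msR    :: "'a \<Rightarrow> 'o \<Rightarrow> 'm"

abbreviation actO :: "'a \<Rightarrow> ('o, 'm, 'a, 'p, 'y) tmod_scheme \<Rightarrow> 'o \<Rightarrow> 'o"  ("(_ \<star>o\<^bsub>_\<^esub>/ _)" [71, 0, 70] 70) where
  "X \<star>o\<^bsub>K\<^esub> A \<equiv> fO (act K) (X, A)"

abbreviation actM :: "'p \<Rightarrow> ('o, 'm, 'a, 'p, 'y) tmod_scheme \<Rightarrow> 'm \<Rightarrow> 'm"  ("(_ \<star>m\<^bsub>_\<^esub>/ _)" [72, 0, 73] 72) where
  "\<xi> \<star>m\<^bsub>K\<^esub> f \<equiv> fM (act K) (\<xi>, f)"

definition act_left ::
  "('a, 'p, 'x) ttcat_scheme \<Rightarrow> ('o, 'm, 'a, 'p, 'y) tmod_scheme \<Rightarrow> 'a \<Rightarrow> ('o, 'm, 'o, 'm) func" where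
  "act_left T K X = \<lparr>fO = (\<lambda>A. X \<star>o\<^bsub>K\<^esub> A), fM = (\<lambda>f. Ide T X \<star>m\<^bsub>K\<^esub> f)\<rparr>"

definition act_right :: "('o, 'm, 'a, 'p, 'y) tmod_scheme \<Rightarrow> 'o \<Rightarrow> ('a, 'p, 'o, 'm) func" where
  "act_right K A = \<lparr>fO = (\<lambda>X. X \<star>o\<^bsub>K\<^esub> A), fM = (\<lambda>\<xi>. \<xi> \<star>m\<^bsub>K\<^esub> Ide K A)\<rparr>"

text \<open>
  The coherence conditions are those of Stevenson (Support theory via actions of tensor
  triangulated categories): pentagon, compatibility with both unitors, compatibility of the
  structure isomorphisms with the suspension isomorphisms, and the sign rule. The sign rule for
  arbitrary powers of \<open>\<Sigma>\<close> follows from the one for a single \<open>\<Sigma>\<close> in each variable.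
\<close>

locale tt_module = compactly_generated U K
  for U :: "'u set" and T :: "('a, 'p, 'x) ttcat_scheme"
    and K :: "('o, 'm, 'a, 'p, 'y) tmod_scheme" +
  assumes act_functor: "is_functor (prod_cat T K) K (act K)"
    and act_left_triangulated: "X \<in> Ob T \<Longrightarrow>
          is_triangulated_functor K K (act_left T K X) (msR K X)"
    and act_right_triangulated: "A \<in> Ob K \<Longrightarrow>
          is_triangulated_functor T K (act_right K A) (\<lambda>X. msL K X A)"
    and act_left_coproducts: "X \<in> Ob T \<Longrightarrow> preserves_small_coproducts U K K (act_left T K X)"
    and act_right_coproducts: "A \<in> Ob K \<Longrightarrow> preserves_small_coproducts U T K (act_right K A)"
    and massoc_iso: "X \<in> Ob T \<Longrightarrow> Y \<in> Ob T \<Longrightarrow> A \<in> Ob K \<Longrightarrow>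
          massoc K X Y A \<in> Hom K (X \<star>o\<^bsub>K\<^esub> (Y \<star>o\<^bsub>K\<^esub> A)) ((X \<otimes>o\<^bsub>T\<^esub> Y) \<star>o\<^bsub>K\<^esub> A) \<and>
          is_iso K (massoc K X Y A)"
    and massoc_natural: "\<xi> \<in> Arr T \<Longrightarrow> \<eta> \<in> Arr T \<Longrightarrow> f \<in> Arr K \<Longrightarrow>
          massoc K (Cod T \<xi>) (Cod T \<eta>) (Cod K f) \<cdot>\<^bsub>K\<^esub> (\<xi> \<star>m\<^bsub>K\<^esub> (\<eta> \<star>m\<^bsub>K\<^esub> f)) =
          ((\<xi> \<otimes>m\<^bsub>T\<^esub> \<eta>) \<star>m\<^bsub>K\<^esub> f) \<cdot>\<^bsub>K\<^esub> massoc K (Dom T \<xi>) (Dom T \<eta>) (Dom K f)"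
    and munit_iso: "A \<in> Ob K \<Longrightarrow> munit K A \<in> Hom K (tunit T \<star>o\<^bsub>K\<^esub> A) A \<and> is_iso K (munit K A)"
    and munit_natural: "f \<in> Arr K \<Longrightarrow>
          munit K (Cod K f) \<cdot>\<^bsub>K\<^esub> (Ide T (tunit T) \<star>m\<^bsub>K\<^esub> f) = f \<cdot>\<^bsub>K\<^esub> munit K (Dom K f)"
    and msL_natural: "\<xi> \<in> Arr T \<Longrightarrow> f \<in> Arr K \<Longrightarrow>
          msL K (Cod T \<xi>) (Cod K f) \<cdot>\<^bsub>K\<^esub> (ShM T \<xi> \<star>m\<^bsub>K\<^esub> f) =
          ShM K (\<xi> \<star>m\<^bsub>K\<^esub> f) \<cdot>\<^bsub>K\<^esub> msL K (Dom T \<xi>) (Dom K f)"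
    and msR_natural: "\<xi> \<in> Arr T \<Longrightarrow> f \<in> Arr K \<Longrightarrow>
          msR K (Cod T \<xi>) (Cod K f) \<cdot>\<^bsub>K\<^esub> (\<xi> \<star>m\<^bsub>K\<^esub> ShM K f) =
          ShM K (\<xi> \<star>m\<^bsub>K\<^esub> f) \<cdot>\<^bsub>K\<^esub> msR K (Dom T \<xi>) (Dom K f)"
    and mpentagon: "X \<in> Ob T \<Longrightarrow> Y \<in> Ob T \<Longrightarrow> Z \<in> Ob T \<Longrightarrow> A \<in> Ob K \<Longrightarrow>
          (tassoc T X Y Z \<star>m\<^bsub>K\<^esub> Ide K A) \<cdot>\<^bsub>K\<^esub> massoc K (X \<otimes>o\<^bsub>T\<^esub> Y) Z A \<cdot>\<^bsub>K\<^esub> massoc K X Y (Z \<star>o\<^bsub>K\<^esub> A) =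
          massoc K X (Y \<otimes>o\<^bsub>T\<^esub> Z) A \<cdot>\<^bsub>K\<^esub> (Ide T X \<star>m\<^bsub>K\<^esub> massoc K Y Z A)"
    and munit_right: "X \<in> Ob T \<Longrightarrow> A \<in> Ob K \<Longrightarrow>
          (trunit T X \<star>m\<^bsub>K\<^esub> Ide K A) \<cdot>\<^bsub>K\<^esub> massoc K X (tunit T) A = Ide T X \<star>m\<^bsub>K\<^esub> munit K A"
    and munit_left: "X \<in> Ob T \<Longrightarrow> A \<in> Ob K \<Longrightarrow>
          (tlunit T X \<star>m\<^bsub>K\<^esub> Ide K A) \<cdot>\<^bsub>K\<^esub> massoc K (tunit T) X A = munit K (X \<star>o\<^bsub>K\<^esub> A)"
    and massoc_shift_left: "X \<in> Ob T \<Longrightarrow> Y \<in> Ob T \<Longrightarrow> A \<in> Ob K \<Longrightarrow>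
          ShM K (massoc K X Y A) \<cdot>\<^bsub>K\<^esub> msL K X (Y \<star>o\<^bsub>K\<^esub> A) =
          msL K (X \<otimes>o\<^bsub>T\<^esub> Y) A \<cdot>\<^bsub>K\<^esub> (tsL T X Y \<star>m\<^bsub>K\<^esub> Ide K A) \<cdot>\<^bsub>K\<^esub> massoc K (ShO T X) Y A"
    and massoc_shift_middle: "X \<in> Ob T \<Longrightarrow> Y \<in> Ob T \<Longrightarrow> A \<in> Ob K \<Longrightarrow>
          ShM K (massoc K X Y A) \<cdot>\<^bsub>K\<^esub> msR K X (Y \<star>o\<^bsub>K\<^esub> A) \<cdot>\<^bsub>K\<^esub> (Ide T X \<star>m\<^bsub>K\<^esub> msL K Y A) =
          msL K (X \<otimes>o\<^bsub>T\<^esub> Y) A \<cdot>\<^bsub>K\<^esub> (tsR T X Y \<star>m\<^bsub>K\<^esub> Ide K A) \<cdot>\<^bsub>K\<^esub> massoc K X (ShO T Y) A"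
    and massoc_shift_right: "X \<in> Ob T \<Longrightarrow> Y \<in> Ob T \<Longrightarrow> A \<in> Ob K \<Longrightarrow>
          ShM K (massoc K X Y A) \<cdot>\<^bsub>K\<^esub> msR K X (Y \<star>o\<^bsub>K\<^esub> A) \<cdot>\<^bsub>K\<^esub> (Ide T X \<star>m\<^bsub>K\<^esub> msR K Y A) =
          msR K (X \<otimes>o\<^bsub>T\<^esub> Y) A \<cdot>\<^bsub>K\<^esub> massoc K X Y (ShO K A)"
    and munit_shift: "A \<in> Ob K \<Longrightarrow>
          ShM K (munit K A) \<cdot>\<^bsub>K\<^esub> msR K (tunit T) A = munit K (ShO K A)"
    and act_shift_sign: "X \<in> Ob T \<Longrightarrow> A \<in> Ob K \<Longrightarrow>
          ShM K (msR K X A) \<cdot>\<^bsub>K\<^esub> msL K X (ShO K A) = neg K (ShM K (msL K X A) \<cdot>\<^bsub>K\<^esub> msR K (ShO T X) A)"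

text \<open>\<open>rel_hom T N X A\<close> is \<open>[X, A]\<^sub>*\<close>, formed in \<open>N\<close>.\<close>

definition rel_hom ::
  "('a, 'p, 'x) ttcat_scheme \<Rightarrow> ('o, 'm, 'a, 'p, 'y) tmod_scheme \<Rightarrow> 'a \<Rightarrow> 'o \<Rightarrow> 'o" where
  "rel_hom T N X = fO (radj N N (act_left T N X))"

definition Coloc_hom ::
  "'u set \<Rightarrow> ('a, 'p, 'x) ttcat_scheme \<Rightarrow> ('o, 'm, 'a, 'p, 'y) tmod_scheme \<Rightarrow> 'o set set" where
  "Coloc_hom U T N =
     {C. colocalizing U N C \<and> (\<forall>X\<in>Ob T. \<forall>A\<in>C. rel_hom T N X A \<in> C)}"

definition coloc_hom ::
  "'u set \<Rightarrow> ('a, 'p, 'x) ttcat_scheme \<Rightarrow> ('o, 'm, 'a, 'p, 'y) tmod_scheme \<Rightarrow> 'o set \<Rightarrow> 'o set" where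
  "coloc_hom U T N A = \<Inter> {C \<in> Coloc_hom U T N. A \<subseteq> C}"


section \<open>Verdier quotients\<close>

definition weak_equivalences :: "('o, 'm, 'x) tricat_scheme \<Rightarrow> 'o set \<Rightarrow> 'm set" where
  "weak_equivalences K M = {f \<in> Arr K. \<exists>g h. (f, g, h) \<in> Tri K \<and> Cod K g \<in> M}"

text \<open>
  A morphism \<open>x \<rightarrow> y\<close> of the quotient is a class of roofs \<open>(s, f)\<close>, i.e. diagrams
  \<open>x \<leftarrow> w \<rightarrow> y\<close> with left leg \<open>s\<close> a weak equivalence; it stands for \<open>f s\<^sup>-\<^sup>1\<close>.
\<close>

definition roofs :: "('o, 'm, 'x) tricat_scheme \<Rightarrow> 'o set \<Rightarrow> ('m \<times> 'm) set" where
  "roofs K M = {(s, f). s \<in> weak_equivalences K M \<and> f \<in> Arr K \<and> Dom K s = Dom K f}"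

definition roof_equiv :: "('o, 'm, 'x) tricat_scheme \<Rightarrow> 'o set \<Rightarrow> 'm \<times> 'm \<Rightarrow> 'm \<times> 'm \<Rightarrow> bool" where
  "roof_equiv K M = (\<lambda>(s, f) (s', f').
     (s, f) \<in> roofs K M \<and> (s', f') \<in> roofs K M \<and>
     (\<exists>u\<in>Arr K. \<exists>v\<in>Arr K.
        Dom K u = Dom K v \<and> Cod K u = Dom K s \<and> Cod K v = Dom K s' \<and>
        s \<cdot>\<^bsub>K\<^esub> u \<in> weak_equivalences K M \<and> s \<cdot>\<^bsub>K\<^esub> u = s' \<cdot>\<^bsub>K\<^esub> v \<and> f \<cdot>\<^bsub>K\<^esub> u = f' \<cdot>\<^bsub>K\<^esub> v))"

definition roof_class :: "('o, 'm, 'x) tricat_scheme \<Rightarrow> 'o set \<Rightarrow> 'm \<times> 'm \<Rightarrow> ('m \<times> 'm) set" where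
  "roof_class K M r = {r'. roof_equiv K M r r'}"

definition quotient_functor ::
  "('o, 'm, 'x) tricat_scheme \<Rightarrow> 'o set \<Rightarrow> ('o, 'm, 'o, ('m \<times> 'm) set) func" where
  "quotient_functor K M = \<lparr>fO = (\<lambda>x. x), fM = (\<lambda>f. roof_class K M (Ide K (Dom K f), f))\<rparr>"

text \<open>
  Operations on classes are given as the union of the classes obtained from all choices of
  representatives (all of which agree): composition through Ore squares \<open>f u = t v\<close>, addition of
  roofs with a common left leg. A triangle is distinguished if it is isomorphic to the image of
  a distinguished triangle of \<open>K\<close>.
\<close>

definition verdier_pre ::
  "('o, 'm, 'x) tricat_scheme \<Rightarrow> 'o set \<Rightarrow> ('o, ('m \<times> 'm) set) tricat" where
  "verdier_pre K M =
     \<lparr>Ob = Ob K,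
      Arr = roof_class K M ` roofs K M,
      Dom = (\<lambda>R. THE x. \<exists>(s, f) \<in> R. x = Cod K s),
      Cod = (\<lambda>R. THE x. \<exists>(s, f) \<in> R. x = Cod K f),
      Ide = (\<lambda>x. roof_class K M (Ide K x, Ide K x)),
      Cmp = (\<lambda>R' R. {r. \<exists>(s, f) \<in> R. \<exists>(t, g) \<in> R'.
               \<exists>u \<in> weak_equivalences K M. \<exists>v \<in> Arr K.
                 Dom K u = Dom K v \<and> Cod K u = Dom K f \<and> Cod K v = Dom K t \<and>
                 f \<cdot>\<^bsub>K\<^esub> u = t \<cdot>\<^bsub>K\<^esub> v \<and> roof_equiv K M (s \<cdot>\<^bsub>K\<^esub> u, g \<cdot>\<^bsub>K\<^esub> v) r}),
      Zro = (\<lambda>x y. roof_class K M (Ide K x, Zro K x y)),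
      Pls = (\<lambda>R R'. {r. \<exists>s f f'. (s, f) \<in> R \<and> (s, f') \<in> R' \<and> roof_equiv K M (s, Pls K f f') r}),
      Sh = \<lparr>fO = ShO K,
            fM = (\<lambda>R. {r. \<exists>(s, f) \<in> R. roof_equiv K M (ShM K s, ShM K f) r})\<rparr>,
      Tri = {}\<rparr>"

definition verdier_quotient ::
  "('o, 'm, 'x) tricat_scheme \<Rightarrow> 'o set \<Rightarrow> ('o, ('m \<times> 'm) set) tricat" where
  "verdier_quotient K M =
     (let Q = verdier_pre K M; j = fM (quotient_functor K M) in
      Q\<lparr>Tri := {t. candidate_triangle Q t \<and>
                   (\<exists>(f, g, h) \<in> Tri K. triangle_iso Q t (j f, j g, j h))}\<rparr>)"

definition quotient_module ::
  "('a, 'p, 'x) ttcat_scheme \<Rightarrow> ('o, 'm, 'a, 'p, 'y) tmod_scheme \<Rightarrow> 'o set \<Rightarrow>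
     ('o, ('m \<times> 'm) set, 'a, 'p) tmod" where
  "quotient_module T K M =
     (let j = fM (quotient_functor K M) in
      tricat.extend (verdier_quotient K M)
        (tmod.fields
          \<lparr>fO = fO (act K),
           fM = (\<lambda>(\<xi>, R). {r. \<exists>(s, f) \<in> R.
                   roof_equiv K M (Ide T (Dom T \<xi>) \<star>m\<^bsub>K\<^esub> s, \<xi> \<star>m\<^bsub>K\<^esub> f) r})\<rparr>
          (\<lambda>X Y A. j (massoc K X Y A))
          (\<lambda>A. j (munit K A))
          (\<lambda>X A. j (msL K X A))
          (\<lambda>X A. j (msR K X A))))"


section \<open>Smashing submodules\<close>

definition smashing_submodule ::
  "'u set \<Rightarrow> ('a, 'p, 'x) ttcat_scheme \<Rightarrow> ('o, 'm, 'a, 'p, 'y) tmod_scheme \<Rightarrow> 'o set \<Rightarrow> bool" where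
  "smashing_submodule U T K M \<longleftrightarrow>
     localizing U K M \<and>
     (\<forall>X\<in>Ob T. \<forall>A\<in>M. X \<star>o\<^bsub>K\<^esub> A \<in> M) \<and>
     (\<exists>k. right_adjoint K (verdier_quotient K M) (quotient_functor K M) k \<and>
          preserves_small_coproducts U (verdier_quotient K M) K k)"

definition k_functor ::
  "('o, 'm, 'x) tricat_scheme \<Rightarrow> 'o set \<Rightarrow> ('o, ('m \<times> 'm) set, 'o, 'm) func" where
  "k_functor K M = radj K (verdier_quotient K M) (quotient_functor K M)"

definition l_functor ::
  "('o, 'm, 'x) tricat_scheme \<Rightarrow> 'o set \<Rightarrow> ('o, 'm, 'o, ('m \<times> 'm) set) func" where
  "l_functor K M = radj (verdier_quotient K M) K (k_functor K M)"

definition right_perp :: "('o, 'm, 'x) tricat_scheme \<Rightarrow> 'o set \<Rightarrow> 'o set" where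
  "right_perp K M = {A \<in> Ob K. \<forall>B\<in>M. Hom K B A = {Zro K B A}}"

text \<open>\<open>S_sub U T K S \<Gamma> M\<close> is the subset \<open>S\<^sub>M\<close> of \<open>S\<close>.\<close>

definition S_sub ::
  "'u set \<Rightarrow> ('a, 'p, 'x) ttcat_scheme \<Rightarrow> ('o, 'm, 'a, 'p, 'y) tmod_scheme \<Rightarrow>
     's set \<Rightarrow> ('s \<Rightarrow> 'a) \<Rightarrow> 'o set \<Rightarrow> 's set" where
  "S_sub U T K S \<Gamma> M = {s \<in> S. rel_hom T K (\<Gamma> s) (BC_cogenerator U K) \<in> right_perp K M}"


section \<open>Cosupport and costratification\<close>

text \<open>
  A support--cosupport pair is determined by the map \<open>\<Gamma>\<close> inducing it, and its goodness is a
  condition on \<open>\<Gamma>\<close> alone.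
\<close>

definition good_support_cosupport_pair ::
  "('a, 'p, 'x) ttcat_scheme \<Rightarrow> 's set \<Rightarrow> ('s \<Rightarrow> 'a) \<Rightarrow> bool" where
  "good_support_cosupport_pair T S \<Gamma> \<longleftrightarrow>
     (\<forall>s\<in>S. \<Gamma> s \<in> Ob T) \<and>
     (\<forall>s\<in>S. \<forall>r\<in>S. s \<noteq> r \<longrightarrow> is_zero T (\<Gamma> s \<otimes>o\<^bsub>T\<^esub> \<Gamma> r)) \<and>
     (\<forall>s\<in>S. isomorphic T (\<Gamma> s \<otimes>o\<^bsub>T\<^esub> \<Gamma> s) (\<Gamma> s) \<and> \<not> is_zero T (\<Gamma> s))"

definition cosupp ::
  "('a, 'p, 'x) ttcat_scheme \<Rightarrow> ('o, 'm, 'a, 'p, 'y) tmod_scheme \<Rightarrow>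
     's set \<Rightarrow> ('s \<Rightarrow> 'a) \<Rightarrow> 'o \<Rightarrow> 's set" where
  "cosupp T N S \<Gamma> A = {s \<in> S. \<not> is_zero N (rel_hom T N (\<Gamma> s) A)}"

definition cominimality ::
  "'u set \<Rightarrow> ('a, 'p, 'x) ttcat_scheme \<Rightarrow> ('o, 'm, 'a, 'p, 'y) tmod_scheme \<Rightarrow>
     's set \<Rightarrow> ('s \<Rightarrow> 'a) \<Rightarrow> 'o \<Rightarrow> bool" where
  "cominimality U T N S \<Gamma> I \<longleftrightarrow>
     (\<forall>s\<in>S. \<forall>C\<in>Coloc_hom U T N. C \<subseteq> coloc_hom U T N {rel_hom T N (\<Gamma> s) I} \<longrightarrow>
        C = {A. is_zero N A} \<or> C = coloc_hom U T N {rel_hom T N (\<Gamma> s) I})"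

definition colocal_to_global ::
  "'u set \<Rightarrow> ('a, 'p, 'x) ttcat_scheme \<Rightarrow> ('o, 'm, 'a, 'p, 'y) tmod_scheme \<Rightarrow>
     's set \<Rightarrow> ('s \<Rightarrow> 'a) \<Rightarrow> bool" where
  "colocal_to_global U T N S \<Gamma> \<longleftrightarrow>
     (\<forall>A\<in>Ob N. coloc_hom U T N {A} = coloc_hom U T N {rel_hom T N (\<Gamma> s) A | s. s \<in> S})"

definition costratified ::
  "'u set \<Rightarrow> ('a, 'p, 'x) ttcat_scheme \<Rightarrow> ('o, 'm, 'a, 'p, 'y) tmod_scheme \<Rightarrow>
     's set \<Rightarrow> ('s \<Rightarrow> 'a) \<Rightarrow> 'o \<Rightarrow> bool" where
  "costratified U T N S \<Gamma> I \<longleftrightarrow>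
     (let \<alpha> = (\<lambda>W. {A \<in> Ob N. cosupp T N S \<Gamma> A \<subseteq> W}); \<beta> = (\<lambda>C. \<Union>A\<in>C. cosupp T N S \<Gamma> A) in
      \<alpha> ` Pow (cosupp T N S \<Gamma> I) \<subseteq> Coloc_hom U T N \<and>
      \<beta> ` Coloc_hom U T N \<subseteq> Pow (cosupp T N S \<Gamma> I) \<and>
      (\<forall>W\<in>Pow (cosupp T N S \<Gamma> I). \<beta> (\<alpha> W) = W) \<and>
      (\<forall>C\<in>Coloc_hom U T N. \<alpha> (\<beta> C) = C))"

end

theory Submission
 imports Defs "HOL-Algebra.Product_Groups" "HOL-Algebra.Multiplicative_Group" "HOL-Algebra.Elementary_Groups"
begin

text \<open>
  Write \<open>[X, A]\<close> for the relative internal hom, \<open>coloc A\<close> for the submodule (colocalizing and closed under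
  all \<open>[X, -]\<close>) generated by \<open>A\<close>, and \<open>I\<close> for the cogenerator of \<open>K\<close>. The quotient \<open>K/M\<close> is equivalent to the
  category \<open>M\<^sup>\<bottom>\<close> of local objects. Its submodules are the submodules of \<open>K\<close> contained in \<open>M\<^sup>\<bottom>\<close>
  (\<open>Coloc_Q\<close>), its internal homs are those of \<open>K\<close> on local objects (\<open>hm_Q\<close>), and the functor \<open>l\<close> is the
  coreflection \<open>R\<close> of \<open>K\<close> into \<open>M\<^sup>\<bottom>\<close> (\<open>local_cogenerator\<close>). So both sides of the theorem are
  conditions on the lattice of submodules of \<open>K\<close>.

  In this lattice the argument is short. The \<open>A\<close> with \<open>[\<Gamma> s, A]\<close> in a given submodule form a submodule, and
  \<open>I\<close> cogenerates \<open>K\<close>; hence \<open>[\<Gamma> s, A]\<close> lies in \<open>coloc [\<Gamma> s, I]\<close> for all \<open>A\<close>. In the same way \<open>R I\<close>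
  cogenerates \<open>M\<^sup>\<bottom>\<close>, because preimages of colocalizing subcategories under \<open>R\<close> are colocalizing, and so
  \<open>[\<Gamma> s, A]\<close> lies in \<open>coloc [\<Gamma> s, R I]\<close> for all local \<open>A\<close>. If \<open>[\<Gamma> s, I]\<close> is local, this applies to
  \<open>A = [\<Gamma> s, I]\<close>, and \<open>\<Gamma> s \<otimes> \<Gamma> s \<cong> \<Gamma> s\<close> gives \<open>coloc [\<Gamma> s, I] = coloc [\<Gamma> s, R I]\<close>. Minimality of
  this submodule is then the same condition in \<open>K\<close> and in \<open>K/M\<close>, which is the first part
  (\<open>comin_iff_local\<close>). For the second, costratification always implies cominimality, by orthogonality of
  the \<open>\<Gamma> s\<close>, and the converse holds under the colocal-to-global principle, which \<open>M\<^sup>\<bottom>\<close> inherits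
  from \<open>K\<close> (\<open>costrat_iff_local\<close>).

  Most of the text establishes that the objects in the statement exist and that \<open>I\<close> cogenerates. Brown
  representability (\<open>representable\<close>) provides products, Brown--Comenetz duals, internal homs and
  \<open>R\<close>; \<open>I\<close> itself needs compact objects to be essentially small (\<open>finitary_factors\<close>) and the rational
  circle to be injective (\<open>injective_extension\<close>); cogeneration is a convergence statement for an
  Adams-type tower (\<open>cogeneration\<close>). The quotient is made accessible by the calculus of fractions.
\<close>


section \<open>Small sets\<close>

lemma small_lepoll: "A \<lesssim> B ==> small U B ==> small U A"
 by (rule lesspoll_trans1)

lemma small_subset: "A <= B ==> small U B ==> small U A"
 using small_lepoll subset_imp_lepoll by blast

lemma small_image: "small U A ==> small U (f ` A)"
 using small_lepoll image_lepoll by blast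

lemma small_inj_on: "inj_on f A ==> f ` A <= B ==> small U B ==> small U A"
 by (meson small_lepoll lepoll_def)

lemma small_reindex:
 assumes "small U A"
 obtains I :: "'u set" and e where "small U I" "I <= U" "bij_betw e I A"
proof -
 from assms obtain f where f: "inj_on f A" "f ` A <= U"
  by (meson lesspoll_imp_lepoll lepoll_def)
 show thesis
 proof (rule that[of "f ` A" "inv_into A f"])
  show "small U (f ` A)" using assms by (rule small_image)
  show "bij_betw (inv_into A f) (f ` A) A"
   using f(1) by (simp add: bij_betw_inv_into bij_betw_imageI)
 qed (use f in auto)
qed

locale universe =
 fixes U :: "'u set"
 assumes universe: "grothendieck_universe U"
begin

lemma small_countable: "countable A ==> small U A"
 using universe small_lepoll[of A "UNIV :: nat set" U]
 by (auto simp: grothendieck_universe_def countable_def lepoll_def)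

lemma infinite_U: "infinite U"
 using universe by (meson grothendieck_universe_def infinite_UNIV_nat lesspoll_imp_lepoll
   lepoll_def finite_imageD finite_subset)

lemma small_Sigma:
 assumes "small U I" "!!i. i : I ==> small U (F i)"
 shows "small U (Sigma I F)"
proof -
 obtain I' :: "'u set" and e where I': "small U I'" "I' <= U" "bij_betw e I' I"
  using small_reindex[OF assms(1)] .
 have "\<exists>g. inj_on g (F i) & g ` F i <= U" if "i : I" for i
  using assms(2)[OF that] by (meson lesspoll_imp_lepoll lepoll_def)
 then obtain g where g: "!!i. i : I ==> inj_on (g i) (F i) & g i ` F i <= U"
  by metis
 have "U \<times> U \<approx> U"
  unfolding eqpoll_iff_card_of_ordIso using infinite_U by (rule card_of_Times_same_infinite)
 then obtain p where p: "inj_on p (U \<times> U)" "p ` (U \<times> U) <= U"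
  by (metis eqpoll_imp_lepoll lepoll_def)
 define G where "G = (%u. p ` ({u} \<times> g (e u) ` F (e u)))"
 have eI: "e u : I" if "u : I'" for u
  using that I'(3) by (auto simp: bij_betw_def)
 have "small U (G u)" if "u : I'" for u
  unfolding G_def
  by (rule small_image, rule small_lepoll[OF _ assms(2)[OF eI[OF that]]],
    rule lepoll_trans[OF eqpoll_imp_lepoll[OF times_singleton_eqpoll]], rule image_lepoll)
 moreover have "G u <= U" if "u : I'" for u
  using p g[OF eI[OF that]] I'(2) that by (fastforce simp: G_def)
 ultimately have sm: "small U (\<Union>u\<in>I'. G u)"
  using universe I'(1,2) unfolding grothendieck_universe_def by blast
 let ?e' = "inv_into I' e"
 have e': "?e' i : I'" "e (?e' i) = i" if "i : I" for i
  using that I'(3) by (auto simp: bij_betw_def inv_into_into f_inv_into_f)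
 have "inj_on (%(i, x). p (?e' i, g i x)) (Sigma I F)"
 proof (rule inj_onI, clarsimp)
  fix i x j y
  assume *: "i : I" "x : F i" "j : I" "y : F j" "p (?e' i, g i x) = p (?e' j, g j y)"
  have "(?e' i, g i x) : U \<times> U" "(?e' j, g j y) : U \<times> U"
   using * e' g I'(2) by blast+
  then have "?e' i = ?e' j & g i x = g j y"
   using p(1) *(5) by (auto dest: inj_onD)
  then show "i = j & x = y"
   using e' * g by (metis inj_onD)
 qed
 moreover have "(%(i, x). p (?e' i, g i x)) ` Sigma I F <= (\<Union>u\<in>I'. G u)"
  using e' by (force simp: G_def)
 ultimately show ?thesis
  using sm by (rule small_inj_on)
qed

lemma small_UN:
 assumes "small U I" "!!i. i : I ==> small U (F i)"
 shows "small U (\<Union>i\<in>I. F i)"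
proof -
 have "(\<Union>i\<in>I. F i) = snd ` Sigma I F" by (auto simp: image_iff)
 then show ?thesis using small_image[OF small_Sigma[OF assms], where f = snd] by simp
qed

lemma small_Un: "small U A ==> small U B ==> small U (A \<union> B)"
 using small_UN[of "{True, False}" "%b. if b then A else B"] small_countable[of "{True, False}"]
 by (auto split: if_splits simp: Un_commute)

lemma small_Pow:
 assumes "small U A" shows "small U (Pow A)"
proof -
 from assms obtain f where f: "inj_on f A" "f ` A <= U"
  by (meson lesspoll_imp_lepoll lepoll_def)
 have "small U (Pow (f ` A))"
  using universe f(2) small_image[OF assms] unfolding grothendieck_universe_def by blast
 moreover have "inj_on ((`) f) (Pow A)"
  using f(1) by (rule inj_on_image_Pow)
 ultimately show ?thesis
  by (meson small_inj_on image_Pow_mono subset_refl)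
qed

lemma small_PiE:
 assumes "small U I" "!!i. i : I ==> small U (F i)"
 shows "small U (PiE I F)"
proof (rule small_inj_on)
 show "small U (Pow (Sigma I F))"
  using assms by (intro small_Pow small_Sigma)
 show "inj_on (%f. (%i. (i, f i)) ` I) (PiE I F)"
 proof (rule inj_onI, rule PiE_ext)
  fix f g i assume "(%i. (i, f i)) ` I = (%i. (i, g i)) ` I" "i : I"
  then have "(i, f i) : (%i. (i, g i)) ` I" by blast
  then show "f i = g i" by auto
 qed
 show "(%f. (%i. (i, f i)) ` I) ` PiE I F <= Pow (Sigma I F)"
  by auto
qed

end


section \<open>Categories, limits and adjoints\<close>

lemma in_Hom [simp]: "f : Hom C x y \<longleftrightarrow> f : Arr C & Dom C f = x & Cod C f = y"
 by (simp add: Hom_def)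

context category
begin

abbreviation dom where "dom \<equiv> Dom C"
abbreviation cod where "cod \<equiv> Cod C"
abbreviation ide where "ide \<equiv> Ide C"
abbreviation ob where "ob \<equiv> Ob C"
abbreviation arr where "arr \<equiv> Arr C"

lemma ob_dom [simp]: "f : arr ==> dom f : ob"
 and ob_cod [simp]: "f : arr ==> cod f : ob"
 by (rule dom_ob cod_ob; assumption)+

lemma ide_arr [simp]: "x : ob ==> ide x : arr"
 and ide_dom [simp]: "x : ob ==> dom (ide x) = x"
 and ide_cod [simp]: "x : ob ==> cod (ide x) = x"
 using ide_hom[of x] by simp_all

lemma cmp_arr [simp]: "f : arr ==> g : arr ==> cod f = dom g ==> g\<cdot>f : arr"
 and cmp_dom [simp]: "f : arr ==> g : arr ==> cod f = dom g ==> dom (g\<cdot>f) = dom f"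
 and cmp_cod [simp]: "f : arr ==> g : arr ==> cod f = dom g ==> cod (g\<cdot>f) = cod g"
 using cmp_hom[of f "dom f" "cod f" g "cod g"] by simp_all

lemma ide_right [simp]: "f : arr ==> dom f = x ==> f\<cdot>ide x = f"
 using cmp_ide_right[of f x "cod f"] by simp

lemma ide_left [simp]: "f : arr ==> cod f = y ==> ide y\<cdot>f = f"
 using cmp_ide_left[of f "dom f" y] by simp

lemma assoc [simp]: "f : arr ==> g : arr ==> h : arr ==> cod f = dom g ==>
  cod g = dom h ==> (h\<cdot>g)\<cdot>f = h\<cdot>(g\<cdot>f)"
 using cmp_assoc[of f "dom f" "cod f" g "cod g" h "cod h"] by simp

text \<open>Rewriting inside a composite that is bracketed to the right.\<close>

lemma cmp_swap:
 assumes "g\<cdot>f = g'\<cdot>f'" "f : arr" "g : arr" "cod f = dom g" "f' : arr" "g' : arr"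
  "cod f' = dom g'" "e : arr" "cod e = dom f" "dom f' = dom f"
 shows "g\<cdot>(f\<cdot>e) = g'\<cdot>(f'\<cdot>e)"
 by (metis assms assoc)

lemma cmp_reduce:
 assumes "g\<cdot>f = h" "f : arr" "g : arr" "cod f = dom g"
  "e : arr" "cod e = dom f"
 shows "g\<cdot>(f\<cdot>e) = h\<cdot>e"
 by (metis assms assoc)

lemma iso_inverse:
 assumes "is_iso C f"
 obtains g where "f : arr" "g : arr" "dom g = cod f" "cod g = dom f"
  "g\<cdot>f = ide (dom f)" "f\<cdot>g = ide (cod f)"
 using assms by (auto simp: is_iso_def inverse_arrs_def)

lemma is_isoI:
 assumes "f : arr" "g : arr" "dom g = cod f" "cod g = dom f"
  "g\<cdot>f = ide (dom f)" "f\<cdot>g = ide (cod f)"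
 shows "is_iso C f"
 using assms by (auto simp: is_iso_def inverse_arrs_def)

lemma is_iso_ide [simp]: "x : ob ==> is_iso C (ide x)"
 by (rule is_isoI[of _ "ide x"]) auto

lemma isomorphicI:
 assumes "f : Hom C x y" "g : Hom C y x" "g\<cdot>f = ide x" "f\<cdot>g = ide y"
 shows "isomorphic C x y"
 using assms is_isoI[of f g] by (auto simp: isomorphic_def)

lemma isomorphicE:
 assumes "isomorphic C x y"
 obtains f g where "f : Hom C x y" "g : Hom C y x" "g\<cdot>f = ide x" "f\<cdot>g = ide y"
  "x : ob" "y : ob"
proof -
 from assms obtain f where f: "f : Hom C x y" "is_iso C f" by (auto simp: isomorphic_def)
 from f(2) obtain g where "f : arr" "g : arr" "dom g = cod f" "cod g = dom f"
  "g\<cdot>f = ide (dom f)" "f\<cdot>g = ide (cod f)" by (rule iso_inverse)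
 with f that[of f g] show thesis by auto
qed

lemma isomorphic_refl [simp]: "x : ob ==> isomorphic C x x"
 by (rule isomorphicI[of "ide x" _ _ "ide x"]) auto

lemma isomorphic_sym: "isomorphic C x y ==> isomorphic C y x"
 by (metis isomorphicE isomorphicI)

lemma isomorphic_trans [trans]:
 assumes "isomorphic C x y" "isomorphic C y z" shows "isomorphic C x z"
proof -
 from assms(1) obtain f g where fg: "f : Hom C x y" "g : Hom C y x" "g\<cdot>f = ide x"
  "f\<cdot>g = ide y" "x : ob" "y : ob" by (rule isomorphicE)
 from assms(2) obtain h k where hk: "h : Hom C y z" "k : Hom C z y" "k\<cdot>h = ide y"
  "h\<cdot>k = ide z" "y : ob" "z : ob" by (rule isomorphicE)
 show ?thesis
 proof (rule isomorphicI)
  show "h\<cdot>f : Hom C x z" "g\<cdot>k : Hom C z x" using fg hk by auto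
  have "g\<cdot>(k\<cdot>(h\<cdot>f)) = g\<cdot>f" using fg hk by (simp add: cmp_reduce[OF hk(3)])
  then show "g\<cdot>k\<cdot>(h\<cdot>f) = ide x" using fg hk by simp
  have "h\<cdot>(f\<cdot>(g\<cdot>k)) = h\<cdot>k" using fg hk by (simp add: cmp_reduce[OF fg(4)])
  then show "h\<cdot>f\<cdot>(g\<cdot>k) = ide z" using fg hk by simp
 qed
qed

lemma isomorphic_ob: "isomorphic C x y ==> x : ob & y : ob"
 by (metis isomorphicE)

lemma isomorphic_iso: "is_iso C f ==> isomorphic C (dom f) (cod f)"
 by (auto simp: isomorphic_def is_iso_def inverse_arrs_def)

lemma zero_in [simp]: "is_zero C z ==> z : ob"
 by (simp add: is_zero_def)

lemma is_zero_iso: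
 assumes "is_zero C x" "isomorphic C x y" shows "is_zero C y"
proof -
 from assms(2) obtain f g where fg: "f : Hom C x y" "g : Hom C y x" "g\<cdot>f = ide x"
  "f\<cdot>g = ide y" "x : ob" "y : ob" by (rule isomorphicE)
 have "\<exists>!h. h : Hom C y w" "\<exists>!h. h : Hom C w y" if "w : ob" for w
 proof -
  obtain a b where a: "!!h. h : Hom C x w \<longleftrightarrow> h = a" and b: "!!h. h : Hom C w x \<longleftrightarrow> h = b"
   using assms(1) \<open>w : ob\<close> unfolding is_zero_def by metis
  have "h = a\<cdot>g" if "h : Hom C y w" for h
  proof -
   have "h\<cdot>f = a" using a[of "h\<cdot>f"] that fg by auto
   moreover have "h\<cdot>(f\<cdot>g) = h" using that fg by simp
   ultimately show ?thesis using that fg by (metis assoc in_Hom)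
  qed
  moreover have "a\<cdot>g : Hom C y w" using a[of a] fg by simp
  ultimately show "\<exists>!h. h : Hom C y w" by blast
  have "h = f\<cdot>b" if "h : Hom C w y" for h
  proof -
   have "g\<cdot>h = b" using b[of "g\<cdot>h"] that fg by auto
   moreover have "f\<cdot>(g\<cdot>h) = h" using that fg by (simp add: cmp_reduce[OF fg(4)])
   ultimately show ?thesis by simp
  qed
  moreover have "f\<cdot>b : Hom C w y" using b[of b] fg by simp
  ultimately show "\<exists>!h. h : Hom C w y" by blast
 qed
 with \<open>y : ob\<close> show ?thesis unfolding is_zero_def by blast
qed

lemma is_zero_eq_from:
 assumes "is_zero C z" "f : Hom C z x" "f' : Hom C z x" shows "f = f'"
proof -
 have "x : ob" using assms(2) by auto
 then have "\<exists>!h. h : Hom C z x" using assms(1) unfolding is_zero_def by blast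
 then show ?thesis using assms(2,3) by blast
qed

lemma is_zero_eq_to:
 assumes "is_zero C z" "f : Hom C x z" "f' : Hom C x z" shows "f = f'"
proof -
 have "x : ob" using assms(2) by auto
 then have "\<exists>!h. h : Hom C x z" using assms(1) unfolding is_zero_def by blast
 then show ?thesis using assms(2,3) by blast
qed

lemma is_zero_from:
 assumes "is_zero C z" "x : ob" obtains f where "f : Hom C z x"
proof -
 have "\<exists>!f. f : Hom C z x" using assms unfolding is_zero_def by blast
 then show thesis using that by (blast dest: ex1_implies_ex)
qed

lemma zeros_isomorphic:
 assumes "is_zero C x" "is_zero C y" shows "isomorphic C x y"
proof -
 obtain f where f: "f : Hom C x y" using is_zero_from[OF assms(1)] zero_in[OF assms(2)] .
 obtain g where g: "g : Hom C y x" using is_zero_from[OF assms(2)] zero_in[OF assms(1)] .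
 show ?thesis
 proof (rule isomorphicI[OF f g])
  show "g\<cdot>f = ide x"
   by (rule is_zero_eq_from[OF assms(1), of _ x]) (use f g assms in auto)
  show "f\<cdot>g = ide y"
   by (rule is_zero_eq_from[OF assms(2), of _ y]) (use f g assms in auto)
 qed
qed

lemma is_coproduct_map:
 assumes "is_coproduct C I X P io" "Y : ob" "!!i. i : I ==> f i : Hom C (X i) Y"
 obtains h where "h : Hom C P Y" "!!i. i : I ==> h\<cdot>io i = f i"
proof -
 have "\<exists>!h. h : Hom C P Y & (\<forall>i\<in>I. h\<cdot>io i = f i)"
  using assms(1,2,3) unfolding is_coproduct_def by blast
 then show thesis using that by blast
qed

lemma is_coproduct_ext:
 assumes "is_coproduct C I X P io" "h : Hom C P Y" "h' : Hom C P Y"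
  "!!i. i : I ==> h\<cdot>io i = h'\<cdot>io i"
 shows "h = h'"
proof -
 have "io i : Hom C (X i) P" if "i : I" for i
  using that assms(1) by (simp add: is_coproduct_def)
 then have *: "\<forall>i\<in>I. h\<cdot>io i : Hom C (X i) Y" using assms(2) by auto
 have "Y : ob" using assms(2) by auto
 have "\<exists>!k. k : Hom C P Y & (\<forall>i\<in>I. k\<cdot>io i = f i)"
  if "\<forall>i\<in>I. f i : Hom C (X i) Y" for f
  using assms(1) \<open>Y : ob\<close> that unfolding is_coproduct_def by blast
 from this[OF *]
 show ?thesis using assms(2-4) by (metis (no_types, lifting))
qed

lemma is_coproductD:
 assumes "is_coproduct C I X P io"
 shows "P : ob" "!!i. i : I ==> X i : ob" "!!i. i : I ==> io i : arr"
  "!!i. i : I ==> dom (io i) = X i" "!!i. i : I ==> cod (io i) = P"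
 using assms by (auto simp: is_coproduct_def)

lemma is_coproductI:
 assumes "P : ob" "!!i. i : I ==> X i : ob" "!!i. i : I ==> io i : Hom C (X i) P"
  and ex: "!!Y f. Y : ob ==> (!!i. i : I ==> f i : Hom C (X i) Y) ==>
     \<exists>h. h : Hom C P Y & (\<forall>i\<in>I. h\<cdot>io i = f i)"
  and un: "!!Y h h'. h : Hom C P Y ==> h' : Hom C P Y ==>
     (!!i. i : I ==> h\<cdot>io i = h'\<cdot>io i) ==> h = h'"
 shows "is_coproduct C I X P io"
 unfolding is_coproduct_def
proof (intro conjI ballI allI impI)
 fix Y f assume Y: "Y : ob" "\<forall>i\<in>I. f i : Hom C (X i) Y"
 show "\<exists>!h. h : Hom C P Y & (\<forall>i\<in>I. h\<cdot>io i = f i)"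
 proof (rule ex_ex1I)
  show "\<exists>h. h : Hom C P Y & (\<forall>i\<in>I. h\<cdot>io i = f i)" using ex Y by blast
  show "h = h'" if "h : Hom C P Y & (\<forall>i\<in>I. h\<cdot>io i = f i)"
   "h' : Hom C P Y & (\<forall>i\<in>I. h'\<cdot>io i = f i)" for h h'
   using that by (intro un[of h Y h']) auto
 qed
qed (use assms in auto)

lemma is_product_map:
 assumes "is_product C I X P pr" "Y : ob" "!!i. i : I ==> f i : Hom C Y (X i)"
 obtains h where "h : Hom C Y P" "!!i. i : I ==> pr i\<cdot>h = f i"
proof -
 have "\<exists>!h. h : Hom C Y P & (\<forall>i\<in>I. pr i\<cdot>h = f i)"
  using assms(1,2,3) unfolding is_product_def by blast
 then show thesis using that by blast
qed

lemma is_product_ext: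
 assumes "is_product C I X P pr" "h : Hom C Y P" "h' : Hom C Y P"
  "!!i. i : I ==> pr i\<cdot>h = pr i\<cdot>h'"
 shows "h = h'"
proof -
 have "Y : ob" using assms(2) by auto
 have "pr i : Hom C P (X i)" if "i : I" for i
  using that assms(1) by (simp add: is_product_def)
 then have *: "\<forall>i\<in>I. pr i\<cdot>h : Hom C Y (X i)" using assms(2) by auto
 have "\<exists>!k. k : Hom C Y P & (\<forall>i\<in>I. pr i\<cdot>k = f i)"
  if "\<forall>i\<in>I. f i : Hom C Y (X i)" for f
  using assms(1) \<open>Y : ob\<close> that unfolding is_product_def by blast
 from this[OF *]
 show ?thesis using assms(2-4) by (metis (no_types, lifting))
qed

lemma is_productD:
 assumes "is_product C I X P pr"
 shows "P : ob" "!!i. i : I ==> X i : ob" "!!i. i : I ==> pr i : arr"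
  "!!i. i : I ==> dom (pr i) = P" "!!i. i : I ==> cod (pr i) = X i"
 using assms by (auto simp: is_product_def)

lemma is_productI:
 assumes "P : ob" "!!i. i : I ==> X i : ob" "!!i. i : I ==> pr i : Hom C P (X i)"
  and ex: "!!Y f. Y : ob ==> (!!i. i : I ==> f i : Hom C Y (X i)) ==>
     \<exists>h. h : Hom C Y P & (\<forall>i\<in>I. pr i\<cdot>h = f i)"
  and un: "!!Y h h'. h : Hom C Y P ==> h' : Hom C Y P ==>
     (!!i. i : I ==> pr i\<cdot>h = pr i\<cdot>h') ==> h = h'"
 shows "is_product C I X P pr"
 unfolding is_product_def
proof (intro conjI ballI allI impI)
 fix Y f assume Y: "Y : ob" "\<forall>i\<in>I. f i : Hom C Y (X i)"
 show "\<exists>!h. h : Hom C Y P & (\<forall>i\<in>I. pr i\<cdot>h = f i)"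
 proof (rule ex_ex1I)
  show "\<exists>h. h : Hom C Y P & (\<forall>i\<in>I. pr i\<cdot>h = f i)" using ex Y by blast
  show "h = h'" if "h : Hom C Y P & (\<forall>i\<in>I. pr i\<cdot>h = f i)"
   "h' : Hom C Y P & (\<forall>i\<in>I. pr i\<cdot>h' = f i)" for h h'
   using that by (intro un[of h Y h']) auto
 qed
qed (use assms in auto)

lemma is_product_isomorphic:
 assumes P: "is_product C I X P pr" and Q: "is_product C I Y Q pr'"
  and iso: "!!i. i : I ==> isomorphic C (X i) (Y i)"
 shows "isomorphic C P Q"
proof -
 have "\<exists>f g. f : Hom C (X i) (Y i) & g : Hom C (Y i) (X i) & g\<cdot>f = ide (X i) &
   f\<cdot>g = ide (Y i)" if "i : I" for i
  using iso[OF that] by (metis isomorphicE)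
 then obtain f g where fg: "!!i. i : I ==> f i : Hom C (X i) (Y i)"
   "!!i. i : I ==> g i : Hom C (Y i) (X i)" "!!i. i : I ==> g i\<cdot>f i = ide (X i)"
   "!!i. i : I ==> f i\<cdot>g i = ide (Y i)"
  by metis
 note D = is_productD[OF P] is_productD[OF Q]
 obtain a where a: "a : Hom C P Q" "!!i. i : I ==> pr' i\<cdot>a = f i\<cdot>pr i"
  using is_product_map[OF Q, of P "%i. f i\<cdot>pr i"] D fg by auto
 obtain b where b: "b : Hom C Q P" "!!i. i : I ==> pr i\<cdot>b = g i\<cdot>pr' i"
  using is_product_map[OF P, of Q "%i. g i\<cdot>pr' i"] D fg by auto
 show ?thesis
 proof (rule isomorphicI[OF a(1) b(1)])
  show "b\<cdot>a = ide P"
  proof (rule is_product_ext[OF P])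
   fix i assume i: "i : I"
   have "pr i\<cdot>(b\<cdot>a) = g i\<cdot>(pr' i\<cdot>a)"
    using a b D fg i by (simp add: cmp_swap[OF b(2)])
   also have "... = pr i" using a D fg i by (simp add: cmp_reduce[OF fg(3)])
   finally show "pr i\<cdot>(b\<cdot>a) = pr i\<cdot>ide P" using D i by simp
  qed (use a b D in auto)
  show "a\<cdot>b = ide Q"
  proof (rule is_product_ext[OF Q])
   fix i assume i: "i : I"
   have "pr' i\<cdot>(a\<cdot>b) = f i\<cdot>(pr i\<cdot>b)"
    using a b D fg i by (simp add: cmp_swap[OF a(2)])
   also have "... = pr' i" using b D fg i by (simp add: cmp_reduce[OF fg(4)])
   finally show "pr' i\<cdot>(a\<cdot>b) = pr' i\<cdot>ide Q" using D i by simp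
  qed (use a b D in auto)
 qed
qed

end

lemma is_coproduct_reindex:
 assumes "is_coproduct C J X P io" "bij_betw e I J"
 shows "is_coproduct C I (X \<circ> e) P (io \<circ> e)"
proof -
 have e: "e i : J" if "i : I" for i using that assms(2) by (auto simp: bij_betw_def)
 let ?d = "inv_into I e"
 have d: "?d j : I" "e (?d j) = j" if "j : J" for j
  using that assms(2) by (auto simp: bij_betw_def inv_into_into f_inv_into_f)
 have de: "?d (e i) = i" if "i : I" for i
  using that assms(2) by (simp add: bij_betw_def)
 have "\<exists>!h. h : Hom C P Y & (\<forall>i\<in>I. h\<cdot>\<^bsub>C\<^esub>io (e i) = f i)"
  if "Y : Ob C" "\<forall>i\<in>I. f i : Hom C (X (e i)) Y" for Y f
 proof -
  have "\<forall>j\<in>J. f (?d j) : Hom C (X j) Y" using that(2) d by metis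
  then have "\<exists>!h. h : Hom C P Y & (\<forall>j\<in>J. h\<cdot>\<^bsub>C\<^esub>io j = f (?d j))"
   using assms(1) that(1) by (simp add: is_coproduct_def)
  moreover have "(\<forall>j\<in>J. h\<cdot>\<^bsub>C\<^esub>io j = f (?d j)) \<longleftrightarrow> (\<forall>i\<in>I. h\<cdot>\<^bsub>C\<^esub>io (e i) = f i)" for h
   using d de e by metis
  ultimately show ?thesis by simp
 qed
 then show ?thesis using assms(1) e by (simp add: is_coproduct_def)
qed

lemma is_product_reindex:
 assumes "is_product C J X P pr" "bij_betw e I J"
 shows "is_product C I (X \<circ> e) P (pr \<circ> e)"
proof -
 have e: "e i : J" if "i : I" for i using that assms(2) by (auto simp: bij_betw_def)
 let ?d = "inv_into I e"
 have d: "?d j : I" "e (?d j) = j" if "j : J" for j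
  using that assms(2) by (auto simp: bij_betw_def inv_into_into f_inv_into_f)
 have de: "?d (e i) = i" if "i : I" for i
  using that assms(2) by (simp add: bij_betw_def)
 have "\<exists>!h. h : Hom C Y P & (\<forall>i\<in>I. pr (e i)\<cdot>\<^bsub>C\<^esub>h = f i)"
  if "Y : Ob C" "\<forall>i\<in>I. f i : Hom C Y (X (e i))" for Y f
 proof -
  have "\<forall>j\<in>J. f (?d j) : Hom C Y (X j)" using that(2) d by metis
  then have "\<exists>!h. h : Hom C Y P & (\<forall>j\<in>J. pr j\<cdot>\<^bsub>C\<^esub>h = f (?d j))"
   using assms(1) that(1) by (simp add: is_product_def)
  moreover have "(\<forall>j\<in>J. pr j\<cdot>\<^bsub>C\<^esub>h = f (?d j)) \<longleftrightarrow> (\<forall>i\<in>I. pr (e i)\<cdot>\<^bsub>C\<^esub>h = f i)" for h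
   using d de e by metis
  ultimately show ?thesis by simp
 qed
 then show ?thesis using assms(1) e by (simp add: is_product_def)
qed


lemma is_functorD:
 assumes "is_functor C D F"
 shows "x : Ob C ==> fO F x : Ob D" "f : Arr C ==> fM F f : Arr D"
  "f : Arr C ==> Dom D (fM F f) = fO F (Dom C f)"
  "f : Arr C ==> Cod D (fM F f) = fO F (Cod C f)"
  "x : Ob C ==> fM F (Ide C x) = Ide D (fO F x)"
  "f : Arr C ==> g : Arr C ==> Cod C f = Dom C g ==>
   fM F (g\<cdot>\<^bsub>C\<^esub>f) = fM F g\<cdot>\<^bsub>D\<^esub>fM F f"
 using assms by (auto simp: is_functor_def)

lemma functor_isomorphic:
 assumes "category C" "category D" "is_functor C D F" "isomorphic C x y"
 shows "isomorphic D (fO F x) (fO F y)"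
proof -
 interpret C: category C by fact
 interpret D: category D by fact
 note F = is_functorD[OF assms(3)]
 from assms(4) obtain f g where fg: "f : Hom C x y" "g : Hom C y x" "g\<cdot>\<^bsub>C\<^esub>f = Ide C x"
  "f\<cdot>\<^bsub>C\<^esub>g = Ide C y" "x : Ob C" "y : Ob C" by (rule C.isomorphicE)
 show ?thesis
 proof (rule D.isomorphicI[of "fM F f" _ _ "fM F g"])
  show "fM F g\<cdot>\<^bsub>D\<^esub>fM F f = Ide D (fO F x)"
   using F(6)[of f g] fg F(5)[of x] by simp
  show "fM F f\<cdot>\<^bsub>D\<^esub>fM F g = Ide D (fO F y)"
   using F(6)[of g f] fg F(5)[of y] by simp
 qed (use fg F in auto)
qed

lemma functor_is_iso:
 assumes "category C" "category D" "is_functor C D F" "is_iso C f"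
 shows "is_iso D (fM F f)"
proof -
 interpret C: category C by fact
 interpret D: category D by fact
 note F = is_functorD[OF assms(3)]
 obtain g where fg: "f : Arr C" "g : Arr C" "Dom C g = Cod C f" "Cod C g = Dom C f"
  "g\<cdot>\<^bsub>C\<^esub>f = Ide C (Dom C f)" "f\<cdot>\<^bsub>C\<^esub>g = Ide C (Cod C f)"
  using assms(4) by (rule C.iso_inverse)
 show ?thesis
 proof (rule D.is_isoI[of _ "fM F g"])
  show "fM F g\<cdot>\<^bsub>D\<^esub>fM F f = Ide D (Dom D (fM F f))"
   using F(6)[of f g] fg F(3,5) by simp
  show "fM F f\<cdot>\<^bsub>D\<^esub>fM F g = Ide D (Cod D (fM F f))"
   using F(6)[of g f] fg F(4,5) by simp
 qed (use fg F in auto)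
qed

text \<open>
 \<open>universal C D F A y g e\<close> says that \<open>e : F g \<rightarrow> y\<close> is a universal arrow from \<open>F\<close>, restricted to the
 full subcategory on \<open>A\<close>, to \<open>y\<close>. All adjunctions below are handled one object at a time in this
 form, because a right adjoint that is chosen arbitrarily is only accessible through its
 universal property.
\<close>

definition universal ::
 "('o, 'm, 'x) cat_scheme => ('p, 'n, 'y) cat_scheme => ('o, 'm, 'p, 'n) func =>
   'o set => 'p => 'o => 'n => bool" where
 "universal C D F A y g e \<longleftrightarrow> g : A & e : Hom D (fO F g) y &
   (\<forall>x\<in>A. \<forall>f\<in>Hom D (fO F x) y. \<exists>h\<in>Hom C x g. e\<cdot>\<^bsub>D\<^esub>fM F h = f) &
   (\<forall>x\<in>A. \<forall>h\<in>Hom C x g. \<forall>h'\<in>Hom C x g. e\<cdot>\<^bsub>D\<^esub>fM F h = e\<cdot>\<^bsub>D\<^esub>fM F h' --> h = h')"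

lemma universalI:
 assumes "g : A" "e : Hom D (fO F g) y"
  "!!x f. x : A ==> f : Hom D (fO F x) y ==> \<exists>h\<in>Hom C x g. e\<cdot>\<^bsub>D\<^esub>fM F h = f"
  "!!x h h'. x : A ==> h : Hom C x g ==> h' : Hom C x g ==>
    e\<cdot>\<^bsub>D\<^esub>fM F h = e\<cdot>\<^bsub>D\<^esub>fM F h' ==> h = h'"
 shows "universal C D F A y g e"
 using assms unfolding universal_def by blast

lemma universalD:
 assumes "universal C D F A y g e"
 shows "g : A" "e : Arr D" "Dom D e = fO F g" "Cod D e = y"
 using assms by (auto simp: universal_def)

lemma universal_lift:
 assumes "universal C D F A y g e" "x : A" "f : Hom D (fO F x) y"
 obtains h where "h : Hom C x g" "e\<cdot>\<^bsub>D\<^esub>fM F h = f"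
 using assms unfolding universal_def by blast

lemma universal_ext:
 assumes "universal C D F A y g e" "x : A" "h : Hom C x g" "h' : Hom C x g"
  "e\<cdot>\<^bsub>D\<^esub>fM F h = e\<cdot>\<^bsub>D\<^esub>fM F h'"
 shows "h = h'"
 using assms unfolding universal_def by blast

lemma universal_isomorphic:
 assumes "category C" "category D" "is_functor C D F" "A <= Ob C"
  and u: "universal C D F A y g e" and u': "universal C D F A y' g' e'"
  and iso: "isomorphic D y y'"
 shows "isomorphic C g g'"
proof -
 interpret C: category C by fact
 interpret D: category D by fact
 note F = is_functorD[OF assms(3)]
 note e = universalD[OF u] universalD[OF u']
 have ob: "g : Ob C" "g' : Ob C" using e assms(4) by auto
 from iso obtain p q where pq: "p : Hom D y y'" "q : Hom D y' y" "q\<cdot>\<^bsub>D\<^esub>p = Ide D y"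
  "p\<cdot>\<^bsub>D\<^esub>q = Ide D y'" "y : Ob D" "y' : Ob D" by (rule D.isomorphicE)
 obtain h where h: "h : Hom C g g'" "e'\<cdot>\<^bsub>D\<^esub>fM F h = p\<cdot>\<^bsub>D\<^esub>e"
  by (rule universal_lift[OF u' e(1), of "p\<cdot>\<^bsub>D\<^esub>e"]) (use e pq in auto)
 obtain k where k: "k : Hom C g' g" "e\<cdot>\<^bsub>D\<^esub>fM F k = q\<cdot>\<^bsub>D\<^esub>e'"
  by (rule universal_lift[OF u e(5), of "q\<cdot>\<^bsub>D\<^esub>e'"]) (use e pq in auto)
 show ?thesis
 proof (rule C.isomorphicI[OF h(1) k(1)])
  have "e\<cdot>\<^bsub>D\<^esub>(fM F k\<cdot>\<^bsub>D\<^esub>fM F h) = q\<cdot>\<^bsub>D\<^esub>(e'\<cdot>\<^bsub>D\<^esub>fM F h)"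
   using e h k pq F by (simp add: D.cmp_swap[OF k(2)])
  also have "... = e" using e h k pq F by (simp add: D.cmp_reduce[OF pq(3)])
  finally show "k\<cdot>\<^bsub>C\<^esub>h = Ide C g"
   by (intro universal_ext[OF u e(1)]) (use e h k ob F in auto)
  have "e'\<cdot>\<^bsub>D\<^esub>(fM F h\<cdot>\<^bsub>D\<^esub>fM F k) = p\<cdot>\<^bsub>D\<^esub>(e\<cdot>\<^bsub>D\<^esub>fM F k)"
   using e h k pq F by (simp add: D.cmp_swap[OF h(2)])
  also have "... = e'" using e h k pq F by (simp add: D.cmp_reduce[OF pq(4)])
  finally show "h\<cdot>\<^bsub>C\<^esub>k = Ide C g'"
   by (intro universal_ext[OF u' e(5)]) (use e h k ob F in auto)
 qed
qed

lemma right_adjoint_universal: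
 assumes "category C" "category D" "is_functor C D F" "right_adjoint C D F G"
 obtains e where "!!y. y : Ob D ==> universal C D F (Ob C) y (fO G y) (e y)"
  "!!b. b : Arr D ==> e (Cod D b)\<cdot>\<^bsub>D\<^esub>fM F (fM G b) = b\<cdot>\<^bsub>D\<^esub>e (Dom D b)"
proof -
 interpret C: category C by fact
 interpret D: category D by fact
 note F = is_functorD[OF assms(3)]
 have "is_functor D C G" using assms(4) by (simp add: right_adjoint_def)
 note G = is_functorD[OF this]
 obtain \<phi> where bij: "!!x y. x : Ob C ==> y : Ob D ==>
    bij_betw (\<phi> x y) (Hom D (fO F x) y) (Hom C x (fO G y))"
  and nat: "!!a b f. a : Arr C ==> b : Arr D ==> f : Hom D (fO F (Cod C a)) (Dom D b) ==>
    \<phi> (Dom C a) (Cod D b) (b\<cdot>\<^bsub>D\<^esub>f\<cdot>\<^bsub>D\<^esub>fM F a) =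
       fM G b\<cdot>\<^bsub>C\<^esub>\<phi> (Cod C a) (Dom D b) f\<cdot>\<^bsub>C\<^esub>a"
  using assms(4) unfolding right_adjoint_def by blast
 have inj: "f = f'" if "\<phi> x y f = \<phi> x y f'" "x : Ob C" "y : Ob D" "f : Hom D (fO F x) y"
   "f' : Hom D (fO F x) y" for x y f f'
  using bij[OF that(2,3)] that by (metis bij_betw_def inj_onD)
 have hom: "\<phi> x y f : Hom C x (fO G y)" if "x : Ob C" "y : Ob D" "f : Hom D (fO F x) y" for x y f
  using bij[OF that(1,2)] that(3) by (metis bij_betw_apply)
 have "\<exists>e. e : Hom D (fO F (fO G y)) y & \<phi> (fO G y) y e = Ide C (fO G y)" if "y : Ob D" for y
 proof -
  have "Ide C (fO G y) : \<phi> (fO G y) y ` Hom D (fO F (fO G y)) y"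
   using bij[of "fO G y" y] that G by (simp add: bij_betw_def)
  then show ?thesis by (metis (no_types, lifting) imageE)
 qed
 then obtain e where e: "!!y. y : Ob D ==> e y : Hom D (fO F (fO G y)) y"
   "!!y. y : Ob D ==> \<phi> (fO G y) y (e y) = Ide C (fO G y)"
  by metis
 have \<phi>e: "\<phi> x y (e y\<cdot>\<^bsub>D\<^esub>fM F h) = h" if "y : Ob D" "h : Hom C x (fO G y)" for x y h
  using nat[of h "Ide D y" "e y"] that e[of y] F G by simp
 show thesis
 proof (rule that)
  fix y assume y: "y : Ob D"
  show "universal C D F (Ob C) y (fO G y) (e y)"
  proof (rule universalI)
   fix x f assume x: "x : Ob C" and f: "f : Hom D (fO F x) y"
   have "e y\<cdot>\<^bsub>D\<^esub>fM F (\<phi> x y f) = f"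
    by (rule inj[of x y]) (use \<phi>e[OF y hom[OF x y f]] hom[OF x y f] x y f e[OF y] F in auto)
   then show "\<exists>h\<in>Hom C x (fO G y). e y\<cdot>\<^bsub>D\<^esub>fM F h = f" using hom[OF x y f] by blast
  next
   fix x h h' assume "h : Hom C x (fO G y)" "h' : Hom C x (fO G y)"
    "e y\<cdot>\<^bsub>D\<^esub>fM F h = e y\<cdot>\<^bsub>D\<^esub>fM F h'"
   then show "h = h'" using \<phi>e[OF y] by metis
  qed (use y e G in auto)
 next
  fix b assume b: "b : Arr D"
  let ?y = "Dom D b" and ?z = "Cod D b"
  show "e ?z\<cdot>\<^bsub>D\<^esub>fM F (fM G b) = b\<cdot>\<^bsub>D\<^esub>e ?y"
  proof (rule inj[of "fO G ?y" ?z])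
   have "\<phi> (fO G ?y) ?z (b\<cdot>\<^bsub>D\<^esub>e ?y) = fM G b"
    using nat[of "Ide C (fO G ?y)" b "e ?y"] b e[of ?y] F G by simp
   then show "\<phi> (fO G ?y) ?z (e ?z\<cdot>\<^bsub>D\<^esub>fM F (fM G b)) = \<phi> (fO G ?y) ?z (b\<cdot>\<^bsub>D\<^esub>e ?y)"
    using \<phi>e[of ?z "fM G b" "fO G ?y"] b G by simp
  qed (use b e[of ?y] e[of ?z] F G in auto)
 qed
qed

lemma universal_right_adjoint:
 assumes "category C" "category D" "is_functor C D F"
  and ex: "!!y. y : Ob D ==> \<exists>g e. universal C D F (Ob C) y g e"
 shows "\<exists>G. right_adjoint C D F G"
proof -
 interpret C: category C by fact
 interpret D: category D by fact
 note F = is_functorD[OF assms(3)]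
 obtain g e where u: "!!y. y : Ob D ==> universal C D F (Ob C) y (g y) (e y)"
  using ex by metis
 note e = universalD[OF u]
 define \<phi> where "\<phi> x y f = (SOME h. h : Hom C x (g y) & e y\<cdot>\<^bsub>D\<^esub>fM F h = f)" for x y f
 have \<phi>: "\<phi> x y f : Arr C" "Dom C (\<phi> x y f) = x" "Cod C (\<phi> x y f) = g y"
   "e y\<cdot>\<^bsub>D\<^esub>fM F (\<phi> x y f) = f"
  if "x : Ob C" "y : Ob D" "f : Hom D (fO F x) y" for x y f
 proof -
  have "\<exists>h. h : Hom C x (g y) & e y\<cdot>\<^bsub>D\<^esub>fM F h = f"
   using universal_lift[OF u[OF that(2)] that(1,3)] by metis
  then have "\<phi> x y f : Hom C x (g y) & e y\<cdot>\<^bsub>D\<^esub>fM F (\<phi> x y f) = f"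
   unfolding \<phi>_def by (rule someI_ex)
  then show "\<phi> x y f : Arr C" "Dom C (\<phi> x y f) = x" "Cod C (\<phi> x y f) = g y"
   "e y\<cdot>\<^bsub>D\<^esub>fM F (\<phi> x y f) = f" by simp_all
 qed
 have ext: "h = h'" if "e y\<cdot>\<^bsub>D\<^esub>fM F h = e y\<cdot>\<^bsub>D\<^esub>fM F h'" "h : Hom C x (g y)"
   "h' : Hom C x (g y)" "y : Ob D" for x y h h'
  by (rule universal_ext[OF u[OF that(4)] _ that(2,3,1)]) (use that in auto)
 define G where "G = \<lparr>fO = g, fM = (%b. \<phi> (g (Dom D b)) (Cod D b) (b\<cdot>\<^bsub>D\<^esub>e (Dom D b)))\<rparr>"
 have Gb: "fM G b : Arr C" "Dom C (fM G b) = g (Dom D b)" "Cod C (fM G b) = g (Cod D b)"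
   "e (Cod D b)\<cdot>\<^bsub>D\<^esub>fM F (fM G b) = b\<cdot>\<^bsub>D\<^esub>e (Dom D b)" if "b : Arr D" for b
  using that \<phi>[of "g (Dom D b)" "Cod D b" "b\<cdot>\<^bsub>D\<^esub>e (Dom D b)"] e[of "Dom D b"]
  by (simp_all add: G_def)
 have fG: "fO G = g" by (simp add: G_def)
 have "is_functor D C G"
  unfolding is_functor_def fG
 proof (intro conjI ballI impI)
  fix y assume y: "y : Ob D"
  show "g y : Ob C" using e y by simp
  show "fM G (Ide D y) = Ide C (g y)"
   by (rule ext[of y _ _ "g y"]) (use y e[OF y] Gb[of "Ide D y"] F in auto)
 next
  fix b c assume bc: "b : Arr D" "c : Arr D" "Cod D b = Dom D c"
  have "e (Cod D c)\<cdot>\<^bsub>D\<^esub>(fM F (fM G c)\<cdot>\<^bsub>D\<^esub>fM F (fM G b)) = c\<cdot>\<^bsub>D\<^esub>(e (Dom D c)\<cdot>\<^bsub>D\<^esub>fM F (fM G b))"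
   using bc Gb[OF bc(1)] Gb[OF bc(2)] e[of "Dom D c"] e[of "Cod D c"] F
   by (simp add: D.cmp_swap[OF Gb(4)[OF bc(2)]])
  also have "... = c\<cdot>\<^bsub>D\<^esub>(b\<cdot>\<^bsub>D\<^esub>e (Dom D b))"
   using Gb(4)[OF bc(1)] bc by simp
  finally show "fM G (c\<cdot>\<^bsub>D\<^esub>b) = fM G c\<cdot>\<^bsub>C\<^esub>fM G b"
   by (intro ext[of "Cod D c" _ _ "g (Dom D b)"])
    (use bc Gb[OF bc(1)] Gb[OF bc(2)] Gb[of "c\<cdot>\<^bsub>D\<^esub>b"] e[of "Dom D b"] e[of "Cod D c"] F in auto)
 qed (use Gb in auto)
 moreover have "bij_betw (\<phi> x y) (Hom D (fO F x) y) (Hom C x (fO G y))"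
  if xy: "x : Ob C" "y : Ob D" for x y
 proof (rule bij_betwI[where g = "%h. e y\<cdot>\<^bsub>D\<^esub>fM F h"])
  show "\<phi> x y : Hom D (fO F x) y \<rightarrow> Hom C x (fO G y)" using \<phi> xy fG by auto
  show "(%h. e y\<cdot>\<^bsub>D\<^esub>fM F h) : Hom C x (fO G y) \<rightarrow> Hom D (fO F x) y"
   using e[OF xy(2)] F fG by auto
  show "e y\<cdot>\<^bsub>D\<^esub>fM F (\<phi> x y f) = f" if "f : Hom D (fO F x) y" for f using \<phi>(4) xy that by blast
  show "\<phi> x y (e y\<cdot>\<^bsub>D\<^esub>fM F h) = h" if "h : Hom C x (fO G y)" for h
   by (rule ext[of y _ _ x]) (use that xy e[OF xy(2)] F fG \<phi>[of x y "e y\<cdot>\<^bsub>D\<^esub>fM F h"] in auto)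
 qed
 moreover have "\<phi> (Dom C a) (Cod D b) (b\<cdot>\<^bsub>D\<^esub>f\<cdot>\<^bsub>D\<^esub>fM F a) =
       fM G b\<cdot>\<^bsub>C\<^esub>\<phi> (Cod C a) (Dom D b) f\<cdot>\<^bsub>C\<^esub>a"
  if ab: "a : Arr C" "b : Arr D" "f : Hom D (fO F (Cod C a)) (Dom D b)" for a b f
 proof (rule ext[of "Cod D b" _ _ "Dom C a"])
  let ?f = "\<phi> (Cod C a) (Dom D b) f"
  have f: "?f : Arr C" "Dom C ?f = Cod C a" "Cod C ?f = g (Dom D b)" "e (Dom D b)\<cdot>\<^bsub>D\<^esub>fM F ?f = f"
   using \<phi>[of "Cod C a" "Dom D b" f] ab by auto
  let ?h = "\<phi> (Dom C a) (Cod D b) (b\<cdot>\<^bsub>D\<^esub>f\<cdot>\<^bsub>D\<^esub>fM F a)"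
  have h: "?h : Arr C" "Dom C ?h = Dom C a" "Cod C ?h = g (Cod D b)"
    "e (Cod D b)\<cdot>\<^bsub>D\<^esub>fM F ?h = b\<cdot>\<^bsub>D\<^esub>f\<cdot>\<^bsub>D\<^esub>fM F a"
   using \<phi>[of "Dom C a" "Cod D b" "b\<cdot>\<^bsub>D\<^esub>f\<cdot>\<^bsub>D\<^esub>fM F a"] ab F by auto
  have "e (Cod D b)\<cdot>\<^bsub>D\<^esub>(fM F (fM G b)\<cdot>\<^bsub>D\<^esub>(fM F ?f\<cdot>\<^bsub>D\<^esub>fM F a)) =
    b\<cdot>\<^bsub>D\<^esub>(e (Dom D b)\<cdot>\<^bsub>D\<^esub>(fM F ?f\<cdot>\<^bsub>D\<^esub>fM F a))"
   using ab f Gb[OF ab(2)] e[of "Dom D b"] e[of "Cod D b"] F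
   by (simp add: D.cmp_swap[OF Gb(4)[OF ab(2)]])
  also have "... = b\<cdot>\<^bsub>D\<^esub>(f\<cdot>\<^bsub>D\<^esub>fM F a)"
   using ab f e[of "Dom D b"] F by (simp add: D.cmp_reduce[OF f(4)])
  finally show "e (Cod D b)\<cdot>\<^bsub>D\<^esub>fM F ?h = e (Cod D b)\<cdot>\<^bsub>D\<^esub>fM F (fM G b\<cdot>\<^bsub>C\<^esub>?f\<cdot>\<^bsub>C\<^esub>a)"
   using h f ab Gb[OF ab(2)] e[of "Cod D b"] F by simp
  show "?h : Hom C (Dom C a) (g (Cod D b))" using h by simp
  show "fM G b\<cdot>\<^bsub>C\<^esub>?f\<cdot>\<^bsub>C\<^esub>a : Hom C (Dom C a) (g (Cod D b))"
   using f ab Gb[OF ab(2)] by simp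
 qed (use ab in auto)
 ultimately have "right_adjoint C D F G"
  unfolding right_adjoint_def by blast
 then show ?thesis by blast
qed

lemma radj_universal:
 assumes "category C" "category D" "is_functor C D F"
  and "!!y. y : Ob D ==> \<exists>g e. universal C D F (Ob C) y g e"
 shows "right_adjoint C D F (radj C D F)"
 unfolding radj_def using universal_right_adjoint[OF assms] by (rule someI_ex)


section \<open>Additive categories\<close>

context additive_category
begin

abbreviation zro where "zro \<equiv> Zro C"
abbreviation pls where "pls \<equiv> Pls C"

lemma hom_group_simps [simp]: "carrier (hom_group C x y) = Hom C x y"
 "mult (hom_group C x y) = pls" "one (hom_group C x y) = zro x y"
 by (simp_all add: hom_group_def)

lemma zro_arr [simp]: "x : ob ==> y : ob ==> zro x y : arr"
 and zro_dom [simp]: "x : ob ==> y : ob ==> dom (zro x y) = x"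
 and zro_cod [simp]: "x : ob ==> y : ob ==> cod (zro x y) = y"
proof -
 assume "x : ob" "y : ob"
 then interpret comm_group "hom_group C x y" by (rule hom_comm_group)
 show "zro x y : arr" "dom (zro x y) = x" "cod (zro x y) = y"
  using one_closed by simp_all
qed

lemma pls_arr [simp]: "f : arr ==> g : arr ==> dom g = dom f ==> cod g = cod f ==>
  pls f g : arr"
 and pls_dom [simp]: "f : arr ==> g : arr ==> dom g = dom f ==> cod g = cod f ==>
  dom (pls f g) = dom f"
 and pls_cod [simp]: "f : arr ==> g : arr ==> dom g = dom f ==> cod g = cod f ==>
  cod (pls f g) = cod f"
proof -
 assume *: "f : arr" "g : arr" "dom g = dom f" "cod g = cod f"
 then interpret comm_group "hom_group C (dom f) (cod f)" by (intro hom_comm_group) auto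
 show "pls f g : arr" "dom (pls f g) = dom f" "cod (pls f g) = cod f"
  using m_closed[of f g] * by simp_all
qed

lemma neg_arr [simp]: "f : arr ==> neg C f : arr"
 and neg_dom [simp]: "f : arr ==> dom (neg C f) = dom f"
 and neg_cod [simp]: "f : arr ==> cod (neg C f) = cod f"
 and pls_neg [simp]: "f : arr ==> pls f (neg C f) = zro (dom f) (cod f)"
proof -
 assume *: "f : arr"
 then interpret comm_group "hom_group C (dom f) (cod f)" by (intro hom_comm_group) auto
 show "neg C f : arr" "dom (neg C f) = dom f" "cod (neg C f) = cod f"
  "pls f (neg C f) = zro (dom f) (cod f)"
  using inv_closed[of f] r_inv[of f] * by (simp_all add: neg_def)
qed

lemma pls_assoc:
 assumes "f : arr" "g : arr" "h : arr" "dom g = dom f" "cod g = cod f"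
  "dom h = dom f" "cod h = cod f"
 shows "pls (pls f g) h = pls f (pls g h)"
proof -
 interpret comm_group "hom_group C (dom f) (cod f)" using assms by (intro hom_comm_group) auto
 show ?thesis using m_assoc[of f g h] assms by simp
qed

lemma pls_comm:
 assumes "f : arr" "g : arr" "dom g = dom f" "cod g = cod f"
 shows "pls f g = pls g f"
proof -
 interpret comm_group "hom_group C (dom f) (cod f)" using assms by (intro hom_comm_group) auto
 show ?thesis using m_comm[of f g] assms by simp
qed

lemma pls_zro [simp]:
 assumes "f : arr" "dom f = x" "cod f = y"
 shows "pls f (zro x y) = f" "pls (zro x y) f = f"
proof -
 interpret comm_group "hom_group C x y" using assms by (intro hom_comm_group) auto
 show "pls f (zro x y) = f" "pls (zro x y) f = f" using r_one[of f] l_one[of f] assms by simp_all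
qed

lemma neg_pls [simp]: "f : arr ==> pls (neg C f) f = zro (dom f) (cod f)"
 using pls_comm[of f "neg C f"] by simp

lemma pls_cancel:
 assumes "pls f g = pls f g'" "f : arr" "g : Hom C (dom f) (cod f)" "g' : Hom C (dom f) (cod f)"
 shows "g = g'"
proof -
 interpret comm_group "hom_group C (dom f) (cod f)" using assms by (intro hom_comm_group) auto
 show ?thesis using Units_l_cancel[of f g g'] assms by simp
qed

lemma neg_unique:
 assumes "pls f g = zro (dom f) (cod f)" "f : arr" "g : Hom C (dom f) (cod f)"
 shows "g = neg C f"
 using pls_cancel[of f g "neg C f"] assms by simp

lemma neg_neg [simp]: "f : arr ==> neg C (neg C f) = f"
 using neg_unique[of "neg C f" f] by simp

lemma cmp_pls [simp]:
 "f : arr ==> f' : arr ==> g : arr ==> dom f' = dom f ==> cod f' = cod f ==>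
  cod f = dom g ==> g\<cdot>pls f f' = pls (g\<cdot>f) (g\<cdot>f')"
 using cmp_pls_right[of f "dom f" "cod f" f' g "cod g"] by simp

lemma pls_cmp [simp]:
 "f : arr ==> g' : arr ==> g : arr ==> dom g' = dom g ==> cod g' = cod g ==>
  cod f = dom g ==> pls g g'\<cdot>f = pls (g\<cdot>f) (g'\<cdot>f)"
 using cmp_pls_left[of f "dom f" "cod f" g "cod g" g'] by simp

lemma cmp_zro [simp]:
 assumes "f : arr" "w : ob" "x = dom f"
 shows "f\<cdot>zro w x = zro w (cod f)"
proof -
 have "pls (f\<cdot>zro w x) (f\<cdot>zro w x) = f\<cdot>pls (zro w x) (zro w x)"
  using assms by (simp del: pls_zro)
 also have "... = pls (f\<cdot>zro w x) (zro w (cod f))" using assms by simp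
 finally show ?thesis by (rule pls_cancel) (use assms in auto)
qed

lemma zro_cmp [simp]:
 assumes "f : arr" "z : ob" "y = cod f"
 shows "zro y z\<cdot>f = zro (dom f) z"
proof -
 have "pls (zro y z\<cdot>f) (zro y z\<cdot>f) = pls (zro y z) (zro y z)\<cdot>f"
  using assms by (simp del: pls_zro)
 also have "... = pls (zro y z\<cdot>f) (zro (dom f) z)" using assms by simp
 finally show ?thesis by (rule pls_cancel) (use assms in auto)
qed

lemma neg_cmp [simp]: "f : arr ==> g : arr ==> cod f = dom g ==> neg C g\<cdot>f = neg C (g\<cdot>f)"
 using pls_cmp[of f "neg C g" g] by (intro neg_unique) (simp_all del: pls_cmp)

lemma cmp_neg [simp]: "f : arr ==> g : arr ==> cod f = dom g ==> g\<cdot>neg C f = neg C (g\<cdot>f)"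
 using cmp_pls[of f "neg C f" g] by (intro neg_unique) (simp_all del: cmp_pls)

lemma neg_zro [simp]: "x : ob ==> y : ob ==> neg C (zro x y) = zro x y"
 using neg_unique[of "zro x y" "zro x y"] by simp

lemma neg_eq_zro: "f : arr ==> neg C f = zro (dom f) (cod f) ==> f = zro (dom f) (cod f)"
 by (metis neg_neg neg_zro ob_cod ob_dom)

abbreviation sub :: "'m => 'm => 'm" where
 "sub f g \<equiv> pls f (neg C g)"

lemma sub_eq_zro:
 assumes "sub f g = zro x y" "f : Hom C x y" "g : Hom C x y"
 shows "f = g"
 using neg_unique[of f "neg C g"] assms by (metis neg_neg neg_arr neg_cod neg_dom in_Hom)

lemma sub_pls:
 assumes "f : arr" "g : arr" "dom g = dom f" "cod g = cod f"
 shows "pls (sub f g) g = f"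
 using assms by (simp add: pls_assoc)

lemma zero_arr_to: "is_zero C z ==> f : arr ==> cod f = z ==> f = zro (dom f) z"
 by (rule is_zero_eq_to[of z]) auto

lemma is_zero_iff: "is_zero C z \<longleftrightarrow> z : ob & ide z = zro z z"
proof
 assume z: "is_zero C z"
 show "z : ob & ide z = zro z z"
  by (rule conjI[OF zero_in[OF z] is_zero_eq_from[OF z, of _ z]]) (use zero_in[OF z] in simp_all)
next
 assume z: "z : ob & ide z = zro z z"
 have "f = zro z x" if "f : Hom C z x" for f x
 proof -
  have "f\<cdot>ide z = f" "f\<cdot>zro z z = zro z x" using that by auto
  then show ?thesis using z by simp
 qed
 moreover have "f = zro x z" if "f : Hom C x z" for f x
 proof -
  have "ide z\<cdot>f = f" "zro z z\<cdot>f = zro x z" using that by auto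
  then show ?thesis using z by simp
 qed
 moreover have "zro x z : Hom C x z" "zro z x : Hom C z x" if "x : ob" for x
  using that z by simp_all
 ultimately show "is_zero C z" using z unfolding is_zero_def by blast
qed

end


section \<open>Triangulated categories\<close>

context category
begin

lemma is_coproduct_iso:
 assumes P: "is_coproduct C I X P io"
  and th: "!!i. i : I ==> is_iso C (th i)" "!!i. i : I ==> th i : Hom C (Y i) (X i)"
  and \<eta>: "is_iso C \<eta>" "\<eta> : Hom C P Q"
 shows "is_coproduct C I Y Q (%i. \<eta>\<cdot>(io i\<cdot>th i))"
proof -
 note D = is_coproductD[OF P]
 obtain \<eta>' where \<eta>': "\<eta>' : arr" "dom \<eta>' = Q" "cod \<eta>' = P" "\<eta>'\<cdot>\<eta> = ide P" "\<eta>\<cdot>\<eta>' = ide Q"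
  by (rule iso_inverse[OF \<eta>(1)]) (use \<eta>(2) in auto)
 have "\<exists>th'. th' : arr & dom th' = X i & cod th' = Y i & th'\<cdot>th i = ide (Y i) & th i\<cdot>th' = ide (X i)"
  if "i : I" for i
  by (rule iso_inverse[OF th(1)[OF that]]) (use th(2)[OF that] in auto)
 then obtain th' where th': "!!i. i : I ==> th' i : arr" "!!i. i : I ==> dom (th' i) = X i"
   "!!i. i : I ==> cod (th' i) = Y i" "!!i. i : I ==> th' i\<cdot>th i = ide (Y i)"
   "!!i. i : I ==> th i\<cdot>th' i = ide (X i)"
  by metis
 show ?thesis
 proof (rule is_coproductI)
  show "Q : ob" using \<eta>(2) by auto
  show "Y i : ob" if "i : I" for i using th(2)[OF that] ob_dom[of "th i"] by simp
  show "\<eta>\<cdot>(io i\<cdot>th i) : Hom C (Y i) Q" if "i : I" for i using th(2)[OF that] \<eta>(2) D that by auto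
 next
  fix Z f assume Z: "Z : ob" and f: "!!i. i : I ==> f i : Hom C (Y i) Z"
  have "\<exists>h. h : Hom C P Z & (\<forall>i\<in>I. h\<cdot>io i = f i\<cdot>th' i)"
   by (rule is_coproduct_map[OF P Z, of "%i. f i\<cdot>th' i"]) (use f th' in auto)
  then obtain h where h: "h : Hom C P Z" "!!i. i : I ==> h\<cdot>io i = f i\<cdot>th' i" by blast
  have "h\<cdot>\<eta>'\<cdot>(\<eta>\<cdot>(io i\<cdot>th i)) = f i" if i: "i : I" for i
  proof -
   have "\<eta>'\<cdot>(\<eta>\<cdot>(io i\<cdot>th i)) = io i\<cdot>th i"
    using cmp_reduce[OF \<eta>'(4), of "io i\<cdot>th i"] D i \<eta>(2) \<eta>' th(2)[OF i] by simp
   then have "h\<cdot>\<eta>'\<cdot>(\<eta>\<cdot>(io i\<cdot>th i)) = h\<cdot>(io i\<cdot>th i)"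
    using D i \<eta>(2) \<eta>' th(2)[OF i] h(1) by simp
   also have "... = f i\<cdot>th' i\<cdot>th i"
    using cmp_reduce[OF h(2)[OF i], of "th i"] D i th(2)[OF i] h(1) by simp
   also have "... = f i" using f[OF i] th' i th(2)[OF i] by simp
   finally show ?thesis .
  qed
  then show "\<exists>h. h : Hom C Q Z & (\<forall>i\<in>I. h\<cdot>(\<eta>\<cdot>(io i\<cdot>th i)) = f i)"
   using h(1) \<eta>' by (intro exI[of _ "h\<cdot>\<eta>'"]) auto
 next
  fix Z h h' assume h: "h : Hom C Q Z" "h' : Hom C Q Z"
   and eq: "!!i. i : I ==> h\<cdot>(\<eta>\<cdot>(io i\<cdot>th i)) = h'\<cdot>(\<eta>\<cdot>(io i\<cdot>th i))"
  have "h\<cdot>\<eta> = h'\<cdot>\<eta>"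
  proof (rule is_coproduct_ext[OF P, of _ Z])
   fix i assume i: "i : I"
   have "h\<cdot>(\<eta>\<cdot>(io i\<cdot>th i))\<cdot>th' i = h'\<cdot>(\<eta>\<cdot>(io i\<cdot>th i))\<cdot>th' i" using eq[OF i] by simp
   then show "h\<cdot>\<eta>\<cdot>io i = h'\<cdot>\<eta>\<cdot>io i" using h \<eta>(2) D i th' th(2)[OF i] by simp
  qed (use h \<eta>(2) in auto)
  then have "h\<cdot>\<eta>\<cdot>\<eta>' = h'\<cdot>\<eta>\<cdot>\<eta>'" by simp
  then show "h = h'" using h \<eta>(2) \<eta>' by simp
 qed
qed

end

context triangulated_category
begin

abbreviation shO where "shO \<equiv> ShO C"
abbreviation shM where "shM \<equiv> ShM C"
abbreviation tri where "tri \<equiv> Tri C"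

lemma shift_functor: "is_functor C C (Sh C)"
 using shift_additive by (simp add: is_additive_functor_def)

lemma sh_ob [simp]: "x : ob ==> shO x : ob"
 and sh_arr [simp]: "f : arr ==> shM f : arr"
 and sh_dom [simp]: "f : arr ==> dom (shM f) = shO (dom f)"
 and sh_cod [simp]: "f : arr ==> cod (shM f) = shO (cod f)"
 and sh_ide [simp]: "x : ob ==> shM (ide x) = ide (shO x)"
 and sh_cmp [simp]: "f : arr ==> g : arr ==> cod f = dom g ==>
   shM (g\<cdot>f) = shM g\<cdot>shM f"
 using is_functorD[OF shift_functor] by simp_all

lemma sh_pls [simp]: "f : arr ==> g : arr ==> dom g = dom f ==> cod g = cod f ==>
  shM (pls f g) = pls (shM f) (shM g)"
 using shift_additive unfolding is_additive_functor_def by (metis in_Hom ob_cod ob_dom)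

lemma sh_faithful:
 assumes "shM f = shM g" "f : Hom C x y" "g : Hom C x y" shows "f = g"
proof -
 have "x : ob" "y : ob" using assms(2) by auto
 then have "inj_on (shM) (Hom C x y)" using shift_fully_faithful by (simp add: bij_betw_def)
 then show ?thesis using assms by (rule inj_onD)
qed

lemma sh_full:
 assumes "h : Hom C (shO x) (shO y)" "x : ob" "y : ob"
 obtains f where "f : Hom C x y" "shM f = h"
 using shift_fully_faithful[of x y] assms unfolding bij_betw_def by (metis (no_types, lifting) imageE)

lemma sh_zro [simp]:
 assumes "x : ob" "y : ob" shows "shM (zro x y) = zro (shO x) (shO y)"
proof -
 have "pls (shM (zro x y)) (shM (zro x y)) = shM (pls (zro x y) (zro x y))"
  using assms by (simp del: pls_zro)
 also have "... = pls (shM (zro x y)) (zro (shO x) (shO y))" using assms by simp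
 finally show ?thesis by (rule pls_cancel) (use assms in auto)
qed

lemma sh_neg [simp]: assumes "f : arr" shows "shM (neg C f) = neg C (shM f)"
proof (rule neg_unique)
 have "pls (shM f) (shM (neg C f)) = shM (pls f (neg C f))"
  using assms by (simp del: pls_neg)
 then show "pls (shM f) (shM (neg C f)) = zro (dom (shM f)) (cod (shM f))"
  using assms by simp
qed (use assms in auto)

lemma sh_zro_iff: "shM f = zro (shO x) (shO y) ==> f : Hom C x y ==> f = zro x y"
 by (rule sh_faithful) auto

lemma zero_sh [simp]: "is_zero C z ==> is_zero C (shO z)"
 unfolding is_zero_iff by (metis sh_ide sh_ob sh_zro)

lemma isomorphic_sh: "isomorphic C x y ==> isomorphic C (shO x) (shO y)"
 using functor_isomorphic[OF category_axioms category_axioms shift_functor] .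

lemma isomorphic_sh_cancel:
 assumes "isomorphic C (shO x) (shO y)" "x : ob" "y : ob" shows "isomorphic C x y"
proof -
 from assms(1) obtain p q where pq: "p : Hom C (shO x) (shO y)" "q : Hom C (shO y) (shO x)"
  "q\<cdot>p = ide (shO x)" "p\<cdot>q = ide (shO y)" by (rule isomorphicE)
 obtain f where f: "f : Hom C x y" "shM f = p" using pq(1) assms(2,3) by (rule sh_full)
 obtain g where g: "g : Hom C y x" "shM g = q" using pq(2) assms(3,2) by (rule sh_full)
 show ?thesis
  by (rule isomorphicI[OF f(1) g(1)]; rule sh_faithful[of _ _ x x] sh_faithful[of _ _ y y]) (use pq f g assms in auto)
qed

lemma unshift_ob:
 assumes "y : ob"
 obtains x th th' where "x : ob" "th : Hom C (shO x) y" "th' : Hom C y (shO x)"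
  "th'\<cdot>th = ide (shO x)" "th\<cdot>th' = ide y"
proof -
 obtain x where "x : ob" "isomorphic C (shO x) y" using shift_ess_surj[OF assms] by blast
 then show thesis using that by (metis isomorphicE)
qed

lemma triD:
 assumes "(f, g, h) : tri"
 shows "f : arr" "g : arr" "h : arr" "dom g = cod f" "dom h = cod g"
  "cod h = shO (dom f)"
 using tri_candidate[OF assms] by (auto simp: candidate_triangle_def)

lemma neg_inj: "neg C f = neg C g ==> f : arr ==> g : arr ==> f = g"
 by (metis neg_neg)

lemma tri_rot: "(f, g, h) : tri ==> (g, h, neg C (shM f)) : tri"
 using tri_rotate tri_candidate by blast

lemma tri_rot_back:
 assumes "(g, h, neg C (shM f)) : tri" "f : arr" "cod f = dom g" "cod h = shO (dom f)"
 shows "(f, g, h) : tri"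
 using tri_rotate[of f g h] assms triD[OF assms(1)] by (auto simp: candidate_triangle_def)

lemma tri_zero_ide:
 assumes "is_zero C z" "w : ob"
 shows "(zro z w, ide w, zro w (shO z)) : tri"
 by (rule tri_rot_back) (use tri_ide[OF assms(2) zero_sh[OF assms(1)]] assms in auto)

lemma tri_ide_zero_rot:
 assumes "is_zero C z" "w : ob"
 shows "(zro w z, zro z (shO w), neg C (ide (shO w))) : tri"
 using tri_rot[OF tri_ide[OF assms(2,1)]] assms by simp

lemma tri_cmp1:
 assumes "(f, g, h) : tri" shows "g\<cdot>f = zro (dom f) (cod g)"
proof -
 note D = triD[OF assms]
 obtain z where z: "is_zero C z" using zero_object by blast
 obtain c where "c : Hom C z (cod g)" "c\<cdot>zro (dom f) z = g\<cdot>f"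
  using tri_fill[OF tri_ide[OF _ z] assms, of "dom f" "ide (dom f)" f] D z by auto
 then show ?thesis using D z by auto
qed

lemma tri_cmp2: "(f, g, h) : tri ==> h\<cdot>g = zro (cod f) (shO (dom f))"
 using tri_cmp1[OF tri_rot] triD by metis

lemma tri_cmp3:
 assumes "(f, g, h) : tri" shows "shM f\<cdot>h = zro (cod g) (shO (cod f))"
proof -
 note D = triD[OF assms]
 have "neg C (shM f)\<cdot>h = zro (cod g) (shO (cod f))"
  using tri_cmp2[OF tri_rot[OF assms]] D by simp
 then show ?thesis using D neg_eq_zro[of "shM f\<cdot>h"] by simp
qed

text \<open>The representable functors turn triangles into exact sequences.\<close>

lemma tri_lift:
 assumes t: "(f, g, h) : tri" and a: "a : Hom C w (cod f)" "g\<cdot>a = zro w (cod g)"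
 obtains b where "b : Hom C w (dom f)" "f\<cdot>b = a"
proof -
 note D = triD[OF t]
 have w: "w : ob" using a by auto
 obtain z where z: "is_zero C z" using zero_object by blast
 obtain c where c: "c : Hom C (shO w) (shO (dom f))"
   "shM a\<cdot>neg C (ide (shO w)) = neg C (shM f)\<cdot>c"
  using tri_fill[OF tri_ide_zero_rot[OF z w] tri_rot[OF t], of a "zro z (cod g)"] D z w a by auto
 obtain b where b: "b : Hom C w (dom f)" "shM b = c" by (rule sh_full[OF c(1) w]) (use D in auto)
 have "neg C (shM a) = neg C (shM f\<cdot>c)" using c D a w by simp
 then have "shM a = shM f\<cdot>c" by (rule neg_inj) (use c(1) D a(1) in simp_all)
 then have "shM (f\<cdot>b) = shM a" using b D by simp
 then have "f\<cdot>b = a" by (rule sh_faithful) (use b D a in auto)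
 with b that show thesis by blast
qed

lemma tri_lift2:
 assumes t: "(f, g, h) : tri" and a: "a : Hom C w (cod g)" "h\<cdot>a = zro w (cod h)"
 obtains b where "b : Hom C w (cod f)" "g\<cdot>b = a"
 using tri_lift[OF tri_rot[OF t] a] triD[OF t] by metis

lemma tri_lift3:
 assumes t: "(f, g, h) : tri" and a: "a : Hom C w (shO (dom f))" "shM f\<cdot>a = zro w (shO (cod f))"
 obtains b where "b : Hom C w (cod g)" "h\<cdot>b = a"
proof -
 note D = triD[OF t]
 have "neg C (shM f)\<cdot>a = zro w (shO (cod f))" using a D by auto
 then show thesis using tri_lift2[OF tri_rot[OF t], of a w] a D that by auto
qed

text \<open>The kernel of \<open>f\<close> is hit by the shifted hom set.\<close>

lemma tri_lift0:
 assumes t: "(f, g, h) : tri" and a: "a : Hom C w (dom f)" "f\<cdot>a = zro w (cod f)"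
 obtains b where "b : Hom C (shO w) (cod g)" "h\<cdot>b = shM a"
proof -
 note D = triD[OF t]
 have w: "w : ob" using a by auto
 have "shM f\<cdot>shM a = shM (f\<cdot>a)" using a(1) D by simp
 also have "... = zro (shO w) (shO (cod f))" using a D w by simp
 finally have *: "shM f\<cdot>shM a = zro (shO w) (shO (cod f))" .
 show thesis by (rule tri_lift3[OF t _ *]) (use a that in auto)
qed

lemma tri_ext:
 assumes t: "(f, g, h) : tri" and a: "a : Hom C (cod f) w" "a\<cdot>f = zro (dom f) w"
 obtains b where "b : Hom C (cod g) w" "b\<cdot>g = a"
proof -
 note D = triD[OF t]
 have w: "w : ob" using a by auto
 obtain z where z: "is_zero C z" using zero_object by blast
 have "\<exists>b\<in>Hom C (cod g) (cod (ide w)). b\<cdot>g = ide w\<cdot>a &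
   shM (zro (dom f) z)\<cdot>h = zro w (shO z)\<cdot>b"
  by (rule tri_fill[OF t tri_zero_ide[OF z w]]) (use D z w a in auto)
 then obtain b where "b : Hom C (cod g) (cod (ide w))" "b\<cdot>g = ide w\<cdot>a" by blast
 then show thesis using that[of b] a w by simp
qed

lemma tri_ext2:
 assumes t: "(f, g, h) : tri" and a: "a : Hom C (cod g) w" "a\<cdot>g = zro (cod f) w"
 obtains b where "b : Hom C (shO (dom f)) w" "b\<cdot>h = a"
 using tri_ext[OF tri_rot[OF t] a(1)] a(2) triD[OF t] by metis

lemma tri_ext3:
 assumes t: "(f, g, h) : tri" and a: "a : Hom C (shO (dom f)) w" "a\<cdot>h = zro (cod g) w"
 obtains b where "b : Hom C (shO (cod f)) w" "b\<cdot>shM f = a"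
proof -
 note D = triD[OF t]
 obtain b where b: "b : Hom C (shO (cod f)) w" "b\<cdot>neg C (shM f) = a"
  using tri_ext2[OF tri_rot[OF t], of a w] a D by auto
 have "neg C b\<cdot>shM f = a" using b D by auto
 then show thesis using that[of "neg C b"] b by auto
qed

lemma tri_sh:
 assumes t: "(f, g, h) : tri" shows "(shM f, shM g, neg C (shM h)) : tri"
proof -
 note D = triD[OF t]
 have r: "(neg C (shM f), neg C (shM g), neg C (shM h)) : tri"
  by (rule tri_rot tri_rot[OF tri_rot] t)+
 show ?thesis
 proof (rule tri_iso[OF r])
  show "candidate_triangle C (shM f, shM g, neg C (shM h))"
   using D by (simp add: candidate_triangle_def)
  let ?x = "shO (dom f)" and ?y = "shO (cod f)" and ?z = "shO (cod g)"
  have i: "is_iso C (neg C (ide w))" if "w : ob" for w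
   by (rule is_isoI[of _ "neg C (ide w)"]) (use that in auto)
  show "triangle_iso C (shM f, shM g, neg C (shM h)) (neg C (shM f), neg C (shM g), neg C (shM h))"
   unfolding triangle_iso_def prod.case
   by (rule bexI[of _ "ide ?x"], rule bexI[of _ "neg C (ide ?y)"], rule bexI[of _ "ide ?z"])
    (use D i in auto)
 qed
qed

text \<open>The five lemma, applied to \<open>Hom(-, N)\<close>, for a morphism of triangles.\<close>

lemma five_lemma_contra:
 assumes t: "(f, g, h) : tri" and t': "(f', g', h') : tri"
  and a: "a : Hom C (dom f) (dom f')" and b: "b : Hom C (cod f) (cod f')"
  and c: "c : Hom C (cod g) (cod g')"
  and sq: "b\<cdot>f = f'\<cdot>a" "c\<cdot>g = g'\<cdot>b" "shM a\<cdot>h = h'\<cdot>c"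
  and inj: "!!m. m : Hom C (dom f') N ==> m\<cdot>a = zro (dom f) N ==> m = zro (dom f') N"
   "!!m. m : Hom C (cod f') N ==> m\<cdot>b = zro (cod f) N ==> m = zro (cod f') N"
   "!!m. m : Hom C (shO (dom f')) N ==> m\<cdot>shM a = zro (shO (dom f)) N ==>
     m = zro (shO (dom f')) N"
  and sur: "!!n. n : Hom C (cod f) N ==> \<exists>m\<in>Hom C (cod f') N. m\<cdot>b = n"
   "!!n. n : Hom C (shO (dom f)) N ==> \<exists>m\<in>Hom C (shO (dom f')) N. m\<cdot>shM a = n"
   "!!n. n : Hom C (shO (cod f)) N ==> \<exists>m\<in>Hom C (shO (cod f')) N. m\<cdot>shM b = n"
 shows "n : Hom C (cod g) N ==> \<exists>m\<in>Hom C (cod g') N. m\<cdot>c = n"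
  and "m : Hom C (cod g') N ==> m\<cdot>c = zro (cod g) N ==> m = zro (cod g') N"
proof -
 note D = triD[OF t] triD[OF t']
 {
  fix n assume n: "n : Hom C (cod g) N"
  then have N: "N : ob" by auto
  obtain m where m: "m : Hom C (cod f') N" "m\<cdot>b = n\<cdot>g" using sur(1)[of "n\<cdot>g"] n D by auto
  have "m\<cdot>f'\<cdot>a = m\<cdot>(b\<cdot>f)" using m(1) D a b sq(1) by simp
  also have "... = n\<cdot>g\<cdot>f" using cmp_reduce[OF m(2), of f] m(1) D b by simp
  also have "... = zro (dom f) N" using n D tri_cmp1[OF t] by simp
  finally have *: "m\<cdot>f'\<cdot>a = zro (dom f) N" .
  have "m\<cdot>f' = zro (dom f') N" by (rule inj(1)[OF _ *]) (use m(1) D in simp)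
  with m(1) obtain m' where m': "m' : Hom C (cod g') N" "m'\<cdot>g' = m" by (rule tri_ext[OF t'])
  have "m'\<cdot>c\<cdot>g = m\<cdot>b" using m' c D sq(2) cmp_reduce[OF m'(2), of b] b by simp
  then have "sub n (m'\<cdot>c)\<cdot>g = zro (cod f) N" using m n m' c D N by simp
  then obtain k where k: "k : Hom C (shO (dom f)) N" "k\<cdot>h = sub n (m'\<cdot>c)"
   using tri_ext2[OF t, of "sub n (m'\<cdot>c)" N] n m' c by auto
  obtain k' where k': "k' : Hom C (shO (dom f')) N" "k'\<cdot>shM a = k" using sur(2)[OF k(1)] by blast
  have "k'\<cdot>h'\<cdot>c = k\<cdot>h" using k' k D c sq(3) a cmp_reduce[OF k'(2), of h] by simp
  then have "pls (k'\<cdot>h') m'\<cdot>c = n" using k k' m' c D n sub_pls[of n "m'\<cdot>c"] by simp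
  moreover have "pls (k'\<cdot>h') m' : Hom C (cod g') N" using k' D m' by auto
  ultimately show "\<exists>m\<in>Hom C (cod g') N. m\<cdot>c = n" by blast
 }
 {
  fix m assume m: "m : Hom C (cod g') N" "m\<cdot>c = zro (cod g) N"
  then have N: "N : ob" by auto
  have "m\<cdot>g'\<cdot>b = m\<cdot>(c\<cdot>g)" using m(1) D b c sq(2) by simp
  also have "... = zro (cod f) N" using cmp_reduce[OF m(2), of g] m(1) D c N by simp
  finally have *: "m\<cdot>g'\<cdot>b = zro (cod f) N" .
  have "m\<cdot>g' = zro (cod f') N" by (rule inj(2)[OF _ *]) (use m(1) D in simp)
  with m(1) obtain k where k: "k : Hom C (shO (dom f')) N" "k\<cdot>h' = m" by (rule tri_ext2[OF t'])
  have "k\<cdot>shM a\<cdot>h = m\<cdot>c" using k D a c sq(3) cmp_reduce[OF k(2), of c] by simp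
  then have "k\<cdot>shM a\<cdot>h = zro (cod g) N" using m by simp
  then obtain l where l: "l : Hom C (shO (cod f)) N" "l\<cdot>shM f = k\<cdot>shM a"
   using tri_ext3[OF t, of "k\<cdot>shM a" N] k a D by auto
  obtain l' where l': "l' : Hom C (shO (cod f')) N" "l'\<cdot>shM b = l" using sur(3)[OF l(1)] by blast
  have "l'\<cdot>(shM f'\<cdot>shM a) = l'\<cdot>shM (b\<cdot>f)" using a b D sq(1) by simp
  also have "... = k\<cdot>shM a" using l l' D b cmp_reduce[OF l'(2), of "shM f"] by simp
  finally have "sub k (l'\<cdot>shM f')\<cdot>shM a = zro (shO (dom f)) N"
   using k l' D a N by simp
  then have "sub k (l'\<cdot>shM f') = zro (shO (dom f')) N"
   by (intro inj(3)) (use k(1) l'(1) D in simp_all)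
  then have "k = l'\<cdot>shM f'" by (rule sub_eq_zro) (use k l' D in auto)
  then have "m = l'\<cdot>(shM f'\<cdot>h')" using k(2)[symmetric] l'(1) D by simp
  then show "m = zro (cod g') N" using l'(1) D tri_cmp3[OF t'] by simp
 }
qed

lemma iso_if_hom_bij:
 assumes c: "c : Hom C z w"
  and sur: "!!N n. n : Hom C z N ==> \<exists>m\<in>Hom C w N. m\<cdot>c = n"
  and inj: "!!N m. m : Hom C w N ==> m\<cdot>c = zro z N ==> m = zro w N"
 shows "is_iso C c"
proof -
 obtain d where d: "d : Hom C w z" "d\<cdot>c = ide z" using sur[of "ide z" z] c by auto
 have w: "w : ob" using c by auto
 have "sub (c\<cdot>d) (ide w)\<cdot>c = zro z w" using c d w by simp
 then have "sub (c\<cdot>d) (ide w) = zro w w" by (intro inj) (use c d(1) w in simp_all)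
 then have "c\<cdot>d = ide w" by (rule sub_eq_zro) (use c d(1) w in simp_all)
 then show ?thesis using c d by (intro is_isoI[of c d]) auto
qed

lemma tri_iso_third:
 assumes t: "(f, g, h) : tri" and t': "(f', g', h') : tri"
  and a: "a : Hom C (dom f) (dom f')" "is_iso C a" and b: "b : Hom C (cod f) (cod f')" "is_iso C b"
  and sq: "b\<cdot>f = f'\<cdot>a"
 obtains c where "c : Hom C (cod g) (cod g')" "is_iso C c" "c\<cdot>g = g'\<cdot>b" "shM a\<cdot>h = h'\<cdot>c"
proof -
 obtain c where c: "c : Hom C (cod g) (cod g')" "c\<cdot>g = g'\<cdot>b" "shM a\<cdot>h = h'\<cdot>c"
  using tri_fill[OF t t' a(1) b(1) sq] by blast
 have inj: "m = zro y N" if iso: "is_iso C u" and u: "u : Hom C x y" and m: "m : Hom C y N"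
   "m\<cdot>u = zro x N" for u x y m N
 proof -
  obtain v where v: "v : arr" "dom v = y" "cod v = x" "u\<cdot>v = ide y"
   using u by (auto intro: iso_inverse[OF iso])
  have "m = m\<cdot>(u\<cdot>v)" using m(1) u v by simp
  also have "... = (m\<cdot>u)\<cdot>v" using m(1) u v by (intro assoc[symmetric]) auto
  also have "... = zro y N" unfolding m(2) using v u m(1) by auto
  finally show ?thesis .
 qed
 have sur: "\<exists>m\<in>Hom C y N. m\<cdot>u = n" if iso: "is_iso C u" and u: "u : Hom C x y" and n: "n : Hom C x N"
   for u x y n N
 proof -
  obtain v where v: "v : arr" "dom v = y" "cod v = x" "v\<cdot>u = ide x"
   using u by (auto intro: iso_inverse[OF iso])
  then show ?thesis using u n by (intro bexI[of _ "n\<cdot>v"]) auto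
 qed
 have i: "is_iso C (shM a)" "is_iso C (shM b)"
  using functor_is_iso[OF category_axioms category_axioms shift_functor] a b by auto
 have ab: "shM a : Hom C (shO (dom f)) (shO (dom f'))"
   "shM b : Hom C (shO (cod f)) (shO (cod f'))" using a b by auto
 note five = five_lemma_contra[OF t t' a(1) b(1) c(1) sq c(2,3)
   inj[OF a(2,1)] inj[OF b(2,1)] inj[OF i(1) ab(1)] sur[OF b(2,1)] sur[OF i(1) ab(1)] sur[OF i(2) ab(2)]]
 have "is_iso C c" by (rule iso_if_hom_bij[OF c(1)]) (use five in blast)+
 with c that show thesis by blast
qed

lemma fibre:
 assumes f: "f : arr"
 obtains p q where "(p, f, q) : tri"
proof -
 obtain g h where t: "(f, g, h) : tri" using tri_cone[OF f] by blast
 note D = triD[OF t]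
 obtain w th th' where w: "w : ob" "th : Hom C (shO w) (cod g)" "th' : Hom C (cod g) (shO w)"
  "th'\<cdot>th = ide (shO w)" "th\<cdot>th' = ide (cod g)" using unshift_ob[of "cod g"] D by auto
 obtain p where p: "p : Hom C w (dom f)" "shM p = neg C (h\<cdot>th)"
  using sh_full[of "neg C (h\<cdot>th)" w "dom f"] w D by auto
 have "(f, th'\<cdot>g, neg C (shM p)) : tri"
 proof (rule tri_iso[OF t])
  show "candidate_triangle C (f, th'\<cdot>g, neg C (shM p))"
   using D w p by (simp add: candidate_triangle_def)
  have i: "is_iso C th" by (rule is_isoI[of _ th']) (use w in auto)
  have "th\<cdot>(th'\<cdot>g) = g" using w D cmp_reduce[OF w(5), of g] by auto
  then show "triangle_iso C (f, th'\<cdot>g, neg C (shM p)) (f, g, h)"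
   unfolding triangle_iso_def prod.case
   by (intro bexI[of _ "ide (dom f)"] bexI[of _ "ide (cod f)"] bexI[of _ th])
    (use D w p i in auto)
 qed
 then have "(p, f, th'\<cdot>g) : tri" by (rule tri_rot_back) (use p w D in auto)
 then show thesis by (rule that)
qed

lemma tri_zero_if_iso:
 assumes t: "(f, g, h) : tri" and i: "is_iso C f" shows "is_zero C (cod g)"
proof -
 note D = triD[OF t]
 obtain k where k: "k : arr" "dom k = cod f" "cod k = dom f" "k\<cdot>f = ide (dom f)"
  "f\<cdot>k = ide (cod f)" using i by (rule iso_inverse)
 have "g\<cdot>(f\<cdot>k) = zro (dom f) (cod g)\<cdot>k"
  using tri_cmp1[OF t] D k by (metis assoc)
 then have g: "g = zro (cod f) (cod g)" using D k by simp
 have "shM k\<cdot>(shM f\<cdot>h) = h" using D k cmp_reduce[of "shM k" "shM f" "ide (shO (dom f))" h]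
  by (metis ide_left ob_dom sh_arr sh_cmp sh_cod sh_dom sh_ide)
 then have "h = zro (cod g) (shO (dom f))" using tri_cmp3[OF t] D k by simp
 then have *: "h\<cdot>ide (cod g) = zro (cod g) (cod h)" using D by simp
 obtain b where "b : Hom C (cod g) (cod f)" "g\<cdot>b = ide (cod g)"
  by (rule tri_lift2[OF t _ *]) (use D in auto)
 then have "ide (cod g) = zro (cod g) (cod g)"
  using g D by (metis in_Hom ob_cod zro_cmp)
 then show ?thesis using D by (simp add: is_zero_iff)
qed

lemma tri_iso_if_zero:
 assumes t: "(f, g, h) : tri" and z: "is_zero C (cod g)" shows "is_iso C f"
proof -
 note D = triD[OF t]
 have "g\<cdot>ide (cod f) = zro (cod f) (cod g)"
  using zero_arr_to[OF z, of g] D by simp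
 then obtain b where b: "b : Hom C (cod f) (dom f)" "f\<cdot>b = ide (cod f)"
  using tri_lift[OF t, of "ide (cod f)"] D by auto
 let ?d = "sub (b\<cdot>f) (ide (dom f))"
 have d: "f\<cdot>?d = zro (dom f) (cod f)" using b D cmp_reduce[OF b(2), of f] by simp
 obtain e where e: "e : Hom C (shO (dom f)) (cod g)" "h\<cdot>e = shM ?d"
  by (rule tri_lift0[OF t _ d]) (use b D in simp_all)
 have "e = zro (shO (dom f)) (cod g)"
  by (rule is_zero_eq_to[OF z e(1)]) (use D in simp)
 then have "shM ?d = zro (shO (dom f)) (shO (dom f))" unfolding e(2)[symmetric] using D by simp
 then have "?d = zro (dom f) (dom f)" by (rule sh_zro_iff) (use b(1) D in simp_all)
 then have "b\<cdot>f = ide (dom f)" by (rule sub_eq_zro) (use b(1) D in simp_all)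
 then show ?thesis using b D by (intro is_isoI[of f b]) auto
qed

subsection \<open>Triangulated subcategories\<close>

lemma triangulated_subcategoryD:
 assumes "triangulated_subcategory C A"
 shows "x : A ==> x : ob" "x : A ==> isomorphic C x y ==> y : A" "is_zero C z ==> z : A"
  "x : ob ==> shO x : A \<longleftrightarrow> x : A"
  "(f, g, h) : tri ==> dom f : A ==> cod f : A ==> cod g : A"
proof -
 assume "x : A" "isomorphic C x y" then show "y : A"
  using assms isomorphic_ob unfolding triangulated_subcategory_def by blast
qed (use assms in \<open>unfold triangulated_subcategory_def, blast+\<close>)

lemma triangulated_subcategoryI:
 assumes "A <= ob" "!!x y. x : A ==> isomorphic C x y ==> y : A" "!!z. is_zero C z ==> z : A"
  "!!x. x : ob ==> shO x : A \<longleftrightarrow> x : A"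
  "!!f g h. (f, g, h) : tri ==> dom f : A ==> cod f : A ==> cod g : A"
 shows "triangulated_subcategory C A"
 unfolding triangulated_subcategory_def using assms by blast

lemma triangulated_subcategory_first:
 assumes "triangulated_subcategory C A" "(f, g, h) : tri" "cod f : A" "cod g : A"
 shows "dom f : A"
 using triangulated_subcategoryD(4,5)[OF assms(1)] tri_rot[OF assms(2)] triD[OF assms(2)] assms(3,4)
 by (metis ob_dom)

lemma triangulated_subcategory_second:
 assumes "triangulated_subcategory C A" "(f, g, h) : tri" "dom f : A" "cod g : A"
 shows "cod f : A"
proof (rule triangulated_subcategory_first[OF assms(1) tri_rot[OF assms(2)], unfolded triD(4)[OF assms(2)]])
 show "cod h : A"
  using triangulated_subcategoryD[OF assms(1)] triD[OF assms(2)] assms(3) by auto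
qed (rule assms(4))

lemma triangulated_subcategory_unshift:
 assumes A: "triangulated_subcategory C A" and y: "y : A"
 obtains x th th' where "x : A" "th : Hom C (shO x) y" "th' : Hom C y (shO x)"
  "th'\<cdot>th = ide (shO x)" "th\<cdot>th' = ide y"
proof -
 note A = triangulated_subcategoryD[OF A]
 obtain x th th' where x: "x : ob" "th : Hom C (shO x) y" "th' : Hom C y (shO x)"
  "th'\<cdot>th = ide (shO x)" "th\<cdot>th' = ide y" using unshift_ob[OF A(1)[OF y]] .
 have "x : A" using A(2)[OF y isomorphicI[OF x(3,2,5,4)]] A(4)[OF x(1)] by simp
 with x that show thesis by blast
qed

lemma triangulated_subcategory_Ob: "triangulated_subcategory C (ob)"
proof (rule triangulated_subcategoryI)
 fix x y assume "isomorphic C x y" then show "y : ob" using isomorphic_ob by blast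
qed (auto dest: triD)

lemma triangulated_subcategory_zeros: "triangulated_subcategory C {z. is_zero C z}"
proof (rule triangulated_subcategoryI)
 fix x assume x: "x : ob"
 have "is_zero C x" if "is_zero C (shO x)"
 proof -
  have "shM (ide x) = shM (zro x x)" using that x by (simp add: is_zero_iff)
  then have "ide x = zro x x" by (rule sh_faithful) (use x in auto)
  then show ?thesis using x by (simp add: is_zero_iff)
 qed
 then show "shO x : {z. is_zero C z} \<longleftrightarrow> x : {z. is_zero C z}" using zero_sh by blast
next
 fix f g h assume t: "(f, g, h) : tri" and z: "dom f : {z. is_zero C z}" "cod f : {z. is_zero C z}"
 note D = triD[OF t]
 have z': "is_zero C (dom f)" "is_zero C (cod f)" using z by simp_all
 have "is_iso C f"
 proof (rule is_isoI[of _ "zro (cod f) (dom f)"])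
  show "zro (cod f) (dom f)\<cdot>f = ide (dom f)"
   by (rule is_zero_eq_from[OF z'(1), of _ "dom f"]) (use D in simp_all)
  show "f\<cdot>zro (cod f) (dom f) = ide (cod f)"
   by (rule is_zero_eq_from[OF z'(2), of _ "cod f"]) (use D in simp_all)
 qed (use D in simp_all)
 then show "cod g : {z. is_zero C z}" using tri_zero_if_iso[OF t] by simp
qed (auto intro: is_zero_iso)

lemma triangulated_subcategory_Int:
 assumes "!!A. A : \<A> ==> triangulated_subcategory C A" "\<A> ~= {}"
 shows "triangulated_subcategory C (\<Inter>\<A>)"
proof (rule triangulated_subcategoryI)
 note D = triangulated_subcategoryD[OF assms(1)]
 show "\<Inter>\<A> <= ob" using D(1) assms(2) by blast
 show "y : \<Inter>\<A>" if "x : \<Inter>\<A>" "isomorphic C x y" for x y using D(2) that by blast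
 show "z : \<Inter>\<A>" if "is_zero C z" for z using D(3) that by blast
 show "shO x : \<Inter>\<A> \<longleftrightarrow> x : \<Inter>\<A>" if "x : ob" for x using D(4) that by blast
 show "cod g : \<Inter>\<A>" if "(f, g, h) : tri" "dom f : \<Inter>\<A>" "cod f : \<Inter>\<A>" for f g h
  using D(5) that by blast
qed

end


context triangulated_category
begin

subsection \<open>Suspension of coproducts and triangles\<close>

lemma coproduct_sh:
 assumes P: "is_coproduct C I X P io"
 shows "is_coproduct C I (%i. shO (X i)) (shO P) (%i. shM (io i))"
proof (rule is_coproductI)
 note D = is_coproductD[OF P]
 show "shO P : ob" using D by simp
 show "shO (X i) : ob" if "i : I" for i using D that by simp
 show "shM (io i) : Hom C (shO (X i)) (shO P)" if "i : I" for i using D that by simp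
 fix Y f assume Y: "Y : ob" and f: "!!i. i : I ==> f i : Hom C (shO (X i)) Y"
 obtain x th th' where x: "x : ob" "th : Hom C (shO x) Y" "th' : Hom C Y (shO x)"
  "th'\<cdot>th = ide (shO x)" "th\<cdot>th' = ide Y" using unshift_ob[OF Y] .
 have "\<exists>k. k : Hom C (X i) x & shM k = th'\<cdot>f i" if i: "i : I" for i
  by (rule sh_full[of "th'\<cdot>f i" "X i" x]) (use f[OF i] x D(2)[OF i] in auto)
 then obtain k where k: "!!i. i : I ==> k i : Hom C (X i) x" "!!i. i : I ==> shM (k i) = th'\<cdot>f i"
  by metis
 obtain h where h: "h : Hom C P x" "!!i. i : I ==> h\<cdot>io i = k i"
  by (rule is_coproduct_map[OF P x(1) k(1)]) auto
 have "th\<cdot>shM h\<cdot>shM (io i) = f i" if i: "i : I" for i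
 proof -
  have "th\<cdot>shM h\<cdot>shM (io i) = th\<cdot>shM (h\<cdot>io i)" using D i x h(1) by simp
  also have "... = th\<cdot>(th'\<cdot>f i)" using h(2)[OF i] k(2)[OF i] by simp
  also have "... = f i" using x f[OF i] cmp_reduce[OF x(5), of "f i"] by simp
  finally show ?thesis .
 qed
 moreover have "th\<cdot>shM h : Hom C (shO P) Y" using h(1) x by simp
 ultimately show "\<exists>h. h : Hom C (shO P) Y & (\<forall>i\<in>I. h\<cdot>shM (io i) = f i)" by blast
next
 note D = is_coproductD[OF P]
 fix Y h h' assume h: "h : Hom C (shO P) Y" "h' : Hom C (shO P) Y"
  and eq: "!!i. i : I ==> h\<cdot>shM (io i) = h'\<cdot>shM (io i)"
 have Y: "Y : ob" using h by auto
 obtain x th th' where x: "x : ob" "th : Hom C (shO x) Y" "th' : Hom C Y (shO x)"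
  "th'\<cdot>th = ide (shO x)" "th\<cdot>th' = ide Y" using unshift_ob[OF Y] .
 obtain k where k: "k : Hom C P x" "shM k = th'\<cdot>h"
  by (rule sh_full[of "th'\<cdot>h" P x]) (use h x D(1) in auto)
 obtain k' where k': "k' : Hom C P x" "shM k' = th'\<cdot>h'"
  by (rule sh_full[of "th'\<cdot>h'" P x]) (use h x D(1) in auto)
 have "k = k'"
 proof (rule is_coproduct_ext[OF P k(1) k'(1)])
  fix i assume i: "i : I"
  have "shM (k\<cdot>io i) = th'\<cdot>(h\<cdot>shM (io i))" using k x h D i by simp
  also have "... = shM (k'\<cdot>io i)" unfolding eq[OF i] using k' x h D i by simp
  finally show "k\<cdot>io i = k'\<cdot>io i" by (rule sh_faithful) (use k k' D i in auto)
 qed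
 then have "th\<cdot>(th'\<cdot>h) = th\<cdot>(th'\<cdot>h')" using k k' by simp
 moreover have "th\<cdot>(th'\<cdot>h) = ide Y\<cdot>h" "th\<cdot>(th'\<cdot>h') = ide Y\<cdot>h'"
  by (rule cmp_reduce[OF x(5)]; use x h in auto)+
 ultimately show "h = h'" using h by simp
qed

lemma coproduct_unsh:
 assumes P: "is_coproduct C I (%i. shO (X i)) (shO P) (%i. shM (io i))"
  and X: "!!i. i : I ==> X i : ob" "P : ob" "!!i. i : I ==> io i : Hom C (X i) P"
 shows "is_coproduct C I X P io"
proof (rule is_coproductI)
 fix Y f assume Y: "Y : ob" and f: "!!i. i : I ==> f i : Hom C (X i) Y"
 obtain h where h: "h : Hom C (shO P) (shO Y)" "!!i. i : I ==> h\<cdot>shM (io i) = shM (f i)"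
  by (rule is_coproduct_map[OF P, of "shO Y" "%i. shM (f i)"]) (use Y f in auto)
 obtain k where k: "k : Hom C P Y" "shM k = h" by (rule sh_full[OF h(1) X(2) Y])
 have "k\<cdot>io i = f i" if i: "i : I" for i
  by (rule sh_faithful) (use h(2)[OF i] k X(3)[OF i] f[OF i] in auto)
 then show "\<exists>h. h : Hom C P Y & (\<forall>i\<in>I. h\<cdot>io i = f i)" using k by blast
next
 fix Y h h' assume h: "h : Hom C P Y" "h' : Hom C P Y"
  and eq: "!!i. i : I ==> h\<cdot>io i = h'\<cdot>io i"
 have "shM h = shM h'"
 proof (rule is_coproduct_ext[OF P, of _ "shO Y"])
  fix i assume i: "i : I"
  have "shM (h\<cdot>io i) = shM (h'\<cdot>io i)" using eq[OF i] by simp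
  then show "shM h\<cdot>shM (io i) = shM h'\<cdot>shM (io i)" using h X(3)[OF i] by simp
 qed (use h in auto)
 then show "h = h'" by (rule sh_faithful) (use h in auto)
qed (use X in auto)

lemma coproduct_unshift:
 assumes Q: "is_coproduct C I Y Q \<kappa>" and X: "!!i. i : I ==> X i : ob" "P : ob"
  and iso: "!!i. i : I ==> isomorphic C (shO (X i)) (Y i)" "isomorphic C (shO P) Q"
 shows "\<exists>io th \<eta>. is_coproduct C I X P io & \<eta> : Hom C Q (shO P) & is_iso C \<eta> &
  (\<forall>i\<in>I. th i : Hom C (shO (X i)) (Y i) & shM (io i) = \<eta>\<cdot>(\<kappa> i\<cdot>th i))"
proof -
 note D = is_coproductD[OF Q]
 have "\<exists>th. th : Hom C (shO (X i)) (Y i) & is_iso C th" if "i : I" for i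
  using iso(1)[OF that] unfolding isomorphic_def by blast
 then obtain th where th: "!!i. i : I ==> th i : Hom C (shO (X i)) (Y i)" "!!i. i : I ==> is_iso C (th i)"
  by metis
 obtain \<eta> where \<eta>: "\<eta> : Hom C Q (shO P)" "is_iso C \<eta>"
  using isomorphic_sym[OF iso(2)] unfolding isomorphic_def by blast
 have c: "is_coproduct C I (%i. shO (X i)) (shO P) (%i. \<eta>\<cdot>(\<kappa> i\<cdot>th i))"
  by (rule is_coproduct_iso[OF Q th(2,1) \<eta>(2,1)])
 have "\<exists>k. k : Hom C (X i) P & shM k = \<eta>\<cdot>(\<kappa> i\<cdot>th i)" if i: "i : I" for i
  by (rule sh_full[of "\<eta>\<cdot>(\<kappa> i\<cdot>th i)" "X i" P]) (use th(1)[OF i] \<eta>(1) X D i in auto)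
 then obtain k where k: "!!i. i : I ==> k i : Hom C (X i) P" "!!i. i : I ==> shM (k i) = \<eta>\<cdot>(\<kappa> i\<cdot>th i)"
  by metis
 have "is_coproduct C I (%i. shO (X i)) (shO P) (%i. shM (k i))"
  using c k(2) by (simp add: is_coproduct_def)
 then have c': "is_coproduct C I X P k" by (rule coproduct_unsh) (use X k in auto)
 have "\<forall>i\<in>I. th i : Hom C (shO (X i)) (Y i) & shM (k i) = \<eta>\<cdot>(\<kappa> i\<cdot>th i)"
  using th(1) k(2) by blast
 then show ?thesis using c' \<eta> by blast
qed

lemma tri_unshift:
 assumes t: "(f, g, h) : tri" and x: "x : ob" "isomorphic C (shO x) (dom f)"
  and y: "y : ob" "isomorphic C (shO y) (cod f)"
 obtains f' g' h' where "(f', g', h') : tri" "dom f' = x" "cod f' = y"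
  "isomorphic C (shO (cod g')) (cod g)"
proof -
 note D = triD[OF t]
 obtain a where a: "a : Hom C (shO x) (dom f)" "is_iso C a" using x(2) unfolding isomorphic_def by blast
 obtain b where b: "b : Hom C (shO y) (cod f)" "is_iso C b" using y(2) unfolding isomorphic_def by blast
 obtain b' where b': "b' : arr" "dom b' = cod f" "cod b' = shO y" "b\<cdot>b' = ide (cod f)"
  by (rule iso_inverse[OF b(2)]) (use b(1) in auto)
 obtain f' where f': "f' : Hom C x y" "shM f' = b'\<cdot>(f\<cdot>a)"
  by (rule sh_full[of "b'\<cdot>(f\<cdot>a)" x y]) (use a b' D x y in auto)
 obtain g' h' where t': "(f', g', h') : tri" using tri_cone[of f'] f'(1) by auto
 note D' = triD[OF t']
 have sq: "b\<cdot>shM f' = f\<cdot>a"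
  unfolding f'(2) using cmp_reduce[OF b'(4), of "f\<cdot>a"] a b b' D by simp
 obtain c where "c : Hom C (cod (shM g')) (cod g)" "is_iso C c"
  by (rule tri_iso_third[OF tri_sh[OF t'] t _ a(2) _ b(2) sq]) (use a(1) b(1) f'(1) D D' in auto)
 then have "isomorphic C (shO (cod g')) (cod g)" using D' unfolding isomorphic_def by auto
 with t' f' that show thesis by auto
qed


subsection \<open>Devissage\<close>

text \<open>
 A set of objects is stable if it is closed under suspension and desuspension up to isomorphism.
 Since there is no chosen desuspension, the largest stable part \<open>core P\<close> of a class \<open>P\<close> replaces
 the condition that all integral suspensions of an object lie in \<open>P\<close>.
\<close>

definition stable :: "'o set => bool" where
 "stable S \<longleftrightarrow> S <= ob & (\<forall>x\<in>S. \<exists>y\<in>S. isomorphic C (shO x) y) &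
   (\<forall>x\<in>S. \<exists>y\<in>S. isomorphic C (shO y) x)"

definition core :: "'o set => 'o set" where
 "core P = \<Union> {Q. stable Q & Q <= P}"

lemma stableD:
 assumes "stable S"
 shows "S <= ob" "x : S ==> \<exists>y\<in>S. isomorphic C (shO x) y" "x : S ==> \<exists>y\<in>S. isomorphic C (shO y) x"
 using assms by (auto simp: stable_def)

lemma stable_core: "stable (core P)"
 unfolding core_def stable_def by blast

lemma core_subset: "core P <= P"
 unfolding core_def by blast

lemma core_maximal: "stable Q ==> Q <= P ==> Q <= core P"
 unfolding core_def by blast

lemma core_iso:
 assumes P: "!!x y. x : P ==> isomorphic C x y ==> y : P" and x: "x : core P" "isomorphic C x y"
 shows "y : core P"
proof -
 have "stable {y. \<exists>x\<in>core P. isomorphic C x y}"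
  unfolding stable_def
 proof (intro conjI ballI)
  show "{y. \<exists>x\<in>core P. isomorphic C x y} <= ob" using isomorphic_ob by blast
  fix z assume "z : {y. \<exists>x\<in>core P. isomorphic C x y}"
  then obtain x where x: "x : core P" "isomorphic C x z" by blast
  obtain y where y: "y : core P" "isomorphic C (shO x) y" using stableD(2)[OF stable_core x(1)] by blast
  obtain w where w: "w : core P" "isomorphic C (shO w) x" using stableD(3)[OF stable_core x(1)] by blast
  have "isomorphic C y (shO z)" using y(2) isomorphic_sh[OF x(2)] isomorphic_sym isomorphic_trans by blast
  then show "\<exists>y\<in>{y. \<exists>x\<in>core P. isomorphic C x y}. isomorphic C (shO z) y"
   using y(1) isomorphic_refl isomorphic_ob by blast
  have "isomorphic C (shO w) z" using w(2) x(2) isomorphic_trans by blast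
  moreover have "isomorphic C w w" using w(1) stableD(1)[OF stable_core] isomorphic_refl by blast
  ultimately show "\<exists>y\<in>{y. \<exists>x\<in>core P. isomorphic C x y}. isomorphic C (shO y) z"
   using w(1) by blast
 qed
 moreover have "{y. \<exists>x\<in>core P. isomorphic C x y} <= P" using P core_subset by blast
 ultimately show ?thesis using core_maximal x by blast
qed

text \<open>
 Closure under suspension has to be built in: a triangle on \<open>x\<close> and \<open>y\<close> gives triangles on all
 suspensions and desuspensions, and these lie in the core again.
\<close>

lemma localizing_core:
 fixes U :: "'u set"
 assumes iso: "!!x y. x : P ==> isomorphic C x y ==> y : P"
  and zero: "!!z. is_zero C z ==> z : P"
  and tri: "!!f g h. (f, g, h) : tri ==> dom f : P ==> cod f : P ==> shO (dom f) : P ==>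
      shO (cod f) : P ==> cod g : P"
  and cop: "!!(I :: 'u set) X Q io. small U I ==> X ` I <= P ==> is_coproduct C I X Q io ==> Q : P"
 shows "localizing U C (core P)"
proof -
 have core_iso: "y : core P" if "x : core P" "isomorphic C x y" for x y
  by (rule core_iso[OF iso that])
 have ob: "x : ob" if "x : core P" for x using stableD(1)[OF stable_core] that by blast
 have sh: "shO x : core P \<longleftrightarrow> x : core P" if x: "x : ob" for x
 proof
  assume "x : core P" then show "shO x : core P"
   using stableD(2)[OF stable_core] core_iso isomorphic_sym by blast
 next
  assume "shO x : core P"
  then obtain y where y: "y : core P" "isomorphic C (shO y) (shO x)"
   using stableD(3)[OF stable_core] by blast
  then have "isomorphic C y x" using isomorphic_sh_cancel x ob by blast
  then show "x : core P" using core_iso y(1) by blast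
 qed
 let ?T = "{z. \<exists>f g h. (f, g, h) : tri & dom f : core P & cod f : core P & isomorphic C (cod g) z}"
 have "stable ?T"
  unfolding stable_def
 proof (intro conjI ballI)
  show "?T <= ob" using isomorphic_ob by blast
  fix z assume "z : ?T"
  then obtain f g h where t: "(f, g, h) : tri" "dom f : core P" "cod f : core P" "isomorphic C (cod g) z"
   by blast
  note D = triD[OF t(1)]
  have "shO (cod g) : ?T"
   using tri_sh[OF t(1)] D t(2,3) sh by (intro CollectI exI[of _ "shM f"] exI[of _ "shM g"] exI) auto
  then have "shO z : ?T" using isomorphic_sh[OF t(4)] isomorphic_trans by blast
  then show "\<exists>y\<in>?T. isomorphic C (shO z) y" using isomorphic_refl isomorphic_ob by blast
  obtain x where x: "x : core P" "isomorphic C (shO x) (dom f)" using stableD(3)[OF stable_core t(2)] by blast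
  obtain y where y: "y : core P" "isomorphic C (shO y) (cod f)" using stableD(3)[OF stable_core t(3)] by blast
  obtain f' g' h' where t': "(f', g', h') : tri" "dom f' = x" "cod f' = y" "isomorphic C (shO (cod g')) (cod g)"
   using tri_unshift[OF t(1) ob[OF x(1)] x(2) ob[OF y(1)] y(2)] .
  have "cod g' : ?T" using t' x y triD[OF t'(1)] by (intro CollectI exI[of _ f'] exI[of _ g'] exI) auto
  moreover have "isomorphic C (shO (cod g')) z" using t'(4) t(4) isomorphic_trans by blast
  ultimately show "\<exists>y\<in>?T. isomorphic C (shO y) z" by blast
 qed
 moreover have "?T <= P"
 proof clarify
  fix z f g h assume t: "(f, g, h) : tri" "dom f : core P" "cod f : core P" "isomorphic C (cod g) z"
  have "cod g : P" using tri[OF t(1)] t(2,3) sh ob core_subset by blast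
  then show "z : P" using iso t(4) by blast
 qed
 ultimately have T: "?T <= core P" by (rule core_maximal)
 have "stable {z. is_zero C z}"
  unfolding stable_def
 proof (intro conjI ballI)
  show "{z. is_zero C z} <= ob" by auto
  fix z assume "z : {z. is_zero C z}"
  then have "is_zero C (shO z)" "is_zero C z" by simp_all
  then show "\<exists>y\<in>{z. is_zero C z}. isomorphic C (shO z) y" "\<exists>y\<in>{z. is_zero C z}. isomorphic C (shO y) z"
   using zeros_isomorphic by blast+
 qed
 then have zer: "{z. is_zero C z} <= core P" using zero by (intro core_maximal) auto
 have ts: "triangulated_subcategory C (core P)"
 proof (rule triangulated_subcategoryI)
  fix f g h assume t: "(f, g, h) : tri" "dom f : core P" "cod f : core P"
  have "isomorphic C (cod g) (cod g)" using triD[OF t(1)] by simp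
  then show "cod g : core P" using T t by blast
 qed (use ob sh zer core_iso in blast)+
 let ?S = "{Q. \<exists>(I :: 'u set) X io. small U I & X ` I <= core P & is_coproduct C I X Q io}"
 have "stable ?S"
  unfolding stable_def
 proof (intro conjI ballI)
  show "?S <= ob" using is_coproductD(1) by blast
  fix Q assume "Q : ?S"
  then obtain I :: "'u set" and X io where I: "small U I" "X ` I <= core P" "is_coproduct C I X Q io" by blast
  have "(%i. shO (X i)) ` I <= core P" using I(2) sh ob by blast
  then have "shO Q : ?S" using coproduct_sh[OF I(3)] I(1) by blast
  then show "\<exists>y\<in>?S. isomorphic C (shO Q) y"
   using isomorphic_refl[OF sh_ob[OF is_coproductD(1)[OF I(3)]]] by blast
  have "\<exists>y\<in>core P. isomorphic C (shO y) (X i)" if "i : I" for i using stableD(3)[OF stable_core] I(2) that by blast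
  then obtain Y where Y: "!!i. i : I ==> Y i : core P" "!!i. i : I ==> isomorphic C (shO (Y i)) (X i)" by metis
  obtain R where R: "R : ob" "isomorphic C (shO R) Q" using shift_ess_surj is_coproductD(1)[OF I(3)] by blast
  have Yo: "Y i : ob" if "i : I" for i using Y(1)[OF that] ob by blast
  have "\<exists>io. is_coproduct C I Y R io" using coproduct_unshift[OF I(3) Yo R(1) Y(2) R(2)] by blast
  moreover have "Y ` I <= core P" using Y(1) by blast
  ultimately have "R : ?S" using I(1) by blast
  then show "\<exists>y\<in>?S. isomorphic C (shO y) Q" using R(2) by blast
 qed
 moreover have "?S <= P"
 proof clarify
  fix Q and I :: "'u set" and X io
  assume "small U I" "X ` I <= core P" "is_coproduct C I X Q io"
  then show "Q : P" using cop[of I X Q io] core_subset[of P] by blast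
 qed
 ultimately have "?S <= core P" by (rule core_maximal)
 then show ?thesis using ts unfolding localizing_def by blast
qed

lemma devissage_core:
 fixes U :: "'u set"
 assumes iso: "!!x y. x : P ==> isomorphic C x y ==> y : P"
  and zero: "!!z. is_zero C z ==> z : P"
  and tri: "!!f g h. (f, g, h) : tri ==> dom f : P ==> cod f : P ==> shO (dom f) : P ==>
      shO (cod f) : P ==> cod g : P"
  and cop: "!!(I :: 'u set) X Q io. small U I ==> X ` I <= P ==> is_coproduct C I X Q io ==> Q : P"
  and gen: "stable S" "S <= P" "G <= S" "loc U C G = ob"
  and x: "x : ob"
 shows "x : P"
proof -
 have "localizing U C (core P)" using iso zero tri cop by (rule localizing_core)
 moreover have "G <= core P" using core_maximal[OF gen(1,2)] gen(3) by blast
 ultimately have "loc U C G <= core P" unfolding loc_def by blast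
 then show ?thesis using x gen(4) core_subset by blast
qed

end

lemma (in universe) small_closure:
 assumes "small U G" "!!x y. small U (R x y)" "!!x. x : G ==> Q x"
  "!!x y z. Q x ==> Q y ==> z : R x y ==> Q z"
 obtains S where "G <= S" "small U S" "!!x y. x : S ==> y : S ==> R x y <= S" "!!x. x : S ==> Q x"
proof -
 define T where "T = rec_nat G (%_ T. T \<union> (\<Union>(x, y)\<in>T \<times> T. R x y))"
 have T0: "T 0 = G" and TS: "T (Suc n) = T n \<union> (\<Union>(x, y)\<in>T n \<times> T n. R x y)" for n
  by (simp_all add: T_def)
 have mono: "T m <= T n" if "m \<le> n" for m n
  by (rule lift_Suc_mono_le[OF _ that]) (auto simp: TS)
 have sm: "small U (T n)" for n
 proof (induction n)
  case (Suc n)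
  have "small U (\<Union>p\<in>T n \<times> T n. R (fst p) (snd p))" using Suc assms(2) by (intro small_UN small_Sigma)
  moreover have "T (Suc n) = T n \<union> (\<Union>p\<in>T n \<times> T n. R (fst p) (snd p))" by (auto simp: TS)
  ultimately show ?case using Suc small_Un by simp
 qed (use assms(1) T0 in simp)
 have Q: "Q x" if "x : T n" for x n
  using that
 proof (induction n arbitrary: x)
  case (Suc n)
  from Suc.prems consider "x : T n" | y z where "y : T n" "z : T n" "x : R y z" unfolding TS by blast
  then show ?case using Suc.IH assms(4) by cases blast+
 qed (use assms(3) T0 in auto)
 show thesis
 proof (rule that[of "\<Union>n. T n"])
  show "G <= (\<Union>n. T n)" using T0 by blast
  show "small U (\<Union>n. T n)" by (rule small_UN[OF small_countable sm]) simp
  show "Q x" if "x : (\<Union>n. T n)" for x using Q that by blast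
  fix x y assume "x : (\<Union>n. T n)" "y : (\<Union>n. T n)"
  then obtain m n where "x : T m" "y : T n" by blast
  then have "x : T (max m n)" "y : T (max m n)" using mono[of m "max m n"] mono[of n "max m n"] by auto
  then have "R x y <= T (Suc (max m n))" by (auto simp: TS)
  then show "R x y <= (\<Union>n. T n)" by blast
 qed
qed


section \<open>Universal arrows along triangulated functors\<close>

lemma additive_functor_zro:
 assumes "additive_category C" "additive_category D" "is_additive_functor C D F" "x : Ob C" "y : Ob C"
 shows "fM F (Zro C x y) = Zro D (fO F x) (fO F y)"
proof -
 interpret C: additive_category C by fact
 interpret D: additive_category D by fact
 have "is_functor C D F" using assms(3) by (simp add: is_additive_functor_def)
 note F = is_functorD[OF this]
 have add: "fM F (Pls C f g) = Pls D (fM F f) (fM F g)" if "f : Hom C x y" "g : Hom C x y" for f g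
  using assms(3-5) that unfolding is_additive_functor_def by blast
 have "Pls D (fM F (Zro C x y)) (fM F (Zro C x y)) = fM F (Pls C (Zro C x y) (Zro C x y))"
  by (rule add[symmetric]) (use assms in auto)
 also have "... = Pls D (fM F (Zro C x y)) (Zro D (fO F x) (fO F y))" using assms(4,5) F by simp
 finally show ?thesis by (rule D.pls_cancel) (use assms(4,5) F in auto)
qed

lemma is_triangulated_functorD:
 assumes "is_triangulated_functor C D F \<sigma>"
 shows "is_functor C D F" "is_additive_functor C D F"
  "f : Arr C ==> g : Arr C ==> Dom C g = Dom C f ==> Cod C g = Cod C f ==> category C ==>
   fM F (Pls C f g) = Pls D (fM F f) (fM F g)"
  "x : Ob C ==> \<sigma> x : Hom D (fO F (ShO C x)) (ShO D (fO F x))" "x : Ob C ==> is_iso D (\<sigma> x)"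
  "f : Arr C ==> \<sigma> (Cod C f)\<cdot>\<^bsub>D\<^esub>fM F (ShM C f) = ShM D (fM F f)\<cdot>\<^bsub>D\<^esub>\<sigma> (Dom C f)"
  "(f, g, h) : Tri C ==> (fM F f, fM F g, \<sigma> (Dom C f)\<cdot>\<^bsub>D\<^esub>fM F h) : Tri D"
proof -
 assume *: "f : Arr C" "g : Arr C" "Dom C g = Dom C f" "Cod C g = Cod C f" "category C"
 then have "Dom C f : Ob C" "Cod C f : Ob C" by (auto intro: category.dom_ob category.cod_ob)
 moreover have "f : Hom C (Dom C f) (Cod C f)" "g : Hom C (Dom C f) (Cod C f)" using * by auto
 ultimately show "fM F (Pls C f g) = Pls D (fM F f) (fM F g)"
  using assms unfolding is_triangulated_functor_def is_additive_functor_def by blast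
next
 show a: "is_additive_functor C D F" using assms by (simp only: is_triangulated_functor_def)
 show "is_functor C D F" using a by (simp only: is_additive_functor_def)
 have "\<forall>x\<in>Ob C. \<sigma> x : Hom D (fO F (ShO C x)) (ShO D (fO F x)) & is_iso D (\<sigma> x)"
  "\<forall>f\<in>Arr C. \<sigma> (Cod C f)\<cdot>\<^bsub>D\<^esub>fM F (ShM C f) = ShM D (fM F f)\<cdot>\<^bsub>D\<^esub>\<sigma> (Dom C f)"
  "\<forall>f g h. (f, g, h) : Tri C --> (fM F f, fM F g, \<sigma> (Dom C f)\<cdot>\<^bsub>D\<^esub>fM F h) : Tri D"
  using assms unfolding is_triangulated_functor_def by - (elim conjE, assumption)+
 then show "x : Ob C ==> \<sigma> x : Hom D (fO F (ShO C x)) (ShO D (fO F x))" "x : Ob C ==> is_iso D (\<sigma> x)"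
  "f : Arr C ==> \<sigma> (Cod C f)\<cdot>\<^bsub>D\<^esub>fM F (ShM C f) = ShM D (fM F f)\<cdot>\<^bsub>D\<^esub>\<sigma> (Dom C f)"
  "(f, g, h) : Tri C ==> (fM F f, fM F g, \<sigma> (Dom C f)\<cdot>\<^bsub>D\<^esub>fM F h) : Tri D"
  by blast+
qed

context triangulated_category
begin

lemma universal_sh:
 assumes F: "is_triangulated_functor C C F \<sigma>" and A: "triangulated_subcategory C A"
  and u: "universal C C F A y g e"
 shows "universal C C F A (shO y) (shO g) (shM e\<cdot>\<sigma> g)"
proof -
 note T = is_triangulated_functorD[OF F] note Fn = is_functorD[OF T(1)]
 note e = universalD[OF u] note A' = triangulated_subcategoryD[OF A]
 have g: "g : ob" using A'(1) e(1) .
 have \<sigma>: "\<sigma> x : arr" "dom (\<sigma> x) = fO F (shO x)" "cod (\<sigma> x) = shO (fO F x)" if "x : ob" for x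
  using T(4)[OF that] by simp_all
 have key: "shM e\<cdot>\<sigma> g\<cdot>fM F (shM h) = shM (e\<cdot>fM F h)\<cdot>\<sigma> x"
  if "x : ob" "h : Hom C x g" for x h
  using T(6)[of h] that e g \<sigma> Fn by simp
 show ?thesis
 proof (rule universalI)
  show "shO g : A" using A'(4)[OF g] e(1) by simp
  show "shM e\<cdot>\<sigma> g : Hom C (fO F (shO g)) (shO y)" using e g \<sigma> by simp
 next
  fix x f assume x: "x : A" and f: "f : Hom C (fO F x) (shO y)"
  obtain w th th' where w: "w : A" "th : Hom C (shO w) x" "th' : Hom C x (shO w)"
   "th'\<cdot>th = ide (shO w)" "th\<cdot>th' = ide x" using triangulated_subcategory_unshift[OF A x] .
  have wo: "w : ob" "x : ob" using A'(1) w(1) x by blast+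
  have y: "y : ob" using e by auto
  obtain s where s: "s : arr" "dom s = shO (fO F w)" "cod s = fO F (shO w)" "s\<cdot>\<sigma> w = ide (fO F (shO w))"
   by (rule iso_inverse[OF T(5)[OF wo(1)]]) (use \<sigma>[OF wo(1)] in auto)
  obtain k where k: "k : Hom C (fO F w) y" "shM k = f\<cdot>(fM F th\<cdot>s)"
   by (rule sh_full[of "f\<cdot>(fM F th\<cdot>s)" "fO F w" y]) (use f w s y wo Fn in auto)
  obtain h where h: "h : Hom C w g" "e\<cdot>fM F h = k" by (rule universal_lift[OF u w(1) k(1)])
  have "shM e\<cdot>\<sigma> g\<cdot>fM F (shM h) = f\<cdot>(fM F th\<cdot>s)\<cdot>\<sigma> w"
   using key[OF wo(1) h(1)] h k by simp
  also have "... = f\<cdot>fM F th" using f w s \<sigma> wo Fn by simp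
  finally have 1: "shM e\<cdot>\<sigma> g\<cdot>fM F (shM h) = f\<cdot>fM F th" .
  have "shM e\<cdot>\<sigma> g\<cdot>fM F (shM h\<cdot>th') = shM e\<cdot>\<sigma> g\<cdot>fM F (shM h)\<cdot>fM F th'"
   using e g \<sigma> Fn h(1) w wo by simp
  also have "... = f\<cdot>fM F (th\<cdot>th')" unfolding 1 using f w(2,3) Fn by simp
  also have "... = f" unfolding w(5) using f wo Fn by simp
  finally show "\<exists>h\<in>Hom C x (shO g). shM e\<cdot>\<sigma> g\<cdot>fM F h = f"
   using h w by (intro bexI[of _ "shM h\<cdot>th'"]) auto
 next
  fix x h h' assume x: "x : A" and h: "h : Hom C x (shO g)" "h' : Hom C x (shO g)"
   and eq: "shM e\<cdot>\<sigma> g\<cdot>fM F h = shM e\<cdot>\<sigma> g\<cdot>fM F h'"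
  obtain w th th' where w: "w : A" "th : Hom C (shO w) x" "th' : Hom C x (shO w)"
   "th'\<cdot>th = ide (shO w)" "th\<cdot>th' = ide x" using triangulated_subcategory_unshift[OF A x] .
  have wo: "w : ob" "x : ob" using A'(1) w(1) x by blast+
  obtain k where k: "k : Hom C w g" "shM k = h\<cdot>th"
   by (rule sh_full[of "h\<cdot>th" w g]) (use h w wo g in auto)
  obtain k' where k': "k' : Hom C w g" "shM k' = h'\<cdot>th"
   by (rule sh_full[of "h'\<cdot>th" w g]) (use h w wo g in auto)
  have "shM e\<cdot>\<sigma> g\<cdot>fM F (shM k) = shM e\<cdot>\<sigma> g\<cdot>fM F h\<cdot>fM F th"
   unfolding k(2) using h w e g \<sigma> Fn by simp
  also have "... = shM e\<cdot>\<sigma> g\<cdot>fM F (shM k')"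
   unfolding k'(2) eq using h w e g \<sigma> Fn by simp
  finally have 1: "shM (e\<cdot>fM F k)\<cdot>\<sigma> w = shM (e\<cdot>fM F k')\<cdot>\<sigma> w"
   using key[OF wo(1) k(1)] key[OF wo(1) k'(1)] by simp
  obtain s where s: "s : arr" "dom s = shO (fO F w)" "cod s = fO F (shO w)" "\<sigma> w\<cdot>s = ide (shO (fO F w))"
   by (rule iso_inverse[OF T(5)[OF wo(1)]]) (use \<sigma>[OF wo(1)] in auto)
  have "shM (e\<cdot>fM F k)\<cdot>\<sigma> w\<cdot>s = shM (e\<cdot>fM F k')\<cdot>\<sigma> w\<cdot>s" using 1 by simp
  then have "shM (e\<cdot>fM F k) = shM (e\<cdot>fM F k')" using s \<sigma> wo e k k' Fn by simp
  then have "e\<cdot>fM F k = e\<cdot>fM F k'" by (rule sh_faithful) (use e k k' Fn in auto)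
  then have "k = k'" by (rule universal_ext[OF u w(1) k(1) k'(1)])
  then have "h\<cdot>th\<cdot>th' = h'\<cdot>th\<cdot>th'" using k k' by simp
  then show "h = h'" using h w wo by simp
 qed
qed

text \<open>
 The values at the ends of \<open>f\<close> are connected by a map whose cone is a value at the cone of \<open>f\<close>, by the
 five lemma for the functors \<open>Hom (F -) x\<close>. Hence objects whose value lies in a triangulated
 subcategory form a triangulated subcategory, although the right adjoint itself is never seen to be exact.
\<close>

lemma universal_cone:
 assumes F: "is_triangulated_functor C C F \<sigma>" and A: "triangulated_subcategory C A"
  and t: "(f, g, h) : tri"
  and ux: "universal C C F A (dom f) gx ex" and uy: "universal C C F A (cod f) gy ey"
 obtains p q r e where "(p, q, r) : tri" "dom p = gx" "cod p = gy"
  "universal C C F A (cod g) (cod q) e"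
proof -
 note T = is_triangulated_functorD[OF F] note Fn = is_functorD[OF T(1)]
 note ex = universalD[OF ux] note ey = universalD[OF uy] note A' = triangulated_subcategoryD[OF A]
 note D = triD[OF t]
 note Fz = additive_functor_zro[OF additive_category_axioms additive_category_axioms T(2)]
 have \<sigma>: "\<sigma> x : arr" "dom (\<sigma> x) = fO F (shO x)" "cod (\<sigma> x) = shO (fO F x)" if "x : ob" for x
  using T(4)[OF that] by simp_all
 have gx: "gx : ob" and gy: "gy : ob" using A'(1) ex(1) ey(1) by blast+
 obtain p where p: "p : Hom C gx gy" "ey\<cdot>fM F p = f\<cdot>ex"
  by (rule universal_lift[OF uy ex(1), of "f\<cdot>ex"]) (use ex D in auto)
 obtain q r where t': "(p, q, r) : tri" using tri_cone[of p] p(1) by auto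
 note D' = triD[OF t']
 have pd: "dom p = gx" "cod p = gy" using p(1) by simp_all
 let ?w = "cod q"
 have wA: "?w : A" using A'(5)[OF t'] pd ex(1) ey(1) by simp
 have Ft: "(fM F p, fM F q, \<sigma> gx\<cdot>fM F r) : tri" using T(7)[OF t'] pd by simp
 have "\<exists>e \<in> Hom C (cod (fM F q)) (cod g). e\<cdot>fM F q = g\<cdot>ey & shM ex\<cdot>(\<sigma> gx\<cdot>fM F r) = h\<cdot>e"
  by (rule tri_fill[OF Ft t]) (use ex ey p D D' Fn in auto)
 then obtain e where e: "e : Hom C (fO F ?w) (cod g)" "e\<cdot>fM F q = g\<cdot>ey"
   "shM ex\<cdot>(\<sigma> gx\<cdot>fM F r) = h\<cdot>e"
  using D' Fn by auto
 note usx = universal_sh[OF F A ux] note usy = universal_sh[OF F A uy]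
 have "universal C C F A (cod g) ?w e"
 proof (rule universalI[OF wA e(1)])
  fix B n assume B: "B : A" and n: "n : Hom C (fO F B) (cod g)"
  have Bo: "B : ob" using A'(1)[OF B] .
  obtain k where k: "k : Hom C B (shO gx)" "shM ex\<cdot>\<sigma> gx\<cdot>fM F k = h\<cdot>n"
   by (rule universal_lift[OF usx B, of "h\<cdot>n"]) (use n D in auto)
  have "shM p\<cdot>k = zro B (shO gy)"
  proof (rule universal_ext[OF usy B])
   have "\<sigma> gy\<cdot>fM F (shM p\<cdot>k) = shM (fM F p)\<cdot>(\<sigma> gx\<cdot>fM F k)"
    using T(6)[of p] p(1) k(1) Fn \<sigma> gx gy cmp_swap[OF T(6), of p "fM F k"] by simp
   then have "shM ey\<cdot>\<sigma> gy\<cdot>fM F (shM p\<cdot>k) = shM (ey\<cdot>fM F p)\<cdot>(\<sigma> gx\<cdot>fM F k)"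
    using p(1) k(1) Fn \<sigma> gx gy ey by simp
   also have "... = shM f\<cdot>(shM ex\<cdot>\<sigma> gx\<cdot>fM F k)"
    unfolding p(2) using k(1) Fn \<sigma> gx ex D by simp
   also have "... = shM f\<cdot>h\<cdot>n" unfolding k(2) using D n by simp
   also have "... = zro (fO F B) (shO (cod f))" using tri_cmp3[OF t] D n by simp
   also have "... = shM ey\<cdot>\<sigma> gy\<cdot>fM F (zro B (shO gy))"
    using Fz[of B "shO gy"] Bo gy ey \<sigma>[OF gy] D Fn by simp
   finally show "shM ey\<cdot>\<sigma> gy\<cdot>fM F (shM p\<cdot>k) = shM ey\<cdot>\<sigma> gy\<cdot>fM F (zro B (shO gy))" .
  qed (use p(1) k(1) gy Bo in auto)
  then obtain l where l: "l : Hom C B ?w" "r\<cdot>l = k"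
   using tri_lift3[OF t', of k B] k(1) pd by auto
  let ?d = "sub n (e\<cdot>fM F l)"
  have "h\<cdot>(e\<cdot>fM F l) = shM ex\<cdot>(\<sigma> gx\<cdot>fM F r)\<cdot>fM F l"
   unfolding e(3) using D e(1) l(1) Fn by simp
  also have "... = shM ex\<cdot>\<sigma> gx\<cdot>fM F (r\<cdot>l)"
   using D' l(1) Fn ex \<sigma> gx pd by simp
  finally have "h\<cdot>?d = zro (fO F B) (cod h)" unfolding l(2) k(2) using n D e(1) l(1) Fn by simp
  then obtain m where m: "m : Hom C (fO F B) (cod f)" "g\<cdot>m = ?d"
   by (rule tri_lift2[OF t, rotated]) (use n D e(1) l(1) Fn in auto)
  obtain m' where m': "m' : Hom C B gy" "ey\<cdot>fM F m' = m" by (rule universal_lift[OF uy B m(1)])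
  have "e\<cdot>fM F (q\<cdot>m') = g\<cdot>ey\<cdot>fM F m'"
   unfolding e(2)[symmetric] using D' pd m'(1) e(1) Fn by simp
  also have "... = ?d" using m' m(2) ey D Fn by simp
  finally have "e\<cdot>fM F (pls (q\<cdot>m') l) = pls ?d (e\<cdot>fM F l)"
   using D' pd m'(1) l(1) e(1) Fn(2-4) T(3)[of "q\<cdot>m'" l] category_axioms by simp
  also have "... = n" by (rule sub_pls) (use n e(1) l(1) Fn in auto)
  finally show "\<exists>h\<in>Hom C B ?w. e\<cdot>fM F h = n"
   using D' pd m'(1) l(1) by (intro bexI[of _ "pls (q\<cdot>m') l"]) auto
 next
  fix B l1 l2 assume B: "B : A" and l12: "l1 : Hom C B ?w" "l2 : Hom C B ?w"
   and eq: "e\<cdot>fM F l1 = e\<cdot>fM F l2"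
  have Bo: "B : ob" using A'(1)[OF B] .
  define l where "l = sub l1 l2"
  have l: "l : Hom C B ?w" using l12 by (simp add: l_def)
  have "pls (fM F l) (fM F l2) = fM F l1"
   using T(3)[of l l2] l l12 category_axioms sub_pls[of l1 l2] by (simp add: l_def)
  then have "pls (e\<cdot>fM F l) (e\<cdot>fM F l2) = pls (zro (fO F B) (cod g)) (e\<cdot>fM F l2)"
   using eq l l12 e(1) Fn cmp_pls[of "fM F l" "fM F l2" e] by simp
  then have "pls (e\<cdot>fM F l2) (e\<cdot>fM F l) = pls (e\<cdot>fM F l2) (zro (fO F B) (cod g))"
   using l l12 e(1) Fn D Bo by (simp add: pls_comm)
  then have el: "e\<cdot>fM F l = zro (fO F B) (cod g)"
   by (rule pls_cancel) (use l l12 e(1) Fn D Bo in auto)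
  have "r\<cdot>l = zro B (shO gx)"
  proof (rule universal_ext[OF usx B])
   have "shM ex\<cdot>\<sigma> gx\<cdot>fM F (r\<cdot>l) = shM ex\<cdot>(\<sigma> gx\<cdot>fM F r)\<cdot>fM F l"
    using D' l Fn ex \<sigma> gx pd by simp
   also have "... = h\<cdot>(e\<cdot>fM F l)" unfolding e(3) using D e(1) l Fn by simp
   also have "... = zro (fO F B) (shO (dom f))" unfolding el using D Bo Fn by simp
   also have "... = shM ex\<cdot>\<sigma> gx\<cdot>fM F (zro B (shO gx))"
    using Fz[of B "shO gx"] Bo gx ex \<sigma>[OF gx] D Fn by simp
   finally show "shM ex\<cdot>\<sigma> gx\<cdot>fM F (r\<cdot>l) = shM ex\<cdot>\<sigma> gx\<cdot>fM F (zro B (shO gx))" .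
  qed (use D' pd l gx Bo in auto)
  then obtain m where m: "m : Hom C B gy" "q\<cdot>m = l"
   using tri_lift2[OF t', of l B] l pd D' by auto
  have "g\<cdot>(ey\<cdot>fM F m) = e\<cdot>fM F q\<cdot>fM F m"
   unfolding e(2) using D ey m(1) Fn by simp
  also have "... = e\<cdot>fM F (q\<cdot>m)" using D' pd m(1) e(1) Fn by simp
  finally have "g\<cdot>(ey\<cdot>fM F m) = zro (fO F B) (cod g)" unfolding m(2) el .
  then obtain n where n: "n : Hom C (fO F B) (dom f)" "f\<cdot>n = ey\<cdot>fM F m"
   by (rule tri_lift[OF t, rotated]) (use ey m(1) Fn in auto)
  obtain n' where n': "n' : Hom C B gx" "ex\<cdot>fM F n' = n" by (rule universal_lift[OF ux B n(1)])
  have "p\<cdot>n' = m"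
  proof (rule universal_ext[OF uy B])
   have "ey\<cdot>fM F (p\<cdot>n') = f\<cdot>ex\<cdot>fM F n'"
    unfolding p(2)[symmetric] using p(1) n'(1) ey Fn by simp
   also have "... = ey\<cdot>fM F m" unfolding n(2)[symmetric] n'(2)[symmetric] using D ex n'(1) Fn by simp
   finally show "ey\<cdot>fM F (p\<cdot>n') = ey\<cdot>fM F m" .
  qed (use p(1) n'(1) m(1) in auto)
  then have "l = q\<cdot>p\<cdot>n'" using m(2) D' pd n'(1) by simp
  then have "l = zro B ?w" using tri_cmp1[OF t'] D' pd n'(1) by simp
  then show "l1 = l2" unfolding l_def by (rule sub_eq_zro) (use l12 in auto)
 qed
 with t' pd that show thesis by blast
qed

lemma preimage_triangulated:
 assumes F: "is_triangulated_functor C C F \<sigma>" and A: "triangulated_subcategory C A"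
  and ex: "!!y. y : ob ==> \<exists>g e. universal C C F A y g e" and D: "triangulated_subcategory C D"
 shows "triangulated_subcategory C {y : ob. \<exists>g\<in>D. \<exists>e. universal C C F A y g e}" (is "triangulated_subcategory C ?P")
proof (rule triangulated_subcategoryI)
 note T = is_triangulated_functorD[OF F] note Fn = is_functorD[OF T(1)]
 note D' = triangulated_subcategoryD[OF D] note A' = triangulated_subcategoryD[OF A]
 have Ao: "A <= ob" using A'(1) by blast
 note uniq = universal_isomorphic[OF category_axioms category_axioms T(1) Ao]
 show "?P <= ob" by blast
 show "y : ?P" if x: "x : ?P" "isomorphic C x y" for x y
 proof -
  obtain g e where g: "g : D" "universal C C F A x g e" using x(1) by blast
  have y: "y : ob" using isomorphic_ob[OF x(2)] by blast
  obtain g' e' where g': "universal C C F A y g' e'" using ex[OF y] by blast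
  have "g' : D" using D'(2)[OF g(1) uniq[OF g(2) g' x(2)]] .
  then show ?thesis using y g' by blast
 qed
 show "z : ?P" if z: "is_zero C z" for z
 proof -
  have zo: "z : ob" using zero_in[OF z] .
  obtain g e where g: "universal C C F A z g e" using ex[OF zo] by blast
  note e = universalD[OF g]
  have go: "g : ob" using A'(1) e(1) .
  have "ide g = zro g g"
  proof (rule universal_ext[OF g e(1)])
   show "e\<cdot>fM F (ide g) = e\<cdot>fM F (zro g g)"
    by (rule is_zero_eq_to[OF z, of _ "fO F g"]) (use e go Fn in auto)
  qed (use go in auto)
  then have "is_zero C g" using go by (simp add: is_zero_iff)
  then show ?thesis using D'(3) zo g by blast
 qed
 show "shO y : ?P \<longleftrightarrow> y : ?P" if y: "y : ob" for y
 proof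
  assume "y : ?P"
  then obtain g e where g: "g : D" "universal C C F A y g e" by blast
  have "shO g : D" using D'(4)[OF D'(1)[OF g(1)]] g(1) by blast
  then show "shO y : ?P" using universal_sh[OF F A g(2)] y by auto
 next
  assume "shO y : ?P"
  then obtain g e where g: "g : D" "universal C C F A (shO y) g e" by blast
  obtain g' e' where g': "universal C C F A y g' e'" using ex[OF y] by blast
  have "isomorphic C g (shO g')" using uniq[OF g(2) universal_sh[OF F A g']] y by simp
  then have "shO g' : D" by (rule D'(2)[OF g(1)])
  then have "g' : D" using D'(4)[of g'] A'(1) universalD(1)[OF g'] by blast
  then show "y : ?P" using y g' by blast
 qed
 show "cod g : ?P" if t: "(f, g, h) : tri" "dom f : ?P" "cod f : ?P" for f g h
 proof -
  obtain gx ex where x: "gx : D" "universal C C F A (dom f) gx ex" using t(2) by blast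
  obtain gy ey where y: "gy : D" "universal C C F A (cod f) gy ey" using t(3) by blast
  obtain p q r e where p: "(p, q, r) : tri" "dom p = gx" "cod p = gy"
   "universal C C F A (cod g) (cod q) e" using universal_cone[OF F A t(1) x(2) y(2)] .
  have "cod q : D" by (rule D'(5)[OF p(1)]) (use p x y in auto)
  then show ?thesis using p(4) triD[OF t(1)] by auto
 qed
qed

lemma universal_product:
 assumes F: "is_functor C C F" and A: "A <= ob"
  and P: "is_product C I X P pr" and R: "is_product C I G R \<rho>" "R : A"
  and u: "!!i. i : I ==> universal C C F A (X i) (G i) (e i)"
 shows "\<exists>e. universal C C F A P R e"
proof -
 note Fn = is_functorD[OF F]
 note DP = is_productD[OF P] note DR = is_productD[OF R(1)]
 note ue = universalD[OF u]
 obtain e' where e': "e' : Hom C (fO F R) P" "!!i. i : I ==> pr i\<cdot>e' = e i\<cdot>fM F (\<rho> i)"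
  by (rule is_product_map[OF P, of "fO F R" "%i. e i\<cdot>fM F (\<rho> i)"]) (use DR ue Fn in auto)
 have key: "pr i\<cdot>(e'\<cdot>fM F h) = e i\<cdot>fM F (\<rho> i\<cdot>h)" if i: "i : I" and h: "h : Hom C x R" for i h x
 proof -
  have "pr i\<cdot>(e'\<cdot>fM F h) = e i\<cdot>fM F (\<rho> i)\<cdot>fM F h"
   by (rule cmp_reduce[OF e'(2)[OF i]]) (use i h DP e'(1) Fn in auto)
  also have "... = e i\<cdot>fM F (\<rho> i\<cdot>h)" using i h DR ue Fn by simp
  finally show ?thesis .
 qed
 have "universal C C F A P R e'"
 proof (rule universalI[OF R(2) e'(1)])
  fix x f assume x: "x : A" and f: "f : Hom C (fO F x) P"
  have "\<exists>k. k : Hom C x (G i) & e i\<cdot>fM F k = pr i\<cdot>f" if i: "i : I" for i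
   by (rule universal_lift[OF u[OF i] x, of "pr i\<cdot>f"]) (use f DP i in auto)
  then obtain k where k: "!!i. i : I ==> k i : Hom C x (G i)" "!!i. i : I ==> e i\<cdot>fM F (k i) = pr i\<cdot>f"
   by metis
  obtain h where h: "h : Hom C x R" "!!i. i : I ==> \<rho> i\<cdot>h = k i"
   by (rule is_product_map[OF R(1) _ k(1)]) (use x A in auto)
  have "e'\<cdot>fM F h = f"
  proof (rule is_product_ext[OF P])
   show "pr i\<cdot>(e'\<cdot>fM F h) = pr i\<cdot>f" if i: "i : I" for i
    using key[OF i h(1)] h(2)[OF i] k(2)[OF i] by simp
  qed (use e'(1) h(1) f Fn in auto)
  then show "\<exists>h\<in>Hom C x R. e'\<cdot>fM F h = f" using h(1) by blast
 next
  fix x h h' assume x: "x : A" and h: "h : Hom C x R" "h' : Hom C x R" and eq: "e'\<cdot>fM F h = e'\<cdot>fM F h'"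
  show "h = h'"
  proof (rule is_product_ext[OF R(1) h])
   fix i assume i: "i : I"
   show "\<rho> i\<cdot>h = \<rho> i\<cdot>h'"
    by (rule universal_ext[OF u[OF i] x]) (use key[OF i h(1)] key[OF i h(2)] eq h DR i in auto)
  qed
 qed
 then show ?thesis by blast
qed

end


section \<open>Compact objects are essentially small\<close>

context additive_category
begin

lemma coproduct_select:
 assumes P: "is_coproduct C I X P io"
 obtains e where "e : Hom C P P" "!!i. i : I ==> e\<cdot>io i = (if i : J then io i else zro (X i) P)"
 by (rule is_coproduct_map[OF P, of P "%i. if i : J then io i else zro (X i) P"])
  (use is_coproductD[OF P] in auto)

lemma coproduct_proj:
 assumes P: "is_coproduct C I X P io" and i: "i : I"
 obtains \<pi> where "\<pi> : Hom C P (X i)" "!!j. j : I ==> \<pi>\<cdot>io j = (if j = i then ide (X i) else zro (X j) (X i))"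
 by (rule is_coproduct_map[OF P, of "X i" "%j. if j = i then ide (X i) else zro (X j) (X i)"])
  (use is_coproductD[OF P] i in auto)

lemma cmp_finprod_eq:
 assumes "finite A" "!!i. i : A ==> a i : Hom C x P" "x : ob" "k : Hom C P Y" "k' : Hom C P Y"
  "!!i. i : A ==> k\<cdot>a i = k'\<cdot>a i"
 shows "finprod (hom_group C x P) a A : Hom C x P &
  k\<cdot>finprod (hom_group C x P) a A = k'\<cdot>finprod (hom_group C x P) a A"
proof -
 have PY: "P : ob" "Y : ob" using assms(4) by auto
 interpret comm_group "hom_group C x P" using assms(3) PY by (intro hom_comm_group) auto
 show ?thesis
  using assms(1,2,6)
 proof (induction A)
  case empty
  then show ?case using assms(3-5) PY by simp
 next
  case (insert i A)
  have IH: "finprod (hom_group C x P) a A : Hom C x P"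
   "k\<cdot>finprod (hom_group C x P) a A = k'\<cdot>finprod (hom_group C x P) a A"
   using insert by simp_all
  have a: "a i : Hom C x P" "k\<cdot>a i = k'\<cdot>a i" using insert.prems by simp_all
  have "finprod (hom_group C x P) a (insert i A) = pls (a i) (finprod (hom_group C x P) a A)"
   using finprod_insert[of A i a] insert.hyps insert.prems(1) by auto
  then show ?case using IH a assms(4,5) by simp
 qed
qed

end

locale cg_category = compactly_generated U C + universe U
 for U :: "'u set" and C :: "('o, 'm, 'x) tricat_scheme" (structure)
begin

text \<open>
 A map into a coproduct that factors through a finite subcoproduct is characterized without
 mentioning sums: it does not distinguish two maps that agree on finitely many summands. This form of
 compactness passes to fibres and suspensions by short diagram chases.
\<close>

definition finite_support :: "'i set => ('i => 'm) => 'm => bool" where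
 "finite_support J io f \<longleftrightarrow> finite J &
   (\<forall>Y k k'. k : Hom C (cod f) Y & k' : Hom C (cod f) Y & (\<forall>i\<in>J. k\<cdot>io i = k'\<cdot>io i) --> k\<cdot>f = k'\<cdot>f)"

definition finitary :: "'o => bool" where
 "finitary x \<longleftrightarrow> x : ob & (\<forall>(I :: 'u set) X P io f. small U I & is_coproduct C I X P io & f : Hom C x P -->
   (\<exists>J\<subseteq>I. finite_support J io f))"

lemma finite_supportD:
 assumes "finite_support J io f"
 shows "finite J" "k : Hom C (cod f) Y ==> k' : Hom C (cod f) Y ==> (!!i. i : J ==> k\<cdot>io i = k'\<cdot>io i) ==> k\<cdot>f = k'\<cdot>f"
 using assms unfolding finite_support_def by blast+

lemma finite_supportI:
 assumes "finite J" "!!Y k k'. k : Hom C (cod f) Y ==> k' : Hom C (cod f) Y ==>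
   (!!i. i : J ==> k\<cdot>io i = k'\<cdot>io i) ==> k\<cdot>f = k'\<cdot>f"
 shows "finite_support J io f"
 using assms unfolding finite_support_def by blast

lemma finitary_ob: "finitary x ==> x : ob"
 by (simp add: finitary_def)

lemma finitaryD:
 assumes "finitary x" "small U I" "is_coproduct C I X P io" "f : Hom C x P"
 obtains J where "J <= I" "finite_support J io f"
proof -
 obtain I' :: "'u set" and e where e: "small U I'" "I' <= U" "bij_betw e I' I"
  using small_reindex[OF assms(2)] .
 obtain J where J: "J <= I'" "finite_support J (io \<circ> e) f"
  using assms(1,4) e(1) is_coproduct_reindex[OF assms(3) e(3)] unfolding finitary_def by blast
 have "finite_support (e ` J) io f"
 proof (rule finite_supportI)
  show "finite (e ` J)" using finite_supportD(1)[OF J(2)] by simp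
  fix Y k k' assume k: "k : Hom C (cod f) Y" "k' : Hom C (cod f) Y"
   "!!i. i : e ` J ==> k\<cdot>io i = k'\<cdot>io i"
  show "k\<cdot>f = k'\<cdot>f"
   by (rule finite_supportD(2)[OF J(2) k(1,2)]) (simp add: k(3))
 qed
 moreover have "e ` J <= I" using J(1) e(3) by (auto simp: bij_betw_def)
 ultimately show thesis using that by blast
qed

lemma compact_finitary:
 assumes "x : compact_objects U C" shows "finitary x"
 unfolding finitary_def
proof (intro conjI allI impI; (elim conjE)?)
 show x: "x : ob" using assms by (simp add: compact_objects_def)
 fix I :: "'u set" and X P io f
 assume I: "small U I" and P: "is_coproduct C I X P io" and f: "f : Hom C x P"
 let ?F = "%g. finprod (hom_group C x P) (%i. io i\<cdot>g i) {i : I. g i ~= zro x (X i)}"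
 have "bij_betw ?F (finitely_supported_families C x I X) (Hom C x P)"
  using assms I P unfolding compact_objects_def by blast
 then have "f : ?F ` finitely_supported_families C x I X" using f by (simp add: bij_betw_def)
 then obtain g where g: "g : finitely_supported_families C x I X" "f = ?F g" by blast
 let ?J = "{i : I. g i ~= zro x (X i)}"
 have J: "finite ?J" and gi: "!!i. i : I ==> g i : Hom C x (X i)"
  using g(1) unfolding finitely_supported_families_def by (auto simp del: in_Hom)
 note D = is_coproductD[OF P]
 have "finite_support ?J io f"
 proof (rule finite_supportI[OF J])
  fix Y k k' assume k: "k : Hom C (cod f) Y" "k' : Hom C (cod f) Y"
   and eq: "!!i. i : ?J ==> k\<cdot>io i = k'\<cdot>io i"
  have kP: "k : Hom C P Y" "k' : Hom C P Y" using k f by auto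
  have "k\<cdot>?F g = k'\<cdot>?F g"
  proof (rule cmp_finprod_eq[THEN conjunct2, OF J _ x kP])
   show "io i\<cdot>g i : Hom C x P" if "i : ?J" for i using that D gi by auto
   show "k\<cdot>(io i\<cdot>g i) = k'\<cdot>(io i\<cdot>g i)" if "i : ?J" for i
    by (rule cmp_swap[OF eq[OF that]]) (use that D gi kP in auto)
  qed
  then show "k\<cdot>f = k'\<cdot>f" using g(2) by simp
 qed
 then show "\<exists>J\<subseteq>I. finite_support J io f" by (intro exI[of _ ?J] conjI) auto
qed

lemma finitary_zero: "is_zero C z ==> finitary z"
 unfolding finitary_def
proof (intro conjI allI impI; (elim conjE)?)
 assume z: "is_zero C z"
 then show "z : ob" by simp
 fix I :: "'u set" and X P and io :: "'u => 'm" and f assume f: "f : Hom C z P"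
 have "finite_support {} io f"
  by (rule finite_supportI) (use f in \<open>auto intro!: is_zero_eq_from[OF z]\<close>)
 then show "\<exists>J\<subseteq>I. finite_support J io f" by blast
qed

lemma finitary_iso:
 assumes x: "finitary x" and iso: "isomorphic C x y" shows "finitary y"
 unfolding finitary_def
proof (intro conjI allI impI; (elim conjE)?)
 show "y : ob" using iso isomorphic_ob by blast
 obtain p q where pq: "p : Hom C x y" "q : Hom C y x" "q\<cdot>p = ide x" "p\<cdot>q = ide y"
  "x : ob" "y : ob" using iso by (rule isomorphicE)
 fix I :: "'u set" and X P io f
 assume I: "small U I" and P: "is_coproduct C I X P io" and f: "f : Hom C y P"
 obtain J where J: "J <= I" "finite_support J io (f\<cdot>p)"
  by (rule finitaryD[OF x I P, of "f\<cdot>p"]) (use f pq in auto)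
 have "finite_support J io f"
 proof (rule finite_supportI[OF finite_supportD(1)[OF J(2)]])
  fix Y k k' assume k: "k : Hom C (cod f) Y" "k' : Hom C (cod f) Y"
   "!!i. i : J ==> k\<cdot>io i = k'\<cdot>io i"
  have "k\<cdot>(f\<cdot>p) = k'\<cdot>(f\<cdot>p)"
   by (rule finite_supportD(2)[OF J(2)]) (use k f pq in auto)
  then have "k\<cdot>(f\<cdot>p)\<cdot>q = k'\<cdot>(f\<cdot>p)\<cdot>q" by simp
  then show "k\<cdot>f = k'\<cdot>f" using k(1,2) f pq by simp
 qed
 then show "\<exists>J\<subseteq>I. finite_support J io f" using J by blast
qed

lemma finitary_unsh:
 assumes x: "finitary (shO x)" and xo: "x : ob" shows "finitary x"
 unfolding finitary_def
proof (intro conjI allI impI; (elim conjE)?)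
 show "x : ob" using xo .
 fix I :: "'u set" and X P io f
 assume I: "small U I" and P: "is_coproduct C I X P io" and f: "f : Hom C x P"
 note D = is_coproductD[OF P]
 obtain J where J: "J <= I" "finite_support J (%i. shM (io i)) (shM f)"
  by (rule finitaryD[OF x I coproduct_sh[OF P], of "shM f"]) (use f in auto)
 have "finite_support J io f"
 proof (rule finite_supportI[OF finite_supportD(1)[OF J(2)]])
  fix Y k k' assume k: "k : Hom C (cod f) Y" "k' : Hom C (cod f) Y"
   and eq: "!!i. i : J ==> k\<cdot>io i = k'\<cdot>io i"
  have "shM k\<cdot>shM f = shM k'\<cdot>shM f"
  proof (rule finite_supportD(2)[OF J(2), of _ "shO Y"])
   fix i assume i: "i : J"
   have "shM (k\<cdot>io i) = shM (k'\<cdot>io i)" using eq[OF i] by simp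
   then show "shM k\<cdot>shM (io i) = shM k'\<cdot>shM (io i)" using k D f i J(1) by auto
  qed (use k f in auto)
  then have "shM (k\<cdot>f) = shM (k'\<cdot>f)" using k f by simp
  then show "k\<cdot>f = k'\<cdot>f" by (rule sh_faithful) (use k f in auto)
 qed
 then show "\<exists>J\<subseteq>I. finite_support J io f" using J by blast
qed

lemma finitary_sh:
 assumes x: "finitary x" shows "finitary (shO x)"
 unfolding finitary_def
proof (intro conjI allI impI; (elim conjE)?)
 have xo: "x : ob" using x by (rule finitary_ob)
 then show "shO x : ob" by simp
 fix I :: "'u set" and Y Q \<kappa> f
 assume I: "small U I" and Q: "is_coproduct C I Y Q \<kappa>" and f: "f : Hom C (shO x) Q"
 note D = is_coproductD[OF Q]
 have "\<exists>z. z : ob & isomorphic C (shO z) (Y i)" if "i : I" for i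
  using shift_ess_surj[OF D(2)[OF that]] by blast
 then obtain X where X: "!!i. i : I ==> X i : ob" "!!i. i : I ==> isomorphic C (shO (X i)) (Y i)" by metis
 obtain P where P: "P : ob" "isomorphic C (shO P) Q" using shift_ess_surj[OF D(1)] by blast
 obtain io th \<eta> where c: "is_coproduct C I X P io" "\<eta> : Hom C Q (shO P)" "is_iso C \<eta>"
  "!!i. i : I ==> th i : Hom C (shO (X i)) (Y i)" "!!i. i : I ==> shM (io i) = \<eta>\<cdot>(\<kappa> i\<cdot>th i)"
  using coproduct_unshift[OF Q X(1) P(1) X(2) P(2)] by blast
 note DP = is_coproductD[OF c(1)]
 obtain \<eta>' where \<eta>': "\<eta>' : arr" "dom \<eta>' = shO P" "cod \<eta>' = Q" "\<eta>'\<cdot>\<eta> = ide Q"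
  by (rule iso_inverse[OF c(3)]) (use c(2) in auto)
 obtain f' where f': "f' : Hom C x P" "shM f' = \<eta>\<cdot>f"
  by (rule sh_full[of "\<eta>\<cdot>f" x P]) (use f c(2) xo P(1) in auto)
 obtain J where J: "J <= I" "finite_support J io f'" by (rule finitaryD[OF x I c(1) f'(1)])
 have "finite_support J \<kappa> f"
 proof (rule finite_supportI[OF finite_supportD(1)[OF J(2)]])
  fix Z k k' assume k0: "k : Hom C (cod f) Z" "k' : Hom C (cod f) Z"
   and eq: "!!i. i : J ==> k\<cdot>\<kappa> i = k'\<cdot>\<kappa> i"
  have k: "k : Hom C Q Z" "k' : Hom C Q Z" using k0 f by auto
  have Z: "Z : ob" using k by auto
  obtain z \<zeta> \<zeta>' where z: "z : ob" "\<zeta> : Hom C (shO z) Z" "\<zeta>' : Hom C Z (shO z)"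
   "\<zeta>'\<cdot>\<zeta> = ide (shO z)" "\<zeta>\<cdot>\<zeta>' = ide Z" using unshift_ob[OF Z] .
  obtain l where l: "l : Hom C P z" "shM l = \<zeta>'\<cdot>(k\<cdot>\<eta>')"
   by (rule sh_full[of "\<zeta>'\<cdot>(k\<cdot>\<eta>')" P z]) (use k \<eta>' z P(1) in auto)
  obtain l' where l': "l' : Hom C P z" "shM l' = \<zeta>'\<cdot>(k'\<cdot>\<eta>')"
   by (rule sh_full[of "\<zeta>'\<cdot>(k'\<cdot>\<eta>')" P z]) (use k \<eta>' z P(1) in auto)
  have \<eta>'\<eta>: "\<eta>'\<cdot>(\<eta>\<cdot>a) = a" if "a : arr" "cod a = Q" for a
   using cmp_reduce[OF \<eta>'(4), of a] that \<eta>' c(2) by simp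
  have "l\<cdot>f' = l'\<cdot>f'"
  proof (rule finite_supportD(2)[OF J(2), of _ z])
   fix i assume i: "i : J"
   then have iI: "i : I" using J(1) by blast
   have "shM (l\<cdot>io i) = \<zeta>'\<cdot>(k\<cdot>(\<eta>'\<cdot>(\<eta>\<cdot>(\<kappa> i\<cdot>th i))))"
    using l DP iI c(2,4,5) k \<eta>' z D by simp
   also have "... = \<zeta>'\<cdot>(k'\<cdot>(\<eta>'\<cdot>(\<eta>\<cdot>(\<kappa> i\<cdot>th i))))"
   proof -
    have "k\<cdot>(\<kappa> i\<cdot>th i) = k'\<cdot>(\<kappa> i\<cdot>th i)"
     by (rule cmp_swap[OF eq[OF i]]) (use D iI c(4)[OF iI] k in auto)
    moreover have "\<eta>'\<cdot>(\<eta>\<cdot>(\<kappa> i\<cdot>th i)) = \<kappa> i\<cdot>th i"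
     by (rule \<eta>'\<eta>) (use D iI c(4)[OF iI] in auto)
    ultimately show ?thesis by simp
   qed
   also have "... = shM (l'\<cdot>io i)"
    using l' DP iI c(2,4,5) k \<eta>' z D by simp
   finally show "l\<cdot>io i = l'\<cdot>io i" by (rule sh_faithful) (use l l' DP iI in auto)
  qed (use l l' f' in auto)
  then have "shM l\<cdot>shM f' = shM l'\<cdot>shM f'" using l l' f' by (metis sh_cmp in_Hom)
  then have "\<zeta>'\<cdot>(k\<cdot>f) = \<zeta>'\<cdot>(k'\<cdot>f)"
   unfolding l(2) l'(2) f'(2) using \<eta>'\<eta>[of f] f k \<eta>' z c(2) by simp
  then have "\<zeta>\<cdot>(\<zeta>'\<cdot>(k\<cdot>f)) = \<zeta>\<cdot>(\<zeta>'\<cdot>(k'\<cdot>f))" by simp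
  moreover have "\<zeta>\<cdot>(\<zeta>'\<cdot>a) = a" if "a : arr" "cod a = Z" for a
   using cmp_reduce[OF z(5), of a] that z by simp
  ultimately show "k\<cdot>f = k'\<cdot>f" using k f by simp
 qed
 then show "\<exists>J\<subseteq>I. finite_support J \<kappa> f" using J by blast
qed

lemma finitary_fibre:
 assumes t: "(u, v, w) : tri" and y: "finitary (cod u)" and z: "finitary (cod v)"
 shows "finitary (dom u)"
 unfolding finitary_def
proof (intro conjI allI impI; (elim conjE)?)
 note T = triD[OF t]
 show "dom u : ob" using T by simp
 fix I :: "'u set" and X P io f
 assume I: "small U I" and P: "is_coproduct C I X P io" and f: "f : Hom C (dom u) P"
 note D = is_coproductD[OF P]
 obtain J where J: "J <= I" "finite_support J (%i. shM (io i)) (shM f\<cdot>w)"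
  by (rule finitaryD[OF z I coproduct_sh[OF P], of "shM f\<cdot>w"]) (use f T in auto)
 obtain e where e: "e : Hom C P P" "!!i. i : I ==> e\<cdot>io i = (if i : J then io i else zro (X i) P)"
  using coproduct_select[OF P] by blast
 have "shM e\<cdot>(shM f\<cdot>w) = ide (shO P)\<cdot>(shM f\<cdot>w)"
 proof (rule finite_supportD(2)[OF J(2)])
  fix i assume i: "i : J"
  have "shM (e\<cdot>io i) = shM (io i)" using e(2)[of i] i J(1) by auto
  then show "shM e\<cdot>shM (io i) = ide (shO P)\<cdot>shM (io i)"
   using e(1) D i J(1) by auto
 qed (use e(1) f T D in auto)
 then have "shM (sub f (e\<cdot>f))\<cdot>w = zro (cod v) (shO P)" using e(1) f T D by simp
 then obtain b where b: "b : Hom C (shO (cod u)) (shO P)" "b\<cdot>shM u = shM (sub f (e\<cdot>f))"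
  by (rule tri_ext3[OF t, rotated]) (use e(1) f T in auto)
 obtain k where k: "k : Hom C (cod u) P" "shM k = b"
  by (rule sh_full[OF b(1)]) (use T D in auto)
 have "shM (k\<cdot>u) = shM (sub f (e\<cdot>f))" using b k T by simp
 then have ku: "k\<cdot>u = sub f (e\<cdot>f)" by (rule sh_faithful) (use k e(1) f T in auto)
 have "pls (k\<cdot>u) (e\<cdot>f) = f" unfolding ku by (rule sub_pls) (use e(1) f in auto)
 then have fe: "pls (k\<cdot>u) (e\<cdot>f) = f" .
 obtain J' where J': "J' <= I" "finite_support J' io k" by (rule finitaryD[OF y I P k(1)])
 have "finite_support (J \<union> J') io f"
 proof (rule finite_supportI)
  show "finite (J \<union> J')" using finite_supportD(1)[OF J(2)] finite_supportD(1)[OF J'(2)] by simp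
  fix Y a a' assume a0: "a : Hom C (cod f) Y" "a' : Hom C (cod f) Y"
   and eq: "!!i. i : J \<union> J' ==> a\<cdot>io i = a'\<cdot>io i"
  have a: "a : Hom C P Y" "a' : Hom C P Y" using a0 f by auto
  have 1: "a\<cdot>k = a'\<cdot>k" by (rule finite_supportD(2)[OF J'(2)]) (use a k eq in auto)
  have 2: "a\<cdot>e = a'\<cdot>e"
  proof (rule is_coproduct_ext[OF P, of _ Y])
   fix i assume i: "i : I"
   have "a\<cdot>(e\<cdot>io i) = a'\<cdot>(e\<cdot>io i)" using e(2)[OF i] eq[of i] a D i by auto
   then show "a\<cdot>e\<cdot>io i = a'\<cdot>e\<cdot>io i" using a e(1) D i by simp
  qed (use a e(1) in auto)
  have "a\<cdot>pls (k\<cdot>u) (e\<cdot>f) = a'\<cdot>pls (k\<cdot>u) (e\<cdot>f)"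
   using cmp_swap[OF 1, of u] cmp_swap[OF 2, of f] a k e(1) f T by simp
  then show "a\<cdot>f = a'\<cdot>f" unfolding fe .
 qed
 then show "\<exists>J\<subseteq>I. finite_support J io f" using J(1) J'(1) by blast
qed

lemma finitary_cone:
 assumes t: "(f, g, h) : tri" and "finitary (dom f)" "finitary (cod f)"
 shows "finitary (cod g)"
 using finitary_fibre[OF tri_rot[OF tri_rot[OF t]]] finitary_sh assms(2,3) triD[OF t] by simp

text \<open>
 A small set of finitary objects that contains generators and is closed, up to isomorphism, under
 suspension, desuspension and cones.
\<close>

lemma skeletal_generators:
 obtains F where "small U F" "stable F" "loc U C F = ob" "!!x. x : F ==> finitary x" "\<exists>z\<in>F. is_zero C z"
  "!!f g h. (f, g, h) : tri ==> dom f : F ==> cod f : F ==> \<exists>y\<in>F. isomorphic C (cod g) y"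
proof -
 obtain G where G: "G <= compact_objects U C" "small U G" "loc U C G = ob" using generated by blast
 obtain z where z: "is_zero C z" using zero_object by blast
 define cone where "cone f = (SOME w. \<exists>g h. (f, g, h) : tri & cod g = w)" for f
 define ush where "ush y = (SOME x. x : ob & isomorphic C (shO x) y)" for y
 have cone: "\<exists>g h. (f, g, h) : tri & cod g = cone f" if "f : arr" for f
  unfolding cone_def by (rule someI_ex) (use tri_cone[OF that] in blast)
 have ush: "ush y : ob & isomorphic C (shO (ush y)) y" if "y : ob" for y
  unfolding ush_def by (rule someI_ex) (use shift_ess_surj[OF that] in blast)
 define R where "R x y = {shO x, ush x} \<union> (if x : ob & y : ob then cone ` Hom C x y else {})" for x y
 have sm: "small U (R x y)" for x y
 proof -
  have "small U {shO x, ush x}" "small U ({} :: 'o set)" by (auto intro: small_countable)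
  moreover have "small U (cone ` Hom C x y)" if "x : ob" "y : ob"
   using loc_small that unfolding locally_small_def by (intro small_image) blast
  ultimately show ?thesis unfolding R_def by (intro small_Un) auto
 qed
 have fin: "finitary w" if "finitary x" "finitary y" "w : R x y" for x y w
 proof -
  have "w = shO x \<or> w = ush x \<or> (\<exists>f\<in>Hom C x y. w = cone f)"
   using that(3) unfolding R_def by (auto split: if_splits simp del: in_Hom)
  then consider "w = shO x" | "w = ush x" | f where "f : Hom C x y" "w = cone f" by blast
  then show ?thesis
  proof cases
   case 1 then show ?thesis using finitary_sh that(1) by simp
  next
   case 2
   have "finitary (shO (ush x))" using finitary_iso[OF that(1)] isomorphic_sym ush[OF finitary_ob[OF that(1)]] by blast
   then show ?thesis using finitary_unsh ush[OF finitary_ob[OF that(1)]] 2 by simp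
  next
   case 3
   then obtain g h where "(f, g, h) : tri" "cod g = cone f" using cone[of f] by auto
   then show ?thesis using finitary_cone[of f g h] that 3 by simp
  qed
 qed
 have base: "finitary x" if "x : insert z G" for x
  using that G(1) compact_finitary finitary_zero[OF z] by auto
 have "small U (insert z G)" using small_Un[OF _ G(2), of "{z}"] small_countable[of "{z}"] by simp
 then obtain F where F: "insert z G <= F" "small U F" "!!x y. x : F ==> y : F ==> R x y <= F"
  "!!x. x : F ==> finitary x"
  by (rule small_closure[of _ R finitary, OF _ sm base fin]) auto
 show thesis
 proof (rule that[OF F(2)])
  show "stable F"
   unfolding stable_def
  proof (intro conjI ballI)
   show "F <= ob" using F(4) finitary_ob by blast
   fix x assume x: "x : F"
   then have xo: "x : ob" using F(4) finitary_ob by blast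
   have "shO x : F" "ush x : F" using F(3)[OF x x] by (auto simp: R_def)
   then show "\<exists>y\<in>F. isomorphic C (shO x) y" "\<exists>y\<in>F. isomorphic C (shO y) x"
    using isomorphic_refl[OF sh_ob[OF xo]] ush[OF xo] by blast+
  qed
  have "loc U C G <= loc U C F" unfolding loc_def using F(1) by blast
  moreover have "localizing U C (ob)"
   unfolding localizing_def using triangulated_subcategory_Ob is_coproductD(1) by blast
  then have "loc U C F <= ob" unfolding loc_def using F(4) finitary_ob by blast
  ultimately show "loc U C F = ob" using G(3) by blast
  show "\<exists>z\<in>F. is_zero C z" using z F(1) by blast
  fix f g h assume t: "(f, g, h) : tri" "dom f : F" "cod f : F"
  note D = triD[OF t(1)]
  obtain g' h' where t': "(f, g', h') : tri" "cod g' = cone f" using cone[OF D(1)] by blast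
  have "cone f : R (dom f) (cod f)" using D by (auto simp: R_def)
  then have "cod g' : F" using F(3)[OF t(2,3)] t'(2) by auto
  moreover obtain c where "c : Hom C (cod g) (cod g')" "is_iso C c"
   by (rule tri_iso_third[OF t(1) t'(1), of "ide (dom f)" "ide (cod f)"]) (use D in auto)
  then have "isomorphic C (cod g) (cod g')" unfolding isomorphic_def by blast
  ultimately show "\<exists>y\<in>F. isomorphic C (cod g) y" by blast
 qed (use F(4) in blast)
qed

text \<open>
 Isomorphic copies and zero objects come for free, as coproducts of one or no object.
\<close>

lemma devissage:
 assumes tri: "!!f g h. (f, g, h) : tri ==> dom f : P ==> cod f : P ==> shO (dom f) : P ==>
      shO (cod f) : P ==> cod g : P"
  and cop: "!!(I :: 'u set) X Q io. small U I ==> X ` I <= P ==> is_coproduct C I X Q io ==> Q : P"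
  and gen: "stable S" "S <= P" "G <= S" "loc U C G = ob" and x: "x : ob"
 shows "x : P"
proof (rule devissage_core[OF _ _ tri cop gen x])
 show "z : P" if z: "is_zero C z" for z
 proof (rule cop)
  show "small U ({} :: 'u set)" by (simp add: small_countable)
  show "is_coproduct C {} (%_. z) z (%_. ide z)"
   unfolding is_coproduct_def using z unfolding is_zero_def by (simp del: in_Hom)
 qed simp
 show "y : P" if x: "x : P" and i: "isomorphic C x y" for x y
 proof -
  obtain p q where pq: "p : Hom C x y" "q : Hom C y x" "q\<cdot>p = ide x" "p\<cdot>q = ide y" "x : ob" "y : ob"
   using i by (rule isomorphicE)
  have 1: "small U {undefined :: 'u}" by (simp add: small_countable)
  have 2: "(%_. x) ` {undefined :: 'u} <= P" using x by simp
  have 3: "is_coproduct C {undefined :: 'u} (%_. x) y (%_. p)"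
  proof (rule is_coproductI[OF pq(6)])
   fix Y f assume f: "!!i :: 'u. i : {undefined} ==> f i : Hom C x Y"
   then have "f undefined\<cdot>q : Hom C y Y" "f undefined\<cdot>q\<cdot>p = f undefined" using pq by simp_all
   then show "\<exists>h. h : Hom C y Y & (\<forall>i\<in>{undefined}. h\<cdot>p = f i)" by (intro exI[of _ "f undefined\<cdot>q"]) simp
  next
   fix Y h h' assume h: "h : Hom C y Y" "h' : Hom C y Y" and eq: "!!i :: 'u. i : {undefined} ==> h\<cdot>p = h'\<cdot>p"
   have "h\<cdot>p\<cdot>q = h'\<cdot>p\<cdot>q" using eq[of undefined] by simp
   then show "h = h'" using h pq by simp
  qed (use pq in auto)
  show ?thesis by (rule cop[OF 1 2 3])
 qed
qed

text \<open>
 A map from a finitary object to a coproduct behaves like a finite sum of maps into the summands.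
\<close>

lemma finitary_induct:
 assumes x: "finitary x" and I: "small U I" and Q: "is_coproduct C I X Q io" and f: "f : Hom C x Q"
  and zero: "R (zro x Q)"
  and add: "!!g i k. R g ==> g : Hom C x Q ==> i : I ==> k : Hom C x (X i) ==> R (pls g (io i\<cdot>k))"
 shows "R f"
proof -
 note D = is_coproductD[OF Q]
 have fac: "R (e\<cdot>f)" if J: "finite J" "J <= I" and e: "e : Hom C Q Q"
   "!!i. i : I ==> e\<cdot>io i = (if i : J then io i else zro (X i) Q)" for J e
  using J e
 proof (induction J arbitrary: e)
  case empty
  have "e = zro Q Q" by (rule is_coproduct_ext[OF Q, of _ Q]) (use empty D in auto)
  then show ?case using f D zero by simp
 next
  case (insert j J)
  obtain e' where e': "e' : Hom C Q Q" "!!i. i : I ==> e'\<cdot>io i = (if i : J then io i else zro (X i) Q)"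
   using coproduct_select[OF Q] by blast
  have jI: "j : I" using insert by blast
  obtain \<pi> where \<pi>: "\<pi> : Hom C Q (X j)" "!!i. i : I ==> \<pi>\<cdot>io i = (if i = j then ide (X j) else zro (X i) (X j))"
   using coproduct_proj[OF Q jI] by blast
  have "e = pls e' (io j\<cdot>\<pi>)"
  proof (rule is_coproduct_ext[OF Q, of _ Q])
   fix i assume i: "i : I"
   show "e\<cdot>io i = pls e' (io j\<cdot>\<pi>)\<cdot>io i"
    using insert.prems(3)[OF i] e'(1) e'(2)[OF i] \<pi>(1) \<pi>(2)[OF i] insert.hyps i jI D by auto
  qed (use insert.prems e' \<pi> D jI in auto)
  then have "e\<cdot>f = pls (e'\<cdot>f) (io j\<cdot>(\<pi>\<cdot>f))" using e'(1) \<pi>(1) D jI f by simp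
  moreover have "R (e'\<cdot>f)" by (rule insert.IH) (use insert.prems e' in auto)
  ultimately show ?case using add[of "e'\<cdot>f" j "\<pi>\<cdot>f"] e'(1) \<pi>(1) jI f by simp
 qed
 obtain J where J: "J <= I" "finite_support J io f" by (rule finitaryD[OF x I Q f])
 obtain e where e: "e : Hom C Q Q" "!!i. i : I ==> e\<cdot>io i = (if i : J then io i else zro (X i) Q)"
  using coproduct_select[OF Q] by blast
 have "e\<cdot>f = ide Q\<cdot>f"
  by (rule finite_supportD(2)[OF J(2)]) (use e f D J(1) in auto)
 then have "e\<cdot>f = f" using f D by simp
 then show ?thesis using fac[OF finite_supportD(1)[OF J(2)] J(1) e] by simp
qed

text \<open>
 Neeman's argument that compact objects are retracts of objects built in finitely many steps. If
 \<open>n : x \<rightarrow> Z\<close> goes to the cone of \<open>A \<rightarrow> B\<close>, then \<open>x \<rightarrow> \<Sigma> A\<close> factors through some \<open>F1\<close>, the restriction of \<open>n\<close> to the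
 fibre of \<open>x \<rightarrow> F1\<close> lifts to \<open>B\<close> and factors through some \<open>F2\<close>, and \<open>n\<close> factors through the extension
 of \<open>F1\<close> by \<open>F2\<close> obtained by pushing out.
\<close>

lemma finitary_factors:
 assumes st: "stable F" and gen: "loc U C F = ob" and fin: "!!x. x : F ==> finitary x"
  and zer: "\<exists>z\<in>F. is_zero C z"
  and cone: "!!f g h. (f, g, h) : tri ==> dom f : F ==> cod f : F ==> \<exists>y\<in>F. isomorphic C (cod g) y"
  and f: "finitary x" "f : Hom C x Y"
 shows "\<exists>y\<in>F. \<exists>a\<in>Hom C x y. \<exists>b\<in>Hom C y Y. f = b\<cdot>a"
proof -
 define through where "through x f = (\<exists>y\<in>F. \<exists>a\<in>Hom C x y. \<exists>b\<in>Hom C y (cod f). f = b\<cdot>a)" for x f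
 have throughE: "\<exists>y\<in>F. \<exists>a\<in>Hom C x y. \<exists>b\<in>Hom C y Y. f = b\<cdot>a" if "through x f" "f : Hom C x Y" for x f Y
  using that by (simp add: through_def)
 have Fo: "y : ob" if "y : F" for y using stableD(1)[OF st] that by blast
 have throughI: "through x (b\<cdot>a)" if y: "y' : F" "isomorphic C y y'" and ab: "a : Hom C x y" "b : Hom C y Y" for x y y' a b Y
 proof -
  obtain p q where pq: "p : Hom C y y'" "q : Hom C y' y" "q\<cdot>p = ide y" using isomorphicE[OF y(2)] by metis
  have "b\<cdot>q\<cdot>(p\<cdot>a) = b\<cdot>(q\<cdot>p\<cdot>a)" using pq(1,2) ab by simp
  also have "... = b\<cdot>a" unfolding pq(3) using ab by simp
  finally have "b\<cdot>a = b\<cdot>q\<cdot>(p\<cdot>a)" by simp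
  moreover have "p\<cdot>a : Hom C x y'" "b\<cdot>q : Hom C y' (cod (b\<cdot>a))" using pq ab by auto
  ultimately show ?thesis using y(1) unfolding through_def by blast
 qed
 have ext: "\<exists>i p y. (i, p, w) : tri & dom i = F2 & y : F & isomorphic C (cod i) y"
  if F12: "F1 : F" "F2 : F" and w: "w : Hom C F1 (shO F2)" for F1 F2 w
 proof -
  obtain p q where t: "(p, w, q) : tri" using fibre[of w] w by auto
  note D = triD[OF t]
  obtain i where i: "i : Hom C F2 (dom p)" "shM i = neg C q"
   by (rule sh_full[of "neg C q" F2 "dom p"]) (use D w Fo[OF F12(2)] in auto)
  have "(i, p, w) : tri" by (rule tri_rot_back) (use t i D w in auto)
  moreover have "\<exists>y\<in>F. isomorphic C (cod i) y"
  proof -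
   obtain F2' where F2': "F2' : F" "isomorphic C (shO F2) F2'" using stableD(2)[OF st F12(2)] by blast
   obtain m where m: "m : Hom C (shO F2) F2'" "is_iso C m" using F2'(2) unfolding isomorphic_def by blast
   obtain g' h' where t': "(m\<cdot>w, g', h') : tri" using tri_cone[of "m\<cdot>w"] m w by auto
   obtain y where y: "y : F" "isomorphic C (cod g') y" using cone[OF t'] F12(1) F2'(1) m w by auto
   note D' = triD[OF t']
   obtain c where "c : Hom C (cod q) (cod g')" "is_iso C c"
    by (rule tri_iso_third[OF tri_rot[OF t, unfolded] t', of "ide F1" m]) (use D D' m w in auto)
   then have "isomorphic C (shO (dom p)) y" using y(2) isomorphic_trans D unfolding isomorphic_def by metis
   moreover obtain y' where y': "y' : F" "isomorphic C (shO y') y" using stableD(3)[OF st y(1)] by blast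
   ultimately have "isomorphic C (shO (dom p)) (shO y')" using isomorphic_sym isomorphic_trans by blast
   then have "isomorphic C (dom p) y'" using isomorphic_sh_cancel D Fo[OF y'(1)] by simp
   then show ?thesis using y'(1) i by auto
  qed
  ultimately obtain y where "(i, p, w) : tri" "y : F" "isomorphic C (cod i) y" by blast
  then show ?thesis using i(1) by (intro exI[of _ i] exI[of _ p] exI[of _ y]) simp
 qed
 \<comment> \<open>Given the triangle of an extension, a map on the subobject that kills the class extends.\<close>
 have extend: "\<exists>d\<in>Hom C (cod i) Y. d\<cdot>i = b"
  if t: "(i, p, w) : tri" and b: "b : Hom C (dom i) Y" "shM b\<cdot>w = zro (cod p) (shO Y)" for i p w b Y
 proof -
  note D = triD[OF t]
  have Y: "Y : ob" using b by auto
  obtain k where k: "k : Hom C (shO (cod i)) (shO Y)" "k\<cdot>shM i = shM b"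
   by (rule tri_ext3[OF t _ b(2)]) (use b in auto)
  obtain d where d: "d : Hom C (cod i) Y" "shM d = k" by (rule sh_full[OF k(1) _ Y]) (use D in auto)
  have "shM (d\<cdot>i) = shM b" using d k D by simp
  then have "d\<cdot>i = b" by (rule sh_faithful) (use d b D in auto)
  then show ?thesis using d by blast
 qed
 have sum: "through x (pls f1 f2)"
  if f1: "through x f1" "f1 : Hom C x Y" and f2: "through x f2" "f2 : Hom C x Y" for f1 f2 x Y
 proof -
  obtain F1 a1 b1 where 1: "F1 : F" "a1 : Hom C x F1" "b1 : Hom C F1 Y" "f1 = b1\<cdot>a1"
   using throughE[OF f1] by blast
  obtain F2 a2 b2 where 2: "F2 : F" "a2 : Hom C x F2" "b2 : Hom C F2 Y" "f2 = b2\<cdot>a2"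
   using throughE[OF f2] by blast
  have o: "F1 : ob" "F2 : ob" "Y : ob" using 1 2 Fo by auto
  obtain i p y where t: "(i, p, zro F1 (shO F2)) : tri" "dom i = F2" "y : F" "isomorphic C (cod i) y"
   using ext[OF 1(1) 2(1), of "zro F1 (shO F2)"] o by auto
  note D = triD[OF t(1)]
  have pc: "cod p = F1" using D o by simp
  obtain s where s: "s : Hom C F1 (cod i)" "p\<cdot>s = ide F1"
   by (rule tri_lift2[OF t(1), of "ide F1" F1]) (use D o pc in auto)
  obtain d0 where d0: "d0 : Hom C (cod i) Y" "d0\<cdot>i = b2"
   using extend[OF t(1), of b2 Y] 2 t(2) o pc by auto
  define d where "d = pls d0 (sub b1 (d0\<cdot>s)\<cdot>p)"
  have d: "d : Hom C (cod i) Y" using d0 s 1 D pc by (simp add: d_def)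
  have "d\<cdot>i = b2" using d0 s 1 D pc tri_cmp1[OF t(1)] t(2) 2 o by (simp add: d_def)
  moreover have "d\<cdot>s = b1"
  proof -
   have "d\<cdot>s = pls (d0\<cdot>s) (sub b1 (d0\<cdot>s))" using d0 s 1 D pc by (simp add: d_def)
   also have "... = pls (sub b1 (d0\<cdot>s)) (d0\<cdot>s)" by (rule pls_comm) (use d0 s 1 in auto)
   also have "... = b1" by (rule sub_pls) (use d0 s 1 in auto)
   finally show ?thesis .
  qed
  ultimately have "d\<cdot>pls (s\<cdot>a1) (i\<cdot>a2) = pls f1 f2"
   using cmp_reduce[of d s b1 a1] cmp_reduce[of d i b2 a2] d s 1 2 D t(2) by simp
  moreover have "pls (s\<cdot>a1) (i\<cdot>a2) : Hom C x (cod i)" using s 1 2 D t(2) by simp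
  ultimately show ?thesis using throughI[OF t(3,4) _ d] by metis
 qed
 define P where "P = {Y : ob. \<forall>x f. finitary x & f : Hom C x Y --> through x f}"
 have PD: "through x f" if "Y : P" "finitary x" "f : Hom C x Y" for x f Y
  using that unfolding P_def by blast
 have "Y : P" if Y: "Y : ob" for Y
 proof (rule devissage[where G = F, OF _ _ st _ subset_refl gen Y])
  \<comment> \<open>The map \<open>n\<close> is rebuilt from \<open>e p + d0\<close>: \<open>d0\<close> extends \<open>g b2\<close> over the extension, and \<open>e\<close> corrects the
   difference, which vanishes on the fibre and so comes from \<open>F1\<close>.\<close>
  show "cod g : P" if t: "(f, g, h) : tri" and fP: "cod f : P" and sP: "shO (dom f) : P" for f g h
  proof -
   note D = triD[OF t]
   have "through x n" if n: "finitary x" "n : Hom C x (cod g)" for x n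
   proof -
    have xo: "x : ob" using n by auto
    have hn: "h\<cdot>n : Hom C x (shO (dom f))" using n D by auto
    have "through x (h\<cdot>n)" by (rule PD[OF sP n(1) hn])
    then obtain F1 a1 b1 where 1: "F1 : F" "a1 : Hom C x F1" "b1 : Hom C F1 (shO (dom f))" "h\<cdot>n = b1\<cdot>a1"
     using throughE[OF _ hn] by blast
    obtain u w where t1: "(u, a1, w) : tri" using fibre[of a1] 1 by auto
    note D1 = triD[OF t1]
    let ?x' = "dom u"
    have ux: "cod u = x" and wd: "dom w = F1" using D1 1 by auto
    have fx': "finitary ?x'" using finitary_fibre[OF t1] n(1) fin[OF 1(1)] ux 1(2) by simp
    have "h\<cdot>(n\<cdot>u) = b1\<cdot>(a1\<cdot>u)" using cmp_swap[OF 1(4), of u] n D D1 1 ux by simp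
    also have "... = zro ?x' (cod h)" using tri_cmp1[OF t1] 1 D D1 by auto
    finally obtain m where m: "m : Hom C ?x' (cod f)" "g\<cdot>m = n\<cdot>u"
     by (rule tri_lift2[OF t, rotated]) (use n D1 ux in auto)
    have "through ?x' m" by (rule PD[OF fP fx' m(1)])
    then obtain F2 a2 b2 where 2: "F2 : F" "a2 : Hom C ?x' F2" "b2 : Hom C F2 (cod f)" "m = b2\<cdot>a2"
     using throughE[OF _ m(1)] by blast
    have nu: "g\<cdot>b2\<cdot>a2 = n\<cdot>u" using m(2) 2 D by simp
    have F2o: "F2 : ob" using Fo 2(1) .
    let ?w = "shM a2\<cdot>w"
    have w': "?w : Hom C F1 (shO F2)" using 2 D1 wd by simp
    obtain i p y where ip: "(i, p, ?w) : tri" "dom i = F2" "y : F" "isomorphic C (cod i) y"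
     using ext[OF 1(1) 2(1) w'] by blast
    note D2 = triD[OF ip(1)]
    have pc: "cod p = F1" using D2 w' by simp
    note r1 = tri_rot[OF tri_rot[OF t1]] and r2 = tri_rot[OF tri_rot[OF ip(1)]]
    have "\<exists>c'\<in>Hom C (cod (neg C (shM u))) (cod (neg C (shM i))).
      c'\<cdot>neg C (shM u) = neg C (shM i)\<cdot>shM a2 &
      shM (ide F1)\<cdot>neg C (shM a1) = neg C (shM p)\<cdot>c'"
     by (rule tri_fill[OF r1 r2]) (use D1 D2 2 1 wd w' ip(2) in auto)
    then obtain c' where c': "c' : Hom C (shO x) (shO (cod i))"
      "neg C (c'\<cdot>shM u) = neg C (shM (i\<cdot>a2))" "neg C (shM a1) = neg C (shM p\<cdot>c')"
     using D1 D2 2 1 ux ip(2) pc by auto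
    obtain c where c: "c : Hom C x (cod i)" "shM c = c'" by (rule sh_full[OF c'(1) xo]) (use D2 in auto)
    have "c'\<cdot>shM u = shM (i\<cdot>a2)" using c'(2) by (rule neg_inj) (use c' D1 D2 2 ux ip(2) in auto)
    then have "shM (c\<cdot>u) = shM (i\<cdot>a2)" using c D1 ux by simp
    then have cu: "c\<cdot>u = i\<cdot>a2" by (rule sh_faithful) (use c D1 D2 ux 2 ip(2) in auto)
    have "shM a1 = shM p\<cdot>c'" using c'(3) by (rule neg_inj) (use c' D2 1 in auto)
    then have "shM (p\<cdot>c) = shM a1" using c D2 by simp
    then have pcc: "p\<cdot>c = a1" by (rule sh_faithful) (use c D2 1 pc in auto)
    have "shM (g\<cdot>b2)\<cdot>?w = shM (g\<cdot>b2\<cdot>a2)\<cdot>w" using 2 D D1 by simp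
    also have "... = shM n\<cdot>(shM u\<cdot>w)" unfolding nu using n D1 ux by simp
    also have "... = zro (cod p) (shO (cod g))" using tri_cmp3[OF t1] n D1 ux 1 pc D Fo[OF 1(1)] by simp
    finally have *: "shM (g\<cdot>b2)\<cdot>?w = zro (cod p) (shO (cod g))" .
    obtain d0 where d0: "d0 : Hom C (cod i) (cod g)" "d0\<cdot>i = g\<cdot>b2"
     using extend[OF ip(1) _ *] 2 D ip(2) by auto
    have "d0\<cdot>c\<cdot>u = n\<cdot>u" using cmp_reduce[OF d0(2), of a2] d0(1) c cu D1 D2 ux 2 nu D ip(2) by simp
    then have "sub n (d0\<cdot>c)\<cdot>u = zro (dom u) (cod g)" using n d0(1) c D1 ux by simp
    then obtain e where e: "e : Hom C F1 (cod g)" "e\<cdot>a1 = sub n (d0\<cdot>c)"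
     using tri_ext[OF t1, of "sub n (d0\<cdot>c)" "cod g"] n d0(1) c ux 1 by auto
    let ?d = "pls (e\<cdot>p) d0"
    have "?d\<cdot>c = pls (sub n (d0\<cdot>c)) (d0\<cdot>c)" using e d0(1) c D2 pc pcc by simp
    also have "... = n" by (rule sub_pls) (use n d0(1) c in auto)
    finally have "n = ?d\<cdot>c" by simp
    moreover have "?d : Hom C (cod i) (cod g)" using e d0 D2 pc by simp
    ultimately show ?thesis using throughI[OF ip(3,4) c(1), of ?d "cod g"] by simp
   qed
   then show ?thesis using D unfolding P_def by simp
  qed
  show "Q : P" if I: "small U I" and XP: "X ` I <= P" and Q: "is_coproduct C I X Q io" for I :: "'u set" and X Q io
  proof -
   note D = is_coproductD[OF Q]
   have "through x f" if f: "finitary x" "f : Hom C x Q" for x f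
   proof -
    have xo: "x : ob" using f by auto
    obtain y where y: "y : F" "is_zero C y" using zer by blast
    have yo: "y : ob" using Fo y(1) .
    have "through x (zro y Q\<cdot>zro x y)"
     by (rule throughI[OF y(1) isomorphic_refl[OF yo]]) (use yo xo D in auto)
    then have z: "through x (zro x Q)" using yo xo D by simp
    show ?thesis
    proof (rule finitary_induct[where R = "through x", OF f(1) I Q f(2) z])
     fix g j k assume g: "through x g" "g : Hom C x Q" and jI: "j : I" and k: "k : Hom C x (X j)"
     have "through x k" by (rule PD[OF _ f(1) k]) (use XP jI in blast)
     then obtain y a b where *: "y : F" "a : Hom C x y" "b : Hom C y (X j)" "k = b\<cdot>a"
      using throughE[OF _ k] by blast
     have "through x (io j\<cdot>b\<cdot>a)"
      by (rule throughI[OF *(1) isomorphic_refl[OF Fo[OF *(1)]] *(2), of _ Q]) (use * D jI in auto)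
     then have "through x (io j\<cdot>k)" unfolding *(4) using * D jI by simp
     then show "through x (pls g (io j\<cdot>k))" by (rule sum[OF g]) (use D jI k in auto)
    qed
   qed
   then show ?thesis using D unfolding P_def by simp
  qed
  show "F <= P"
  proof
   fix y assume y: "y : F"
   have "through x f" if f: "finitary x" "f : Hom C x y" for x f
    using throughI[OF y isomorphic_refl[OF Fo[OF y]] f(2), of "ide y" y] f(2) Fo[OF y] by simp
   then show "y : P" using Fo[OF y] unfolding P_def by blast
  qed
 qed
 then have "Y : P" using f(2) by auto
 then have "through x f" using f by (rule PD)
 then show ?thesis using f(2) by (rule throughE)
qed

text \<open>A compact object is a retract of an object of a small set \<open>F\<close>, because its identity factors through one;
 an object has only a set of idempotents, so there is only a set of retracts.\<close>

lemma skeleton_small: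
 assumes B: "is_skeleton C (compact_objects U C) B"
 shows "small U B"
proof -
 obtain F where F: "small U F" "stable F" "loc U C F = ob" "!!x. x : F ==> finitary x" "\<exists>z\<in>F. is_zero C z"
  "!!f g h. (f, g, h) : tri ==> dom f : F ==> cod f : F ==> \<exists>y\<in>F. isomorphic C (cod g) y"
  using skeletal_generators by blast
 have Bc: "x : compact_objects U C" if "x : B" for x using B that unfolding is_skeleton_def by blast
 have "\<exists>y s r. y : F & s : Hom C x y & r : Hom C y x & r\<cdot>s = ide x" if "x : B" for x
 proof -
  have x: "finitary x" using compact_finitary[OF Bc[OF that]] .
  have "\<exists>y\<in>F. \<exists>a\<in>Hom C x y. \<exists>b\<in>Hom C y x. ide x = b\<cdot>a"
   by (rule finitary_factors[OF F(2,3,4,5,6) x]) (use finitary_ob[OF x] in auto)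
  then show ?thesis by metis
 qed
 then obtain y s r where r: "!!x. x : B ==> y x : F" "!!x. x : B ==> s x : Hom C x (y x)"
  "!!x. x : B ==> r x : Hom C (y x) x" "!!x. x : B ==> r x\<cdot>s x = ide x" by metis
 text \<open>A retract is determined up to isomorphism by the ambient object and the idempotent.\<close>
 have "inj_on (%x. (y x, s x\<cdot>r x)) B"
 proof (rule inj_onI)
  fix x x' assume x: "x : B" "x' : B" "(y x, s x\<cdot>r x) = (y x', s x'\<cdot>r x')"
  then have e: "y x = y x'" "s x\<cdot>r x = s x'\<cdot>r x'" by simp_all
  note R = r(2-4)[OF x(1)] r(2-4)[OF x(2)]
  have o: "x : ob" "x' : ob" using Bc x(1,2) by (auto simp: compact_objects_def)
  have "isomorphic C x x'"
  proof (rule isomorphicI[of "r x'\<cdot>s x" _ _ "r x\<cdot>s x'"])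
   have "r x\<cdot>s x'\<cdot>(r x'\<cdot>s x) = r x\<cdot>(s x\<cdot>r x\<cdot>s x)" unfolding e(2) using R e(1) by simp
   also have "... = r x\<cdot>s x\<cdot>(r x\<cdot>s x)" using R(1,2) by simp
   finally show "r x\<cdot>s x'\<cdot>(r x'\<cdot>s x) = ide x" unfolding R(3) using o by simp
   have "r x'\<cdot>s x\<cdot>(r x\<cdot>s x') = r x'\<cdot>(s x'\<cdot>r x'\<cdot>s x')" unfolding e(2)[symmetric] using R e(1) by simp
   also have "... = r x'\<cdot>s x'\<cdot>(r x'\<cdot>s x')" using R(4,5) by simp
   finally show "r x'\<cdot>s x\<cdot>(r x\<cdot>s x') = ide x'" unfolding R(6) using o by simp
  qed (use R e(1) in auto)
  moreover have "\<exists>!y. y : B & isomorphic C x y" using B Bc[OF x(1)] unfolding is_skeleton_def by blast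
  ultimately show "x = x'" using isomorphic_refl[OF o(1)] x(1,2) by blast
 qed
 moreover have "(%x. (y x, s x\<cdot>r x)) ` B <= (SIGMA w:F. Hom C w w)" using r by auto
 moreover have "small U (SIGMA w:F. Hom C w w)"
  using F(1) loc_small stableD(1)[OF F(2)] unfolding locally_small_def by (intro small_Sigma) auto
 ultimately show ?thesis by (rule small_inj_on)
qed

lemma skeleton_exists: "\<exists>B. is_skeleton C (compact_objects U C) B"
proof -
 let ?A = "compact_objects U C"
 have Ao: "x : ob" if "x : ?A" for x using that by (simp add: compact_objects_def)
 define rep where "rep x = (SOME y. y : ?A & isomorphic C x y)" for x
 have rep: "rep x : ?A & isomorphic C x (rep x)" if "x : ?A" for x
  unfolding rep_def by (rule someI[of _ x]) (use that Ao in simp)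
 have eq: "rep x = rep y" if "isomorphic C x y" for x y
 proof -
  have "(%z. z : ?A & isomorphic C x z) = (%z. z : ?A & isomorphic C y z)"
   using that isomorphic_sym isomorphic_trans by blast
  then show ?thesis unfolding rep_def by simp
 qed
 have "is_skeleton C ?A (rep ` ?A)"
  unfolding is_skeleton_def
 proof (intro conjI ballI)
  show "rep ` ?A <= ?A" using rep by blast
  fix x assume x: "x : ?A"
  show "\<exists>!y. y : rep ` ?A & isomorphic C x y"
  proof (rule ex1I[of _ "rep x"])
   show "rep x : rep ` ?A & isomorphic C x (rep x)" using rep x by blast
   fix y assume y: "y : rep ` ?A & isomorphic C x y"
   then obtain w where w: "w : ?A" "y = rep w" by blast
   have "isomorphic C x w"
    using y w rep[OF w(1)] isomorphic_sym[of w y] isomorphic_trans[of x y w] by simp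
   then show "y = rep x" using eq w by simp
  qed
 qed
 then show ?thesis by blast
qed

end


section \<open>Brown representability\<close>

context cg_category
begin

lemma coproduct_exists:
 assumes "small U I" "!!i. i : I ==> X i : ob"
 obtains P io where "is_coproduct C I X P io"
proof -
 obtain I' :: "'u set" and e where e: "small U I'" "I' <= U" "bij_betw e I' I"
  using small_reindex[OF assms(1)] .
 have "(X \<circ> e) ` I' <= ob" using assms(2) e(3) by (auto simp: bij_betw_def)
 then obtain P io where P: "is_coproduct C I' (X \<circ> e) P io"
  using coproducts e(1) unfolding has_small_coproducts_def by blast
 have "is_coproduct C I ((X \<circ> e) \<circ> inv_into I' e) P (io \<circ> inv_into I' e)"
  by (rule is_coproduct_reindex[OF P bij_betw_inv_into[OF e(3)]])
 moreover have "((X \<circ> e) \<circ> inv_into I' e) i = X i" if "i : I" for i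
  using that e(3) by (auto simp: bij_betw_def f_inv_into_f)
 ultimately have "is_coproduct C I X P (io \<circ> inv_into I' e)" by (simp add: is_coproduct_def)
 then show thesis by (rule that)
qed

text \<open>
 The mapping telescope of a sequence. The map \<open>t = 1 - s\<close> is injective on maps from finitary
 objects, so such maps into the telescope lift to the coproduct and hence factor through a stage.
\<close>

lemma telescope_injective:
 fixes X :: "nat => 'o"
 assumes P: "is_coproduct C UNIV X P io" and i: "!!n. i n : Hom C (X n) (X (Suc n))"
  and s: "s : Hom C P P" "!!n. s\<cdot>io n = io (Suc n)\<cdot>i n"
  and y: "finitary y" and h: "h : Hom C y P" "s\<cdot>h = h"
 shows "h = zro y P"
proof -
 note D = is_coproductD[OF P]
 have kill: "e\<cdot>h = zro y P" if "e : Hom C P P" "!!m. n \<le> m ==> e\<cdot>io m = zro (X m) P" for e n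
  using that
 proof (induction n arbitrary: e)
  case 0
  have "e = zro P P" by (rule is_coproduct_ext[OF P, of _ P]) (use 0 D in auto)
  then show ?case using h(1) D by simp
 next
  case (Suc n)
  have "e\<cdot>s\<cdot>h = zro y P"
  proof (rule Suc.IH)
   show "e\<cdot>s : Hom C P P" using Suc.prems(1) s(1) by simp
   fix m assume m: "n \<le> m"
   have "e\<cdot>s\<cdot>io m = e\<cdot>(s\<cdot>io m)" using Suc.prems(1) s(1) D by simp
   also have "... = e\<cdot>io (Suc m)\<cdot>i m" unfolding s(2) using Suc.prems(1) D i[of m] by simp
   also have "... = zro (X m) P" using Suc.prems(2)[of "Suc m"] m D i[of m] by simp
   finally show "e\<cdot>s\<cdot>io m = zro (X m) P" .
  qed
  then show ?case using h s(1) Suc.prems(1) by simp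
 qed
 obtain J where J: "finite_support J io h"
  by (rule finitaryD[OF y small_countable P h(1)]) auto
 obtain n where n: "J <= {..<n}" using finite_supportD(1)[OF J] finite_nat_iff_bounded by blast
 obtain e where e: "e : Hom C P P" "!!m. m : UNIV ==> e\<cdot>io m = (if m : {..<n} then io m else zro (X m) P)"
  using coproduct_select[OF P] by blast
 have "e\<cdot>h = ide P\<cdot>h"
  by (rule finite_supportD(2)[OF J, of _ P]) (use e h n D in auto)
 then show ?thesis using kill[OF e(1), of n] e(2) h D by simp
qed

lemma telescope:
 fixes X :: "nat => 'o"
 assumes i: "!!n. i n : Hom C (X n) (X (Suc n))"
 obtains P io t q r where "is_coproduct C UNIV X P io" "(t, q, r) : tri" "t : Hom C P P"
  "!!n. t\<cdot>io n = sub (io n) (io (Suc n)\<cdot>i n)"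
  "!!n. q\<cdot>io n = q\<cdot>(io (Suc n)\<cdot>i n)"
  "!!x f. finitary x ==> f : Hom C x (cod q) ==> \<exists>n. \<exists>f'\<in>Hom C x (X n). f = q\<cdot>(io n\<cdot>f')"
proof -
 have Xo: "X n : ob" for n using i[of n] ob_dom[of "i n"] by simp
 obtain P io where P: "is_coproduct C UNIV X P io"
  by (rule coproduct_exists[of "UNIV :: nat set" X]) (use Xo in \<open>auto intro: small_countable\<close>)
 note D = is_coproductD[OF P]
 obtain s where s: "s : Hom C P P" "!!n. s\<cdot>io n = io (Suc n)\<cdot>i n"
  using is_coproduct_map[OF P, of P "%n. io (Suc n)\<cdot>i n"] i D by auto
 define t where "t = sub (ide P) s"
 have t: "t : Hom C P P" using s(1) D by (simp add: t_def)
 have tio: "t\<cdot>io n = sub (io n) (io (Suc n)\<cdot>i n)" for n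
  using s(1) s(2)[of n] D by (simp add: t_def)
 obtain q r where tr: "(t, q, r) : tri" using tri_cone[of t] t by auto
 note T = triD[OF tr]
 have qio: "q\<cdot>io n = q\<cdot>(io (Suc n)\<cdot>i n)" for n
 proof (rule sub_eq_zro)
  have "sub (q\<cdot>io n) (q\<cdot>(io (Suc n)\<cdot>i n)) = q\<cdot>t\<cdot>io n" using tio[of n] T t D i[of n] by simp
  also have "... = zro (X n) (cod q)" using tri_cmp1[OF tr] T t D by simp
  finally show "sub (q\<cdot>io n) (q\<cdot>(io (Suc n)\<cdot>i n)) = zro (X n) (cod q)" .
 qed (use T t D i[of n] in auto)
 have fac: "\<exists>n. \<exists>f'\<in>Hom C x (X n). f = q\<cdot>(io n\<cdot>f')" if x: "finitary x" and f: "f : Hom C x (cod q)" for x f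
 proof -
  have xo: "x : ob" using finitary_ob[OF x] .
  obtain y th th' where y: "y : ob" "th : Hom C (shO y) x" "th' : Hom C x (shO y)"
   "th'\<cdot>th = ide (shO y)" "th\<cdot>th' = ide x" using unshift_ob[OF xo] .
  have fy: "finitary y"
   by (rule finitary_unsh[OF finitary_iso[OF x] y(1)]) (rule isomorphicI[OF y(3,2,5,4)])
  obtain h where h: "h : Hom C y P" "shM h = r\<cdot>(f\<cdot>th)"
   by (rule sh_full[of "r\<cdot>(f\<cdot>th)" y P]) (use T t f y D in auto)
  have "shM (t\<cdot>h) = shM t\<cdot>r\<cdot>(f\<cdot>th)" using h t T f y by simp
  also have "... = zro (shO y) (shO P)" unfolding tri_cmp3[OF tr] using T f y t D by simp
  finally have "t\<cdot>h = zro y P" by (rule sh_zro_iff) (use t h in auto)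
  then have "sub h (s\<cdot>h) = zro y P" using s(1) h D by (simp add: t_def)
  then have "h = s\<cdot>h" by (rule sub_eq_zro) (use s(1) h in auto)
  then have "h = zro y P" using telescope_injective[OF P i s fy h(1)] by simp
  then have "r\<cdot>(f\<cdot>th) = zro (shO y) (shO P)" using h(2) y(1) D by simp
  then have "r\<cdot>(f\<cdot>th)\<cdot>th' = zro x (shO P)" using y D by simp
  then have rf: "r\<cdot>f = zro x (cod r)" using T f y t by simp
  obtain g where g: "g : Hom C x P" "q\<cdot>g = f"
   by (rule tri_lift2[OF tr f rf]) (use T t in auto)
  obtain J where J: "finite_support J io g"
   by (rule finitaryD[OF x small_countable P g(1)]) auto
  obtain n where n: "J <= {..<n}" using finite_supportD(1)[OF J] finite_nat_iff_bounded by blast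
  define tr where "tr = (%m. rec_nat (ide (X m)) (%k a. i (m + k)\<cdot>a))"
  have tr0: "tr m 0 = ide (X m)" and trS: "tr m (Suc k) = i (m + k)\<cdot>tr m k" for m k
   by (simp_all add: tr_def)
  have tr: "tr m k : Hom C (X m) (X (m + k)) & q\<cdot>(io (m + k)\<cdot>tr m k) = q\<cdot>io m" for m k
  proof (induction k)
   case 0 then show ?case using Xo D tr0 by simp
  next
   case (Suc k)
   have "q\<cdot>(io (m + Suc k)\<cdot>tr m (Suc k)) = q\<cdot>(io (Suc (m + k))\<cdot>i (m + k))\<cdot>tr m k"
    using Suc trS[of m k] i[of "m + k"] T t D by simp
   also have "... = q\<cdot>(io (m + k)\<cdot>tr m k)" unfolding qio[symmetric] using Suc T t D by simp
   finally show ?case using Suc trS[of m k] i[of "m + k"] by simp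
  qed
  obtain \<kappa> where \<kappa>: "\<kappa> : Hom C P (X n)" "!!m. \<kappa>\<cdot>io m = (if m \<le> n then tr m (n - m) else zro (X m) (X n))"
  proof (rule is_coproduct_map[OF P Xo[of n], of "%m. if m \<le> n then tr m (n - m) else zro (X m) (X n)"])
   show "(if m \<le> n then tr m (n - m) else zro (X m) (X n)) : Hom C (X m) (X n)" for m
    using tr[of m "n - m"] Xo by auto
  qed (use that in auto)
  have "q\<cdot>(io n\<cdot>\<kappa>)\<cdot>g = q\<cdot>g"
  proof (rule finite_supportD(2)[OF J, of _ "cod q"])
   fix m assume "m : J"
   then have m: "m \<le> n" using n by auto
   have "q\<cdot>(io n\<cdot>\<kappa>)\<cdot>io m = q\<cdot>(io n\<cdot>(\<kappa>\<cdot>io m))" using T t D \<kappa>(1) by simp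
   also have "... = q\<cdot>io m" using \<kappa>(2)[of m] m tr[of m "n - m"] by simp
   finally show "q\<cdot>(io n\<cdot>\<kappa>)\<cdot>io m = q\<cdot>io m" .
  qed (use T t D \<kappa>(1) g in auto)
  then have "f = q\<cdot>(io n\<cdot>(\<kappa>\<cdot>g))" using g T t D \<kappa>(1) by simp
  moreover have "\<kappa>\<cdot>g : Hom C x (X n)" using g \<kappa>(1) by simp
  ultimately show ?thesis by blast
 qed
 show thesis by (rule that[OF P tr t tio qio fac])
qed

end

locale cohomological = cg_category U C
 for U :: "'u set" and C :: "('o, 'm, 'x) tricat_scheme" (structure) +
 fixes HG :: "'o => 'h monoid" and Hm :: "'m => 'h => 'h"
 assumes H_group: "x : Ob C ==> comm_group (HG x)"
  and H_map: "f : Arr C ==> a : carrier (HG (Cod C f)) ==> Hm f a : carrier (HG (Dom C f))"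
  and H_mult: "f : Arr C ==> a : carrier (HG (Cod C f)) ==> b : carrier (HG (Cod C f)) ==>
     Hm f (a \<otimes>\<^bsub>HG (Cod C f)\<^esub> b) = Hm f a \<otimes>\<^bsub>HG (Dom C f)\<^esub> Hm f b"
  and H_ide: "x : Ob C ==> a : carrier (HG x) ==> Hm (Ide C x) a = a"
  and H_cmp: "f : Arr C ==> g : Arr C ==> Cod C f = Dom C g ==> a : carrier (HG (Cod C g)) ==>
     Hm (g\<cdot>f) a = Hm f (Hm g a)"
  and H_pls: "f : Arr C ==> g : Arr C ==> Dom C g = Dom C f ==> Cod C g = Cod C f ==>
     a : carrier (HG (Cod C f)) ==> Hm (Pls C f g) a = Hm f a \<otimes>\<^bsub>HG (Dom C f)\<^esub> Hm g a"
  and H_exact: "(f, g, h) : Tri C ==> a : carrier (HG (Cod C f)) ==> Hm f a = \<one>\<^bsub>HG (Dom C f)\<^esub> ==>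
     \<exists>b\<in>carrier (HG (Cod C g)). Hm g b = a"
  and H_coproduct: "small U I ==> is_coproduct C (I :: 'u set) X P io ==> (!!i. i : I ==> c i : carrier (HG (X i))) ==>
     \<exists>b\<in>carrier (HG P). \<forall>i\<in>I. Hm (io i) b = c i"
  and H_coproduct_ext: "small U I ==> is_coproduct C (I :: 'u set) X P io ==> b : carrier (HG P) ==>
     b' : carrier (HG P) ==> (!!i. i : I ==> Hm (io i) b = Hm (io i) b') ==> b = b'"
  and H_small: "x : Ob C ==> small U (carrier (HG x))"
begin

abbreviation H :: "'o => 'h set" where "H x \<equiv> carrier (HG x)"

lemma H_one: "x : ob ==> \<one>\<^bsub>HG x\<^esub> : H x"
 using H_group[of x] by (simp add: monoid.one_closed comm_group_def comm_monoid_def)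

lemma H_inv: "x : ob ==> a : H x ==> inv\<^bsub>HG x\<^esub> a : H x & a \<otimes>\<^bsub>HG x\<^esub> inv\<^bsub>HG x\<^esub> a = \<one>\<^bsub>HG x\<^esub>"
 using H_group[of x] by (simp add: comm_group_def group.inv_closed group.r_inv)

lemma H_idem: "x : ob ==> a : H x ==> a \<otimes>\<^bsub>HG x\<^esub> a = a ==> a = \<one>\<^bsub>HG x\<^esub>"
 using H_group[of x] group.l_cancel_one[of "HG x" a a] by (simp add: comm_group_def)

lemma H_map_one:
 assumes "f : arr" shows "Hm f \<one>\<^bsub>HG (cod f)\<^esub> = \<one>\<^bsub>HG (dom f)\<^esub>"
proof (rule H_idem)
 interpret comm_group "HG (cod f)" using H_group assms by simp
 show "Hm f \<one>\<^bsub>HG (cod f)\<^esub> \<otimes>\<^bsub>HG (dom f)\<^esub> Hm f \<one>\<^bsub>HG (cod f)\<^esub> = Hm f \<one>\<^bsub>HG (cod f)\<^esub>"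
  using H_mult[OF assms one_closed one_closed] by simp
qed (use assms H_map H_one in auto)

lemma H_zro:
 assumes "x : ob" "y : ob" "a : H y" shows "Hm (zro x y) a = \<one>\<^bsub>HG x\<^esub>"
proof (rule H_idem)
 show "Hm (zro x y) a \<otimes>\<^bsub>HG x\<^esub> Hm (zro x y) a = Hm (zro x y) a"
  using H_pls[of "zro x y" "zro x y" a] assms by simp
qed (use assms H_map[of "zro x y" a] in auto)

lemma H_neg:
 assumes "f : arr" "a : H (cod f)" shows "Hm (neg C f) a = inv\<^bsub>HG (dom f)\<^esub> Hm f a"
proof -
 interpret comm_group "HG (dom f)" using H_group assms by simp
 have "Hm (neg C f) a \<otimes>\<^bsub>HG (dom f)\<^esub> Hm f a = Hm (pls (neg C f) f) a"
  using H_pls[of "neg C f" f a] assms by simp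
 also have "... = \<one>\<^bsub>HG (dom f)\<^esub>" using assms H_zro by simp
 finally show ?thesis using inv_equality H_map[of f a] H_map[of "neg C f" a] assms by simp
qed

lemma H_sub_one:
 assumes "f : arr" "g : arr" "dom g = dom f" "cod g = cod f" "a : H (cod f)" "Hm f a = Hm g a"
 shows "Hm (sub f g) a = \<one>\<^bsub>HG (dom f)\<^esub>"
 using H_pls[of f "neg C g" a] H_neg[of g a] H_inv[of "dom f" "Hm g a"] H_map[of g a] assms by simp

lemma H_exact2:
 assumes "(f, g, h) : tri" "a : H (cod g)" "Hm g a = \<one>\<^bsub>HG (cod f)\<^esub>"
 shows "\<exists>b\<in>H (shO (dom f)). Hm h b = a"
 using H_exact[OF tri_rot[OF assms(1)]] assms triD[OF assms(1)] by simp

lemma H_exact3: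
 assumes t: "(f, g, h) : tri" and a: "a : H (shO (dom f))" "Hm h a = \<one>\<^bsub>HG (cod g)\<^esub>"
 shows "\<exists>b\<in>H (shO (cod f)). Hm (shM f) b = a"
proof -
 note D = triD[OF t]
 obtain b where b: "b : H (shO (cod f))" "Hm (neg C (shM f)) b = a"
  using H_exact2[OF tri_rot[OF t], of a] a D by auto
 let ?y = "shO (cod f)" and ?x = "shO (dom f)"
 interpret x: comm_group "HG ?x" using H_group D by simp
 have b': "inv\<^bsub>HG ?y\<^esub> b : H ?y" "b \<otimes>\<^bsub>HG ?y\<^esub> inv\<^bsub>HG ?y\<^esub> b = \<one>\<^bsub>HG ?y\<^esub>" using H_inv[of ?y b] b(1) D by auto
 have "Hm (shM f) b \<otimes>\<^bsub>HG ?x\<^esub> Hm (shM f) (inv\<^bsub>HG ?y\<^esub> b) = \<one>\<^bsub>HG ?x\<^esub>"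
  using H_mult[of "shM f" b "inv\<^bsub>HG ?y\<^esub> b"] b' b(1) D H_map_one[of "shM f"] by simp
 then have "Hm (shM f) (inv\<^bsub>HG ?y\<^esub> b) = inv\<^bsub>HG ?x\<^esub> Hm (shM f) b"
  using x.inv_equality[of "Hm (shM f) (inv\<^bsub>HG ?y\<^esub> b)" "Hm (shM f) b"]
   x.m_comm H_map[of "shM f"] b' b(1) D by simp
 also have "... = a" using b(2) H_neg[of "shM f" b] b(1) D by simp
 finally show ?thesis using b' by blast
qed

lemma H_coproduct':
 assumes I: "small U I" and P: "is_coproduct C I X P io" and a: "!!i. i : I ==> a i : H (X i)"
 obtains b where "b : H P" "!!i. i : I ==> Hm (io i) b = a i"
proof -
 obtain I' :: "'u set" and e where e: "small U I'" "I' <= U" "bij_betw e I' I"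
  using small_reindex[OF I] .
 obtain b where b: "b : H P" "\<forall>i\<in>I'. Hm ((io \<circ> e) i) b = (a \<circ> e) i"
  using H_coproduct[OF e(1) is_coproduct_reindex[OF P e(3)], of "a \<circ> e"] a e(3) by (auto simp: bij_betw_def)
 have "Hm (io i) b = a i" if "i : I" for i
  using b(2)[rule_format, of "inv_into I' e i"] that e(3) by (auto simp: bij_betw_def inv_into_into f_inv_into_f)
 with b(1) that show thesis by blast
qed

lemma H_coproduct_ext':
 assumes I: "small U I" and P: "is_coproduct C I X P io" and b: "b : H P" "b' : H P"
  "!!i. i : I ==> Hm (io i) b = Hm (io i) b'"
 shows "b = b'"
proof -
 obtain I' :: "'u set" and e where e: "small U I'" "I' <= U" "bij_betw e I' I"
  using small_reindex[OF I] .
 show ?thesis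
  by (rule H_coproduct_ext[OF e(1) is_coproduct_reindex[OF P e(3)] b(1,2)])
   (use b(3) e(3) in \<open>auto simp: bij_betw_def\<close>)
qed

text \<open>
 An element of \<open>H X\<close> is enlarged step by step: first all elements of \<open>H\<close> at generators are hit, then
 the unwanted kernel is killed. The telescope of the steps represents \<open>H\<close> on the generators, and
 devissage extends this to all objects.
\<close>

theorem representable:
 obtains Y al where "Y : ob" "al : H Y"
  "!!B a. B : ob ==> a : H B ==> \<exists>f\<in>Hom C B Y. Hm f al = a"
  "!!B f f'. f : Hom C B Y ==> f' : Hom C B Y ==> Hm f al = Hm f' al ==> f = f'"
proof -
 obtain F where F: "small U F" "stable F" "loc U C F = ob" "!!x. x : F ==> finitary x" "\<exists>z\<in>F. is_zero C z"
  "!!f g h. (f, g, h) : tri ==> dom f : F ==> cod f : F ==> \<exists>y\<in>F. isomorphic C (cod g) y"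
  using skeletal_generators by blast
 have Fo: "x : ob" if "x : F" for x using F(4) finitary_ob that by blast
 define good where "good s = (fst s : ob & snd s : H (fst s))" for s :: "'o \<times> 'h"
 define step where "step s s' = (\<exists>i\<in>Hom C (fst s) (fst s'). Hm i (snd s') = snd s &
   (\<forall>g\<in>F. \<forall>f\<in>Hom C g (fst s). Hm f (snd s) = \<one>\<^bsub>HG g\<^esub> --> i\<cdot>f = zro g (fst s')))" for s s' :: "'o \<times> 'h"
 \<comment> \<open>The coproduct of copies of the generators, one for each element of \<open>H\<close> at a generator.\<close>
 have start: "\<exists>s. good s & (\<forall>g\<in>F. \<forall>a\<in>H g. \<exists>f\<in>Hom C g (fst s). Hm f (snd s) = a)"
 proof -
  have sm: "small U (Sigma F H)" by (rule small_Sigma[OF F(1)]) (use H_small Fo in auto)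
  obtain P io where P: "is_coproduct C (Sigma F H) fst P io"
   by (rule coproduct_exists[OF sm, of fst]) (use Fo in auto)
  obtain b where b: "b : H P" "!!i. i : Sigma F H ==> Hm (io i) b = snd i"
   by (rule H_coproduct'[OF sm P, of snd]) auto
  note D = is_coproductD[OF P]
  have "\<exists>f\<in>Hom C g P. Hm f b = a" if "g : F" "a : H g" for g a
   using b(2)[of "(g, a)"] D(3-5)[of "(g, a)"] that by (intro bexI[of _ "io (g, a)"]) auto
  then show ?thesis using b(1) D(1) unfolding good_def by (intro exI[of _ "(P, b)"]) simp
 qed
 \<comment> \<open>The cone of a map that hits all of the kernel at the generators; the element extends over it
  because \<open>H\<close> is exact.\<close>
 have next': "\<exists>s'. good s' & step s s'" if s: "good s" for s
 proof -
  obtain X al where X: "s = (X, al)" "X : ob" "al : H X" using s unfolding good_def by (cases s) auto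
  let ?K = "{p : Sigma F (%g. Hom C g X). Hm (snd p) al = \<one>\<^bsub>HG (fst p)\<^esub>}"
  have sm: "small U ?K"
  proof (rule small_subset)
   show "small U (Sigma F (%g. Hom C g X))"
    using loc_small Fo X(2) unfolding locally_small_def by (intro small_Sigma[OF F(1)]) blast
  qed blast
  obtain P io where P: "is_coproduct C ?K fst P io"
   by (rule coproduct_exists[OF sm, of fst]) (use Fo in auto)
  note D = is_coproductD[OF P]
  obtain \<phi> where \<phi>: "\<phi> : Hom C P X" "!!p. p : ?K ==> \<phi>\<cdot>io p = snd p"
   by (rule is_coproduct_map[OF P X(2), of snd]) auto
  have "Hm \<phi> al = \<one>\<^bsub>HG P\<^esub>"
  proof (rule H_coproduct_ext'[OF sm P])
   show "Hm \<phi> al : H P" using H_map[of \<phi> al] \<phi>(1) X by simp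
   show "\<one>\<^bsub>HG P\<^esub> : H P" using H_one D by simp
   fix p assume p: "p : ?K"
   have "Hm (io p) (Hm \<phi> al) = Hm (snd p) al"
    using H_cmp[of "io p" \<phi> al] \<phi>(1) \<phi>(2)[OF p] D(3,5)[OF p] X by simp
   also have "... = Hm (io p) \<one>\<^bsub>HG P\<^esub>" using p H_map_one[of "io p"] D(3-5)[OF p] by auto
   finally show "Hm (io p) (Hm \<phi> al) = Hm (io p) \<one>\<^bsub>HG P\<^esub>" .
  qed
  moreover obtain i h where t: "(\<phi>, i, h) : tri" using tri_cone[of \<phi>] \<phi>(1) by auto
  note T = triD[OF t]
  ultimately obtain al' where al': "al' : H (cod i)" "Hm i al' = al"
   using H_exact[OF t, of al] \<phi>(1) X by auto
  have kill: "i\<cdot>f = zro g (cod i)" if "g : F" "f : Hom C g X" "Hm f al = \<one>\<^bsub>HG g\<^esub>" for g f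
  proof -
   have p: "(g, f) : ?K" using that by auto
   have "i\<cdot>f = i\<cdot>\<phi>\<cdot>io (g, f)" using \<phi>(1) \<phi>(2)[OF p] T D(3,5)[OF p] by simp
   also have "... = zro g (cod i)" using tri_cmp1[OF t] D(3-5)[OF p] \<phi>(1) T by simp
   finally show ?thesis .
  qed
  have "step s (cod i, al')"
   unfolding step_def X(1) using T \<phi>(1) al'(2) kill by (intro bexI[of _ i]) auto
  moreover have "good (cod i, al')" using T al' by (simp add: good_def)
  ultimately show ?thesis by blast
 qed
 obtain s0 where s0: "good s0" "\<forall>g\<in>F. \<forall>a\<in>H g. \<exists>f\<in>Hom C g (fst s0). Hm f (snd s0) = a" using start by blast
 obtain s where s: "s 0 = s0" "!!n. good (s n)" "!!n. step (s n) (s (Suc n))"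
 proof -
  have "\<exists>f. \<forall>n::nat. (good (f n) & (n = 0 --> f n = s0)) & step (f n) (f (Suc n))"
  proof (rule dependent_nat_choice)
   show "\<exists>x. good x & ((0::nat) = 0 --> x = s0)" using s0(1) by blast
   show "\<exists>y. (good y & (Suc n = 0 --> y = s0)) & step x y" if "good x & (n = 0 --> x = s0)" for x n
    using next' that by blast
  qed
  then show thesis using that by blast
 qed
 define X where "X n = fst (s n)" for n
 define aln where "aln n = snd (s n)" for n
 have Xn: "X n : ob" "aln n : H (X n)" for n using s(2) by (auto simp: X_def aln_def good_def)
 have "\<exists>i. i : Hom C (X n) (X (Suc n)) & Hm i (aln (Suc n)) = aln n &
   (\<forall>g\<in>F. \<forall>f\<in>Hom C g (X n). Hm f (aln n) = \<one>\<^bsub>HG g\<^esub> --> i\<cdot>f = zro g (X (Suc n)))" for n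
  using s(3)[of n] unfolding step_def X_def aln_def by blast
 then obtain i where i: "!!n. i n : Hom C (X n) (X (Suc n))" "!!n. Hm (i n) (aln (Suc n)) = aln n"
   "!!n g f. g : F ==> f : Hom C g (X n) ==> Hm f (aln n) = \<one>\<^bsub>HG g\<^esub> ==> i n\<cdot>f = zro g (X (Suc n))"
  by metis
 obtain P io t q r where tel: "is_coproduct C UNIV X P io" "(t, q, r) : tri" "t : Hom C P P"
  "!!n. t\<cdot>io n = sub (io n) (io (Suc n)\<cdot>i n)" "!!n. q\<cdot>io n = q\<cdot>(io (Suc n)\<cdot>i n)"
  "!!x f. finitary x ==> f : Hom C x (cod q) ==> \<exists>n. \<exists>f'\<in>Hom C x (X n). f = q\<cdot>(io n\<cdot>f')"
  using telescope[where i = i and X = X, OF i(1)] by blast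
 note D = is_coproductD[OF tel(1)] and T = triD[OF tel(2)]
 have smN: "small U (UNIV :: nat set)" by (rule small_countable) simp
 obtain \<beta> where \<beta>: "\<beta> : H P" "!!n. Hm (io n) \<beta> = aln n"
  using H_coproduct'[OF smN tel(1), of aln] Xn(2) by auto
 have "Hm t \<beta> = \<one>\<^bsub>HG P\<^esub>"
 proof (rule H_coproduct_ext'[OF smN tel(1)])
  show "Hm t \<beta> : H P" using H_map[of t \<beta>] tel(3) \<beta>(1) by simp
  show "\<one>\<^bsub>HG P\<^esub> : H P" using H_one D by simp
  fix n
  have "Hm (io n) (Hm t \<beta>) = Hm (sub (io n) (io (Suc n)\<cdot>i n)) \<beta>"
   using H_cmp[of "io n" t \<beta>] tel(3) tel(4)[of n] D \<beta>(1) by simp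
  also have "... = \<one>\<^bsub>HG (X n)\<^esub>"
   using H_sub_one[of "io n" "io (Suc n)\<cdot>i n" \<beta>] D i(1)[of n] \<beta> i(2)[of n] H_cmp[of "i n" "io (Suc n)" \<beta>] by simp
  also have "... = Hm (io n) \<one>\<^bsub>HG P\<^esub>" using H_map_one[of "io n"] D by simp
  finally show "Hm (io n) (Hm t \<beta>) = Hm (io n) \<one>\<^bsub>HG P\<^esub>" .
 qed
 then obtain al where al: "al : H (cod q)" "Hm q al = \<beta>"
  using H_exact[OF tel(2), of \<beta>] \<beta>(1) tel(3) by auto
 let ?Y = "cod q"
 have Y: "?Y : ob" using T by simp
 have qio: "q\<cdot>(io n\<cdot>f) : Hom C x ?Y" "Hm (q\<cdot>(io n\<cdot>f)) al = Hm f (aln n)" if "f : Hom C x (X n)" for f n x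
  using that H_cmp[of "io n\<cdot>f" q al] H_cmp[of f "io n" \<beta>] T D tel(3) al \<beta> by simp_all
 define Good where "Good = {B : ob. (\<forall>f\<in>Hom C B ?Y. Hm f al = \<one>\<^bsub>HG B\<^esub> --> f = zro B ?Y) &
   (\<forall>a\<in>H B. \<exists>f\<in>Hom C B ?Y. Hm f al = a)}"
 have GoodI: "B : Good" if "B : ob" "!!f. f : Hom C B ?Y ==> Hm f al = \<one>\<^bsub>HG B\<^esub> ==> f = zro B ?Y"
   "!!a. a : H B ==> \<exists>f\<in>Hom C B ?Y. Hm f al = a" for B
  using that unfolding Good_def by blast
 have GoodD: "B : ob" "f : Hom C B ?Y ==> Hm f al = \<one>\<^bsub>HG B\<^esub> ==> f = zro B ?Y"
   "a : H B ==> \<exists>f\<in>Hom C B ?Y. Hm f al = a" if "B : Good" for B f a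
  using that unfolding Good_def by blast+
 have FG: "g : Good" if g: "g : F" for g
 proof (rule GoodI)
  show go: "g : ob" using Fo g .
  fix f assume f: "f : Hom C g ?Y" "Hm f al = \<one>\<^bsub>HG g\<^esub>"
  obtain n f' where f': "f' : Hom C g (X n)" "f = q\<cdot>(io n\<cdot>f')" using tel(6)[OF F(4)[OF g] f(1)] by blast
  have "Hm f' (aln n) = \<one>\<^bsub>HG g\<^esub>" using qio(2)[OF f'(1)] f(2) f'(2) by simp
  then have kill: "i n\<cdot>f' = zro g (X (Suc n))" using i(3)[OF g f'(1)] by simp
  have "f = q\<cdot>io n\<cdot>f'" unfolding f'(2) using f'(1) T D tel(3) by simp
  also have "... = q\<cdot>(io (Suc n)\<cdot>(i n\<cdot>f'))" unfolding tel(5) using f'(1) T D tel(3) i(1)[of n] by simp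
  also have "... = zro g ?Y" unfolding kill using T D tel(3) go by simp
  finally show "f = zro g ?Y" .
 next
  fix a assume a: "a : H g"
  obtain f where f: "f : Hom C g (X 0)" "Hm f (aln 0) = a"
   using s0(2) g a s(1) unfolding X_def aln_def by blast
  show "\<exists>f\<in>Hom C g ?Y. Hm f al = a" using qio[OF f(1)] f(2) by blast
 qed
 have all: "B : Good" if B: "B : ob" for B
 proof (rule devissage[where G = F, OF _ _ F(2) _ subset_refl F(3) B])
  show "F <= Good" using FG by blast
 next
  fix f g h assume t: "(f, g, h) : tri" and G: "dom f : Good" "cod f : Good"
   "shO (dom f) : Good" "shO (cod f) : Good"
  note E = triD[OF t]
  show "cod g : Good"
  proof (rule GoodI)
   show "cod g : ob" using E by simp
   fix m assume m: "m : Hom C (cod g) ?Y" "Hm m al = \<one>\<^bsub>HG (cod g)\<^esub>"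
   have "Hm (m\<cdot>g) al = \<one>\<^bsub>HG (cod f)\<^esub>" using H_cmp[of g m al] m E al H_map_one[of g] by simp
   then have mg: "m\<cdot>g = zro (cod f) ?Y" by (intro GoodD(2)[OF G(2)]) (use m E in auto)
   obtain k where k: "k : Hom C (shO (dom f)) ?Y" "k\<cdot>h = m" by (rule tri_ext2[OF t m(1) mg])
   have "Hm h (Hm k al) = \<one>\<^bsub>HG (cod g)\<^esub>" using H_cmp[of h k al] k E al m by simp
   then obtain b where b: "b : H (shO (cod f))" "Hm (shM f) b = Hm k al"
    using H_exact3[OF t, of "Hm k al"] H_map[of k al] k al by auto
   obtain l where l: "l : Hom C (shO (cod f)) ?Y" "Hm l al = b" using GoodD(3)[OF G(4) b(1)] by blast
   have "Hm (l\<cdot>shM f) al = Hm k al" using H_cmp[of "shM f" l al] l E al b by simp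
   then have "Hm (sub k (l\<cdot>shM f)) al = \<one>\<^bsub>HG (shO (dom f))\<^esub>"
    using H_sub_one[of k "l\<cdot>shM f" al] k l E al by simp
   then have "sub k (l\<cdot>shM f) = zro (shO (dom f)) ?Y"
    by (intro GoodD(2)[OF G(3)]) (use k l E in auto)
   then have "k = l\<cdot>shM f" by (rule sub_eq_zro) (use k l E in auto)
   then have "m = l\<cdot>(shM f\<cdot>h)" using k l E by simp
   then show "m = zro (cod g) ?Y" using tri_cmp3[OF t] l E by simp
  next
   fix c assume c: "c : H (cod g)"
   have gc: "Hm g c : H (cod f)" using H_map[of g c] c E by simp
   obtain m where m: "m : Hom C (cod f) ?Y" "Hm m al = Hm g c" using GoodD(3)[OF G(2) gc] by blast
   have "Hm (m\<cdot>f) al = Hm (g\<cdot>f) c" using H_cmp[of f m al] H_cmp[of f g c] m c E al by simp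
   also have "... = \<one>\<^bsub>HG (dom f)\<^esub>" using tri_cmp1[OF t] H_zro[of "dom f" "cod g" c] c E by simp
   finally have "m\<cdot>f = zro (dom f) ?Y" by (intro GoodD(2)[OF G(1)]) (use m E in auto)
   then obtain m' where m': "m' : Hom C (cod g) ?Y" "m'\<cdot>g = m" by (rule tri_ext[OF t m(1)])
   interpret z: comm_group "HG (cod g)" using H_group E by simp
   interpret y: comm_group "HG (cod f)" using H_group E by simp
   have m'al: "Hm m' al : H (cod g)" using H_map[of m' al] m' al by simp
   let ?c = "c \<otimes>\<^bsub>HG (cod g)\<^esub> inv\<^bsub>HG (cod g)\<^esub> Hm m' al"
   have "Hm g (Hm m' al) = Hm g c" using H_cmp[of g m' al] m m' E al by simp
   moreover have "inv\<^bsub>HG (cod g)\<^esub> Hm m' al = Hm (neg C m') al" using H_neg[of m' al] m' al by simp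
   moreover have "Hm g (Hm (neg C m') al) = inv\<^bsub>HG (cod f)\<^esub> Hm g (Hm m' al)"
   proof -
    have "Hm g (Hm (neg C m') al) = Hm (neg C (m'\<cdot>g)) al"
     using H_cmp[of g "neg C m'" al] m'(1) E al(1) by simp
    also have "... = inv\<^bsub>HG (cod f)\<^esub> Hm (m'\<cdot>g) al"
     using H_neg[of "m'\<cdot>g" al] m'(1) E al(1) by simp
    also have "Hm (m'\<cdot>g) al = Hm g (Hm m' al)" using H_cmp[of g m' al] m'(1) E al(1) by simp
    finally show ?thesis .
   qed
   ultimately have "Hm g ?c = \<one>\<^bsub>HG (cod f)\<^esub>"
    using H_mult[of g c "inv\<^bsub>HG (cod g)\<^esub> Hm m' al"] H_map[of "neg C m'" al] m'(1) al(1) c m'al E gc by simp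
   then obtain b where b: "b : H (shO (dom f))" "Hm h b = ?c"
    using H_exact2[OF t, of ?c] c m'al by auto
   obtain k where k: "k : Hom C (shO (dom f)) ?Y" "Hm k al = b" using GoodD(3)[OF G(3) b(1)] by blast
   have "Hm (pls (k\<cdot>h) m') al = ?c \<otimes>\<^bsub>HG (cod g)\<^esub> Hm m' al"
    using H_pls[of "k\<cdot>h" m' al] H_cmp[of h k al] k m' E al b by simp
   also have "... = c" using c m'al by (simp add: z.m_assoc)
   finally show "\<exists>f\<in>Hom C (cod g) ?Y. Hm f al = c"
    using k m' E by (intro bexI[of _ "pls (k\<cdot>h) m'"]) auto
  qed
 next
  fix I :: "'u set" and X Q \<kappa>
  assume I: "small U I" and XG: "X ` I <= Good" and Q: "is_coproduct C I X Q \<kappa>"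
  note E = is_coproductD[OF Q]
  have XG': "X i : Good" if "i : I" for i using XG that by blast
  show "Q : Good"
  proof (rule GoodI[OF E(1)])
   fix f assume f: "f : Hom C Q ?Y" "Hm f al = \<one>\<^bsub>HG Q\<^esub>"
   show "f = zro Q ?Y"
   proof (rule is_coproduct_ext[OF Q f(1)])
    fix i assume i: "i : I"
    have "Hm (f\<cdot>\<kappa> i) al = \<one>\<^bsub>HG (X i)\<^esub>"
     using H_cmp[of "\<kappa> i" f al] H_map_one[of "\<kappa> i"] f E i al by simp
    then have "f\<cdot>\<kappa> i = zro (X i) ?Y" by (intro GoodD(2)[OF XG'[OF i]]) (use f E i in auto)
    then show "f\<cdot>\<kappa> i = zro Q ?Y\<cdot>\<kappa> i" using E i Y by simp
   qed (use E Y in auto)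
  next
   fix a assume a: "a : H Q"
   have "\<exists>f. f : Hom C (X i) ?Y & Hm f al = Hm (\<kappa> i) a" if i: "i : I" for i
    using GoodD(3)[OF XG'[OF i], of "Hm (\<kappa> i) a"] H_map[of "\<kappa> i" a] E i a by auto
   then obtain f where f: "!!i. i : I ==> f i : Hom C (X i) ?Y" "!!i. i : I ==> Hm (f i) al = Hm (\<kappa> i) a"
    by metis
   obtain g where g: "g : Hom C Q ?Y" "!!i. i : I ==> g\<cdot>\<kappa> i = f i"
    by (rule is_coproduct_map[OF Q Y f(1)]) auto
   have "Hm g al = a"
   proof (rule H_coproduct_ext[OF I Q _ a])
    show "Hm g al : H Q" using H_map[of g al] g(1) al by simp
    fix i assume i: "i : I"
    show "Hm (\<kappa> i) (Hm g al) = Hm (\<kappa> i) a"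
     using H_cmp[of "\<kappa> i" g al] g(1) g(2)[OF i] f(2)[OF i] E i al by simp
   qed
   then show "\<exists>f\<in>Hom C Q ?Y. Hm f al = a" using g(1) by blast
  qed
 qed
 show thesis
 proof (rule that[OF Y al(1)])
  show "\<exists>f\<in>Hom C B ?Y. Hm f al = a" if "B : ob" "a : H B" for B a using GoodD(3)[OF all[OF that(1)] that(2)] .
  fix B f f' assume f: "f : Hom C B ?Y" "f' : Hom C B ?Y" "Hm f al = Hm f' al"
  have B: "B : ob" using f by auto
  have "Hm (sub f f') al = \<one>\<^bsub>HG B\<^esub>" using H_sub_one[of f f' al] f al by simp
  then have "sub f f' = zro B ?Y" by (intro GoodD(2)[OF all[OF B]]) (use f in auto)
  then show "f = f'" by (rule sub_eq_zro) (use f in auto)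
 qed
qed

end


section \<open>The rational circle is injective\<close>

lemma QZ_facts:
 shows QZ_comm_group: "comm_group QZ" and QZ_countable: "countable (carrier QZ)"
  and QZ_divisible: "a : carrier QZ ==> 0 < n ==> \<exists>b\<in>carrier QZ. b [^]\<^bsub>QZ\<^esub> (n::nat) = a"
  and QZ_torsion: "1 < n ==> \<exists>q\<in>carrier QZ. q ~= \<one>\<^bsub>QZ\<^esub> & q [^]\<^bsub>QZ\<^esub> (n::nat) = \<one>\<^bsub>QZ\<^esub>"
proof -
 interpret R: comm_group rat_group
  by (rule comm_groupI) (auto simp: rat_group_def intro: exI[of _ "- x" for x] add.left_inverse)
 have sub: "subgroup \<int> rat_group"
 proof (rule R.subgroupI)
  show "inv\<^bsub>rat_group\<^esub> x : \<int>" if x: "x : \<int>" for x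
  proof -
   have "inv\<^bsub>rat_group\<^esub> x = - x" by (rule R.inv_equality) (simp_all add: rat_group_def)
   then show ?thesis using x by simp
  qed
 qed (auto simp: rat_group_def)
 then interpret N: normal \<int> rat_group using R.normal_iff_subgroup by blast
 show "comm_group QZ" unfolding QZ_def by (rule R.abelian_FactGroup[OF sub])
 then interpret Q: comm_group QZ .
 define p where "p = (%x :: rat. \<int> #>\<^bsub>rat_group\<^esub> x)"
 have car: "carrier QZ = range p"
  unfolding QZ_def carrier_FactGroup p_def by (simp add: rat_group_def)
 show "countable (carrier QZ)" unfolding car by simp
 have "p : hom rat_group QZ" unfolding p_def QZ_def by (rule N.r_coset_hom_Mod)
 then interpret p: group_hom rat_group QZ p by (simp add: group_hom_def group_hom_axioms_def)
 have pw: "x [^]\<^bsub>rat_group\<^esub> (n::nat) = of_nat n * x" for x n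
  by (induction n) (simp_all add: rat_group_def algebra_simps)
 have p_pow: "p x [^]\<^bsub>QZ\<^esub> n = p (of_nat n * x)" for x and n :: nat
  using p.hom_nat_pow[of x n] pw[of x n] by (simp add: rat_group_def)
 have p_one: "p x = \<one>\<^bsub>QZ\<^esub> \<longleftrightarrow> x : \<int>" for x
 proof -
  have "\<one>\<^bsub>QZ\<^esub> = \<int>" by (simp add: QZ_def)
  then show ?thesis unfolding p_def
   using R.coset_join1[OF _ _ sub] R.coset_join2[OF _ sub] by (auto simp: rat_group_def)
 qed
 show "\<exists>b\<in>carrier QZ. b [^]\<^bsub>QZ\<^esub> n = a" if a: "a : carrier QZ" "0 < n"
 proof -
  obtain x where "a = p x" using a(1) unfolding car by auto
  then have "p (x / of_nat n) [^]\<^bsub>QZ\<^esub> n = a" using p_pow[of "x / of_nat n" n] a(2) by simp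
  then show ?thesis using car by blast
 qed
 show "\<exists>q\<in>carrier QZ. q ~= \<one>\<^bsub>QZ\<^esub> & q [^]\<^bsub>QZ\<^esub> n = \<one>\<^bsub>QZ\<^esub>" if n: "1 < n"
 proof -
  have "1 / of_nat n \<notin> (\<int> :: rat set)"
  proof
   assume "1 / of_nat n : (\<int> :: rat set)"
   then obtain k :: int where "1 / of_nat n = (of_int k :: rat)" by (auto elim: Ints_cases)
   then have "(of_int (k * int n) :: rat) = of_int 1" using n by (simp add: field_simps)
   then have "k * int n = 1" by (simp only: of_int_eq_iff)
   then have "int n dvd 1" by (metis dvd_triv_right)
   then show False using n by simp
  qed
  moreover have "p (1 / of_nat n) [^]\<^bsub>QZ\<^esub> n = \<one>\<^bsub>QZ\<^esub>"
   using p_pow[of "1 / of_nat n" n] p_one[of 1] n by simp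
  ultimately show ?thesis by (intro bexI[of _ "p (1 / of_nat n)"]) (auto simp: p_one car)
 qed
qed

lemma group_eq_if_div_one:
 assumes "group G" "x : carrier G" "y : carrier G" "x \<otimes>\<^bsub>G\<^esub> inv\<^bsub>G\<^esub> y = \<one>\<^bsub>G\<^esub>"
 shows "x = y"
proof -
 interpret group G by fact
 show ?thesis using inv_equality[OF assms(4)] assms(2,3) by simp
qed

text \<open>A partial homomorphism is a single-valued subgroup \<open>R\<close> of the product. It extends to \<open>a\<close> by sending \<open>a\<close>
 to an \<open>n\<close>-th root of the value at \<open>a\<^sup>n\<close>, where \<open>n\<close> is least positive with \<open>a\<^sup>n\<close> in the domain, or to
 the unit if there is no such \<open>n\<close>.\<close>

lemma partial_hom_extend:
 assumes A: "comm_group A" and D: "comm_group D"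
  and div: "!!d n. d : carrier D ==> 0 < n ==> \<exists>b\<in>carrier D. b [^]\<^bsub>D\<^esub> (n::nat) = d"
  and R: "subgroup R (A \<times>\<times> D)" "!!q. (\<one>\<^bsub>A\<^esub>, q) : R ==> q = \<one>\<^bsub>D\<^esub>"
  and a: "a : carrier A"
 obtains R' where "R <= R'" "subgroup R' (A \<times>\<times> D)" "!!q. (\<one>\<^bsub>A\<^esub>, q) : R' ==> q = \<one>\<^bsub>D\<^esub>" "a : Domain R'"
proof -
 interpret A: comm_group A by fact
 interpret D: comm_group D by fact
 interpret G: group "A \<times>\<times> D" by (rule DirProd_group) unfold_locales
 have Rc: "(x, q) : R ==> x : carrier A & q : carrier D" for x q
  using subgroup.subset[OF R(1)] by auto
 have Rm: "(x, q) : R ==> (y, r) : R ==> (x \<otimes>\<^bsub>A\<^esub> y, q \<otimes>\<^bsub>D\<^esub> r) : R" for x q y r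
  using subgroup.m_closed[OF R(1), of "(x, q)" "(y, r)"] by simp
 have R1: "(\<one>\<^bsub>A\<^esub>, \<one>\<^bsub>D\<^esub>) : R" using subgroup.one_closed[OF R(1)] by simp
 have Ri: "(inv\<^bsub>A\<^esub> x, inv\<^bsub>D\<^esub> q) : R" if "(x, q) : R" for x q
  using subgroup.m_inv_closed[OF R(1) that] Rc[OF that] inv_DirProd[of A D x q] by (simp add: A.is_group D.is_group)
 have Rn: "(x [^]\<^bsub>A\<^esub> n, q [^]\<^bsub>D\<^esub> n) : R" if "(x, q) : R" for x q and n :: nat
  by (induction n) (use that R1 Rm in auto)
 have Rp: "(x [^]\<^bsub>A\<^esub> k, q [^]\<^bsub>D\<^esub> k) : R" if "(x, q) : R" for x q and k :: int
 proof (cases "k \<ge> 0")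
  case True
  then obtain n where "k = int n" using nonneg_int_cases by blast
  then show ?thesis using Rn[OF that, of n] by (simp add: int_pow_int)
 next
  case False
  then obtain n where "k = - int n" by (metis int_cases2 of_nat_0_le_iff)
  then show ?thesis using Ri[OF Rn[OF that, of n]] Rc[OF that] by (simp add: A.int_pow_neg_int D.int_pow_neg_int)
 qed
 have Runiq: "q = r" if "(x, q) : R" "(x, r) : R" for x q r
 proof -
  have "(x \<otimes>\<^bsub>A\<^esub> inv\<^bsub>A\<^esub> x, q \<otimes>\<^bsub>D\<^esub> inv\<^bsub>D\<^esub> r) : R" using Rm[OF that(1) Ri[OF that(2)]] .
  then have "q \<otimes>\<^bsub>D\<^esub> inv\<^bsub>D\<^esub> r = \<one>\<^bsub>D\<^esub>" using R(2) Rc[OF that(1)] by simp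
  then show ?thesis using group_eq_if_div_one[OF D.is_group] Rc[OF that(1)] Rc[OF that(2)] by blast
 qed
 obtain c where c: "c : carrier D" "!!k :: int. a [^]\<^bsub>A\<^esub> k : Domain R ==> (a [^]\<^bsub>A\<^esub> k, c [^]\<^bsub>D\<^esub> k) : R"
 proof (cases "\<exists>n > 0. a [^]\<^bsub>A\<^esub> (n::nat) : Domain R")
  case False
  have "k = 0" if k: "a [^]\<^bsub>A\<^esub> k : Domain R" for k :: int
  proof (rule ccontr)
   assume "k ~= 0"
   then consider n where "k = int n" "n > 0" | n where "k = - int n" "n > 0"
    by (metis int_cases2 neg_0_equal_iff_equal of_nat_0 gr0I)
   then show False
   proof cases
    case 1
    then have "a [^]\<^bsub>A\<^esub> n : Domain R" using k by (simp add: int_pow_int)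
    then show False using False 1(2) by blast
   next
    case 2
    then obtain q where "(inv\<^bsub>A\<^esub> (a [^]\<^bsub>A\<^esub> n), q) : R" using k a by (auto simp: A.int_pow_neg_int)
    then have "(a [^]\<^bsub>A\<^esub> n, inv\<^bsub>D\<^esub> q) : R" using Ri a by fastforce
    then show False using False 2 by blast
   qed
  qed
  then have "(a [^]\<^bsub>A\<^esub> k, \<one>\<^bsub>D\<^esub> [^]\<^bsub>D\<^esub> k) : R" if "a [^]\<^bsub>A\<^esub> k : Domain R" for k :: int
   using R1 that by fastforce
  then show thesis using that[of "\<one>\<^bsub>D\<^esub>"] by blast
 next
  case True
  define n where "n = (LEAST n. n > 0 & a [^]\<^bsub>A\<^esub> (n::nat) : Domain R)"
  have n: "n > 0" "a [^]\<^bsub>A\<^esub> n : Domain R" using LeastI_ex[OF True] by (simp_all add: n_def)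
  have least: "n \<le> m" if "m > 0" "a [^]\<^bsub>A\<^esub> m : Domain R" for m
   unfolding n_def using that by (intro Least_le) simp
  obtain q where q: "(a [^]\<^bsub>A\<^esub> n, q) : R" using n(2) by blast
  obtain c where c: "c : carrier D" "c [^]\<^bsub>D\<^esub> n = q" using div[of q n] Rc[OF q] n(1) by blast
  have "(a [^]\<^bsub>A\<^esub> k, c [^]\<^bsub>D\<^esub> k) : R" if k: "a [^]\<^bsub>A\<^esub> k : Domain R" for k :: int
  proof -
   define m r where "m = k div int n" and "r = nat (k mod int n)"
   have kmr: "k = int n * m + int r" "r < n" using n(1) unfolding m_def r_def by (simp_all add: nat_less_iff)
   have q': "(a [^]\<^bsub>A\<^esub> (int n * m), c [^]\<^bsub>D\<^esub> (int n * m)) : R"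
    using Rp[OF q, of m] a c by (simp add: A.int_pow_pow[symmetric] D.int_pow_pow[symmetric] int_pow_int)
   obtain w where w: "(a [^]\<^bsub>A\<^esub> k, w) : R" using k by blast
   have "a [^]\<^bsub>A\<^esub> r = a [^]\<^bsub>A\<^esub> k \<otimes>\<^bsub>A\<^esub> inv\<^bsub>A\<^esub> (a [^]\<^bsub>A\<^esub> (int n * m))"
    using A.int_pow_diff[OF a, of k "int n * m"] kmr(1) by (simp add: int_pow_int)
   then have "a [^]\<^bsub>A\<^esub> r : Domain R" using Rm[OF w Ri[OF q']] by auto
   then have "r = 0" using least[of r] kmr(2) by (cases "r = 0") auto
   then show ?thesis using q' kmr(1) by simp
  qed
  then show thesis using that c(1) by blast
 qed
 define R' where "R' = {(a [^]\<^bsub>A\<^esub> k \<otimes>\<^bsub>A\<^esub> d, c [^]\<^bsub>D\<^esub> k \<otimes>\<^bsub>D\<^esub> q) | (k :: int) d q. (d, q) : R}"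
 have in_R': "(a [^]\<^bsub>A\<^esub> k \<otimes>\<^bsub>A\<^esub> d, c [^]\<^bsub>D\<^esub> k \<otimes>\<^bsub>D\<^esub> q) : R'" if "(d, q) : R" for k :: int and d q
  using that unfolding R'_def by blast
 show thesis
 proof (rule that[of R'])
  show "R <= R'"
  proof
   fix p assume "p : R"
   then show "p : R'" using in_R'[of "fst p" "snd p" 0] Rc[of "fst p" "snd p"] by simp
  qed
  show "a : Domain R'" using in_R'[OF R1, of 1] a c(1) by (auto simp: A.int_pow_1 D.int_pow_1)
  show "q = \<one>\<^bsub>D\<^esub>" if q: "(\<one>\<^bsub>A\<^esub>, q) : R'" for q
  proof -
   obtain k :: int and d r where k: "\<one>\<^bsub>A\<^esub> = a [^]\<^bsub>A\<^esub> k \<otimes>\<^bsub>A\<^esub> d" "q = c [^]\<^bsub>D\<^esub> k \<otimes>\<^bsub>D\<^esub> r" "(d, r) : R"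
    using q unfolding R'_def by blast
   have d: "d = a [^]\<^bsub>A\<^esub> (- k)"
    using k(1) Rc[OF k(3)] a by (metis A.int_pow_closed A.int_pow_neg A.inv_equality A.m_comm)
   then have "(d, c [^]\<^bsub>D\<^esub> (- k)) : R" using c(2)[of "- k"] k(3) by blast
   then have "r = c [^]\<^bsub>D\<^esub> (- k)" using Runiq k(3) by blast
   then show ?thesis using k(2) c(1) by (simp add: D.int_pow_mult[symmetric])
  qed
  show "subgroup R' (A \<times>\<times> D)"
  proof (rule G.subgroupI)
   show "R' <= carrier (A \<times>\<times> D)" using Rc a c(1) unfolding R'_def by auto
   show "R' ~= {}" using in_R'[OF R1] by blast
  next
   fix p assume "p : R'"
   then obtain k :: int and d q where p: "p = (a [^]\<^bsub>A\<^esub> k \<otimes>\<^bsub>A\<^esub> d, c [^]\<^bsub>D\<^esub> k \<otimes>\<^bsub>D\<^esub> q)" "(d, q) : R"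
    unfolding R'_def by blast
   have "inv\<^bsub>A \<times>\<times> D\<^esub> p = (a [^]\<^bsub>A\<^esub> (- k) \<otimes>\<^bsub>A\<^esub> inv\<^bsub>A\<^esub> d, c [^]\<^bsub>D\<^esub> (- k) \<otimes>\<^bsub>D\<^esub> inv\<^bsub>D\<^esub> q)"
    using p Rc[OF p(2)] a c(1)
    by (simp add: inv_DirProd[OF A.is_group D.is_group] A.inv_mult D.inv_mult A.int_pow_neg D.int_pow_neg)
   then show "inv\<^bsub>A \<times>\<times> D\<^esub> p : R'" using in_R'[OF Ri[OF p(2)], of "- k"] by simp
  next
   fix p p' assume "p : R'" "p' : R'"
   then obtain k l :: int and d q e r where
    p: "p = (a [^]\<^bsub>A\<^esub> k \<otimes>\<^bsub>A\<^esub> d, c [^]\<^bsub>D\<^esub> k \<otimes>\<^bsub>D\<^esub> q)" "(d, q) : R"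
    "p' = (a [^]\<^bsub>A\<^esub> l \<otimes>\<^bsub>A\<^esub> e, c [^]\<^bsub>D\<^esub> l \<otimes>\<^bsub>D\<^esub> r)" "(e, r) : R"
    unfolding R'_def by blast
   have "p \<otimes>\<^bsub>A \<times>\<times> D\<^esub> p' = (a [^]\<^bsub>A\<^esub> (k + l) \<otimes>\<^bsub>A\<^esub> (d \<otimes>\<^bsub>A\<^esub> e), c [^]\<^bsub>D\<^esub> (k + l) \<otimes>\<^bsub>D\<^esub> (q \<otimes>\<^bsub>D\<^esub> r))"
    using p Rc[OF p(2)] Rc[OF p(4)] a c(1)
    by (simp add: A.int_pow_mult D.int_pow_mult A.m_ac D.m_ac)
   then show "p \<otimes>\<^bsub>A \<times>\<times> D\<^esub> p' : R'" using in_R'[OF Rm[OF p(2,4)], of "k + l"] by simp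
  qed
 qed
qed

text \<open>Zorn's lemma: a maximal partial homomorphism is total, as it extends to every element.\<close>

lemma injective_extension:
 assumes A: "comm_group A" and B: "comm_group B" and \<phi>: "\<phi> : hom B A" and \<chi>: "\<chi> : hom B QZ"
  and ker: "!!b. b : carrier B ==> \<phi> b = \<one>\<^bsub>A\<^esub> ==> \<chi> b = \<one>\<^bsub>QZ\<^esub>"
 shows "\<exists>\<psi>\<in>hom A QZ. \<forall>b\<in>carrier B. \<psi> (\<phi> b) = \<chi> b"
proof -
 interpret A: comm_group A by fact
 interpret B: comm_group B by fact
 interpret D: comm_group QZ by (rule QZ_comm_group)
 interpret G: group "A \<times>\<times> QZ" by (rule DirProd_group) unfold_locales
 interpret p: group_hom B "A \<times>\<times> QZ" "%b. (\<phi> b, \<chi> b)"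
  using \<phi> \<chi> by (auto simp: group_hom_def group_hom_axioms_def hom_def B.is_group G.is_group)
 let ?R0 = "(%b. (\<phi> b, \<chi> b)) ` carrier B"
 define \<R> where "\<R> = {R. ?R0 <= R & subgroup R (A \<times>\<times> QZ) & (\<forall>q. (\<one>\<^bsub>A\<^esub>, q) : R --> q = \<one>\<^bsub>QZ\<^esub>)}"
 have "?R0 : \<R>" unfolding \<R>_def using p.img_is_subgroup ker by (auto simp: eq_commute)
 then have ne: "\<R> ~= {}" by blast
 have "\<exists>M\<in>\<R>. \<forall>X\<in>\<R>. M <= X --> X = M"
 proof (rule subset_Zorn_nonempty[OF ne])
  fix \<C> assume C: "\<C> ~= {}" "subset.chain \<R> \<C>"
  then have CR: "!!R. R : \<C> ==> R : \<R>" and tot: "!!R S. R : \<C> ==> S : \<C> ==> R <= S \<or> S <= R"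
   by (auto simp: subset.chain_def)
  have sub: "subgroup R (A \<times>\<times> QZ)" "?R0 <= R" if "R : \<C>" for R using CR[OF that] by (simp_all add: \<R>_def)
  have "subgroup (\<Union>\<C>) (A \<times>\<times> QZ)"
  proof (rule G.subgroupI)
   show "\<Union>\<C> <= carrier (A \<times>\<times> QZ)" using subgroup.subset[OF sub(1)] by blast
   show "\<Union>\<C> ~= {}" using C(1) subgroup.one_closed[OF sub(1)] by blast
   show "inv\<^bsub>A \<times>\<times> QZ\<^esub> x : \<Union>\<C>" if "x : \<Union>\<C>" for x
    using that subgroup.m_inv_closed[OF sub(1)] by blast
   fix x y assume "x : \<Union>\<C>" "y : \<Union>\<C>"
   then obtain R S where RS: "R : \<C>" "S : \<C>" "x : R" "y : S" by blast
   then obtain V where "V : \<C>" "x : V" "y : V" using tot[OF RS(1,2)] by blast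
   then show "x \<otimes>\<^bsub>A \<times>\<times> QZ\<^esub> y : \<Union>\<C>" using subgroup.m_closed[OF sub(1)] by blast
  qed
  moreover have "?R0 <= \<Union>\<C>" using C(1) sub(2) by blast
  moreover have "\<forall>q. (\<one>\<^bsub>A\<^esub>, q) : \<Union>\<C> --> q = \<one>\<^bsub>QZ\<^esub>" using CR by (auto simp: \<R>_def)
  ultimately show "\<Union>\<C> : \<R>" by (simp add: \<R>_def)
 qed
 then obtain R where R: "R : \<R>" "!!X. X : \<R> ==> R <= X ==> X = R" by blast
 have Rs: "subgroup R (A \<times>\<times> QZ)" and R0: "?R0 <= R" and R1: "!!q. (\<one>\<^bsub>A\<^esub>, q) : R ==> q = \<one>\<^bsub>QZ\<^esub>"
  using R(1) by (auto simp: \<R>_def)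
 have dom: "a : Domain R" if a: "a : carrier A" for a
 proof -
  obtain R' where R': "R <= R'" "subgroup R' (A \<times>\<times> QZ)" "!!q. (\<one>\<^bsub>A\<^esub>, q) : R' ==> q = \<one>\<^bsub>QZ\<^esub>" "a : Domain R'"
   using partial_hom_extend[OF A QZ_comm_group QZ_divisible Rs R1 a] by blast
  have "R' : \<R>" using R' R0 by (auto simp: \<R>_def)
  then show ?thesis using R(2) R'(1,4) by blast
 qed
 have Rc: "x : carrier A & q : carrier QZ" if "(x, q) : R" for x q
  using subgroup.subset[OF Rs] that by auto
 have uniq: "q = r" if "(x, q) : R" "(x, r) : R" for x q r
 proof -
  have "(inv\<^bsub>A\<^esub> x, inv\<^bsub>QZ\<^esub> r) : R"
   using subgroup.m_inv_closed[OF Rs that(2)] Rc[OF that(2)] inv_DirProd[of A QZ x r] by (simp add: A.is_group D.is_group)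
  then have "(x \<otimes>\<^bsub>A\<^esub> inv\<^bsub>A\<^esub> x, q \<otimes>\<^bsub>QZ\<^esub> inv\<^bsub>QZ\<^esub> r) : R"
   using subgroup.m_closed[OF Rs that(1)] by fastforce
  then have "q \<otimes>\<^bsub>QZ\<^esub> inv\<^bsub>QZ\<^esub> r = \<one>\<^bsub>QZ\<^esub>" using R1 Rc[OF that(1)] by simp
  then show ?thesis using group_eq_if_div_one[OF D.is_group] Rc[OF that(1)] Rc[OF that(2)] by blast
 qed
 define \<psi> where "\<psi> a = (THE q. (a, q) : R)" for a
 have \<psi>: "\<psi> a = q" if "(a, q) : R" for a q
  unfolding \<psi>_def by (rule the_equality[of "%q. (a, q) : R", OF that]) (rule uniq[OF _ that])
 have \<psi>R: "(a, \<psi> a) : R" if "a : carrier A" for a using dom[OF that] \<psi> by blast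
 show ?thesis
 proof (intro bexI[of _ \<psi>] ballI)
  show "\<psi> : hom A QZ"
  proof (rule homI)
   show "\<psi> x : carrier QZ" if "x : carrier A" for x using Rc[OF \<psi>R[OF that]] by simp
   show "\<psi> (x \<otimes>\<^bsub>A\<^esub> y) = \<psi> x \<otimes>\<^bsub>QZ\<^esub> \<psi> y" if "x : carrier A" "y : carrier A" for x y
    using subgroup.m_closed[OF Rs \<psi>R[OF that(1)] \<psi>R[OF that(2)]] by (intro \<psi>) simp
  qed
  show "\<psi> (\<phi> b) = \<chi> b" if "b : carrier B" for b using R0 that by (intro \<psi>) blast
 qed
qed

lemma characters_separate:
 assumes A: "comm_group A" and a: "a : carrier A" "a ~= \<one>\<^bsub>A\<^esub>"
 obtains \<psi> where "\<psi> : hom A QZ" "\<psi> a ~= \<one>\<^bsub>QZ\<^esub>"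
proof -
 interpret A: comm_group A by fact
 interpret D: comm_group QZ by (rule QZ_comm_group)
 have Z: "comm_group integer_group" by (rule comm_groupI) (auto simp: integer_group_def intro: exI[of _ "- x" for x] add.left_inverse)
 define n where "n = (if A.ord a = 0 then 2 else A.ord a)"
 have "A.ord a ~= 1" using A.ord_eq_1[OF a(1)] a(2) by simp
 then have n: "1 < n" unfolding n_def by auto
 obtain q where q: "q : carrier QZ" "q ~= \<one>\<^bsub>QZ\<^esub>" "q [^]\<^bsub>QZ\<^esub> n = \<one>\<^bsub>QZ\<^esub>" using QZ_torsion[OF n] by blast
 have ker: "q [^]\<^bsub>QZ\<^esub> k = \<one>\<^bsub>QZ\<^esub>" if k: "a [^]\<^bsub>A\<^esub> k = \<one>\<^bsub>A\<^esub>" for k :: int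
 proof -
  have "int (A.ord a) dvd k" using A.int_pow_eq_id[OF a(1)] k by blast
  then have "int n dvd k" by (auto simp: n_def split: if_splits)
  then obtain m where "k = int n * m" by blast
  then show ?thesis using q(1,3) by (simp add: D.int_pow_pow[symmetric] int_pow_int)
 qed
 have h: "(%k. a [^]\<^bsub>A\<^esub> k) : hom integer_group A" "(%k. q [^]\<^bsub>QZ\<^esub> k) : hom integer_group QZ"
  using a(1) q(1) by (auto simp: hom_def integer_group_def A.int_pow_mult D.int_pow_mult)
 have "\<exists>\<psi>\<in>hom A QZ. \<forall>(k::int)\<in>carrier integer_group. \<psi> (a [^]\<^bsub>A\<^esub> k) = q [^]\<^bsub>QZ\<^esub> k"
  by (rule injective_extension[OF A Z h]) (rule ker)
 then obtain \<psi> where \<psi>: "\<psi> : hom A QZ" "!!k :: int. \<psi> (a [^]\<^bsub>A\<^esub> k) = q [^]\<^bsub>QZ\<^esub> k"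
  by auto
 have "\<psi> a = q" using \<psi>(2)[of 1] a(1) q(1) by (simp add: integer_group_def)
 then show thesis using that \<psi>(1) q(2) by blast
qed


section \<open>Consequences of Brown representability\<close>

lemma comm_group_product_group:
 assumes "!!i. i : I ==> comm_group (G i)" shows "comm_group (product_group I G)"
proof (rule group.group_comm_groupI)
 show "group (product_group I G)" using assms by (simp add: comm_group_def)
 fix x y assume "x : carrier (product_group I G)" "y : carrier (product_group I G)"
 then have "x i \<otimes>\<^bsub>G i\<^esub> y i = y i \<otimes>\<^bsub>G i\<^esub> x i" if "i : I" for i
  using assms[OF that] that by (auto simp: comm_group_def intro!: comm_monoid.m_comm)
 then show "x \<otimes>\<^bsub>product_group I G\<^esub> y = y \<otimes>\<^bsub>product_group I G\<^esub> x" by (auto intro: restrict_ext)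
qed

context cg_category
begin

text \<open>
 An exact functor that preserves coproducts has a right adjoint: \<open>Hom (F -) A\<close> is cohomological.
\<close>

lemma universal_exists:
 assumes F: "is_functor C C F"
  and add: "!!f g. f : arr ==> g : arr ==> dom g = dom f ==> cod g = cod f ==>
   fM F (pls f g) = pls (fM F f) (fM F g)"
  and ex: "!!f g h b. (f, g, h) : tri ==> b : Hom C (fO F (cod f)) A ==>
   b\<cdot>fM F f = zro (fO F (dom f)) A ==> \<exists>c\<in>Hom C (fO F (cod g)) A. c\<cdot>fM F g = b"
  and cop: "preserves_small_coproducts U C C F" and A: "A : ob"
 shows "\<exists>g e. universal C C F (ob) A g e"
proof -
 note Fn = is_functorD[OF F]
 have cop': "is_coproduct C I (%i. fO F (X i)) (fO F P) (%i. fM F (io i))"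
  if "small U I" "is_coproduct C I X P io" for I :: "'u set" and X P io
  using cop that unfolding preserves_small_coproducts_def by blast
 have sm: "small U (carrier (hom_group C (fO F x) A))" if "x : ob" for x
  using loc_small Fn(1)[OF that] A unfolding locally_small_def hom_group_simps by blast
 interpret H: cohomological U C "%x. hom_group C (fO F x) A" "%f a. a\<cdot>fM F f"
 proof (rule cohomological.intro[OF cg_category_axioms], rule cohomological_axioms.intro)
  show "comm_group (hom_group C (fO F x) A)" if "x : ob" for x using that Fn A hom_comm_group by simp
  show "\<exists>b\<in>carrier (hom_group C (fO F (cod g)) A). b\<cdot>fM F g = a"
   if "(f, g, h) : tri" "a : carrier (hom_group C (fO F (cod f)) A)"
    "a\<cdot>fM F f = \<one>\<^bsub>hom_group C (fO F (dom f)) A\<^esub>" for f g h a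
   using ex[OF that(1), of a] that(2,3) unfolding hom_group_simps by blast
  show "\<exists>b\<in>carrier (hom_group C (fO F P) A). \<forall>i\<in>I. b\<cdot>fM F (io i) = c i"
   if "small U I" "is_coproduct C I X P io" "!!i. i : I ==> c i : carrier (hom_group C (fO F (X i)) A)"
   for I :: "'u set" and X P io c
   unfolding hom_group_simps
  proof (rule is_coproduct_map[OF cop'[OF that(1,2)] A, of c])
   show "c i : Hom C (fO F (X i)) A" if "i : I" for i using \<open>!!i. i : I ==> _\<close>[OF that] by simp
  qed blast
  show "b = b'" if "small U I" "is_coproduct C I X P io" "b : carrier (hom_group C (fO F P) A)"
   "b' : carrier (hom_group C (fO F P) A)" "!!i. i : I ==> b\<cdot>fM F (io i) = b'\<cdot>fM F (io i)"
   for I :: "'u set" and X P io b b'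
   by (rule is_coproduct_ext[OF cop'[OF that(1,2)] _ _ that(5)]) (use that(3,4) in auto)
  show "small U (carrier (hom_group C (fO F x) A))" if "x : ob" for x using sm[OF that] .
 qed (use Fn add A in auto)
 obtain Y al where Y: "Y : ob" "al : Hom C (fO F Y) A"
  "!!B a. B : ob ==> a : Hom C (fO F B) A ==> \<exists>f\<in>Hom C B Y. al\<cdot>fM F f = a"
  "!!B f f'. f : Hom C B Y ==> f' : Hom C B Y ==> al\<cdot>fM F f = al\<cdot>fM F f' ==> f = f'"
  using H.representable unfolding hom_group_simps by metis
 have "universal C C F (ob) A Y al"
  by (rule universalI[OF Y(1,2)]) (use Y(3,4) in blast)+
 then show ?thesis by blast
qed

text \<open>The functor \<open>\<Prod>i. Hom x (X i)\<close> is cohomological, and the object that represents it is the product.\<close>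

lemma product_exists:
 assumes I: "small U I" and X: "!!i. i : I ==> X i : ob"
 obtains P pr where "is_product C I X P pr"
proof -
 let ?G = "%x. product_group I (%i. hom_group C x (X i))" and ?H = "%f a. \<lambda>i\<in>I. a i\<cdot>f"
 interpret H: cohomological U C ?G ?H
 proof (rule cohomological.intro[OF cg_category_axioms], rule cohomological_axioms.intro)
  show "comm_group (?G x)" if "x : ob" for x
   using that X hom_comm_group by (intro comm_group_product_group) blast
  show "small U (carrier (?G x))" if "x : ob" for x
   using loc_small X that unfolding locally_small_def carrier_product_group hom_group_simps
   by (intro small_PiE[OF I]) blast
  show "?H f (a \<otimes>\<^bsub>?G (cod f)\<^esub> b) = ?H f a \<otimes>\<^bsub>?G (dom f)\<^esub> ?H f b"
   if "f : arr" "a : carrier (?G (cod f))" "b : carrier (?G (cod f))" for f a b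
   using that by (auto simp: PiE_iff intro!: restrict_ext)
  show "?H (ide x) a = a" if "x : ob" "a : carrier (?G x)" for x a
   using that by (auto simp: PiE_iff extensional_def restrict_def fun_eq_iff)
  show "?H (g\<cdot>f) a = ?H f (?H g a)"
   if "f : arr" "g : arr" "cod f = dom g" "a : carrier (?G (cod g))" for f g a
   using that by (auto simp: PiE_iff intro!: restrict_ext)
  show "?H (pls f g) a = ?H f a \<otimes>\<^bsub>?G (dom f)\<^esub> ?H g a"
   if "f : arr" "g : arr" "dom g = dom f" "cod g = cod f" "a : carrier (?G (cod f))" for f g a
   using that by (auto simp: PiE_iff intro!: restrict_ext)
  show "\<exists>b\<in>carrier (?G (cod g)). ?H g b = a"
   if t: "(f, g, h) : tri" and a: "a : carrier (?G (cod f))" "?H f a = \<one>\<^bsub>?G (dom f)\<^esub>" for f g h a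
  proof -
   have "\<exists>b. b : Hom C (cod g) (X i) & b\<cdot>g = a i" if i: "i : I" for i
   proof -
    have "?H f a i = \<one>\<^bsub>?G (dom f)\<^esub> i" using a(2) by simp
    then have "a i\<cdot>f = zro (dom f) (X i)" using i by simp
    moreover have "a i : Hom C (cod f) (X i)" using a(1) i by (simp add: PiE_iff)
    ultimately show ?thesis using tri_ext[OF t, of "a i" "X i"] by blast
   qed
   then obtain b where b: "!!i. i : I ==> b i : Hom C (cod g) (X i)" "!!i. i : I ==> b i\<cdot>g = a i" by metis
   have "?H g (restrict b I) = a"
    using a(1) b(2) by (auto simp: PiE_iff extensional_def restrict_def fun_eq_iff)
   moreover have "restrict b I : carrier (?G (cod g))" using b(1) by simp
   ultimately show ?thesis by blast
  qed
  show "\<exists>b\<in>carrier (?G P). \<forall>j\<in>J. ?H (io j) b = c j"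
   if J: "small U J" and P: "is_coproduct C J Z P io" and c: "!!j. j : J ==> c j : carrier (?G (Z j))"
   for J :: "'u set" and Z P io c
  proof -
   have "\<exists>b. b : Hom C P (X i) & (\<forall>j\<in>J. b\<cdot>io j = c j i)" if i: "i : I" for i
   proof (rule is_coproduct_map[OF P X[OF i], of "%j. c j i"])
    show "c j i : Hom C (Z j) (X i)" if "j : J" for j using c[OF that] i by (simp add: PiE_iff)
   qed blast
   then obtain b where b: "!!i. i : I ==> b i : Hom C P (X i)" "!!i j. i : I ==> j : J ==> b i\<cdot>io j = c j i"
    by metis
   have "?H (io j) (restrict b I) = c j" if "j : J" for j
    using c[OF that] b(2) that by (auto simp: PiE_iff extensional_def restrict_def fun_eq_iff)
   moreover have "restrict b I : carrier (?G P)" using b(1) by simp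
   ultimately show ?thesis by blast
  qed
  show "b = b'"
   if J: "small U J" and P: "is_coproduct C J Z P io" and b: "b : carrier (?G P)" "b' : carrier (?G P)"
    "!!j. j : J ==> ?H (io j) b = ?H (io j) b'" for J :: "'u set" and Z P io b b'
  proof (rule PiE_ext)
   show "b : (\<Pi>\<^sub>E i\<in>I. Hom C P (X i))" "b' : (\<Pi>\<^sub>E i\<in>I. Hom C P (X i))" using b(1,2) by simp_all
   fix i assume i: "i : I"
   show "b i = b' i"
   proof (rule is_coproduct_ext[OF P, of _ "X i"])
    show "b i : Hom C P (X i)" "b' i : Hom C P (X i)" using b(1,2) i by (simp_all add: PiE_iff)
    fix j assume "j : J"
    then have "?H (io j) b i = ?H (io j) b' i" using b(3) by simp
    then show "b i\<cdot>io j = b' i\<cdot>io j" using i by simp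
   qed
  qed
 qed (auto simp: PiE_iff)
 obtain Y al where Y: "Y : ob" "al : carrier (?G Y)"
  "!!B a. B : ob ==> a : carrier (?G B) ==> \<exists>f\<in>Hom C B Y. ?H f al = a"
  "!!B f f'. f : Hom C B Y ==> f' : Hom C B Y ==> ?H f al = ?H f' al ==> f = f'"
  by (rule H.representable) blast
 have "is_product C I X Y al"
 proof (rule is_productI[OF Y(1) X])
  show "al i : Hom C Y (X i)" if "i : I" for i using Y(2) that by (simp add: PiE_iff)
  fix B f assume B: "B : ob" and f: "!!i. i : I ==> f i : Hom C B (X i)"
  have "restrict f I : carrier (?G B)" using f by simp
  then obtain h where h: "h : Hom C B Y" "?H h al = restrict f I" using Y(3)[OF B] by blast
  have "al i\<cdot>h = f i" if "i : I" for i using fun_cong[OF h(2), of i] that by simp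
  then show "\<exists>h. h : Hom C B Y & (\<forall>i\<in>I. al i\<cdot>h = f i)" using h(1) by blast
 next
  fix B h h' assume h: "h : Hom C B Y" "h' : Hom C B Y" and eq: "!!i. i : I ==> al i\<cdot>h = al i\<cdot>h'"
  have "?H h al = ?H h' al" using eq by (auto intro: restrict_ext)
  then show "h = h'" using Y(4) h by blast
 qed
 then show thesis by (rule that)
qed

definition char_group :: "'o => 'o => ('m => rat set) monoid" where
 "char_group x y = \<lparr>carrier = characters C x y, mult = (%\<chi> \<psi>. \<lambda>f\<in>Hom C x y. \<chi> f \<otimes>\<^bsub>QZ\<^esub> \<psi> f),
   one = (\<lambda>f\<in>Hom C x y. \<one>\<^bsub>QZ\<^esub>)\<rparr>"

lemma char_group_simps [simp]:
 "carrier (char_group x y) = characters C x y"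
 "mult (char_group x y) = (%\<chi> \<psi>. \<lambda>f\<in>Hom C x y. \<chi> f \<otimes>\<^bsub>QZ\<^esub> \<psi> f)"
 "one (char_group x y) = (\<lambda>f\<in>Hom C x y. \<one>\<^bsub>QZ\<^esub>)"
 by (simp_all add: char_group_def)

lemma charactersD:
 assumes "\<chi> : characters C x y"
 shows "f : Hom C x y ==> \<chi> f : carrier QZ"
  "f : Hom C x y ==> g : Hom C x y ==> \<chi> (pls f g) = \<chi> f \<otimes>\<^bsub>QZ\<^esub> \<chi> g"
  "\<chi> : extensional (Hom C x y)"
  "x : ob ==> y : ob ==> \<chi> (zro x y) = \<one>\<^bsub>QZ\<^esub>"
proof -
 have h: "\<chi> : hom (hom_group C x y) QZ" using assms by (simp add: characters_def)
 show "\<chi> (pls f g) = \<chi> f \<otimes>\<^bsub>QZ\<^esub> \<chi> g" if "f : Hom C x y" "g : Hom C x y"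
  using hom_mult[OF h, of f g] that by simp
 show "\<chi> f : carrier QZ" if "f : Hom C x y" using hom_carrier[OF h] that by auto
 show "\<chi> : extensional (Hom C x y)" using assms by (simp add: characters_def)
 assume xy: "x : ob" "y : ob"
 have "group (hom_group C x y)" "group QZ"
  using hom_comm_group[OF xy] QZ_comm_group by (simp_all add: comm_group_def)
 then show "\<chi> (zro x y) = \<one>\<^bsub>QZ\<^esub>" using hom_one[OF h] by simp
qed

lemma charactersI:
 assumes "!!f. f : Hom C x y ==> \<chi> f : carrier QZ"
  "!!f g. f : Hom C x y ==> g : Hom C x y ==> \<chi> (pls f g) = \<chi> f \<otimes>\<^bsub>QZ\<^esub> \<chi> g"
 shows "restrict \<chi> (Hom C x y) : characters C x y"
 unfolding characters_def using assms by (auto simp: hom_def)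

lemma char_group_comm_group:
 assumes x: "x : ob" "y : ob" shows "comm_group (char_group x y)"
proof (rule comm_groupI)
 interpret Q: comm_group QZ by (rule QZ_comm_group)
 note D = charactersD
 show "\<one>\<^bsub>char_group x y\<^esub> : carrier (char_group x y)"
  unfolding char_group_simps by (rule charactersI) simp_all
 fix \<chi> assume "\<chi> : carrier (char_group x y)"
 then have c: "\<chi> : characters C x y" by simp
 show "\<one>\<^bsub>char_group x y\<^esub> \<otimes>\<^bsub>char_group x y\<^esub> \<chi> = \<chi>"
  using D(1,3)[OF c] by (auto simp: extensional_def restrict_def fun_eq_iff)
 have "restrict (%f. inv\<^bsub>QZ\<^esub> \<chi> f) (Hom C x y) : characters C x y"
  by (rule charactersI) (use D(1,2)[OF c] in \<open>auto simp: Q.inv_mult\<close>)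
 moreover have "restrict (%f. inv\<^bsub>QZ\<^esub> \<chi> f) (Hom C x y) \<otimes>\<^bsub>char_group x y\<^esub> \<chi> = \<one>\<^bsub>char_group x y\<^esub>"
  using D(1)[OF c] by (auto intro!: restrict_ext)
 ultimately show "\<exists>\<psi>\<in>carrier (char_group x y). \<psi> \<otimes>\<^bsub>char_group x y\<^esub> \<chi> = \<one>\<^bsub>char_group x y\<^esub>"
  by (intro bexI[of _ "restrict (%f. inv\<^bsub>QZ\<^esub> \<chi> f) (Hom C x y)"]) (simp_all only: char_group_simps(1))
 fix \<psi> assume "\<psi> : carrier (char_group x y)"
 then have c': "\<psi> : characters C x y" by simp
 show "\<chi> \<otimes>\<^bsub>char_group x y\<^esub> \<psi> : carrier (char_group x y)"
  unfolding char_group_simps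
  by (rule charactersI) (use D(1,2)[OF c] D(1,2)[OF c'] in \<open>auto simp: Q.m_ac\<close>)
 show "\<chi> \<otimes>\<^bsub>char_group x y\<^esub> \<psi> = \<psi> \<otimes>\<^bsub>char_group x y\<^esub> \<chi>"
  using D(1)[OF c] D(1)[OF c'] by (auto simp: Q.m_comm intro!: restrict_ext)
 fix \<eta> assume "\<eta> : carrier (char_group x y)"
 then have c'': "\<eta> : characters C x y" by simp
 show "\<chi> \<otimes>\<^bsub>char_group x y\<^esub> \<psi> \<otimes>\<^bsub>char_group x y\<^esub> \<eta> = \<chi> \<otimes>\<^bsub>char_group x y\<^esub> (\<psi> \<otimes>\<^bsub>char_group x y\<^esub> \<eta>)"
  using D(1)[OF c] D(1)[OF c'] D(1)[OF c''] by (auto simp: Q.m_assoc intro!: restrict_ext)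
qed

text \<open>
 A character that vanishes on the image of \<open>f\<close> factors through the image of \<open>g\<close> in \<open>Hom x (cod g)\<close>; since
 the rational circle is injective, it extends from there.
\<close>

lemma characters_exact:
 assumes t: "(f, g, h) : tri" and x: "x : ob" and \<chi>: "\<chi> : characters C x (cod f)"
  and z: "!!a. a : Hom C x (dom f) ==> \<chi> (f\<cdot>a) = \<one>\<^bsub>QZ\<^esub>"
 shows "\<exists>\<psi>\<in>characters C x (cod g). \<forall>a\<in>Hom C x (cod f). \<psi> (g\<cdot>a) = \<chi> a"
proof -
 note T = triD[OF t]
 have G: "comm_group (hom_group C x (cod f))" "comm_group (hom_group C x (cod g))"
  using x T hom_comm_group by simp_all
 have h: "(%a. g\<cdot>a) : hom (hom_group C x (cod f)) (hom_group C x (cod g))"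
  using T by (auto simp: hom_def)
 have h': "\<chi> : hom (hom_group C x (cod f)) QZ" using \<chi> by (simp add: characters_def)
 have "\<exists>\<psi>\<in>hom (hom_group C x (cod g)) QZ. \<forall>a\<in>carrier (hom_group C x (cod f)). \<psi> (g\<cdot>a) = \<chi> a"
 proof (rule injective_extension[OF G(2,1) h h'])
  fix b assume b: "b : carrier (hom_group C x (cod f))" "g\<cdot>b = \<one>\<^bsub>hom_group C x (cod g)\<^esub>"
  then obtain a where "a : Hom C x (dom f)" "f\<cdot>a = b" using tri_lift[OF t, of b x] by auto
  then show "\<chi> b = \<one>\<^bsub>QZ\<^esub>" using z by blast
 qed
 then obtain \<psi> where \<psi>: "\<psi> : hom (hom_group C x (cod g)) QZ" "!!a. a : Hom C x (cod f) ==> \<psi> (g\<cdot>a) = \<chi> a"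
  by (auto simp del: in_Hom)
 have "restrict \<psi> (Hom C x (cod g)) : characters C x (cod g)"
 proof (rule charactersI)
  show "\<psi> a : carrier QZ" if "a : Hom C x (cod g)" for a using hom_carrier[OF \<psi>(1)] that by auto
  show "\<psi> (pls a b) = \<psi> a \<otimes>\<^bsub>QZ\<^esub> \<psi> b" if "a : Hom C x (cod g)" "b : Hom C x (cod g)" for a b
   using hom_mult[OF \<psi>(1), of a b] that by simp
 qed
 moreover have "restrict \<psi> (Hom C x (cod g)) (g\<cdot>a) = \<chi> a" if "a : Hom C x (cod f)" for a
  using \<psi>(2)[OF that] that T by simp
 ultimately show ?thesis by blast
qed

text \<open>A map \<open>f\<close> from \<open>x\<close> has only finitely many nonzero components \<open>\<pi> i f\<close>, so the product of the \<open>c i (\<pi> i f)\<close>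
 makes sense.\<close>

lemma characters_coproduct:
 assumes x: "finitary x" and I: "small U (I :: 'u set)" and P: "is_coproduct C I X P io"
  and c: "!!i. i : I ==> c i : characters C x (X i)"
 shows "\<exists>\<chi>\<in>characters C x P. \<forall>i\<in>I. \<forall>f\<in>Hom C x (X i). \<chi> (io i\<cdot>f) = c i f"
proof -
 interpret Q: comm_group QZ by (rule QZ_comm_group)
 note D = is_coproductD[OF P] and xo = finitary_ob[OF x]
 have "\<exists>\<pi>. \<pi> : Hom C P (X i) & (\<forall>j\<in>I. \<pi>\<cdot>io j = (if j = i then ide (X i) else zro (X j) (X i)))" if "i : I" for i
  by (rule coproduct_proj[OF P that]) blast
 then obtain \<pi> where \<pi>: "!!i. i : I ==> \<pi> i : Hom C P (X i)"
  "!!i j. i : I ==> j : I ==> \<pi> i\<cdot>io j = (if j = i then ide (X i) else zro (X j) (X i))" by metis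
 define S where "S f = {i : I. \<pi> i\<cdot>f ~= zro x (X i)}" for f
 have \<pi>f: "\<pi> i\<cdot>f : Hom C x (X i)" if "i : I" "f : Hom C x P" for i f using \<pi>(1)[OF that(1)] that(2) by auto
 have cf: "c i (\<pi> i\<cdot>f) : carrier QZ" if "i : I" "f : Hom C x P" for i f
  using charactersD(1)[OF c[OF that(1)] \<pi>f[OF that]] .
 have fin: "finite (S f)" if f: "f : Hom C x P" for f
 proof -
  obtain J where J: "J <= I" "finite_support J io f" by (rule finitaryD[OF x I P f])
  have "S f <= J"
  proof
   fix i assume i: "i : S f"
   then have iI: "i : I" by (simp add: S_def)
   show "i : J"
   proof (rule ccontr)
    assume nJ: "i \<notin> J"
    have "\<pi> i\<cdot>f = zro P (X i)\<cdot>f"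
    proof (rule finite_supportD(2)[OF J(2), of _ "X i"])
     fix j assume j: "j : J"
     then have "j : I" "j ~= i" using J(1) nJ by auto
     then show "\<pi> i\<cdot>io j = zro P (X i)\<cdot>io j" using \<pi>(2)[OF iI] D iI by simp
    qed (use \<pi>(1)[OF iI] f D iI in auto)
    then show False using i f D iI by (simp add: S_def)
   qed
  qed
  then show ?thesis using finite_supportD(1)[OF J(2)] finite_subset by blast
 qed
 define \<chi> where "\<chi> f = finprod QZ (%i. c i (\<pi> i\<cdot>f)) (S f)" for f
 have over: "\<chi> f = finprod QZ (%i. c i (\<pi> i\<cdot>f)) B" if f: "f : Hom C x P" and B: "finite B" "S f <= B" "B <= I" for f B
  unfolding \<chi>_def
 proof (rule Q.finprod_mono_neutral_cong_left[OF B(1,2)])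
  show "c i (\<pi> i\<cdot>f) = \<one>\<^bsub>QZ\<^esub>" if "i : B - S f" for i
  proof -
   have iI: "i : I" and "\<pi> i\<cdot>f = zro x (X i)" using that B(3) by (auto simp: S_def)
   then show ?thesis using charactersD(4)[OF c[OF iI] xo D(2)[OF iI]] by simp
  qed
  show "(%i. c i (\<pi> i\<cdot>f)) : B \<rightarrow> carrier QZ" using cf[OF _ f] B(3) by blast
 qed simp
 have SI: "S f <= I" for f by (auto simp: S_def)
 have ch: "restrict \<chi> (Hom C x P) : characters C x P"
 proof (rule charactersI)
  fix f assume f: "f : Hom C x P"
  show "\<chi> f : carrier QZ" unfolding \<chi>_def by (rule Q.finprod_closed) (use cf[OF _ f] SI in blast)
  fix g assume g: "g : Hom C x P"
  have fg: "pls f g : Hom C x P" using f g by auto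
  let ?B = "S f \<union> S g \<union> S (pls f g)"
  have B: "finite ?B" "?B <= I" using fin[OF f] fin[OF g] fin[OF fg] SI by auto
  have "\<chi> (pls f g) = finprod QZ (%i. c i (\<pi> i\<cdot>pls f g)) ?B" by (rule over[OF fg B(1) _ B(2)]) blast
  also have "... = finprod QZ (%i. c i (\<pi> i\<cdot>f) \<otimes>\<^bsub>QZ\<^esub> c i (\<pi> i\<cdot>g)) ?B"
  proof (rule Q.finprod_cong')
   show "c i (\<pi> i\<cdot>pls f g) = c i (\<pi> i\<cdot>f) \<otimes>\<^bsub>QZ\<^esub> c i (\<pi> i\<cdot>g)" if "i : ?B" for i
   proof -
    have iI: "i : I" using that B(2) by blast
    have "\<pi> i\<cdot>pls f g = pls (\<pi> i\<cdot>f) (\<pi> i\<cdot>g)" using \<pi>(1)[OF iI] f g by simp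
    then show ?thesis using charactersD(2)[OF c[OF iI] \<pi>f[OF iI f] \<pi>f[OF iI g]] by simp
   qed
   show "(%i. c i (\<pi> i\<cdot>f) \<otimes>\<^bsub>QZ\<^esub> c i (\<pi> i\<cdot>g)) : ?B \<rightarrow> carrier QZ"
    using cf[OF _ f] cf[OF _ g] B(2) by (auto simp del: in_Hom)
  qed simp
  also have "... = finprod QZ (%i. c i (\<pi> i\<cdot>f)) ?B \<otimes>\<^bsub>QZ\<^esub> finprod QZ (%i. c i (\<pi> i\<cdot>g)) ?B"
   by (rule Q.finprod_multf) (use cf[OF _ f] cf[OF _ g] B(2) in \<open>blast+\<close>)
  also have "... = \<chi> f \<otimes>\<^bsub>QZ\<^esub> \<chi> g"
  proof -
   have "S f <= ?B" "S g <= ?B" by blast+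
   from over[OF f B(1) this(1) B(2)] over[OF g B(1) this(2) B(2)] show ?thesis by (simp only:)
  qed
  finally show "\<chi> (pls f g) = \<chi> f \<otimes>\<^bsub>QZ\<^esub> \<chi> g" .
 qed
 have val: "\<chi> (io i\<cdot>f) = c i f" if i: "i : I" and f: "f : Hom C x (X i)" for i f
 proof -
  have iof: "io i\<cdot>f : Hom C x P" using D i f by auto
  have \<pi>io: "\<pi> j\<cdot>(io i\<cdot>f) = (if i = j then f else zro x (X j))" if j: "j : I" for j
  proof -
   have "\<pi> j\<cdot>(io i\<cdot>f) = (if i = j then ide (X j) else zro (X i) (X j))\<cdot>f"
    by (rule cmp_reduce[OF \<pi>(2)[OF j i]]) (use D i f \<pi>(1)[OF j] in auto)
   then show ?thesis using f D j by auto
  qed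
  have "S (io i\<cdot>f) <= {i}" using \<pi>io by (auto simp: S_def split: if_splits)
  then have "\<chi> (io i\<cdot>f) = finprod QZ (%j. c j (\<pi> j\<cdot>(io i\<cdot>f))) {i}"
   using over[OF iof, of "{i}"] i by simp
  also have "... = c i f"
   using \<pi>io[OF i] charactersD(1)[OF c[OF i] f] by simp
  finally show ?thesis .
 qed
 have "\<forall>i\<in>I. \<forall>f\<in>Hom C x (X i). restrict \<chi> (Hom C x P) (io i\<cdot>f) = c i f"
  using val D by auto
 then show ?thesis using ch by blast
qed

lemma characters_coproduct_ext:
 assumes x: "finitary x" and I: "small U (I :: 'u set)" and P: "is_coproduct C I X P io"
  and c: "\<chi> : characters C x P" "\<psi> : characters C x P"
  and eq: "!!i f. i : I ==> f : Hom C x (X i) ==> \<chi> (io i\<cdot>f) = \<psi> (io i\<cdot>f)"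
 shows "\<chi> = \<psi>"
proof (rule extensionalityI[OF charactersD(3)[OF c(1)] charactersD(3)[OF c(2)]])
 note D = is_coproductD[OF P] and xo = finitary_ob[OF x]
 fix f assume f: "f : Hom C x P"
 show "\<chi> f = \<psi> f"
 proof (rule finitary_induct[where R = "%f. \<chi> f = \<psi> f", OF x I P f])
  show "\<chi> (zro x P) = \<psi> (zro x P)"
   using charactersD(4)[OF c(1) xo D(1)] charactersD(4)[OF c(2) xo D(1)] by simp
  fix g i k assume g: "\<chi> g = \<psi> g" "g : Hom C x P" and i: "i : I" and k: "k : Hom C x (X i)"
  have h: "io i\<cdot>k : Hom C x P" using D i k by simp
  show "\<chi> (pls g (io i\<cdot>k)) = \<psi> (pls g (io i\<cdot>k))"
   unfolding charactersD(2)[OF c(1) g(2) h] charactersD(2)[OF c(2) g(2) h] g(1) eq[OF i k] ..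
 qed
qed

text \<open>
 The characters of \<open>Hom x y\<close> turn coproducts in \<open>y\<close> into products because \<open>x\<close> is finitary.
\<close>

lemma BC_dual_exists:
 assumes x: "finitary x"
 shows "\<exists>E. is_BC_dual C x E"
proof -
 note xo = finitary_ob[OF x]
 interpret Q: comm_group QZ by (rule QZ_comm_group)
 let ?H = "%h \<chi>. \<lambda>f\<in>Hom C x (dom h). \<chi> (h\<cdot>f)"
 interpret H: cohomological U C "char_group x" ?H
 proof (rule cohomological.intro[OF cg_category_axioms], rule cohomological_axioms.intro)
  show "comm_group (char_group x y)" if "y : ob" for y using char_group_comm_group xo that .
  show "small U (carrier (char_group x y))" if y: "y : ob" for y
  proof (rule small_subset)
   show "small U (PiE (Hom C x y) (%_. carrier QZ))"
    using loc_small xo y small_countable[OF QZ_countable] unfolding locally_small_def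
    by (intro small_PiE) blast+
   show "carrier (char_group x y) <= PiE (Hom C x y) (%_. carrier QZ)"
    unfolding char_group_simps by (intro subsetI PiE_I) (auto simp: extensional_arb[OF charactersD(3)] dest: charactersD(1) simp del: in_Hom)
  qed
  show Hc: "?H h \<chi> : carrier (char_group x (dom h))"
   if "h : arr" "\<chi> : carrier (char_group x (cod h))" for h \<chi>
   unfolding char_group_simps
   by (rule charactersI) (use that charactersD(1,2)[of \<chi> x "cod h"] in auto)
  show "?H h (\<chi> \<otimes>\<^bsub>char_group x (cod h)\<^esub> \<psi>) = ?H h \<chi> \<otimes>\<^bsub>char_group x (dom h)\<^esub> ?H h \<psi>"
   if "h : arr" for h \<chi> \<psi> using that by (auto intro!: restrict_ext)
  show "?H (ide y) \<chi> = \<chi>" if "y : ob" "\<chi> : carrier (char_group x y)" for y \<chi>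
   using that charactersD(3)[of \<chi> x y] by (auto simp: extensional_def restrict_def fun_eq_iff)
  show "?H (h'\<cdot>h) \<chi> = ?H h (?H h' \<chi>)" if "h : arr" "h' : arr" "cod h = dom h'" for h h' \<chi>
   using that by (auto intro!: restrict_ext)
  show "?H (pls h h') \<chi> = ?H h \<chi> \<otimes>\<^bsub>char_group x (dom h)\<^esub> ?H h' \<chi>"
   if "h : arr" "h' : arr" "dom h' = dom h" "cod h' = cod h" "\<chi> : carrier (char_group x (cod h))" for h h' \<chi>
   using that charactersD(2)[of \<chi> x "cod h"] by (auto intro!: restrict_ext)
  show "\<exists>\<psi>\<in>carrier (char_group x (cod g)). ?H g \<psi> = \<chi>"
   if t: "(f, g, h) : tri" and \<chi>: "\<chi> : carrier (char_group x (cod f))" "?H f \<chi> = \<one>\<^bsub>char_group x (dom f)\<^esub>" for f g h \<chi>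
  proof -
   have "\<chi> (f\<cdot>a) = \<one>\<^bsub>QZ\<^esub>" if "a : Hom C x (dom f)" for a
    using fun_cong[OF \<chi>(2), of a] that by simp
   then obtain \<psi> where \<psi>: "\<psi> : characters C x (cod g)" "\<forall>a\<in>Hom C x (cod f). \<psi> (g\<cdot>a) = \<chi> a"
    using characters_exact[OF t xo, of \<chi>] \<chi>(1) by auto
   have "?H g \<psi> = \<chi>"
    using \<psi>(2) charactersD(3)[of \<chi> x "cod f"] \<chi>(1) triD[OF t]
    by (auto simp: extensional_def restrict_def fun_eq_iff)
   then show ?thesis using \<psi>(1) by auto
  qed
  show "\<exists>\<chi>\<in>carrier (char_group x P). \<forall>i\<in>I. ?H (io i) \<chi> = c i"
   if I: "small U I" and P: "is_coproduct C I X P io" and c: "!!i. i : I ==> c i : carrier (char_group x (X i))"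
   for I :: "'u set" and X P io c
  proof -
   have c': "c i : characters C x (X i)" if "i : I" for i using c[OF that] by simp
   obtain \<chi> where \<chi>: "\<chi> : characters C x P" "\<forall>i\<in>I. \<forall>f\<in>Hom C x (X i). \<chi> (io i\<cdot>f) = c i f"
    using characters_coproduct[OF x I P c'] by blast
   have "?H (io i) \<chi> = c i" if i: "i : I" for i
    using \<chi>(2) i charactersD(3)[OF c'[OF i]] is_coproductD[OF P]
    by (auto simp: extensional_def restrict_def fun_eq_iff)
   then show ?thesis using \<chi>(1) by auto
  qed
  show "\<chi> = \<psi>"
   if I: "small U I" and P: "is_coproduct C I X P io" and c: "\<chi> : carrier (char_group x P)" "\<psi> : carrier (char_group x P)"
    and eq: "!!i. i : I ==> ?H (io i) \<chi> = ?H (io i) \<psi>" for I :: "'u set" and X P io \<chi> \<psi>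
  proof (rule characters_coproduct_ext[OF x I P])
   show "\<chi> (io i\<cdot>f) = \<psi> (io i\<cdot>f)" if "i : I" "f : Hom C x (X i)" for i f
    using fun_cong[OF eq[OF that(1)], of f] that is_coproductD[OF P] by simp
  qed (use c in auto)
 qed
 obtain Y al where Y: "Y : ob" "al : carrier (char_group x Y)"
  "!!B a. B : ob ==> a : carrier (char_group x B) ==> \<exists>f\<in>Hom C B Y. ?H f al = a"
  "!!B f f'. f : Hom C B Y ==> f' : Hom C B Y ==> ?H f al = ?H f' al ==> f = f'"
  using H.representable by metis
 have "bij_betw (%g. ?H g al) (Hom C y Y) (characters C x y)" if y: "y : ob" for y
  unfolding bij_betw_def
 proof
  show "inj_on (%g. ?H g al) (Hom C y Y)" by (rule inj_onI) (use Y(4) in blast)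
  show "(%g. ?H g al) ` Hom C y Y = characters C x y"
  proof
   show "(%g. ?H g al) ` Hom C y Y <= characters C x y"
   proof (rule image_subsetI)
    fix g assume "g : Hom C y Y"
    then show "?H g al : characters C x y" using H.H_map[of g al] Y(2) by auto
   qed
   show "characters C x y <= (%g. ?H g al) ` Hom C y Y"
    using Y(3)[OF y] unfolding char_group_simps by blast
  qed
 qed
 moreover have "\<forall>h\<in>arr. \<forall>g\<in>Hom C (cod h) Y. \<forall>f\<in>Hom C x (dom h).
   ?H (g\<cdot>h) al f = ?H g al (h\<cdot>f)"
  by auto
 ultimately show ?thesis
  unfolding is_BC_dual_def using Y(1) by (intro exI[of _ Y] conjI exI[of _ "%_ g. ?H g al"] ballI) blast+
qed

text \<open>What is needed of Brown--Comenetz duals is only that they separate the maps out of \<open>x\<close>.\<close>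

definition separates :: "'o => 'o => bool" where
 "separates E x \<longleftrightarrow> (\<forall>A\<in>ob. \<forall>a\<in>Hom C x A. a ~= zro x A --> (\<exists>e\<in>Hom C A E. e\<cdot>a ~= zro x E))"

lemma BC_dual_separates:
 assumes E: "is_BC_dual C x E" and x: "x : ob"
 shows "separates E x"
 unfolding separates_def
proof (intro ballI impI)
 fix A a assume A: "A : ob" and a: "a : Hom C x A" "a ~= zro x A"
 obtain \<phi> where bij: "!!y. y : ob ==> bij_betw (\<phi> y) (Hom C y E) (characters C x y)"
  and nat: "!!h g f. h : arr ==> g : Hom C (cod h) E ==> f : Hom C x (dom h) ==>
    \<phi> (dom h) (g\<cdot>h) f = \<phi> (cod h) g (h\<cdot>f)"
  using E unfolding is_BC_dual_def by blast
 have Eo: "E : ob" using E by (simp add: is_BC_dual_def)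
 have ch: "\<phi> y g : characters C x y" if "g : Hom C y E" for y g
 proof -
  have "y : ob" using that by auto
  then show ?thesis using bij_betw_apply[OF bij that] by blast
 qed
 obtain \<psi> where \<psi>: "\<psi> : hom (hom_group C x A) QZ" "\<psi> a ~= \<one>\<^bsub>QZ\<^esub>"
  by (rule characters_separate[OF hom_comm_group[OF x A], of a]) (use a in auto)
 have "restrict \<psi> (Hom C x A) : characters C x A"
 proof (rule charactersI)
  show "\<psi> f : carrier QZ" if "f : Hom C x A" for f using hom_carrier[OF \<psi>(1)] that by auto
  show "\<psi> (pls f g) = \<psi> f \<otimes>\<^bsub>QZ\<^esub> \<psi> g" if "f : Hom C x A" "g : Hom C x A" for f g
   using hom_mult[OF \<psi>(1), of f g] that by simp
 qed
 then obtain e where e: "e : Hom C A E" "\<phi> A e = restrict \<psi> (Hom C x A)"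
  using bij[OF A] unfolding bij_betw_def by (metis (no_types, lifting) imageE)
 have "e\<cdot>a ~= zro x E"
 proof
  assume z: "e\<cdot>a = zro x E"
  have 1: "\<phi> x (e\<cdot>a) (ide x) = \<psi> a"
   using nat[of a e "ide x"] a(1) e x by simp
  have "\<phi> x (zro x E) (ide x) = \<phi> x (zro x E) (zro x x)"
   using nat[of "zro x x" "zro x E" "ide x"] x Eo by simp
  also have "... = \<one>\<^bsub>QZ\<^esub>" using charactersD(4)[OF ch[of "zro x E" x]] x Eo by simp
  finally show False using 1 \<psi>(2) z by simp
 qed
 then show "\<exists>e\<in>Hom C A E. e\<cdot>a ~= zro x E" using e(1) by blast
qed

lemma BC_cogenerator_separates:
 shows "BC_cogenerator U C : ob" "x : compact_objects U C ==> separates (BC_cogenerator U C) x"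
proof -
 let ?Q = "%P. \<exists>B D pr. is_skeleton C (compact_objects U C) B &
    (\<forall>x\<in>B. is_BC_dual C x (D x)) & is_product C B D P pr"
 obtain B where B: "is_skeleton C (compact_objects U C) B" using skeleton_exists by blast
 have Bc: "x : compact_objects U C" if "x : B" for x using B that unfolding is_skeleton_def by blast
 obtain D where D: "!!x. x : B ==> is_BC_dual C x (D x)"
  using BC_dual_exists[OF compact_finitary[OF Bc]] by metis
 have "\<exists>P. ?Q P"
 proof (rule product_exists[OF skeleton_small[OF B], of D])
  show "D x : ob" if "x : B" for x using D[OF that] by (simp add: is_BC_dual_def)
 qed (use B D in blast)
 then have "?Q (BC_cogenerator U C)" unfolding BC_cogenerator_def by (rule someI_ex)
 then obtain B D pr where B: "is_skeleton C (compact_objects U C) B" and D: "!!x. x : B ==> is_BC_dual C x (D x)"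
  and P: "is_product C B D (BC_cogenerator U C) pr" by blast
 note DP = is_productD[OF P]
 let ?I = "BC_cogenerator U C"
 show Io: "?I : ob" using DP(1) .
 assume x: "x : compact_objects U C"
 then obtain y where y: "y : B" "isomorphic C x y" using B unfolding is_skeleton_def by blast
 obtain p q where pq: "p : Hom C x y" "q : Hom C y x" "q\<cdot>p = ide x" "p\<cdot>q = ide y"
  "x : ob" "y : ob" using y(2) by (rule isomorphicE)
 show "separates ?I x"
  unfolding separates_def
 proof (intro ballI impI)
  fix A a assume A: "A : ob" and a: "a : Hom C x A" "a ~= zro x A"
  have "a\<cdot>q ~= zro y A"
  proof
   assume "a\<cdot>q = zro y A"
   then have "a\<cdot>q\<cdot>p = zro x A" using pq A by simp
   then show False using a pq by simp
  qed
  moreover have "a\<cdot>q : Hom C y A" using a pq by auto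
  ultimately obtain e where e: "e : Hom C A (D y)" "e\<cdot>(a\<cdot>q) ~= zro y (D y)"
   using BC_dual_separates[OF D[OF y(1)] pq(6)] A unfolding separates_def by blast
  obtain h where h: "h : Hom C A ?I" "!!i. i : B ==> pr i\<cdot>h = (if i = y then e else zro A (D i))"
   by (rule is_product_map[OF P A, of "%i. if i = y then e else zro A (D i)"]) (use e(1) DP A in auto)
  have "h\<cdot>a ~= zro x ?I"
  proof
   assume z: "h\<cdot>a = zro x ?I"
   have "e\<cdot>(a\<cdot>q) = pr y\<cdot>h\<cdot>(a\<cdot>q)" using h(2)[OF y(1)] by simp
   also have "... = pr y\<cdot>(h\<cdot>a\<cdot>q)" using h(1) DP y(1) a pq by simp
   also have "... = zro y (D y)" unfolding z using DP y(1) pq Io by simp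
   finally show False using e(2) by simp
  qed
  then show "\<exists>e\<in>Hom C A ?I. e\<cdot>a ~= zro x ?I" using h(1) by blast
 qed
qed

end


section \<open>Cogeneration\<close>

context cg_category
begin

lemma colocalizingD:
 assumes "colocalizing U C D"
 shows "triangulated_subcategory C D"
  "small U I ==> (!!i. i : I ==> X i : D) ==> is_product C I X P pr ==> P : D"
proof -
 show "triangulated_subcategory C D" using assms by (simp add: colocalizing_def)
 assume I: "small U I" and X: "!!i. i : I ==> X i : D" and P: "is_product C I X P pr"
 obtain J :: "'u set" and e where J: "small U J" "J <= U" "bij_betw e J I" by (rule small_reindex[OF I])
 have "(X \<circ> e) ` J <= D" using J(3) X by (auto simp: bij_betw_def)
 then show "P : D"
  using assms J(1) is_product_reindex[OF P J(3)] unfolding colocalizing_def by blast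
qed

text \<open>
 A single map into a product of objects of \<open>\<E>\<close> that kills only what all maps into \<open>\<E>\<close> kill.
\<close>

lemma product_of_maps:
 assumes D: "colocalizing U C D" and E: "\<E> <= D" "small U \<E>" and A: "A : ob"
 obtains Q u where "Q : D" "u : Hom C A Q"
  "!!x a E e. a : Hom C x A ==> u\<cdot>a = zro x Q ==> E : \<E> ==> e : Hom C A E ==> e\<cdot>a = zro x E"
proof -
 note T = triangulated_subcategoryD[OF colocalizingD(1)[OF D]]
 let ?I = "Sigma \<E> (Hom C A)"
 have Eo: "E : ob" if "E : \<E>" for E using E(1) T(1) that by blast
 have I: "small U ?I" using loc_small A Eo by (intro small_Sigma[OF E(2)]) (simp add: locally_small_def)
 obtain Q pr where Q: "is_product C ?I fst Q pr" by (rule product_exists[OF I, of fst]) (use Eo in auto)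
 note DQ = is_productD[OF Q]
 obtain u where u: "u : Hom C A Q" "!!i. i : ?I ==> pr i\<cdot>u = snd i"
  by (rule is_product_map[OF Q A, of snd]) auto
 show thesis
 proof (rule that[OF _ u(1)])
  show "Q : D" by (rule colocalizingD(2)[OF D I _ Q]) (use E(1) in auto)
  fix x a F e assume a: "a : Hom C x A" "u\<cdot>a = zro x Q" and e: "F : \<E>" "e : Hom C A F"
  then have i: "(F, e) : ?I" by simp
  have "e\<cdot>a = pr (F, e)\<cdot>u\<cdot>a" using u(2)[OF i] by simp
  also have "... = pr (F, e)\<cdot>(u\<cdot>a)" using DQ i u(1) a(1) by simp
  also have "... = zro x F" unfolding a(2) using DQ i a(1) by auto
  finally show "e\<cdot>a = zro x F" .
 qed
qed

lemma detected_sh: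
 assumes E: "stable \<E>" and x: "x : ob"
  and det: "!!A a. a : Hom C x A ==> a ~= zro x A ==> \<exists>E\<in>\<E>. \<exists>e\<in>Hom C A E. e\<cdot>a ~= zro x E"
  and a: "a : Hom C (shO x) A" "a ~= zro (shO x) A"
 shows "\<exists>E\<in>\<E>. \<exists>e\<in>Hom C A E. e\<cdot>a ~= zro (shO x) E"
proof -
 have A: "A : ob" using a(1) by auto
 obtain B th th' where B: "B : ob" "th : Hom C (shO B) A" "th' : Hom C A (shO B)"
  "th'\<cdot>th = ide (shO B)" "th\<cdot>th' = ide A" using unshift_ob[OF A] .
 obtain b where b: "b : Hom C x B" "shM b = th'\<cdot>a"
  by (rule sh_full[of "th'\<cdot>a" x B]) (use a B x in auto)
 have "b ~= zro x B"
 proof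
  assume "b = zro x B"
  then have z: "th'\<cdot>a = zro (shO x) (shO B)" using b(2) x B(1) by simp
  have "a = th\<cdot>(th'\<cdot>a)" using cmp_reduce[OF B(5), of a] a(1) B by simp
  also have "... = zro (shO x) A" unfolding z using B(2) x by simp
  finally show False using a(2) by blast
 qed
 then obtain E e where e: "E : \<E>" "e : Hom C B E" "e\<cdot>b ~= zro x E" using det b(1) by blast
 have Eo: "E : ob" using e(2) by auto
 obtain F where F: "F : \<E>" "isomorphic C (shO E) F" using stableD(2)[OF E e(1)] by blast
 obtain p q where pq: "p : Hom C (shO E) F" "q : Hom C F (shO E)" "q\<cdot>p = ide (shO E)"
  "p\<cdot>q = ide F" "F : ob" using F(2) by (rule isomorphicE)
 have "p\<cdot>(shM e\<cdot>th')\<cdot>a ~= zro (shO x) F"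
 proof
  assume z: "p\<cdot>(shM e\<cdot>th')\<cdot>a = zro (shO x) F"
  have "shM (e\<cdot>b) = shM e\<cdot>(th'\<cdot>a)" using b e(2) by simp
  also have "... = q\<cdot>(p\<cdot>(shM e\<cdot>(th'\<cdot>a)))"
   using cmp_reduce[OF pq(3), of "shM e\<cdot>(th'\<cdot>a)"] pq e(2) B a by simp
  also have "... = q\<cdot>(p\<cdot>(shM e\<cdot>th')\<cdot>a)" using pq e(2) B a by simp
  also have "... = zro (shO x) (shO E)" unfolding z using pq x by simp
  finally show False using e b sh_zro_iff[of "e\<cdot>b" x E] by auto
 qed
 moreover have "p\<cdot>(shM e\<cdot>th') : Hom C A F" using pq e(2) B by auto
 ultimately show ?thesis using F(1) by blast
qed

lemma detected_unsh:
 assumes E: "stable \<E>" and y: "y : ob" "isomorphic C (shO y) x"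
  and det: "!!A a. a : Hom C x A ==> a ~= zro x A ==> \<exists>E\<in>\<E>. \<exists>e\<in>Hom C A E. e\<cdot>a ~= zro x E"
  and b: "b : Hom C y B" "b ~= zro y B"
 shows "\<exists>E\<in>\<E>. \<exists>e\<in>Hom C B E. e\<cdot>b ~= zro y E"
proof -
 have B: "B : ob" using b(1) by auto
 obtain p q where pq: "p : Hom C (shO y) x" "q : Hom C x (shO y)" "q\<cdot>p = ide (shO y)"
  "p\<cdot>q = ide x" "x : ob" using y(2) by (rule isomorphicE)
 have "shM b\<cdot>q ~= zro x (shO B)"
 proof
  assume z: "shM b\<cdot>q = zro x (shO B)"
  have "shM b = shM b\<cdot>q\<cdot>p" using pq b(1) by simp
  also have "... = zro (shO y) (shO B)" unfolding z using pq B by simp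
  finally show False using b sh_zro_iff by blast
 qed
 moreover have "shM b\<cdot>q : Hom C x (shO B)" using b(1) pq by auto
 ultimately obtain E e where e: "E : \<E>" "e : Hom C (shO B) E" "e\<cdot>(shM b\<cdot>q) ~= zro x E"
  using det by blast
 obtain F where F: "F : \<E>" "isomorphic C (shO F) E" using stableD(3)[OF E e(1)] by blast
 have Fo: "F : ob" using stableD(1)[OF E] F(1) by blast
 obtain r s where rs: "r : Hom C (shO F) E" "s : Hom C E (shO F)" "s\<cdot>r = ide (shO F)"
  "r\<cdot>s = ide E" "E : ob" using F(2) by (rule isomorphicE)
 obtain e' where e': "e' : Hom C B F" "shM e' = s\<cdot>e"
  by (rule sh_full[of "s\<cdot>e" B F]) (use e rs B Fo in auto)
 have "e'\<cdot>b ~= zro y F"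
 proof
  assume z: "e'\<cdot>b = zro y F"
  have "e\<cdot>(shM b\<cdot>q) = r\<cdot>(s\<cdot>(e\<cdot>(shM b\<cdot>q)))"
   using cmp_reduce[OF rs(4), of "e\<cdot>(shM b\<cdot>q)"] rs e(2) b(1) pq by simp
  also have "... = r\<cdot>((s\<cdot>e)\<cdot>shM b\<cdot>q)" using rs e(2) b(1) pq by simp
  also have "(s\<cdot>e)\<cdot>shM b = shM (e'\<cdot>b)" unfolding e'(2)[symmetric] using e'(1) b(1) by simp
  also have "r\<cdot>(shM (e'\<cdot>b)\<cdot>q) = zro x E" unfolding z using rs pq y(1) Fo by simp
  finally show False using e(3) by blast
 qed
 then show ?thesis using e'(1) F(1) by blast
qed

lemma zero_if_undetected:
 assumes S: "stable S" "G <= S" "loc U C G = ob" and Y: "Y : ob"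
  and z: "!!x m. x : S ==> m : Hom C x Y ==> m = zro x Y"
 shows "is_zero C Y"
proof -
 let ?P = "{B : ob. \<forall>m\<in>Hom C B Y. m = zro B Y}"
 have "Y : ?P"
 proof (rule devissage[where S = S and G = G])
  fix f g h assume t: "(f, g, h) : tri" and P: "cod f : ?P" "shO (dom f) : ?P"
  have "m = zro (cod g) Y" if m: "m : Hom C (cod g) Y" for m
  proof -
   have "m\<cdot>g = zro (cod f) Y" using P(1) m triD[OF t] by auto
   then obtain b where b: "b : Hom C (shO (dom f)) Y" "b\<cdot>h = m" using tri_ext2[OF t m] by blast
   then have "b = zro (shO (dom f)) Y" using P(2) by blast
   then show ?thesis using b(2) triD[OF t] Y by simp
  qed
  then show "cod g : ?P" using triD[OF t] by simp
 next
  fix I :: "'u set" and X Q io assume X: "X ` I <= ?P" and Q: "is_coproduct C I X Q io"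
  note DQ = is_coproductD[OF Q]
  have "m = zro Q Y" if m: "m : Hom C Q Y" for m
  proof (rule is_coproduct_ext[OF Q m])
   show "zro Q Y : Hom C Q Y" using DQ Y by simp
   fix i assume i: "i : I"
   then have "m\<cdot>io i = zro (X i) Y" using X m DQ by auto
   then show "m\<cdot>io i = zro Q Y\<cdot>io i" using DQ i Y by simp
  qed
  then show "Q : ?P" using DQ(1) by blast
 qed (use S Y z stableD(1)[OF S(1)] in auto)
 then have "ide Y = zro Y Y" using Y by simp
 then show ?thesis using Y is_zero_iff by blast
qed

text \<open>
 \<open>A\<close> is the homotopy limit of the tower: on maps from \<open>S\<close>, the approximation property makes the tower
 of the hom sets have the limit \<open>Hom x A\<close> and no derived limit.
\<close>

lemma tower_limit:
 assumes D: "colocalizing U C D" and A: "A : ob"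
  and S: "stable S" "!!x. x : S ==> shO x : S" "G <= S" "loc U C G = ob"
  and c: "!!n::nat. c n : Hom C A (X n)" "!!n. X n : D"
  and t: "!!n. t n : Hom C (X (Suc n)) (X n)" "!!n. t n\<cdot>c (Suc n) = c n"
  and mono: "!!x a. x : S ==> a : Hom C x A ==> c 0\<cdot>a = zro x (X 0) ==> a = zro x A"
  and approx: "!!n x b. x : S ==> b : Hom C x (X (Suc n)) ==> \<exists>a\<in>Hom C x A. t n\<cdot>b = c n\<cdot>a"
 shows "A : D"
proof -
 note T = triangulated_subcategoryD[OF colocalizingD(1)[OF D]]
 have Xo: "X n : ob" for n using T(1) c(2) by blast
 have So: "x : ob" if "x : S" for x using stableD(1)[OF S(1)] that by blast
 have N: "small U (UNIV :: nat set)" by (rule small_countable) simp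
 obtain Y pr where Y: "is_product C (UNIV :: nat set) X Y pr" by (rule product_exists[OF N]) (use Xo in blast)
 have DY [simp]: "Y : ob" "pr n : arr" "dom (pr n) = Y" "cod (pr n) = X n" for n
  using is_productD[OF Y] by simp_all
 have c' [simp]: "c n : arr" "dom (c n) = A" "cod (c n) = X n" for n using c(1)[of n] by simp_all
 have t' [simp]: "t n : arr" "dom (t n) = X (Suc n)" "cod (t n) = X n" for n using t(1)[of n] by simp_all
 have YD: "Y : D" using colocalizingD(2)[OF D N _ Y] c(2) by blast
 obtain s where s: "s : Hom C Y Y" "!!n. pr n\<cdot>s = t n\<cdot>pr (Suc n)"
  by (rule is_product_map[OF Y DY(1), of "%n. t n\<cdot>pr (Suc n)"]) auto
 define w where "w = sub (ide Y) s"
 have w [simp]: "w : arr" "dom w = Y" "cod w = Y" using s(1) by (simp_all add: w_def)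
 have prw: "pr n\<cdot>(w\<cdot>v) = sub (pr n\<cdot>v) (t n\<cdot>(pr (Suc n)\<cdot>v))" if v: "v : Hom C x Y" for n x v
 proof -
  have "pr n\<cdot>(w\<cdot>v) = sub (pr n\<cdot>v) (pr n\<cdot>s\<cdot>v)" using v s(1) by (simp add: w_def)
  also have "pr n\<cdot>s\<cdot>v = t n\<cdot>(pr (Suc n)\<cdot>v)" unfolding s(2) using v by simp
  finally show ?thesis .
 qed
 obtain r q where r: "(r, w, q) : tri" by (rule fibre[of w]) auto
 note R = triD[OF r]
 define Z where "Z = dom r"
 have r' [simp]: "r : arr" "dom r = Z" "cod r = Y" "Z : ob" "q : arr" "dom q = Y" "cod q = shO Z"
  using R by (simp_all add: Z_def)
 have ZD: "Z : D" unfolding Z_def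
  by (rule triangulated_subcategory_first[OF colocalizingD(1)[OF D] r]) (use YD in simp_all)
 obtain y0 where y0: "y0 : Hom C A Y" "!!n. pr n\<cdot>y0 = c n"
  by (rule is_product_map[OF Y A, of c]) auto
 have "w\<cdot>y0 = zro A Y"
 proof (rule is_product_ext[OF Y])
  fix n show "pr n\<cdot>(w\<cdot>y0) = pr n\<cdot>zro A Y"
   unfolding prw[OF y0(1)] y0(2) t(2) using A c' Xo by simp
 qed (use y0(1) A in auto)
 then obtain z where z: "z : Hom C A Z" "r\<cdot>z = y0"
  using tri_lift[OF r, of y0 A] y0(1) by auto
 have z' [simp]: "z : arr" "dom z = A" "cod z = Z" using z(1) by simp_all
 have pz: "pr n\<cdot>(r\<cdot>(z\<cdot>a)) = c n\<cdot>a" if a: "a : Hom C x A" for n x a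
 proof -
  have "pr n\<cdot>(r\<cdot>(z\<cdot>a)) = pr n\<cdot>(r\<cdot>z)\<cdot>a" using a by simp
  also have "... = c n\<cdot>a" unfolding z(2) y0(2) ..
  finally show ?thesis .
 qed
 have inj: "a = zro x A" if x: "x : S" and a: "a : Hom C x A" "z\<cdot>a = zro x Z" for x a
  using mono[OF x a(1)] pz[OF a(1), of 0] a(2) So[OF x] Xo by simp
 have monon: "a = zro x A" if x: "x : S" and a: "a : Hom C x A" "c n\<cdot>a = zro x (X n)" for x a n
  using a(2)
 proof (induction n)
  case 0 then show ?case using mono[OF x a(1)] by blast
 next
  case (Suc n)
  have "c n\<cdot>a = t n\<cdot>(c (Suc n)\<cdot>a)" using cmp_reduce[OF t(2), of n a] a(1) by simp
  then show ?case using Suc So[OF x] Xo by simp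
 qed
 \<comment> \<open>The obstruction to lifting maps into the tower vanishes: an explicit solution of
  \<open>v n - t n v (n + 1) = y n\<close>.\<close>
 have lim1: "\<exists>v\<in>Hom C x Y. w\<cdot>v = y" if x: "x : S" and y: "y : Hom C x Y" for x y
 proof -
  have xo [simp]: "x : ob" by (rule So[OF x])
  have y' [simp]: "y : arr" "dom y = x" "cod y = Y" using y by simp_all
  have "\<exists>e. e : Hom C x A & t n\<cdot>(pr (Suc n)\<cdot>y) = c n\<cdot>e" for n
   using approx[OF x, of "pr (Suc n)\<cdot>y" n] by auto
  then obtain e where e: "!!n. e n : Hom C x A" "!!n. t n\<cdot>(pr (Suc n)\<cdot>y) = c n\<cdot>e n" by metis
  have e' [simp]: "e n : arr" "dom (e n) = x" "cod (e n) = A" for n using e(1)[of n] by simp_all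
  define f where "f = rec_nat (zro x A) (%n f. sub f (e n))"
  have f [simp]: "f n : arr" "dom (f n) = x" "cod (f n) = A" for n
   unfolding f_def by (induction n) (use A in auto)
  have fS: "f (Suc n) = sub (f n) (e n)" for n by (simp add: f_def)
  obtain v where v: "v : Hom C x Y" "!!n. pr n\<cdot>v = pls (pr n\<cdot>y) (c n\<cdot>f n)"
   by (rule is_product_map[OF Y xo, of "%n. pls (pr n\<cdot>y) (c n\<cdot>f n)"]) auto
  have "w\<cdot>v = y"
  proof (rule is_product_ext[OF Y])
   fix n
   have "t n\<cdot>(pr (Suc n)\<cdot>v) = pls (c n\<cdot>e n) (t n\<cdot>(c (Suc n)\<cdot>f (Suc n)))"
    unfolding v(2) using e(2)[of n] by simp
   also have "t n\<cdot>(c (Suc n)\<cdot>f (Suc n)) = c n\<cdot>f (Suc n)" using cmp_reduce[OF t(2), of n "f (Suc n)"] by simp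
   also have "pls (c n\<cdot>e n) (c n\<cdot>f (Suc n)) = c n\<cdot>pls (e n) (f (Suc n))" by simp
   also have "pls (e n) (f (Suc n)) = f n" unfolding fS using pls_comm[of "e n" "sub (f n) (e n)"] sub_pls[of "f n" "e n"] by simp
   finally have "t n\<cdot>(pr (Suc n)\<cdot>v) = c n\<cdot>f n" .
   then show "pr n\<cdot>(w\<cdot>v) = pr n\<cdot>y"
    unfolding prw[OF v(1)] v(2) by (simp add: pls_assoc)
  qed (use v(1) in auto)
  then show ?thesis using v(1) by blast
 qed
 have sur: "\<exists>a\<in>Hom C x A. z\<cdot>a = b" if x: "x : S" and b: "b : Hom C x Z" for x b
 proof -
  have xo [simp]: "x : ob" by (rule So[OF x])
  have b' [simp]: "b : arr" "dom b = x" "cod b = Z" using b by simp_all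
  have "\<exists>e. e : Hom C x A & t n\<cdot>(pr (Suc n)\<cdot>(r\<cdot>b)) = c n\<cdot>e" for n
   using approx[OF x, of "pr (Suc n)\<cdot>(r\<cdot>b)" n] by auto
  then obtain a where a: "!!n. a n : Hom C x A" "!!n. t n\<cdot>(pr (Suc n)\<cdot>(r\<cdot>b)) = c n\<cdot>a n" by metis
  have a' [simp]: "a n : arr" "dom (a n) = x" "cod (a n) = A" for n using a(1)[of n] by simp_all
  have "w\<cdot>(r\<cdot>b) = zro x Y" using cmp_reduce[OF tri_cmp1[OF r], of b] R by simp
  then have y: "pr n\<cdot>(r\<cdot>b) = c n\<cdot>a n" for n
   using prw[of "r\<cdot>b" x n] Xo sub_eq_zro[of "pr n\<cdot>(r\<cdot>b)" "t n\<cdot>(pr (Suc n)\<cdot>(r\<cdot>b))" x "X n"] a(2) by simp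
  have an: "a (Suc n) = a n" for n
  proof -
   have "c n\<cdot>a n = t n\<cdot>(c (Suc n)\<cdot>a (Suc n))" using a(2)[of n] y[of "Suc n"] by simp
   also have "... = c n\<cdot>a (Suc n)" using cmp_reduce[OF t(2), of n "a (Suc n)"] by simp
   finally have eq: "c n\<cdot>a n = c n\<cdot>a (Suc n)" .
   have "c n\<cdot>sub (a (Suc n)) (a n) = zro x (X n)" using eq by simp
   then have "sub (a (Suc n)) (a n) = zro x A" using monon[OF x] by simp
   then show ?thesis by (rule sub_eq_zro) simp_all
  qed
  have a0: "a n = a 0" for n by (induction n) (simp_all add: an)
  let ?d = "sub b (z\<cdot>a 0)"
  have "r\<cdot>?d = zro x Y"
  proof (rule is_product_ext[OF Y])
   fix n show "pr n\<cdot>(r\<cdot>?d) = pr n\<cdot>zro x Y"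
    using y[of n] pz[OF a(1)[of 0], of n] a0[of n] Xo by simp
  qed simp_all
  then obtain v where v: "v : Hom C (shO x) Y" "q\<cdot>v = shM ?d"
   using tri_lift0[OF r, of ?d x] by auto
  obtain u where u: "u : Hom C (shO x) Y" "w\<cdot>u = v" using lim1[OF S(2)[OF x] v(1)] by blast
  have "shM ?d = q\<cdot>(w\<cdot>u)" using v(2) u(2) by simp
  also have "... = zro (shO x) (shO Z)" using cmp_reduce[OF tri_cmp2[OF r], of u] u(1) by simp
  finally have "?d = zro x Z" by (rule sh_zro_iff) simp
  then have "b = z\<cdot>a 0" by (rule sub_eq_zro) simp_all
  then show ?thesis using a(1) by blast
 qed
 obtain g h where tz: "(z, g, h) : tri" using tri_cone[of z] by auto
 note TZ = triD[OF tz]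
 have "is_zero C (cod g)"
 proof (rule zero_if_undetected[OF S(1,3,4)])
  show "cod g : ob" using TZ by simp
  fix x m assume x: "x : S" and m: "m : Hom C x (cod g)"
  have xo [simp]: "x : ob" by (rule So[OF x])
  obtain x' where x': "x' : S" "isomorphic C (shO x') x" using stableD(3)[OF S(1) x] by blast
  obtain p p' where p: "p : Hom C (shO x') x" "p' : Hom C x (shO x')" "p'\<cdot>p = ide (shO x')"
   "p\<cdot>p' = ide x" using x'(2) by (rule isomorphicE)
  obtain a where a: "a : Hom C x' A" "shM a = h\<cdot>(m\<cdot>p)"
   by (rule sh_full[of "h\<cdot>(m\<cdot>p)" x' A]) (use m p TZ A So[OF x'(1)] in auto)
  have "shM (z\<cdot>a) = shM z\<cdot>(h\<cdot>(m\<cdot>p))" using a by simp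
  also have "... = zro (shO x') (shO Z)"
   using cmp_reduce[OF tri_cmp3[OF tz], of "m\<cdot>p"] m p TZ by simp
  finally have "z\<cdot>a = zro x' Z" by (rule sh_zro_iff) (use a in simp)
  then have "a = zro x' A" by (rule inj[OF x'(1) a(1)])
  then have hmp: "h\<cdot>(m\<cdot>p) = zro (shO x') (shO A)" using a(2) A So[OF x'(1)] by simp
  have "h\<cdot>m = h\<cdot>(m\<cdot>p)\<cdot>p'" using m p TZ by simp
  also have "... = zro x (shO A)" unfolding hmp using p A by simp
  finally have "h\<cdot>m = zro x (cod h)" using TZ by simp
  then obtain b where b: "b : Hom C x Z" "g\<cdot>b = m" using tri_lift2[OF tz m] by auto
  obtain a where a: "a : Hom C x A" "z\<cdot>a = b" using sur[OF x b(1)] by blast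
  have "m = g\<cdot>(z\<cdot>a)" using a b by simp
  also have "... = zro x (cod g)" using cmp_reduce[OF tri_cmp1[OF tz], of a] a(1) TZ by simp
  finally show "m = zro x (cod g)" .
 qed
 then have "isomorphic C A Z" using isomorphic_iso[OF tri_iso_if_zero[OF tz]] by simp
 then show ?thesis using T(2)[OF ZD] isomorphic_sym by blast
qed

text \<open>
 An Adams resolution. From \<open>c : A \<rightarrow> X\<close> with \<open>X : D\<close>, the next stage is the fibre of a map from \<open>X\<close>
 through the cone of \<open>c\<close> to a product of suspensions of \<open>I\<close> which is injective on maps from \<open>S\<close> out of the
 cone; so a map from \<open>S\<close> to the next stage comes from \<open>A\<close> one stage earlier.
\<close>

theorem cogeneration:
 assumes D: "colocalizing U C D" and I: "I : D"
  and sep: "!!x. x : compact_objects U C ==> separates I x"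
 shows "D = ob"
proof
 note TD = colocalizingD(1)[OF D] and T = triangulated_subcategoryD[OF colocalizingD(1)[OF D]]
 show "D <= ob" using T(1) by blast
 define unsh where "unsh x = (SOME y. y : D & isomorphic C (shO y) x)" for x
 have unsh: "unsh x : D & isomorphic C (shO (unsh x)) x" if x: "x : D" for x
  unfolding unsh_def
 proof (rule someI_ex)
  obtain y p q where "y : D" "p : Hom C (shO y) x" "q : Hom C x (shO y)"
   "q\<cdot>p = ide (shO y)" "p\<cdot>q = ide x"
   using triangulated_subcategory_unshift[OF TD x] .
  then show "\<exists>y. y : D & isomorphic C (shO y) x" using isomorphicI by blast
 qed
 obtain \<E> where \<E>: "{I} <= \<E>" "small U \<E>" "!!x y. x : \<E> ==> y : \<E> ==> {shO x, unsh x} <= \<E>" "!!x. x : \<E> ==> x : D"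
 proof (rule small_closure[of "{I}" "%x _. {shO x, unsh x}" "%x. x : D"])
  show "small U {I}" "small U {shO x, unsh x}" for x by (simp_all add: small_countable)
  show "z : D" if "x : D" "z : {shO x, unsh x}" for x z
   using that T(1,4)[of x] unsh[of x] by auto
 qed (use I in auto)
 have \<E>D: "\<E> <= D" using \<E>(4) by blast
 have st: "stable \<E>"
  unfolding stable_def
 proof (intro conjI ballI)
  show "\<E> <= ob" using \<E>D T(1) by blast
  fix x assume x: "x : \<E>"
  have "shO x : \<E>" "unsh x : \<E>" using \<E>(3)[OF x x] by auto
  then show "\<exists>y\<in>\<E>. isomorphic C (shO x) y" "\<exists>y\<in>\<E>. isomorphic C (shO y) x"
   using unsh[OF \<E>(4)[OF x]] T(1)[OF \<E>(4)] by (meson isomorphic_refl)+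
 qed
 \<comment> \<open>Detection by the suspensions and desuspensions of \<open>I\<close> is stable under suspension, unlike detection by \<open>I\<close> alone.\<close>
 define S where "S = {x : ob. \<forall>A. \<forall>a\<in>Hom C x A. a ~= zro x A --> (\<exists>E\<in>\<E>. \<exists>e\<in>Hom C A E. e\<cdot>a ~= zro x E)}"
 have SD: "x : ob" "!!A a. a : Hom C x A ==> a ~= zro x A ==> \<exists>E\<in>\<E>. \<exists>e\<in>Hom C A E. e\<cdot>a ~= zro x E"
  if "x : S" for x using that unfolding S_def by blast+
 have Ssh: "shO x : S" if x: "x : S" for x
  using detected_sh[OF st SD(1)[OF x] SD(2)[OF x]] SD(1)[OF x] unfolding S_def by (simp del: in_Hom)
 have Sst: "stable S"
  unfolding stable_def
 proof (intro conjI ballI)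
  show "S <= ob" by (auto simp: S_def)
  fix x assume x: "x : S"
  show "\<exists>y\<in>S. isomorphic C (shO x) y" using Ssh[OF x] SD(1)[OF x] by (meson isomorphic_refl SD(1))
  obtain y p q where y: "y : ob" "p : Hom C (shO y) x" "q : Hom C x (shO y)"
   "q\<cdot>p = ide (shO y)" "p\<cdot>q = ide x" using unshift_ob[OF SD(1)[OF x]] .
  have i: "isomorphic C (shO y) x" using y(2-) by (rule isomorphicI)
  have "y : S" using detected_unsh[OF st y(1) i SD(2)[OF x]] y(1) unfolding S_def by blast
  then show "\<exists>y\<in>S. isomorphic C (shO y) x" using i by blast
 qed
 obtain G where G: "G <= compact_objects U C" "loc U C G = ob" using generated by blast
 have GS: "G <= S"
 proof
  fix x assume "x : G"
  then have x: "x : compact_objects U C" using G(1) by blast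
  have "\<exists>E\<in>\<E>. \<exists>e\<in>Hom C A E. e\<cdot>a ~= zro x E" if a: "a : Hom C x A" "a ~= zro x A" for A a
  proof -
   have "A : ob" using a(1) by auto
   then show ?thesis using sep[OF x] a \<E>(1) unfolding separates_def by blast
  qed
  then show "x : S" using x unfolding S_def compact_objects_def by blast
 qed
 show "ob <= D"
 proof
  fix A assume A: "A : ob"
  have mono: "\<exists>Q\<in>D. \<exists>u\<in>Hom C B Q. \<forall>x\<in>S. \<forall>a\<in>Hom C x B. u\<cdot>a = zro x Q --> a = zro x B" if B: "B : ob" for B
  proof -
   obtain Q u where Q: "Q : D" "u : Hom C B Q"
    "!!x a E e. a : Hom C x B ==> u\<cdot>a = zro x Q ==> E : \<E> ==> e : Hom C B E ==> e\<cdot>a = zro x E"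
    using product_of_maps[OF D \<E>D \<E>(2) B] by blast
   have "a = zro x B" if "x : S" "a : Hom C x B" "u\<cdot>a = zro x Q" for x a
    using SD(2)[OF that(1,2)] Q(3)[OF that(2,3)] by blast
   then show ?thesis using Q(1,2) by blast
  qed
  define step where "step c c' \<longleftrightarrow> (\<exists>t\<in>Hom C (cod c') (cod c). t\<cdot>c' = c &
    (\<forall>x\<in>S. \<forall>b\<in>Hom C x (cod c'). \<exists>a\<in>Hom C x A. t\<cdot>b = c\<cdot>a))" for c c'
  \<comment> \<open>The fibre of the composite of \<open>c\<close>'s cone map \<open>d\<close> with the detecting map \<open>u\<close>.\<close>
  have step: "\<exists>c'. (c' : arr & dom c' = A & cod c' : D) & step c c'"
   if c: "c : arr & dom c = A & cod c : D" for c
  proof -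
   obtain d k where d: "(c, d, k) : tri" using tri_cone c by blast
   note Td = triD[OF d]
   obtain Q u where Q: "Q : D" "u : Hom C (cod d) Q"
    "!!x a. x : S ==> a : Hom C x (cod d) ==> u\<cdot>a = zro x Q ==> a = zro x (cod d)"
    using mono[of "cod d"] Td by auto
   obtain t q where t: "(t, u\<cdot>d, q) : tri" by (rule fibre[of "u\<cdot>d"]) (use Q Td in auto)
   note Tt = triD[OF t]
   have ct: "cod t = cod c" using Tt(4) Q(2) Td by simp
   have "u\<cdot>d\<cdot>c = zro A (cod (u\<cdot>d))"
    using tri_cmp1[OF d] Q(2) Td c A by simp
   then obtain c' where c': "c' : Hom C A (dom t)" "t\<cdot>c' = c"
    using tri_lift[OF t, of c A] c ct by auto
   have tD: "dom t : D"
    by (rule triangulated_subcategory_first[OF TD t]) (use ct c Q Td in auto)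
   have ap: "\<exists>a\<in>Hom C x A. t\<cdot>b = c\<cdot>a" if x: "x : S" and b: "b : Hom C x (dom t)" for x b
   proof -
    have tb: "t\<cdot>b : Hom C x (cod c)" using b Tt ct by auto
    have "u\<cdot>(d\<cdot>(t\<cdot>b)) = (u\<cdot>d)\<cdot>t\<cdot>b" using b Tt ct Q(2) Td by simp
    also have "... = zro x Q" unfolding tri_cmp1[OF t] using b Tt Q(2) Td T(1)[OF Q(1)] by simp
    finally have "d\<cdot>(t\<cdot>b) = zro x (cod d)" using Q(3)[OF x] tb Td by auto
    then obtain a where "a : Hom C x A" "c\<cdot>a = t\<cdot>b" using tri_lift[OF d tb] c by auto
    then show ?thesis by (metis (no_types))
   qed
   have cc: "cod c' = dom t" "c' : arr" "dom c' = A" using c'(1) by auto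
   have "step c c'"
    unfolding step_def cc(1)
    by (rule bexI[of _ t]) (use c'(2) ap Tt ct in \<open>auto simp del: in_Hom\<close>, simp)
   then show ?thesis using cc tD by metis
  qed
  obtain Q u where Q: "Q : D" "u : Hom C A Q"
   "!!x a. x : S ==> a : Hom C x A ==> u\<cdot>a = zro x Q ==> a = zro x A"
   using mono[OF A] by blast
  have "\<exists>c. \<forall>n. ((c n : arr & dom (c n) = A & cod (c n) : D) & (n = 0 --> c n = u)) & step (c n) (c (Suc n))"
  proof (rule dependent_nat_choice)
   show "\<exists>c. (c : arr & dom c = A & cod c : D) & (0 = (0::nat) --> c = u)" using Q by auto
  qed (use step in blast)
  then obtain c where c: "!!n. c n : arr" "!!n. dom (c n) = A" "!!n. cod (c n) : D" "c 0 = u"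
   "!!n. step (c n) (c (Suc n))" by metis
  obtain t where t: "!!n. t n : Hom C (cod (c (Suc n))) (cod (c n))" "!!n. t n\<cdot>c (Suc n) = c n"
   "!!n x b. x : S ==> b : Hom C x (cod (c (Suc n))) ==> \<exists>a\<in>Hom C x A. t n\<cdot>b = c n\<cdot>a"
   using c(5) unfolding step_def by metis
  show "A : D"
   by (rule tower_limit[where c = c and t = t, OF D A Sst Ssh GS G(2) _ c(3) t(1,2) _ t(3)])
    (use c Q in auto)
 qed
qed

end


section \<open>Verdier quotients as categories of fractions\<close>

locale verdier_localization = triangulated_category C
 for C :: "('o, 'm, 'x) tricat_scheme" (structure) +
 fixes M :: "'o set" and Q :: "('o, ('m \<times> 'm) set, 'z) cat_scheme"
 assumes M_sub: "triangulated_subcategory C M"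
  and Q_fields: "Ob Q = Ob (verdier_pre C M)" "Arr Q = Arr (verdier_pre C M)"
   "Dom Q = Dom (verdier_pre C M)" "Cod Q = Cod (verdier_pre C M)"
   "Ide Q = Ide (verdier_pre C M)" "Cmp Q = Cmp (verdier_pre C M)"
begin

abbreviation W :: "'m set" where "W \<equiv> weak_equivalences C M"
abbreviation cls :: "'m => 'm => ('m \<times> 'm) set" where "cls s f \<equiv> roof_class C M (s, f)"
abbreviation req :: "'m \<times> 'm => 'm \<times> 'm => bool" where "req \<equiv> roof_equiv C M"

abbreviation Qcmp (infixl "\<odot>" 70) where "R \<odot> R' \<equiv> Cmp Q R R'"

lemmas M_D = triangulated_subcategoryD[OF M_sub]

lemma W_arr [simp]: "s : W ==> s : arr" by (simp add: weak_equivalences_def)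

lemma W_I: "(f, g, h) : tri ==> cod g : M ==> f : W"
 using triD[of f g h] unfolding weak_equivalences_def by blast

lemma W_cone:
 assumes s: "s : W" and t: "(s, g, h) : tri" shows "cod g : M"
proof -
 obtain g' h' where t': "(s, g', h') : tri" "cod g' : M" using s unfolding weak_equivalences_def by blast
 have "\<exists>c\<in>Hom C (cod g') (cod g). is_iso C c"
  by (rule tri_iso_third[OF t'(1) t, of "ide (dom s)" "ide (cod s)"]) (use s in auto)
 then show ?thesis using M_D(2)[OF t'(2)] unfolding isomorphic_def by blast
qed

lemma W_ide [simp]: assumes "x : ob" shows "ide x : W"
proof -
 obtain z where z: "is_zero C z" using zero_object by blast
 show ?thesis by (rule W_I[OF tri_ide[OF assms z]]) (use z assms M_D(3) in simp)
qed

lemma W_cmp [simp]: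
 assumes f: "f : W" and g: "g : W" and fg: "cod f = dom g" shows "g\<cdot>f : W"
proof -
 obtain f1 f2 where t: "(f, f1, f2) : tri" using tri_cone[OF W_arr[OF f]] by blast
 obtain g1 g2 where t': "(g, g1, g2) : tri" using tri_cone[OF W_arr[OF g]] by blast
 obtain h1 h2 where t'': "(g\<cdot>f, h1, h2) : tri" using tri_cone[of "g\<cdot>f"] f g fg by fastforce
 obtain u v where uv: "(u, v, shM f1\<cdot>g2) : tri" "u\<cdot>f1 = h1\<cdot>g" "h2\<cdot>u = f2" "v\<cdot>h1 = g1" "g2\<cdot>v = shM f\<cdot>h2"
  using octahedral[OF t t' fg t''] by blast
 note T = triD[OF t] triD[OF t'] triD[OF t''] triD[OF uv(1)]
 \<comment> \<open>The octahedral axiom does not give the ends of \<open>u\<close> and \<open>v\<close> separately: they follow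
  from the triangle they form with \<open>\<Sigma> f1\<cdot>g2\<close>.\<close>
 have "dom (g2\<cdot>v) = dom (shM f\<cdot>h2)" using uv(5) by (rule arg_cong)
 then have u: "cod u = cod h1" using T fg by simp
 have "dom (h2\<cdot>u) = dom f2" using uv(3) by (rule arg_cong)
 then have "dom u = cod f1" using T u by simp
 then have "dom u : M" using W_cone[OF f t] by simp
 moreover have "cod v = cod g1" using T fg by simp
 then have "cod v : M" using W_cone[OF g t'] by simp
 ultimately have "cod h1 : M" using triangulated_subcategory_second[OF M_sub uv(1)] u by simp
 then show ?thesis by (rule W_I[OF t''])
qed

lemma W_ore:
 assumes f: "f : arr" and t: "t : W" and ft: "cod f = cod t"
 obtains u v where "u : W" "v : arr" "cod u = dom f" "dom v = dom u" "cod v = dom t"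
  "f\<cdot>u = t\<cdot>v"
proof -
 obtain g h where T: "(t, g, h) : tri" using tri_cone[OF W_arr[OF t]] by blast
 note T' = triD[OF T]
 obtain u q where F: "(u, g\<cdot>f, q) : tri" by (rule fibre[of "g\<cdot>f"]) (use f ft T' in auto)
 note F' = triD[OF F]
 have c: "cod u = dom f" "cod (g\<cdot>f) = cod g" using F' f ft T' by simp_all
 have u: "u : W" by (rule W_I[OF F]) (use W_cone[OF t T] c in simp)
 have "g\<cdot>(f\<cdot>u) = zro (dom u) (cod g)" using tri_cmp1[OF F] f ft T' F' c by simp
 then obtain v where v: "v : Hom C (dom u) (dom t)" "t\<cdot>v = f\<cdot>u"
  using tri_lift[OF T, of "f\<cdot>u" "dom u"] f ft F' c by auto
 show thesis by (rule that[OF u, of v]) (use v c in auto)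
qed

lemma W_cancel:
 assumes f: "f : Hom C a w" "f' : Hom C a w" and t: "t : W" "dom t = w" and eq: "t\<cdot>f = t\<cdot>f'"
 obtains u where "u : W" "cod u = a" "f\<cdot>u = f'\<cdot>u"
proof -
 obtain r q where R: "(r, t, q) : tri" by (rule fibre[OF W_arr[OF t(1)]])
 note R' = triD[OF R]
 have rM: "dom r : M"
 proof -
  have "shO (dom r) : M" using W_cone[OF t(1) tri_rot[OF R]] R' by simp
  then show ?thesis using M_D(4) R' by simp
 qed
 have "t\<cdot>sub f f' = zro a (cod t)" using f t eq by simp
 then obtain e where e: "e : Hom C a (dom r)" "r\<cdot>e = sub f f'"
  using tri_lift[OF R, of "sub f f'" a] f t(2) R' by auto
 obtain u q' where F: "(u, e, q') : tri" by (rule fibre[of e]) (use e in auto)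
 note F' = triD[OF F]
 have u: "u : W" by (rule W_I[OF F]) (use e rM in simp)
 have c: "cod u = a" using F' e by simp
 have "sub f f'\<cdot>u = r\<cdot>(e\<cdot>u)" unfolding e(2)[symmetric] using e(1) R' F' c by simp
 also have "... = zro (dom u) w" using tri_cmp1[OF F] e(1) R' F' t(2) by simp
 finally have "sub (f\<cdot>u) (f'\<cdot>u) = zro (dom u) w" using f u c by simp
 then have "f\<cdot>u = f'\<cdot>u" by (rule sub_eq_zro) (use f u c in auto)
 then show thesis using that u c by blast
qed

lemma roofs_iff: "(s, f) : roofs C M \<longleftrightarrow> s : W & f : arr & dom s = dom f"
 by (simp add: roofs_def)

lemma reqI:
 assumes "s : W" "f : arr" "dom s = dom f" "s' : W" "f' : arr" "dom s' = dom f'"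
  "u : arr" "v : arr" "dom u = dom v" "cod u = dom s" "cod v = dom s'"
  "s\<cdot>u : W" "s\<cdot>u = s'\<cdot>v" "f\<cdot>u = f'\<cdot>v"
 shows "req (s, f) (s', f')"
 unfolding roof_equiv_def roofs_iff prod.case using assms by blast

lemma reqE:
 assumes "req (s, f) (s', f')"
 obtains u v where "s : W" "f : arr" "dom f = dom s" "s' : W" "f' : arr" "dom f' = dom s'"
  "u : arr" "v : arr" "dom v = dom u" "cod u = dom s" "cod v = dom s'"
  "s\<cdot>u : W" "s\<cdot>u = s'\<cdot>v" "f\<cdot>u = f'\<cdot>v"
 using assms unfolding roof_equiv_def roofs_iff by auto

lemma req_refl: "(s, f) : roofs C M ==> req (s, f) (s, f)"
 unfolding roofs_iff by (rule reqI[where u = "ide (dom s)" and v = "ide (dom s)"]) auto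

lemma req_sym: "req r r' ==> req r' r"
 by (cases r; cases r') (auto elim!: reqE intro: reqI)

lemma req_ends: "req (s, f) (s', f') ==> cod s' = cod s & cod f' = cod f"
proof (erule reqE)
 fix u v assume a: "s : W" "f : arr" "dom f = dom s" "s' : W" "f' : arr" "dom f' = dom s'"
  "u : arr" "v : arr" "cod u = dom s" "cod v = dom s'" "s\<cdot>u = s'\<cdot>v" "f\<cdot>u = f'\<cdot>v"
 have "cod (s\<cdot>u) = cod s" "cod (s'\<cdot>v) = cod s'" "cod (f\<cdot>u) = cod f" "cod (f'\<cdot>v) = cod f'"
  using a(1-10) by simp_all
 then show ?thesis using a(11,12) by metis
qed

text \<open>Two roofs with the same legs up to a common refinement of their left legs: the right
 legs agree after a further refinement.\<close>

lemma refine: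
 assumes s: "s : W" and u: "u : arr" "cod u = dom s" "s\<cdot>u : W"
  and u': "u' : arr" "cod u' = dom s" "s\<cdot>u' : W"
 obtains p q where "p : W" "q : arr" "cod p = dom u" "cod q = dom u'" "dom q = dom p"
  "u\<cdot>p = u'\<cdot>q"
proof -
 obtain p q where pq: "p : W" "q : arr" "cod p = dom (s\<cdot>u)" "dom q = dom p"
  "cod q = dom (s\<cdot>u')" "s\<cdot>u\<cdot>p = s\<cdot>u'\<cdot>q"
  by (rule W_ore[of "s\<cdot>u" "s\<cdot>u'"]) (use s u u' in auto)
 have d: "cod p = dom u" "cod q = dom u'" using pq(3,5) s u u' by simp_all
 obtain r where r: "r : W" "cod r = dom p" "u\<cdot>p\<cdot>r = u'\<cdot>q\<cdot>r"
 proof (rule W_cancel[of "u\<cdot>p" "dom p" "dom s" "u'\<cdot>q" s])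
  show "s\<cdot>(u\<cdot>p) = s\<cdot>(u'\<cdot>q)" using pq(6) pq(1,2,4) d s u u' by simp
 qed (use pq d s u u' in auto)
 show thesis
  by (rule that[of "p\<cdot>r" "q\<cdot>r"]) (use r pq d u u' in auto)
qed

lemma req_trans:
 assumes "req r r'" "req r' r''" shows "req r r''"
proof -
 obtain s f where r: "r = (s, f)" by (cases r)
 obtain s' f' where r': "r' = (s', f')" by (cases r')
 obtain s'' f'' where r'': "r'' = (s'', f'')" by (cases r'')
 from assms(1)[unfolded r r'] obtain u v where a: "s : W" "f : arr" "dom f = dom s" "s' : W" "f' : arr" "dom f' = dom s'"
  "u : arr" "v : arr" "dom v = dom u" "cod u = dom s" "cod v = dom s'"
  "s\<cdot>u : W" "s\<cdot>u = s'\<cdot>v" "f\<cdot>u = f'\<cdot>v" by (rule reqE)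
 from assms(2)[unfolded r' r''] obtain u' v' where b: "s'' : W" "f'' : arr" "dom f'' = dom s''"
  "u' : arr" "v' : arr" "dom v' = dom u'" "cod u' = dom s'" "cod v' = dom s''"
  "s'\<cdot>u' : W" "s'\<cdot>u' = s''\<cdot>v'" "f'\<cdot>u' = f''\<cdot>v'" by (rule reqE)
 obtain p q where pq: "p : W" "q : arr" "cod p = dom v" "cod q = dom u'" "dom q = dom p" "v\<cdot>p = u'\<cdot>q"
  by (rule refine[of s' v u']) (use a b in auto)
 show ?thesis
  unfolding r r''
 proof (rule reqI[of s f s'' f'' "u\<cdot>p" "v'\<cdot>q"])
  have "s\<cdot>(u\<cdot>p) = s'\<cdot>(v\<cdot>p)" using cmp_swap[OF a(13), of p] a pq by simp
  also have "... = s''\<cdot>(v'\<cdot>q)" unfolding pq(6) using cmp_swap[OF b(10), of q] a b pq by simp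
  finally show "s\<cdot>(u\<cdot>p) = s''\<cdot>(v'\<cdot>q)" .
  have "f\<cdot>(u\<cdot>p) = f'\<cdot>(v\<cdot>p)" using cmp_swap[OF a(14), of p] a pq by simp
  also have "... = f''\<cdot>(v'\<cdot>q)" unfolding pq(6) using cmp_swap[OF b(11), of q] a b pq by simp
  finally show "f\<cdot>(u\<cdot>p) = f''\<cdot>(v'\<cdot>q)" .
  show "s\<cdot>(u\<cdot>p) : W" using W_cmp[OF pq(1) a(12)] a(1-11) pq(1-5) by simp
 qed (use a(1-11) b(1-8) pq(1-5) in auto)
qed

lemma in_cls: "r : cls s f \<longleftrightarrow> req (s, f) r"
 by (simp add: roof_class_def)

lemma cls_eq: "req (s, f) (s', f') ==> cls s f = cls s' f'"
 unfolding roof_class_def using req_trans req_sym by blast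

lemma cls_eqD: "cls s f = cls s' f' ==> (s, f) : roofs C M ==> req (s, f) (s', f')"
 using req_refl in_cls req_sym by metis

lemma Dom_cls [simp]:
 assumes "s : W" "f : arr" "dom f = dom s" shows "Dom Q (cls s f) = cod s" "Cod Q (cls s f) = cod f"
proof -
 have m: "(s, f) : cls s f" using assms req_refl in_cls roofs_iff by simp
 have e: "!!s' f'. (s', f') : cls s f ==> cod s' = cod s & cod f' = cod f" using in_cls req_ends by blast
 show "Dom Q (cls s f) = cod s" unfolding Q_fields verdier_pre_def tricat.simps cat.simps
  by (rule the_equality, rule bexI[OF _ m], simp, elim bexE, use e in auto)
 show "Cod Q (cls s f) = cod f" unfolding Q_fields verdier_pre_def tricat.simps cat.simps
  by (rule the_equality, rule bexI[OF _ m], simp, elim bexE, use e in auto)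
qed

lemma Q_Ob: "Ob Q = ob" and Q_Arr: "Arr Q = (%(s, f). cls s f) ` roofs C M" and Q_Ide: "Ide Q x = cls (ide x) (ide x)"
 unfolding Q_fields verdier_pre_def by auto

lemma cls_arr [simp]: "s : W ==> f : arr ==> dom f = dom s ==> cls s f : Arr Q"
 unfolding Q_Arr using roofs_iff by force

lemma Q_homE:
 assumes "R : Hom Q x y"
 obtains s f where "R = cls s f" "s : W" "f : arr" "dom f = dom s" "cod s = x" "cod f = y"
proof -
 obtain s f where sf: "R = cls s f" "(s, f) : roofs C M" using assms unfolding in_Hom Q_Arr by auto
 then show thesis using assms that[of s f] unfolding roofs_iff by simp
qed

text \<open>The composite of two roofs does not depend on the Ore square.\<close>

lemma ore_independent:
 assumes st: "s : W" "t : W" "f : arr" "g : arr" "dom f = dom s" "dom g = dom t" "cod f = cod t"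
  and u: "u : arr" "cod u = dom s" "s\<cdot>u : W" "v : Hom C (dom u) (dom t)" "f\<cdot>u = t\<cdot>v"
  and u': "u' : arr" "cod u' = dom s" "s\<cdot>u' : W" "v' : Hom C (dom u') (dom t)" "f\<cdot>u' = t\<cdot>v'"
 shows "req (s\<cdot>u, g\<cdot>v) (s\<cdot>u', g\<cdot>v')"
proof -
 obtain p q where pq: "p : W" "q : arr" "cod p = dom u" "cod q = dom u'" "dom q = dom p" "u\<cdot>p = u'\<cdot>q"
  by (rule refine[OF st(1) u(1-3) u'(1-3)])
 have "t\<cdot>(v\<cdot>p) = f\<cdot>(u\<cdot>p)" using cmp_swap[OF u(5), of p] st u pq by simp
 also have "... = t\<cdot>(v'\<cdot>q)" unfolding pq(6) using cmp_swap[OF u'(5), of q] st u' pq by simp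
 finally have eq: "t\<cdot>(v\<cdot>p) = t\<cdot>(v'\<cdot>q)" .
 obtain r where r: "r : W" "cod r = dom p" "v\<cdot>p\<cdot>r = v'\<cdot>q\<cdot>r"
  by (rule W_cancel[OF _ _ st(2) _ eq, of "dom p"]) (use u u' pq in auto)
 show ?thesis
 proof (rule reqI[where u = "p\<cdot>r" and v = "q\<cdot>r"])
  have "s\<cdot>u\<cdot>(p\<cdot>r) = s\<cdot>(u\<cdot>p\<cdot>r)" using st u pq(1-5) r(1,2) by simp
  also have "... = s\<cdot>u'\<cdot>(q\<cdot>r)" unfolding pq(6) using st u' pq(1-5) r(1,2) by simp
  finally show "s\<cdot>u\<cdot>(p\<cdot>r) = s\<cdot>u'\<cdot>(q\<cdot>r)" .
  have "g\<cdot>v\<cdot>(p\<cdot>r) = g\<cdot>(v\<cdot>p\<cdot>r)" using st u pq(1-5) r(1,2) by simp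
  also have "... = g\<cdot>v'\<cdot>(q\<cdot>r)" unfolding r(3) using st u' pq(1-5) r(1,2) by simp
  finally show "g\<cdot>v\<cdot>(p\<cdot>r) = g\<cdot>v'\<cdot>(q\<cdot>r)" .
  have "p\<cdot>r : W" using pq r(1,2) by simp
  then show "s\<cdot>u\<cdot>(p\<cdot>r) : W" using W_cmp[OF _ u(3), of "p\<cdot>r"] st u pq(1-5) r(1,2) by simp
 qed (use st u u' pq(1-5) r(1,2) in auto)
qed

lemma cmp_well_defined:
 assumes r: "req (s, f) (s', f')" "req (t, g) (t', g')" and ft: "cod f = cod t"
  and u: "u : W" "cod u = dom s" "v : Hom C (dom u) (dom t)" "f\<cdot>u = t\<cdot>v"
  and u': "u' : W" "cod u' = dom s'" "v' : Hom C (dom u') (dom t')" "f'\<cdot>u' = t'\<cdot>v'"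
 shows "req (s\<cdot>u, g\<cdot>v) (s'\<cdot>u', g'\<cdot>v')"
proof -
 from r(1) obtain a b where a: "s : W" "f : arr" "dom f = dom s" "s' : W" "f' : arr" "dom f' = dom s'"
  "a : arr" "b : arr" "dom b = dom a" "cod a = dom s" "cod b = dom s'"
  "s\<cdot>a : W" "s\<cdot>a = s'\<cdot>b" "f\<cdot>a = f'\<cdot>b" by (rule reqE)
 from r(2) obtain c d where c: "t : W" "g : arr" "dom g = dom t" "t' : W" "g' : arr" "dom g' = dom t'"
  "c : arr" "d : arr" "dom d = dom c" "cod c = dom t" "cod d = dom t'"
  "t\<cdot>c : W" "t\<cdot>c = t'\<cdot>d" "g\<cdot>c = g'\<cdot>d" by (rule reqE)
 have ft': "cod f' = cod t'" using req_ends[OF r(1)] req_ends[OF r(2)] ft by simp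
 obtain p q where pq: "p : W" "q : arr" "cod p = dom (f\<cdot>a)" "dom q = dom p" "cod q = dom (t\<cdot>c)"
  "f\<cdot>a\<cdot>p = t\<cdot>c\<cdot>q"
  by (rule W_ore[of "f\<cdot>a" "t\<cdot>c"]) (use a(1-12) c(1-12) ft in auto)
 have d: "cod p = dom a" "cod q = dom c" using pq(3,5) a(1-12) c(1-12) by simp_all
 have sap: "s\<cdot>(a\<cdot>p) : W"
  using W_cmp[OF pq(1) a(12)] a(1-11) pq(1-5) d by simp
 have e1: "s\<cdot>(a\<cdot>p) = s'\<cdot>(b\<cdot>p)" using cmp_swap[OF a(13), of p] a pq d by simp
 have e2: "g\<cdot>(c\<cdot>q) = g'\<cdot>(d\<cdot>q)" using cmp_swap[OF c(14), of q] c pq d by simp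
 have e3: "f\<cdot>(a\<cdot>p) = t\<cdot>(c\<cdot>q)" using pq a(1-12) c(1-12) d ft by simp
 have "f'\<cdot>(b\<cdot>p) = f\<cdot>(a\<cdot>p)" using cmp_swap[OF a(14), of p] a pq d by simp
 also have "... = t'\<cdot>(d\<cdot>q)" unfolding e3 using cmp_swap[OF c(13), of q] c pq d by simp
 finally have e4: "f'\<cdot>(b\<cdot>p) = t'\<cdot>(d\<cdot>q)" .
 have 1: "req (s\<cdot>u, g\<cdot>v) (s\<cdot>(a\<cdot>p), g\<cdot>(c\<cdot>q))"
  by (rule ore_independent[OF a(1) c(1) a(2) c(2)]) (use a(1-12) c(1-12) u ft pq(1-5) d sap e3 in auto)
 have 2: "req (s'\<cdot>(b\<cdot>p), g'\<cdot>(d\<cdot>q)) (s'\<cdot>u', g'\<cdot>v')"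
  by (rule ore_independent[OF a(4) c(4) a(5) c(5)]) (use a(1-12) c(1-12) u' ft' pq(1-5) d sap e1 e4 in auto)
 show ?thesis using req_trans[OF 1] 2 e1 e2 by simp
qed

lemma bex_pair: "(\<exists>(s, f)\<in>A. P s f) \<longleftrightarrow> (\<exists>s f. (s, f) : A & P s f)"
 by auto

lemma Cmp_cls:
 assumes st: "s : W" "t : W" "f : arr" "g : arr" "dom f = dom s" "dom g = dom t" "cod f = cod t"
  and u: "u : W" "cod u = dom s" "v : Hom C (dom u) (dom t)" "f\<cdot>u = t\<cdot>v"
 shows "cls t g\<odot>cls s f = cls (s\<cdot>u) (g\<cdot>v)"
proof -
 have E: "cls t g\<odot>cls s f = {r. \<exists>(s, f) \<in> cls s f. \<exists>(t, g) \<in> cls t g.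
        \<exists>u \<in> W. \<exists>v \<in> arr. dom u = dom v & cod u = dom f & cod v = dom t &
         f\<cdot>u = t\<cdot>v & req (s\<cdot>u, g\<cdot>v) r}"
  unfolding Q_fields verdier_pre_def by simp
 have sf: "(s, f) : cls s f" "(t, g) : cls t g" using st by (simp_all add: in_cls req_refl roofs_iff)
 show ?thesis
 proof (intro subset_antisym subsetI)
  fix r assume "r : cls t g\<odot>cls s f"
  then obtain s' f' t' g' u' v' where a: "req (s, f) (s', f')" "req (t, g) (t', g')" "u' : W" "v' : arr"
   "dom u' = dom v'" "cod u' = dom f'" "cod v' = dom t'" "f'\<cdot>u' = t'\<cdot>v'" "req (s'\<cdot>u', g'\<cdot>v') r"
   unfolding E mem_Collect_eq bex_pair in_cls by blast
  have "dom f' = dom s'" using a(1) by (auto elim: reqE)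
  then have "req (s\<cdot>u, g\<cdot>v) (s'\<cdot>u', g'\<cdot>v')"
   by (intro cmp_well_defined[OF a(1,2) st(7) u]) (use a in auto)
  then show "r : cls (s\<cdot>u) (g\<cdot>v)" unfolding in_cls using a(9) req_trans by blast
 next
  fix r assume "r : cls (s\<cdot>u) (g\<cdot>v)"
  then have r: "req (s\<cdot>u, g\<cdot>v) r" unfolding in_cls .
  have "v : arr" "dom u = dom v" "cod u = dom f" "cod v = dom t" using u st by auto
  then show "r : cls t g\<odot>cls s f"
   unfolding E mem_Collect_eq bex_pair using sf u(1,4) r by blast
 qed
qed

lemma category_Q: "category Q"
proof
 show "Dom Q R : Ob Q" "Cod Q R : Ob Q" if "R : Arr Q" for R
  using that unfolding Q_Arr Q_Ob by (auto simp: roofs_iff)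
 show "Ide Q x : Hom Q x x" if "x : Ob Q" for x using that unfolding Q_Ob Q_Ide by simp
 show cmp: "R'\<odot>R : Hom Q x z" if R: "R : Hom Q x y" and R': "R' : Hom Q y z" for R R' x y z
 proof -
  obtain s f where s: "R = cls s f" "s : W" "f : arr" "dom f = dom s" "cod s = x" "cod f = y"
   using R by (rule Q_homE)
  obtain t g where t: "R' = cls t g" "t : W" "g : arr" "dom g = dom t" "cod t = y" "cod g = z"
   using R' by (rule Q_homE)
  obtain u v where u: "u : W" "v : arr" "cod u = dom f" "dom v = dom u" "cod v = dom t" "f\<cdot>u = t\<cdot>v"
   by (rule W_ore[of f t]) (use s t in auto)
  have "R'\<odot>R = cls (s\<cdot>u) (g\<cdot>v)" unfolding s(1) t(1) by (rule Cmp_cls) (use s t u in auto)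
  then show ?thesis using s t u by simp
 qed
 show "R\<odot>Ide Q x = R" if R: "R : Hom Q x y" for R x y
 proof -
  obtain s f where s: "R = cls s f" "s : W" "f : arr" "dom f = dom s" "cod s = x" "cod f = y"
   using R by (rule Q_homE)
  have x: "x : ob" using s by auto
  have "R\<odot>Ide Q x = cls (ide x\<cdot>s) (f\<cdot>ide (dom s))"
   unfolding s(1) Q_Ide by (rule Cmp_cls) (use s x in auto)
  then show ?thesis using s by simp
 qed
 show "Ide Q y\<odot>R = R" if R: "R : Hom Q x y" for R x y
 proof -
  obtain s f where s: "R = cls s f" "s : W" "f : arr" "dom f = dom s" "cod s = x" "cod f = y"
   using R by (rule Q_homE)
  have y: "y : ob" using s by auto
  have "Ide Q y\<odot>R = cls (s\<cdot>ide (dom s)) (ide y\<cdot>f)"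
   unfolding s(1) Q_Ide by (rule Cmp_cls) (use s y in auto)
  then show ?thesis using s by simp
 qed
 show "R''\<odot>(R'\<odot>R) = R''\<odot>R'\<odot>R"
  if R: "R : Hom Q w x" and R': "R' : Hom Q x y" and R'': "R'' : Hom Q y z" for R R' R'' w x y z
 proof -
  obtain s f where s: "R = cls s f" "s : W" "f : arr" "dom f = dom s" "cod s = w" "cod f = x"
   using R by (rule Q_homE)
  obtain t g where t: "R' = cls t g" "t : W" "g : arr" "dom g = dom t" "cod t = x" "cod g = y"
   using R' by (rule Q_homE)
  obtain p h where p: "R'' = cls p h" "p : W" "h : arr" "dom h = dom p" "cod p = y" "cod h = z"
   using R'' by (rule Q_homE)
  obtain a b where a: "a : W" "b : arr" "cod a = dom g" "dom b = dom a" "cod b = dom p" "g\<cdot>a = p\<cdot>b"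
   by (rule W_ore[of g p]) (use t p in auto)
  obtain c d where c: "c : W" "d : arr" "cod c = dom f" "dom d = dom c" "cod d = dom (t\<cdot>a)" "f\<cdot>c = t\<cdot>a\<cdot>d"
   by (rule W_ore[of f "t\<cdot>a"]) (use s t a in auto)
  have d: "cod d = dom a" using c(5) t a by simp
  have c6: "f\<cdot>c = t\<cdot>(a\<cdot>d)" using c(6) t a c d by simp
  have 1: "R''\<odot>R' = cls (t\<cdot>a) (h\<cdot>b)" unfolding t(1) p(1) by (rule Cmp_cls) (use t p a in auto)
  have 2: "R''\<odot>R'\<odot>R = cls (s\<cdot>c) (h\<cdot>b\<cdot>d)"
   unfolding 1 s(1) by (rule Cmp_cls) (use s t p a c d in auto)
  have 3: "R'\<odot>R = cls (s\<cdot>c) (g\<cdot>(a\<cdot>d))"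
   unfolding s(1) t(1) by (rule Cmp_cls) (use s t a c d c6 in auto)
  have "g\<cdot>(a\<cdot>d) = p\<cdot>(b\<cdot>d)" using cmp_swap[OF a(6), of d] t p a c d by simp
  then have "R''\<odot>(R'\<odot>R) = cls (s\<cdot>c\<cdot>ide (dom c)) (h\<cdot>(b\<cdot>d))"
   unfolding 3 p(1) by (intro Cmp_cls) (use s t p a c d in auto)
  then show ?thesis unfolding 2 using s t p a c d by simp
 qed
qed

sublocale Q: category Q by (rule category_Q)

definition j :: "'m => ('m \<times> 'm) set" where "j f = cls (ide (dom f)) f"

lemma j_arr [simp]: "f : arr ==> j f : Arr Q" "f : arr ==> Dom Q (j f) = dom f" "f : arr ==> Cod Q (j f) = cod f"
 by (simp_all add: j_def)

lemma j_ide: "x : ob ==> j (ide x) = Ide Q x"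
 by (simp add: j_def Q_Ide)

lemma j_cmp: assumes "f : arr" "g : arr" "cod f = dom g" shows "j (g\<cdot>f) = j g\<odot>j f"
proof -
 have "j g\<odot>j f = cls (ide (dom f)\<cdot>ide (dom f)) (g\<cdot>f)"
  unfolding j_def by (rule Cmp_cls) (use assms in auto)
 then show ?thesis using assms by (simp add: j_def)
qed

lemma j_functor: "is_functor C Q (quotient_functor C M)" "fO (quotient_functor C M) x = x" "fM (quotient_functor C M) f = j f"
proof -
 show e: "fO (quotient_functor C M) x = x" "fM (quotient_functor C M) f = j f" for x f
  by (simp_all add: quotient_functor_def j_def)
 show "is_functor C Q (quotient_functor C M)"
  unfolding is_functor_def e by (auto simp: Q_Ob j_ide j_cmp)
qed

lemma roof_cmp: assumes "s : W" "f : arr" "dom f = dom s"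
 shows "cls s (ide (dom s))\<odot>j s = Ide Q (dom s)" "j s\<odot>cls s (ide (dom s)) = Ide Q (cod s)"
  "cls s f\<odot>j s = j f"
proof -
 let ?d = "ide (dom s)"
 have c: "cls s g\<odot>j s = cls (?d\<cdot>?d) (g\<cdot>?d)" if "g : arr" "dom g = dom s" for g
  unfolding j_def by (rule Cmp_cls) (use assms that in auto)
 show "cls s f\<odot>j s = j f" using c[of f] assms by (simp add: j_def)
 show "cls s ?d\<odot>j s = Ide Q (dom s)" using c[of ?d] assms by (simp add: Q_Ide)
 have "j s\<odot>cls s ?d = cls (s\<cdot>?d) (s\<cdot>?d)"
  unfolding j_def by (rule Cmp_cls) (use assms in auto)
 also have "... = cls s s" using assms by simp
 also have "... = Ide Q (cod s)" unfolding Q_Ide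
  by (rule cls_eq, rule reqI[where u = ?d and v = s]) (use assms in auto)
 finally show "j s\<odot>cls s ?d = Ide Q (cod s)" .
qed

lemma j_eqD:
 assumes "j f = j g" "f : arr"
 obtains u where "u : W" "cod u = dom f" "f\<cdot>u = g\<cdot>u"
proof -
 have "req (ide (dom f), f) (ide (dom g), g)" using cls_eqD assms roofs_iff unfolding j_def by simp
 then show thesis
  by (rule reqE) (use that in auto)
qed

lemma j_isomorphic: "isomorphic C x y ==> isomorphic Q x y"
 using functor_isomorphic[OF category_axioms category_Q j_functor(1)] j_functor(2) by metis

text \<open>
 The union over all representatives in the definition of a functor on classes is the class of one.
\<close>

lemma map_cls:
 assumes F: "is_functor C C F" and FW: "!!s. s : W ==> fM F s : W" and s: "s : W" "f : arr" "dom f = dom s"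
 shows "{r. \<exists>(s', f') \<in> cls s f. req (fM F s', fM F f') r} = cls (fM F s) (fM F f)"
proof -
 note Fn = is_functorD[OF F]
 have sf: "(s, f) : cls s f" using s by (simp add: in_cls req_refl roofs_iff)
 have F_req: "req (fM F s, fM F f) (fM F s', fM F f')" if "req (s, f) (s', f')" for s' f'
  using that
 proof (rule reqE)
  fix u v assume a: "s : W" "f : arr" "dom f = dom s" "s' : W" "f' : arr" "dom f' = dom s'"
   "u : arr" "v : arr" "dom v = dom u" "cod u = dom s" "cod v = dom s'"
   "s\<cdot>u : W" "s\<cdot>u = s'\<cdot>v" "f\<cdot>u = f'\<cdot>v"
  have m: "fM F s\<cdot>fM F u = fM F (s\<cdot>u)" "fM F s'\<cdot>fM F v = fM F (s'\<cdot>v)"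
   "fM F f\<cdot>fM F u = fM F (f\<cdot>u)" "fM F f'\<cdot>fM F v = fM F (f'\<cdot>v)" using a(1-11) Fn(6) by simp_all
  show ?thesis
  proof (rule reqI[where u = "fM F u" and v = "fM F v"])
   show "fM F s\<cdot>fM F u : W" "fM F s\<cdot>fM F u = fM F s'\<cdot>fM F v" "fM F f\<cdot>fM F u = fM F f'\<cdot>fM F v"
    unfolding m using a(12-14) FW by simp_all
  qed (use a(1-11) FW Fn(2-4) in auto)
 qed
 show ?thesis
 proof (intro subset_antisym subsetI)
  fix r assume "r : {r. \<exists>(s', f') \<in> cls s f. req (fM F s', fM F f') r}"
  then show "r : cls (fM F s) (fM F f)" unfolding mem_Collect_eq bex_pair in_cls using F_req req_trans by blast
 next
  fix r assume "r : cls (fM F s) (fM F f)"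
  then show "r : {r. \<exists>(s', f') \<in> cls s f. req (fM F s', fM F f') r}"
   unfolding mem_Collect_eq bex_pair using sf in_cls by blast
 qed
qed

end


section \<open>Local objects of a smashing localization\<close>

context verdier_localization
begin

abbreviation perp :: "'o set" where "perp \<equiv> right_perp C M"

lemma perp_iff: "A : perp \<longleftrightarrow> A : ob & (\<forall>B\<in>M. \<forall>m\<in>Hom C B A. m = zro B A)"
 unfolding right_perp_def using M_D(1) by (auto simp del: in_Hom) (auto)

lemma perpD: "A : perp ==> A : ob" "A : perp ==> B : M ==> m : Hom C B A ==> m = zro B A"
 unfolding perp_iff by blast+

lemma perpI: "A : ob ==> (!!B m. B : M ==> m : Hom C B A ==> m = zro B A) ==> A : perp"
 unfolding perp_iff by blast

lemma W_fibre: assumes "(r, s, q) : tri" "s : W" shows "dom r : M"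
proof -
 have "shO (dom r) : M" using W_cone[OF assms(2) tri_rot[OF assms(1)]] triD[OF assms(1)] by simp
 then show ?thesis using M_D(4) triD[OF assms(1)] by simp
qed

lemma Q_from_M:
 assumes B: "B : M" and R: "R : Hom Q B A" "R' : Hom Q B A" shows "R = R'"
proof -
 obtain s f where s: "R = cls s f" "s : W" "f : arr" "dom f = dom s" "cod s = B" "cod f = A" using R(1) by (rule Q_homE)
 obtain s' f' where s': "R' = cls s' f'" "s' : W" "f' : arr" "dom f' = dom s'" "cod s' = B" "cod f' = A" using R(2) by (rule Q_homE)
 obtain z where z: "is_zero C z" using zero_object by blast
 have Bo: "B : ob" "z : ob" using M_D(1)[OF B] z by simp_all
 have W0: "zro z B : W" by (rule W_I[OF tri_zero_ide[OF z Bo(1)]]) (use B Bo in simp)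
 show ?thesis unfolding s(1) s'(1)
  by (rule cls_eq, rule reqI[where u = "zro z (dom s)" and v = "zro z (dom s')"]) (use s s' Bo W0 in auto)
qed

lemma perp_inj:
 assumes N: "N : perp" and s: "s : W" and m: "m : Hom C (cod s) N" "m' : Hom C (cod s) N" "m\<cdot>s = m'\<cdot>s"
 shows "m = m'"
proof -
 obtain g h where t: "(s, g, h) : tri" using tri_cone[OF W_arr[OF s]] by blast
 note T = triD[OF t]
 have "sub m m'\<cdot>s = zro (dom s) N" using m s by simp
 then obtain b where b: "b : Hom C (cod g) N" "b\<cdot>g = sub m m'" using tri_ext[OF t, of "sub m m'" N] m by auto
 have "b = zro (cod g) N" by (rule perpD(2)[OF N W_cone[OF s t] b(1)])
 then have "sub m m' = zro (cod s) N" using b(2) T perpD(1)[OF N] by simp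
 then show ?thesis by (rule sub_eq_zro) (use m in auto)
qed

lemma perp_sur:
 assumes N: "N : perp" and s: "s : W" and n: "n : Hom C (dom s) N"
 obtains m where "m : Hom C (cod s) N" "m\<cdot>s = n"
proof -
 obtain r q where t: "(r, s, q) : tri" by (rule fibre[OF W_arr[OF s]])
 note T = triD[OF t]
 have "n\<cdot>r = zro (dom r) N" by (rule perpD(2)[OF N W_fibre[OF t s]]) (use n T in auto)
 then show thesis using tri_ext[OF t, of n N] n T that by auto
qed

text \<open>
 Maps into a local object are the same in the quotient as before, since they extend uniquely
 along weak equivalences.
\<close>

lemma j_inj:
 assumes N: "N : perp" and f: "f : Hom C B N" "g : Hom C B N" "j f = j g" shows "f = g"
proof -
 obtain u where u: "u : W" "cod u = dom f" "f\<cdot>u = g\<cdot>u" by (rule j_eqD[OF f(3)]) (use f in auto)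
 show ?thesis by (rule perp_inj[OF N u(1)]) (use u f in auto)
qed

lemma j_sur:
 assumes N: "N : perp" and R: "R : Hom Q B N" obtains f where "f : Hom C B N" "j f = R"
proof -
 obtain s f where s: "R = cls s f" "s : W" "f : arr" "dom f = dom s" "cod s = B" "cod f = N" using R by (rule Q_homE)
 obtain m where m: "m : Hom C B N" "m\<cdot>s = f" by (rule perp_sur[OF N s(2), of f]) (use s in auto)
 have "cls s (m\<cdot>s) = j m" unfolding j_def
  by (rule cls_eq, rule reqI[where u = "ide (dom s)" and v = s]) (use s(2,5) m(1) in auto)
 then have "cls s f = j m" unfolding m(2) .
 then show thesis using that m(1) s(1) by simp
qed

lemma perp_iso: assumes "A : perp" "isomorphic C A B" shows "B : perp"
proof -
 obtain p q where pq: "p : Hom C A B" "q : Hom C B A" "q\<cdot>p = ide A" "p\<cdot>q = ide B" "A : ob" "B : ob"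
  using assms(2) by (rule isomorphicE)
 have "m = zro D B" if D: "D : M" "m : Hom C D B" for D m
 proof -
  have z: "q\<cdot>m = zro D A" by (rule perpD(2)[OF assms(1) D(1)]) (use D pq in auto)
  have "m = p\<cdot>(q\<cdot>m)" using cmp_reduce[OF pq(4), of m] D pq by simp
  also have "... = zro D B" unfolding z using pq M_D(1)[OF D(1)] by simp
  finally show ?thesis .
 qed
 then show ?thesis by (intro perpI) (use pq in \<open>auto simp del: in_Hom\<close>)
qed

lemma perp_sh: assumes A: "A : ob" shows "shO A : perp \<longleftrightarrow> A : perp"
proof
 assume P: "shO A : perp"
 have "m = zro B A" if B: "B : M" "m : Hom C B A" for B m
 proof (rule sh_zro_iff[OF _ B(2)])
  show "shM m = zro (shO B) (shO A)"
   by (rule perpD(2)[OF P]) (use B M_D(1)[OF B(1)] M_D(4)[of B] in auto)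
 qed
 then show "A : perp" by (intro perpI) (use A in \<open>auto simp del: in_Hom\<close>)
next
 assume P: "A : perp"
 have "m = zro B (shO A)" if B: "B : M" "m : Hom C B (shO A)" for B m
 proof -
  obtain D p q where D: "D : M" "p : Hom C (shO D) B" "q : Hom C B (shO D)" "q\<cdot>p = ide (shO D)" "p\<cdot>q = ide B"
   using triangulated_subcategory_unshift[OF M_sub B(1)] .
  have Do: "D : ob" by (rule M_D(1)[OF D(1)])
  obtain f where f: "f : Hom C D A" "shM f = m\<cdot>p" by (rule sh_full[of "m\<cdot>p" D A]) (use B D A Do in auto)
  have "f = zro D A" by (rule perpD(2)[OF P D(1) f(1)])
  then have z: "m\<cdot>p = zro (shO D) (shO A)" using f(2) A Do by simp
  have "m = m\<cdot>p\<cdot>q" using D B by simp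
  also have "... = zro B (shO A)" unfolding z using D A by simp
  finally show ?thesis .
 qed
 then show "shO A : perp" by (intro perpI) (use A in \<open>auto simp del: in_Hom\<close>)
qed

lemma perp_triangulated: "triangulated_subcategory C perp"
proof (rule triangulated_subcategoryI)
 show "perp <= ob" using perpD(1) by blast
 show "z : perp" if "is_zero C z" for z unfolding perp_iff using zero_arr_to[OF that] that by auto
 show "cod g : perp" if t: "(f, g, h) : tri" and P: "dom f : perp" "cod f : perp" for f g h
 proof -
  note T = triD[OF t]
  have "m = zro B (cod g)" if B: "B : M" "m : Hom C B (cod g)" for B m
  proof -
   have "h\<cdot>m = zro B (cod h)"
    by (rule perpD(2)[OF _ B(1)]) (use B T perp_sh P(1) perpD(1) in auto)
   then obtain b where b: "b : Hom C B (cod f)" "g\<cdot>b = m" using tri_lift2[OF t B(2)] by blast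
   have "b = zro B (cod f)" by (rule perpD(2)[OF P(2) B(1) b(1)])
   then show ?thesis using b(2) T M_D(1)[OF B(1)] by simp
  qed
  then show ?thesis by (intro perpI) (use T in \<open>auto simp del: in_Hom\<close>)
 qed
qed (use perp_iso perp_sh in blast)+

lemma perp_product:
 assumes P: "is_product C I X P pr" and X: "!!i. i : I ==> X i : perp" shows "P : perp"
proof -
 note D = is_productD[OF P]
 have "m = zro B P" if B: "B : M" "m : Hom C B P" for B m
 proof (rule is_product_ext[OF P B(2)])
  show "zro B P : Hom C B P" using D M_D(1)[OF B(1)] by simp
  fix i assume i: "i : I"
  have "pr i\<cdot>m = zro B (X i)" by (rule perpD(2)[OF X[OF i] B(1)]) (use i D B in auto)
  then show "pr i\<cdot>m = pr i\<cdot>zro B P" using D i M_D(1)[OF B(1)] by simp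
 qed
 then show ?thesis by (intro perpI) (use D in \<open>auto simp del: in_Hom\<close>)
qed

end

locale localization = cg_category U C + verdier_localization C M Q
 for U :: "'u set" and C :: "('o, 'm, 'x) tricat_scheme" (structure) and M :: "'o set"
  and Q :: "('o, ('m \<times> 'm) set, 'z) cat_scheme" +
 fixes k :: "('o, ('m \<times> 'm) set, 'o, 'm) func"
 assumes k_adjoint: "right_adjoint C Q (quotient_functor C M) k"
begin

definition counit :: "'o => ('m \<times> 'm) set" where
 "counit = (SOME e. (\<forall>y\<in>ob. universal C Q (quotient_functor C M) (ob) y (fO k y) (e y)) &
   (\<forall>b\<in>Arr Q. e (Cod Q b)\<odot>j (fM k b) = b\<odot>e (Dom Q b)))"

lemma counit:
 shows counit_universal: "y : ob ==> universal C Q (quotient_functor C M) (ob) y (fO k y) (counit y)"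
  and counit_natural: "b : Arr Q ==> counit (Cod Q b)\<odot>j (fM k b) = b\<odot>counit (Dom Q b)"
proof -
 obtain e where "!!y. y : Ob Q ==> universal C Q (quotient_functor C M) (ob) y (fO k y) (e y)"
  "!!b. b : Arr Q ==> e (Cod Q b)\<odot>fM (quotient_functor C M) (fM k b) = b\<odot>e (Dom Q b)"
  using right_adjoint_universal[OF category_axioms category_Q j_functor(1) k_adjoint] by blast
 then have "\<exists>e. (\<forall>y\<in>ob. universal C Q (quotient_functor C M) (ob) y (fO k y) (e y)) &
   (\<forall>b\<in>Arr Q. e (Cod Q b)\<odot>j (fM k b) = b\<odot>e (Dom Q b))"
  unfolding j_functor Q_Ob by blast
 from someI_ex[OF this]
 show "y : ob ==> universal C Q (quotient_functor C M) (ob) y (fO k y) (counit y)"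
  "b : Arr Q ==> counit (Cod Q b)\<odot>j (fM k b) = b\<odot>counit (Dom Q b)"
  unfolding counit_def by blast+
qed

lemma k_functor: "is_functor Q C k" using k_adjoint by (simp add: right_adjoint_def)

abbreviation lam :: "'o => 'o" where "lam \<equiv> fO k"

lemma counit_simps [simp]:
 assumes "y : ob" shows "lam y : ob" "counit y : Arr Q" "Dom Q (counit y) = lam y" "Cod Q (counit y) = y"
 using universalD[OF counit_universal[OF assms]] unfolding j_functor by simp_all

lemma counit_lift:
 assumes "y : ob" "R : Hom Q x y" obtains h where "h : Hom C x (lam y)" "counit y\<odot>j h = R"
proof -
 have "x : ob" using assms(2) Q.ob_dom[of R] unfolding Q_Ob by auto
 then show thesis using universal_lift[OF counit_universal[OF assms(1)], of x R] that assms(2) unfolding j_functor by blast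
qed

lemma counit_ext:
 assumes "y : ob" "h : Hom C x (lam y)" "h' : Hom C x (lam y)" "counit y\<odot>j h = counit y\<odot>j h'"
 shows "h = h'"
proof -
 have "x : ob" using assms(2) by auto
 from universal_ext[OF counit_universal[OF assms(1)] this assms(2,3)] assms(4)
 show ?thesis unfolding j_functor by blast
qed

lemma lam_perp: assumes y: "y : ob" shows "lam y : perp"
proof -
 have "m = zro B (lam y)" if B: "B : M" "m : Hom C B (lam y)" for B m
 proof (rule counit_ext[OF y B(2)])
  show "zro B (lam y) : Hom C B (lam y)" using y M_D(1)[OF B(1)] by simp
  show "counit y\<odot>j m = counit y\<odot>j (zro B (lam y))"
   by (rule Q_from_M[OF B(1), of _ y]) (use y B(2) M_D(1)[OF B(1)] in auto)
 qed
 then show ?thesis by (intro perpI) (use y in \<open>auto simp del: in_Hom\<close>)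
qed

definition unit :: "'o => 'm" where
 "unit x = (SOME h. h : Hom C x (lam x) & counit x\<odot>j h = Ide Q x)"

lemma unit:
 assumes x: "x : ob"
 shows "unit x : Hom C x (lam x)" "counit x\<odot>j (unit x) = Ide Q x" "j (unit x)\<odot>counit x = Ide Q (lam x)"
proof -
 have "\<exists>h. h : Hom C x (lam x) & counit x\<odot>j h = Ide Q x"
  by (rule counit_lift[OF x, of "Ide Q x" x]) (use x Q_Ob in auto)
 from someI_ex[OF this] show u: "unit x : Hom C x (lam x)" "counit x\<odot>j (unit x) = Ide Q x"
  unfolding unit_def by blast+
 have u' [simp]: "unit x : arr" "dom (unit x) = x" "cod (unit x) = lam x" using u(1) by simp_all
 have "j (unit x)\<odot>counit x : Hom Q (lam x) (lam x)" using x by simp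
 then obtain m where m: "m : Hom C (lam x) (lam x)" "j m = j (unit x)\<odot>counit x" by (rule j_sur[OF lam_perp[OF x]])
 have "m = ide (lam x)"
 proof (rule counit_ext[OF x m(1)])
  show "counit x\<odot>j m = counit x\<odot>j (ide (lam x))"
   unfolding m(2) using Q.cmp_reduce[OF u(2), of "counit x"] x by (simp add: j_ide)
 qed (use x in simp)
 then show "j (unit x)\<odot>counit x = Ide Q (lam x)" using m(2) x j_ide by simp
qed

lemma unit_simps [simp]:
 "x : ob ==> unit x : arr" "x : ob ==> dom (unit x) = x" "x : ob ==> cod (unit x) = lam x"
 using unit(1)[of x] by simp_all

lemma lam_isomorphic: "x : ob ==> isomorphic Q (lam x) x"
 by (rule Q.isomorphicI[of "counit x" _ _ "j (unit x)"]) (use unit(2,3)[of x] in auto)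

lemma unit_inj:
 assumes x: "x : ob" and N: "N : perp" and m: "m : Hom C (lam x) N" "m' : Hom C (lam x) N" "m\<cdot>unit x = m'\<cdot>unit x"
 shows "m = m'"
proof (rule j_inj[OF N m(1,2)])
 have c: "j n = j (n\<cdot>unit x)\<odot>counit x" if "n : Hom C (lam x) N" for n
  using that x unit(3)[OF x] by (simp add: j_cmp)
 show "j m = j m'" using c[OF m(1)] c[OF m(2)] m(3) by simp
qed

lemma unit_sur:
 assumes x: "x : ob" and N: "N : perp" and n: "n : Hom C x N"
 obtains m where "m : Hom C (lam x) N" "m\<cdot>unit x = n"
proof -
 have "j n\<odot>counit x : Hom Q (lam x) N" using n x by simp
 then obtain m where m: "m : Hom C (lam x) N" "j m = j n\<odot>counit x" by (rule j_sur[OF N])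
 have "m\<cdot>unit x = n"
  by (rule j_inj[OF N]) (use m n x unit(2)[OF x] in \<open>auto simp: j_cmp\<close>)
 then show thesis using that m(1) by blast
qed

lemma unit_iso: assumes N: "N : perp"
 obtains \<mu> where "\<mu> : Hom C (lam N) N" "\<mu>\<cdot>unit N = ide N" "unit N\<cdot>\<mu> = ide (lam N)"
proof -
 have No: "N : ob" by (rule perpD(1)[OF N])
 obtain \<mu> where \<mu>: "\<mu> : Hom C (lam N) N" "\<mu>\<cdot>unit N = ide N" by (rule unit_sur[OF No N, of "ide N"]) (use No in auto)
 have "unit N\<cdot>\<mu> = ide (lam N)"
  by (rule unit_inj[OF No lam_perp[OF No]]) (use \<mu> No in auto)
 then show thesis using that \<mu> by blast
qed

definition L :: "('o, 'm, 'o, 'm) func" where "L = \<lparr>fO = lam, fM = (%f. fM k (j f))\<rparr>"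

lemma L_simps [simp]: "fO L x = lam x" by (simp add: L_def)

lemma L_functor: "is_functor C C L"
 using is_functorD[OF k_functor] unfolding is_functor_def L_def by (auto simp: j_ide j_cmp Q_Ob)

lemma L_arr [simp]: "f : arr ==> fM L f : arr" "f : arr ==> dom (fM L f) = lam (dom f)" "f : arr ==> cod (fM L f) = lam (cod f)"
 using is_functorD[OF L_functor] by simp_all

lemma L_unit:
 assumes f: "f : arr" shows "fM L f\<cdot>unit (dom f) = unit (cod f)\<cdot>f"
proof (rule counit_ext[of "cod f"])
 have "counit (cod f)\<odot>j (fM L f) = j f\<odot>counit (dom f)"
  using counit_natural[of "j f"] f by (simp add: L_def)
 then have "counit (cod f)\<odot>(j (fM L f)\<odot>j (unit (dom f))) = j f\<odot>(counit (dom f)\<odot>j (unit (dom f)))"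
  by (rule Q.cmp_swap) (use f in auto)
 also have "... = j f" using unit(2)[of "dom f"] f by simp
 also have "... = counit (cod f)\<odot>(j (unit (cod f))\<odot>j f)"
  using Q.cmp_reduce[OF unit(2)[of "cod f"], of "j f"] f by simp
 finally show "counit (cod f)\<odot>j (fM L f\<cdot>unit (dom f)) = counit (cod f)\<odot>j (unit (cod f)\<cdot>f)"
  using f by (simp add: j_cmp)
qed (use f in auto)

lemma j_coproduct:
 assumes P: "is_coproduct C I X P io" shows "is_coproduct Q I X P (%i. j (io i))"
proof (rule Q.is_coproductI)
 note D = is_coproductD[OF P]
 show "X i : Ob Q" "j (io i) : Hom Q (X i) P" if "i : I" for i using D that Q_Ob by auto
 show "P : Ob Q" using D Q_Ob by simp
 fix Y f assume Y: "Y : Ob Q" and f: "!!i. i : I ==> f i : Hom Q (X i) Y"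
 have Yo: "Y : ob" using Y Q_Ob by simp
 have "\<exists>h. h : Hom C (X i) (lam Y) & counit Y\<odot>j h = f i" if i: "i : I" for i
  by (rule counit_lift[OF Yo f[OF i]]) blast
 then obtain h where h: "!!i. i : I ==> h i : Hom C (X i) (lam Y)" "!!i. i : I ==> counit Y\<odot>j (h i) = f i" by metis
 obtain g where g: "g : Hom C P (lam Y)" "!!i. i : I ==> g\<cdot>io i = h i"
  by (rule is_coproduct_map[OF P _ h(1)]) (use Yo in auto)
 have "(counit Y\<odot>j g)\<odot>j (io i) = f i" if i: "i : I" for i
 proof -
  have "(counit Y\<odot>j g)\<odot>j (io i) = counit Y\<odot>j (g\<cdot>io i)" using g(1) D i Yo by (simp add: j_cmp)
  then show ?thesis using g(2)[OF i] h(2)[OF i] by simp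
 qed
 moreover have "counit Y\<odot>j g : Hom Q P Y" using g(1) Yo by simp
 ultimately show "\<exists>h. h : Hom Q P Y & (\<forall>i\<in>I. h\<odot>j (io i) = f i)" by blast
next
 note D = is_coproductD[OF P]
 fix Y h h' assume h: "h : Hom Q P Y" "h' : Hom Q P Y" and eq: "!!i. i : I ==> h\<odot>j (io i) = h'\<odot>j (io i)"
 have Y: "Y : ob" using h(1) Q.ob_cod[of h] Q_Ob by auto
 obtain g where g: "g : Hom C P (lam Y)" "counit Y\<odot>j g = h" by (rule counit_lift[OF Y h(1)])
 obtain g' where g': "g' : Hom C P (lam Y)" "counit Y\<odot>j g' = h'" by (rule counit_lift[OF Y h(2)])
 have "g = g'"
 proof (rule is_coproduct_ext[OF P g(1) g'(1)])
  fix i assume i: "i : I"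
  show "g\<cdot>io i = g'\<cdot>io i"
   by (rule counit_ext[OF Y, of _ "X i"]) (use g g' D i Y eq[OF i] in \<open>auto simp: j_cmp\<close>)
 qed
 then show "h = h'" using g g' by simp
qed

lemma lam_of_M: assumes B: "B : M" shows "is_zero C (lam B)"
proof -
 have Bo: "B : ob" by (rule M_D(1)[OF B])
 have u: "unit B = zro B (lam B)" by (rule perpD(2)[OF lam_perp[OF Bo] B unit(1)[OF Bo]])
 have "ide (lam B) = zro (lam B) (lam B)"
 proof (rule unit_inj[OF Bo lam_perp[OF Bo]])
  have "ide (lam B)\<cdot>unit B = zro B (lam B)" using u Bo by simp
  then show "ide (lam B)\<cdot>unit B = zro (lam B) (lam B)\<cdot>unit B" using Bo by simp
 qed (use Bo in auto)
 then show ?thesis unfolding is_zero_iff using Bo by simp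
qed

definition id_func :: "('o, 'm, 'o, 'm) func" where "id_func = \<lparr>fO = (%x. x), fM = (%f. f)\<rparr>"

lemma id_func [simp]: "fO id_func x = x" "fM id_func f = f" by (simp_all add: id_func_def)

text \<open>
 On objects of the quotient, \<open>k\<close> takes local values, so a coreflection \<open>R\<close> of \<open>A\<close> into the local objects
 is also the value at \<open>A\<close> of a right adjoint of \<open>k\<close>, for whichever choice of \<open>k\<close>.
\<close>

lemma coreflection_universal:
 assumes R: "R : perp" and u: "universal C C id_func perp A R \<epsilon>"
 shows "\<exists>al. universal Q C k (Ob Q) A R al"
proof -
 note u' = universalD[OF u, simplified] and Ro = perpD(1)[OF R]
 obtain m where m: "m : Hom C (lam R) R" "j m = counit R" by (rule j_sur[OF R, of "counit R" "lam R"]) (use Ro in auto)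
 have kh: "fM k h : Hom C (lam x) (lam R) & j (m\<cdot>fM k h) = h\<odot>counit x" if h: "h : Hom Q x R" for h x
  using is_functorD(2-4)[OF k_functor, of h] counit_natural[of h] h m by (simp add: j_cmp)
 have "universal Q C k (Ob Q) A R (\<epsilon>\<cdot>m)"
 proof (rule universalI)
  show "R : Ob Q" "\<epsilon>\<cdot>m : Hom C (lam R) A" using u' m Ro Q_Ob by simp_all
  fix x f assume x: "x : Ob Q" and f: "f : Hom C (lam x) A"
  have xo: "x : ob" using x Q_Ob by simp
  obtain n where n: "n : Hom C (lam x) R" "\<epsilon>\<cdot>n = f" using universal_lift[OF u lam_perp[OF xo], of f] f by auto
  have h: "j (n\<cdot>unit x) : Hom Q x R" using n(1) xo by simp
  have "j (n\<cdot>unit x)\<odot>counit x = j n" using n(1) xo unit(3)[OF xo] by (simp add: j_cmp)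
  then have "m\<cdot>fM k (j (n\<cdot>unit x)) = n" using kh[OF h] m(1) n(1) by (intro j_inj[OF R, of _ "lam x"]) auto
  then have "\<epsilon>\<cdot>m\<cdot>fM k (j (n\<cdot>unit x)) = f" using kh[OF h] m(1) u' n(2) by simp
  then show "\<exists>h\<in>Hom Q x R. \<epsilon>\<cdot>m\<cdot>fM k h = f" using h by blast
 next
  fix x h h' assume x: "x : Ob Q" and h: "h : Hom Q x R" "h' : Hom Q x R" and eq: "\<epsilon>\<cdot>m\<cdot>fM k h = \<epsilon>\<cdot>m\<cdot>fM k h'"
  have xo: "x : ob" using x Q_Ob by simp
  have "m\<cdot>fM k h = m\<cdot>fM k h'"
   by (rule universal_ext[OF u lam_perp[OF xo]]) (use kh[OF h(1)] kh[OF h(2)] m(1) u' eq in auto)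
  then have e: "h\<odot>counit x = h'\<odot>counit x" using kh[OF h(1)] kh[OF h(2)] by simp
  have "g = g\<odot>counit x\<odot>j (unit x)" if "g : Hom Q x R" for g using that xo unit(2)[OF xo] by simp
  then show "h = h'" using h e by metis
 qed
 then show ?thesis by blast
qed

end

locale smashing_localization = localization U C M Q k
 for U :: "'u set" and C :: "('o, 'm, 'x) tricat_scheme" (structure) and M :: "'o set"
  and Q :: "('o, ('m \<times> 'm) set, 'z) cat_scheme" and k :: "('o, ('m \<times> 'm) set, 'o, 'm) func" +
 assumes k_coproducts: "preserves_small_coproducts U Q C k"
begin

lemma L_coproduct:
 assumes "small U (I :: 'u set)" "is_coproduct C I X P io" shows "is_coproduct C I (%i. lam (X i)) (lam P) (%i. fM L (io i))"
 using k_coproducts assms(1) j_coproduct[OF assms(2)] unfolding preserves_small_coproducts_def L_def by fastforce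

text \<open>
 The localization functor \<open>L\<close> is exact and, the localization being smashing, preserves coproducts.
 So each \<open>Hom (L -) A\<close> is representable; the representing object is local, as \<open>L\<close> kills \<open>M\<close>.
\<close>

theorem coreflection:
 assumes A: "A : ob"
 obtains R \<epsilon> where "R : perp" "universal C C id_func perp A R \<epsilon>"
proof -
 have "\<exists>R al. universal C C L (ob) A R al"
 proof (rule universal_exists[OF L_functor])
  show "fM L (pls f g) = pls (fM L f) (fM L g)"
   if "f : arr" "g : arr" "dom g = dom f" "cod g = cod f" for f g
   by (rule unit_inj[of "dom f" "lam (cod f)"]) (use that lam_perp L_unit[of f] L_unit[of g] L_unit[of "pls f g"] in auto)
  show "preserves_small_coproducts U C C L" unfolding preserves_small_coproducts_def using L_coproduct by simp
  show "\<exists>c\<in>Hom C (fO L (cod g)) A. c\<cdot>fM L g = b"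
   if t: "(f, g, h) : tri" and b: "b : Hom C (fO L (cod f)) A" "b\<cdot>fM L f = zro (fO L (dom f)) A" for f g h b
  proof -
   note T = triD[OF t]
   obtain g' h' where t': "(fM L f, g', h') : tri" using tri_cone[of "fM L f"] T by auto
   note T' = triD[OF t']
   have Z: "cod g' : perp"
    by (rule triangulated_subcategoryD(5)[OF perp_triangulated t']) (use T lam_perp in auto)
   obtain c where c: "c : Hom C (cod g) (cod g')" "c\<cdot>g = g'\<cdot>unit (cod f)"
    using tri_fill[OF t t', of "unit (dom f)" "unit (cod f)"] L_unit[of f] T by auto
   obtain m where m: "m : Hom C (lam (cod g)) (cod g')" "m\<cdot>unit (cod g) = c"
    by (rule unit_sur[OF _ Z c(1)]) (use T in auto)
   have "m\<cdot>fM L g = g'"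
   proof (rule unit_inj[OF _ Z])
    have "m\<cdot>fM L g\<cdot>unit (cod f) = m\<cdot>unit (cod g)\<cdot>g" using L_unit[of g] T m(1) by simp
    then show "m\<cdot>fM L g\<cdot>unit (cod f) = g'\<cdot>unit (cod f)" using m(2) c(2) by simp
   qed (use m(1) T T' in auto)
   moreover obtain b' where b': "b' : Hom C (cod g') A" "b'\<cdot>g' = b"
    using tri_ext[OF t', of b A] b T by auto
   ultimately have "b'\<cdot>m\<cdot>fM L g = b" using m(1) T by simp
   moreover have "b'\<cdot>m : Hom C (fO L (cod g)) A" using b'(1) m(1) by simp
   ultimately show ?thesis by blast
  qed
 qed (rule A)
 then obtain R al where u: "universal C C L (ob) A R al" by blast
 note u' = universalD[OF u]
 have R: "R : perp"
 proof -
  have "m = zro B R" if B: "B : M" "m : Hom C B R" for B m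
  proof -
   have Bo: "B : ob" by (rule M_D(1)[OF B(1)])
   have z: "zro B R : Hom C B R" using Bo u'(1) by simp
   have "fM L m = fM L (zro B R)"
    by (rule is_zero_eq_from[OF lam_of_M[OF B(1)], of _ "lam R"]) (use B(2) Bo u'(1) in auto)
   then show ?thesis using universal_ext[OF u Bo B(2) z] by simp
  qed
  then show ?thesis by (intro perpI) (use u'(1) in \<open>auto simp del: in_Hom\<close>)
 qed
 have "universal C C id_func perp A R (al\<cdot>unit R)"
 proof (rule universalI[OF R])
  have Lh: "al\<cdot>unit R\<cdot>h = al\<cdot>fM L h\<cdot>unit N" if h: "h : Hom C N R" for h N
   using L_unit[of h] h u' ob_dom[of h] by auto
  show "al\<cdot>unit R : Hom C (fO id_func R) A" using u' by simp
  show "\<exists>h\<in>Hom C N R. al\<cdot>unit R\<cdot>fM id_func h = f" if N: "N : perp" and f: "f : Hom C (fO id_func N) A" for N f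
  proof -
   obtain \<mu> where \<mu>: "\<mu> : Hom C (lam N) N" "\<mu>\<cdot>unit N = ide N" "unit N\<cdot>\<mu> = ide (lam N)" by (rule unit_iso[OF N])
   obtain h where h: "h : Hom C N R" "al\<cdot>fM L h = f\<cdot>\<mu>"
    by (rule universal_lift[OF u, of N "f\<cdot>\<mu>"]) (use f \<mu> perpD(1)[OF N] in auto)
   have "al\<cdot>unit R\<cdot>h = f" unfolding Lh[OF h(1)] h(2) using \<mu> f perpD(1)[OF N] by simp
   then show ?thesis using h(1) by auto
  qed
  show "h = h'" if N: "N : perp" and h: "h : Hom C N R" "h' : Hom C N R"
   and eq: "al\<cdot>unit R\<cdot>fM id_func h = al\<cdot>unit R\<cdot>fM id_func h'" for N h h'
  proof -
   obtain \<mu> where \<mu>: "\<mu> : Hom C (lam N) N" "\<mu>\<cdot>unit N = ide N" "unit N\<cdot>\<mu> = ide (lam N)" by (rule unit_iso[OF N])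
   have No: "N : ob" by (rule perpD(1)[OF N])
   have c: "al\<cdot>fM L g = al\<cdot>fM L g\<cdot>unit N\<cdot>\<mu>" if "g : Hom C N R" for g using that \<mu> u' No by simp
   have "al\<cdot>fM L h = al\<cdot>fM L h'" using c[OF h(1)] c[OF h(2)] Lh[OF h(1)] Lh[OF h(2)] eq by simp
   then show ?thesis by (rule universal_ext[OF u No h])
  qed
 qed
 then show thesis using that R by blast
qed

end


section \<open>Cominimality and costratification in a lattice of subcategories\<close>

definition least_containing :: "'o set set => 'o set => 'o set" where
 "least_containing \<C> A = \<Inter> {C : \<C>. A <= C}"

definition comin :: "'o set => 'o set set => ('s => 'o => 'o) => 's set => 'o => bool" where
 "comin Z \<C> h S I \<longleftrightarrow> (\<forall>s\<in>S. \<forall>C\<in>\<C>. C <= least_containing \<C> {h s I} --> C = Z \<or> C = least_containing \<C> {h s I})"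

definition locus :: "'o set => ('s => 'o => 'o) => 's set => 'o => 's set" where
 "locus Z h S A = {s : S. h s A \<notin> Z}"

definition costrat :: "'o set => 'o set => 'o set set => ('s => 'o => 'o) => 's set => 'o => bool" where
 "costrat X Z \<C> h S I \<longleftrightarrow>
   (\<forall>W\<subseteq>locus Z h S I. {A : X. locus Z h S A <= W} : \<C> & (\<Union>A\<in>{A : X. locus Z h S A <= W}. locus Z h S A) = W) &
   (\<forall>C\<in>\<C>. (\<Union>A\<in>C. locus Z h S A) <= locus Z h S I & {A : X. locus Z h S A <= (\<Union>A\<in>C. locus Z h S A)} = C)"

lemma costratD: "costrat X Z \<C> h S I ==> C : \<C> ==> {A : X. locus Z h S A <= (\<Union>A\<in>C. locus Z h S A)} = C"
 by (simp add: costrat_def)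

lemma in_least: "x : least_containing \<C> A \<longleftrightarrow> (\<forall>C\<in>\<C>. A <= C --> x : C)"
 unfolding least_containing_def by blast

locale cosupport_model =
 fixes X Z :: "'o set" and \<C> :: "'o set set" and h :: "'s => 'o => 'o" and S :: "'s set" and I :: 'o
 assumes sub: "C : \<C> ==> C <= X" and whole: "X : \<C>" and zero: "Z : \<C>" and zero_least: "C : \<C> ==> Z <= C"
  and inter: "\<D> <= \<C> ==> \<D> ~= {} ==> \<Inter>\<D> : \<C>"
  and closed: "s : S ==> C : \<C> ==> A : C ==> h s A : C"
  and preimage: "s : S ==> C : \<C> ==> {A : X. h s A : C} : \<C>"
  and I_in: "I : X" and cogenerates: "C : \<C> ==> I : C ==> C = X"
  and orthogonal: "s : S ==> r : S ==> r ~= s ==> A : X ==> h r (h s A) : Z"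
  and idempotent: "s : S ==> A : X ==> C : \<C> ==> h s (h s A) : C \<longleftrightarrow> h s A : C"
begin

abbreviation lst :: "'o => 'o set" where "lst A \<equiv> least_containing \<C> {A}"
abbreviation loc :: "'o => 's set" where "loc \<equiv> locus Z h S"

lemma lst_in: "A : X ==> lst A : \<C>"
 unfolding least_containing_def by (rule inter) (use whole in auto)

lemma lst_self: "A : lst A" by (simp add: in_least)

lemma lst_min: "C : \<C> ==> A : C ==> lst A <= C" by (auto simp: in_least)

lemma h_in: "s : S ==> A : X ==> h s A : X" using closed whole by blast

text \<open>Since \<open>I\<close> cogenerates, \<open>h s I\<close> generates all values of \<open>h s\<close>.\<close>

lemma value_in_lst:
 assumes s: "s : S" and A: "A : X" shows "h s A : lst (h s I)"
proof -
 have "{A : X. h s A : lst (h s I)} = X"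
  by (rule cogenerates[OF preimage[OF s lst_in[OF h_in[OF s I_in]]]]) (use I_in lst_self in simp)
 then show ?thesis using A by blast
qed

lemma loc_lst:
 assumes s: "s : S" and A: "A : lst (h s I)" shows "loc A <= {s}"
proof -
 have "h r A : Z" if r: "r : S" "r ~= s" for r
 proof -
  have "lst (h s I) <= {A : X. h r A : Z}"
   by (rule lst_min[OF preimage[OF r(1) zero]]) (use orthogonal[OF s r] I_in h_in s in simp)
  then show ?thesis using A by blast
 qed
 then show ?thesis unfolding locus_def by blast
qed

text \<open>
 A subcategory of \<open>lst (h s I)\<close> has its locus in \<open>{s}\<close>, and is determined by it.
\<close>

lemma costrat_imp_comin:
 assumes c: "costrat X Z \<C> h S I" shows "comin Z \<C> h S I"
 unfolding comin_def
proof (intro ballI impI)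
 fix s C assume s: "s : S" and C: "C : \<C>" and sub': "C <= lst (h s I)"
 let ?al = "%W. {A : X. loc A <= W}" and ?\<beta> = "%C. \<Union>A\<in>C. loc A"
 have ab: "?al (?\<beta> C) = C" if "C : \<C>" for C by (rule costratD[OF c that])
 have L: "lst (h s I) : \<C>" by (rule lst_in[OF h_in[OF s I_in]])
 have bL: "?\<beta> (lst (h s I)) <= {s}" using loc_lst[OF s] by blast
 have bZ: "?\<beta> Z = {}" unfolding locus_def using closed[OF _ zero] by blast
 have bC: "?\<beta> C <= ?\<beta> (lst (h s I))" using sub' by blast
 show "C = Z \<or> C = lst (h s I)"
 proof (cases "?\<beta> C = {}")
  case True then show ?thesis using ab[OF C] ab[OF zero] bZ by metis
 next
  case False
  then have "?\<beta> C = ?\<beta> (lst (h s I))" using bC bL by blast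
  then show ?thesis using ab[OF C] ab[OF L] by metis
 qed
qed

text \<open>
 If \<open>s\<close> is in the locus of \<open>C\<close>, then by minimality \<open>C\<close> contains all of \<open>lst (h s I)\<close> and with it every
 value of \<open>h s\<close>; the local-to-global principle then puts into \<open>C\<close> all objects with locus in that of \<open>C\<close>.
\<close>

lemma comin_imp_costrat:
 assumes c: "comin Z \<C> h S I"
  and ctg: "!!A. A : X ==> least_containing \<C> {A} = least_containing \<C> {h s A | s. s : S}"
 shows "costrat X Z \<C> h S I"
 unfolding costrat_def
proof (intro conjI ballI allI impI)
 let ?al = "%W. {A : X. loc A <= W}"
 fix W assume W: "W <= loc I"
 have e: "?al W = \<Inter> (insert X ((%s. {A : X. h s A : Z}) ` (S - W)))" unfolding locus_def by blast
 show "?al W : \<C>" unfolding e by (rule inter) (use whole preimage zero in blast)+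
 have "s : (\<Union>A\<in>?al W. loc A)" if "s : W" for s
 proof -
  have s: "s : S" "h s I \<notin> Z" using W that unfolding locus_def by blast+
  have "h s I : ?al W" using h_in[OF s(1) I_in] loc_lst[OF s(1) lst_self] that by blast
  moreover have "s : loc (h s I)" using s idempotent[OF s(1) I_in zero] unfolding locus_def by simp
  ultimately show ?thesis by blast
 qed
 then show "(\<Union>A\<in>?al W. loc A) = W" by blast
next
 fix C assume C: "C : \<C>"
 show "(\<Union>A\<in>C. loc A) <= loc I"
 proof
  fix s assume "s : (\<Union>A\<in>C. loc A)"
  then obtain A where A: "A : X" "s : S" "h s A \<notin> Z" using sub[OF C] unfolding locus_def by blast
  have "h s I \<notin> Z"
  proof
   assume "h s I : Z"
   then have "{A : X. h s A : Z} = X" using cogenerates[OF preimage[OF A(2) zero]] I_in by blast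
   then show False using A by blast
  qed
  then show "s : loc I" using A(2) unfolding locus_def by blast
 qed
 show "{A : X. loc A <= (\<Union>A\<in>C. loc A)} = C"
 proof
  show "C <= {A : X. loc A <= (\<Union>A\<in>C. loc A)}" using sub[OF C] by blast
  show "{A : X. loc A <= (\<Union>A\<in>C. loc A)} <= C"
  proof
   fix A assume "A : {A : X. loc A <= (\<Union>A\<in>C. loc A)}"
   then have A: "A : X" "loc A <= (\<Union>A\<in>C. loc A)" by blast+
   have "h s A : C" if s: "s : S" for s
   proof (cases "h s A : Z")
    case True then show ?thesis using zero_least[OF C] by blast
   next
    case False
    then obtain B where B: "B : C" "h s B \<notin> Z" using A(2) s unfolding locus_def by blast
    have BX: "B : X" using B(1) sub[OF C] by blast
    have "lst (h s B) <= lst (h s I)" by (rule lst_min[OF lst_in[OF h_in[OF s I_in]] value_in_lst[OF s BX]])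
    then have "lst (h s B) = lst (h s I)"
     using c s lst_in[OF h_in[OF s BX]] lst_self[of "h s B"] B(2) unfolding comin_def by blast
    then show ?thesis using value_in_lst[OF s A(1)] lst_min[OF C closed[OF s C B(1)]] by blast
   qed
   then have "{h s A | s. s : S} <= C" by blast
   then have "least_containing \<C> {h s A | s. s : S} <= C" using C unfolding least_containing_def by blast
   then show "A : C" using ctg[OF A(1)] lst_self[of A] by blast
  qed
 qed
qed

text \<open>Restriction to the subcategories of members \<open>P s\<close> of \<open>\<C>\<close>, each with a cogenerator \<open>J s\<close>.\<close>

context
 fixes P :: "'s => 'o set" and J :: "'s => 'o"
 assumes P: "!!s. s : S ==> P s : \<C>" and J: "!!s. s : S ==> J s : P s"
  and J_cogenerates: "!!s C. s : S ==> C : \<C> ==> C <= P s ==> J s : C ==> C = P s"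
begin

lemma PX: "s : S ==> A : P s ==> A : X" using sub[OF P] by blast

lemma least_sub:
 assumes s: "s : S" and A: "A <= P s" shows "least_containing {C : \<C>. C <= P s} A = least_containing \<C> A"
proof (intro subset_antisym subsetI)
 fix x assume x: "x : least_containing {C : \<C>. C <= P s} A"
 show "x : least_containing \<C> A"
  unfolding in_least
 proof (intro ballI impI)
  fix C assume C: "C : \<C>" "A <= C"
  have "\<Inter> {C, P s} : \<C>" by (rule inter) (use C P[OF s] in auto)
  then have "\<Inter> {C, P s} : {C : \<C>. C <= P s}" by blast
  moreover have "A <= \<Inter> {C, P s}" using A C by blast
  ultimately show "x : C" using x unfolding in_least by blast
 qed
qed (simp add: in_least)

lemma submodel: assumes s: "s : S" shows "cosupport_model (P s) Z {C : \<C>. C <= P s} h S (J s)"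
proof
 show "\<Inter> \<D> : {C : \<C>. C <= P s}" if "\<D> <= {C : \<C>. C <= P s}" "\<D> ~= {}" for \<D>
 proof -
  have "\<D> <= \<C>" "\<Inter> \<D> <= P s" using that by auto
  then show ?thesis using inter[of \<D>] that(2) by simp
 qed
 show "{A : P s. h r A : C} : {C : \<C>. C <= P s}" if r: "r : S" and C: "C : {C : \<C>. C <= P s}" for r C
 proof -
  have e: "{A : P s. h r A : C} = \<Inter> {P s, {A : X. h r A : C}}" using PX[OF s] by blast
  have "\<Inter> {P s, {A : X. h r A : C}} : \<C>" by (rule inter) (use P[OF s] preimage[OF r] C in auto)
  then show ?thesis using e by auto
 qed
 show "h r (h t A) : Z" if "t : S" "r : S" "r ~= t" "A : P s" for r t A by (rule orthogonal[OF that(1-3) PX[OF s that(4)]])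
 show "h t (h t A) : C \<longleftrightarrow> h t A : C" if "t : S" "A : P s" "C : {C : \<C>. C <= P s}" for t A C
  using idempotent[OF that(1) PX[OF s that(2)]] that(3) by blast
 show "C = P s" if "C : {C : \<C>. C <= P s}" "J s : C" for C using J_cogenerates[OF s] that by blast
 show "h r A : C" if "r : S" "C : {C : \<C>. C <= P s}" "A : C" for r C A using closed that by blast
qed (use P[OF s] zero zero_least J[OF s] in blast)+

text \<open>If \<open>h s I\<close> lies in \<open>P s\<close>, then it generates the same subcategory as \<open>h s (J s)\<close>.\<close>

theorem comin_iff_local:
 assumes loc: "!!s. s : S ==> h s I : P s"
 shows "comin Z \<C> h S I \<longleftrightarrow> (\<forall>s\<in>S. comin Z {C : \<C>. C <= P s} h S (J s))"
proof -
 have ls: "least_containing {C : \<C>. C <= P s} {h t (J s)} = lst (h t (J s))" if "s : S" "t : S" for s t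
  using least_sub[OF that(1), of "{h t (J s)}"] closed[OF that(2) P[OF that(1)] J[OF that(1)]] by simp
 have JI: "lst (h t (J s)) <= lst (h t I)" if "s : S" "t : S" for s t
  by (rule lst_min[OF lst_in[OF h_in[OF that(2) I_in]] value_in_lst[OF that(2) PX[OF that(1) J[OF that(1)]]]])
 have IJ: "lst (h s I) = lst (h s (J s))" if s: "s : S" for s
 proof (rule subset_antisym[OF _ JI[OF s s]])
  interpret P: cosupport_model "P s" Z "{C : \<C>. C <= P s}" h S "J s" by (rule submodel[OF s])
  have L: "lst (h s (J s)) : \<C>" by (rule lst_in[OF h_in[OF s PX[OF s J[OF s]]]])
  have "h s (h s I) : lst (h s (J s))" using P.value_in_lst[OF s loc[OF s]] ls[OF s s] by simp
  then show "lst (h s I) <= lst (h s (J s))" using lst_min[OF L] idempotent[OF s I_in L] by blast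
 qed
 show ?thesis
 proof
  assume c: "comin Z \<C> h S I"
  show "\<forall>s\<in>S. comin Z {C : \<C>. C <= P s} h S (J s)"
   unfolding comin_def
  proof (intro ballI impI)
   fix s t C assume s: "s : S" and t: "t : S" and C: "C : {C : \<C>. C <= P s}"
    and sub: "C <= least_containing {C : \<C>. C <= P s} {h t (J s)}"
   have C': "C <= lst (h t (J s))" using sub ls[OF s t] by simp
   have L: "lst (h t (J s)) : \<C>" by (rule lst_in[OF h_in[OF t PX[OF s J[OF s]]]])
   have d: "D = Z \<or> D = lst (h t I)" if "D : \<C>" "D <= lst (h t (J s))" for D
    using c t that JI[OF s t] unfolding comin_def by blast
   show "C = Z \<or> C = least_containing {C : \<C>. C <= P s} {h t (J s)}"
    unfolding ls[OF s t] using d[OF _ C'] d[OF L subset_refl] C C' zero_least[of C] by auto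
  qed
 next
  assume c: "\<forall>s\<in>S. comin Z {C : \<C>. C <= P s} h S (J s)"
  show "comin Z \<C> h S I"
   unfolding comin_def
  proof (intro ballI impI)
   fix s C assume s: "s : S" and C: "C : \<C>" and sub: "C <= lst (h s I)"
   have "C <= P s" using sub lst_min[OF P[OF s] loc[OF s]] by blast
   then show "C = Z \<or> C = lst (h s I)"
    using c[THEN bspec, OF s] s C sub unfolding comin_def IJ[OF s] ls[OF s s, symmetric] by blast
  qed
 qed
qed

theorem costrat_iff_local:
 assumes loc: "!!s. s : S ==> h s I : P s"
  and ctg: "!!A. A : X ==> least_containing \<C> {A} = least_containing \<C> {h s A | s. s : S}"
 shows "costrat X Z \<C> h S I \<longleftrightarrow> (\<forall>s\<in>S. costrat (P s) Z {C : \<C>. C <= P s} h S (J s))"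
proof -
 have "costrat (P s) Z {C : \<C>. C <= P s} h S (J s) \<longleftrightarrow> comin Z {C : \<C>. C <= P s} h S (J s)" if s: "s : S" for s
 proof -
  interpret P: cosupport_model "P s" Z "{C : \<C>. C <= P s}" h S "J s" by (rule submodel[OF s])
  have "least_containing {C : \<C>. C <= P s} {A} = least_containing {C : \<C>. C <= P s} {h s A | s. s : S}" if A: "A : P s" for A
  proof -
   have "{h s A | s. s : S} <= P s" using closed P[OF s] A by blast
   then show ?thesis using least_sub[OF s] A ctg[OF PX[OF s A]] by simp
  qed
  then show ?thesis using P.costrat_imp_comin P.comin_imp_costrat by blast
 qed
 moreover have "costrat X Z \<C> h S I \<longleftrightarrow> comin Z \<C> h S I"
  using costrat_imp_comin comin_imp_costrat ctg by blast
 ultimately show ?thesis using comin_iff_local[OF loc] by simp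
qed

end

text \<open>A second model whose subcategories are the preimages of those of the first along a map
 \<open>l\<close>, which does not move the objects of the first out of any subcategory they belong to.\<close>

context
 fixes X' :: "'o set" and \<C>' :: "'o set set" and h' :: "'s => 'o => 'o" and I' :: 'o and l :: "'o => 'o"
  and Z' :: "'o set"
 assumes X': "X <= X'" and \<C>': "\<C>' = (%C. {A : X'. l A : C}) ` \<C>" and Z': "Z' = {A : X'. l A : Z}"
  and l: "!!A C. A : X ==> C : \<C> ==> l A : C \<longleftrightarrow> A : C"
  and h': "!!s A C. s : S ==> A : X' ==> C : \<C> ==> h' s A : X' & (l (h' s A) : C \<longleftrightarrow> h s (l A) : C)"
  and lX: "!!A. A : X' ==> l A : X"
  and I': "I' : X'" "!!s C. s : S ==> C : \<C> ==> h s (l I') : C \<longleftrightarrow> h s I : C"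
  and hl: "!!s A C. s : S ==> A : X ==> C : \<C> ==> h s (l A) : C \<longleftrightarrow> h s A : C"
begin

abbreviation (input) pre :: "'o set => 'o set" where "pre C \<equiv> {A : X'. l A : C}"

lemma pre_mono: assumes "C : \<C>" "D : \<C>" shows "pre C <= pre D \<longleftrightarrow> C <= D"
proof
 assume p: "pre C <= pre D"
 show "C <= D"
 proof
  fix A assume A: "A : C"
  then have AX: "A : X" using sub[OF assms(1)] by blast
  then have "A : pre C" using l[OF AX assms(1)] A X' by blast
  then show "A : D" using p l[OF AX assms(2)] by blast
 qed
qed blast

lemma pre_eq: assumes "C : \<C>" "D : \<C>" shows "pre C = pre D \<longleftrightarrow> C = D"
 using pre_mono[OF assms] pre_mono[OF assms(2,1)] by blast

lemma pre_lst:
 assumes s: "s : S" shows "least_containing \<C>' {h' s I'} = pre (lst (h s I))"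
proof -
 have e: "h' s I' : pre C \<longleftrightarrow> h s I : C" if "C : \<C>" for C
  using h'[OF s I'(1) that] I'(2)[OF s that] by blast
 have "A : X' ==> l A : X" for A by (rule lX)
 show ?thesis
 proof (intro subset_antisym subsetI)
  fix A assume "A : least_containing \<C>' {h' s I'}"
  then have "\<forall>D\<in>\<C>'. {h' s I'} <= D --> A : D" unfolding in_least .
  then have A: "A : pre C" if "C : \<C>" "h s I : C" for C
   using e[OF that(1)] that unfolding \<C>' by simp
  have "A : X'" using A[OF whole h_in[OF s I_in]] by blast
  then show "A : pre (lst (h s I))" using A unfolding in_least by blast
 next
  fix A assume "A : pre (lst (h s I))"
  then show "A : least_containing \<C>' {h' s I'}" unfolding in_least \<C>' using e by blast
 qed
qed

lemma comin_transport: "comin Z' \<C>' h' S I' \<longleftrightarrow> comin Z \<C> h S I"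
proof -
 have "(pre C <= least_containing \<C>' {h' s I'} --> pre C = Z' \<or> pre C = least_containing \<C>' {h' s I'}) \<longleftrightarrow>
  (C <= lst (h s I) --> C = Z \<or> C = lst (h s I))" if s: "s : S" and C: "C : \<C>" for s C
  using pre_lst[OF s] Z' pre_mono[OF C lst_in[OF h_in[OF s I_in]]] pre_eq[OF C lst_in[OF h_in[OF s I_in]]]
   pre_eq[OF C zero] by simp
 then show ?thesis unfolding comin_def \<C>' by simp
qed

text \<open>The preimage map is an isomorphism of lattices and, up to \<open>l\<close>, preserves loci.\<close>

lemma costrat_transport: "costrat X' Z' \<C>' h' S I' \<longleftrightarrow> costrat X Z \<C> h S I"
proof -
 have loc': "locus Z' h' S A = loc (l A)" if "A : X'" for A
  unfolding locus_def using h'[OF _ that zero] Z' by blast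
 have locl: "loc (l A) = loc A" if "A : X" for A
  unfolding locus_def using hl[OF _ that zero] by blast
 have locI: "locus Z' h' S I' = loc I" unfolding loc'[OF I'(1)] unfolding locus_def using I'(2)[OF _ zero] by blast
 have al: "{A : X'. locus Z' h' S A <= W} = pre {A : X. loc A <= W}" for W using loc' lX by blast
 have \<beta>: "(\<Union>A\<in>pre C. locus Z' h' S A) = (\<Union>A\<in>C. loc A)" if C: "C <= X" "!!A. A : X ==> l A : C \<longleftrightarrow> A : C" for C
 proof
  show "(\<Union>A\<in>pre C. locus Z' h' S A) <= (\<Union>A\<in>C. loc A)" using loc' by blast
  show "(\<Union>A\<in>C. loc A) <= (\<Union>A\<in>pre C. locus Z' h' S A)"
  proof
   fix s assume "s : (\<Union>A\<in>C. loc A)"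
   then obtain A where A: "A : C" "s : loc A" by blast
   have AX: "A : X" "A : X'" using A C X' by blast+
   then have "A : pre C" "s : locus Z' h' S A" using A C(2)[OF AX(1)] loc'[OF AX(2)] locl[OF AX(1)] by auto
   then show "s : (\<Union>A\<in>pre C. locus Z' h' S A)" by blast
  qed
 qed
 have \<beta>C: "(\<Union>A\<in>pre C. locus Z' h' S A) = (\<Union>A\<in>C. loc A)" if "C : \<C>" for C
  by (rule \<beta>[OF sub[OF that] l[OF _ that]])
 have \<beta>al: "(\<Union>A\<in>pre {A : X. loc A <= W}. locus Z' h' S A) = (\<Union>A\<in>{A : X. loc A <= W}. loc A)" for W
 proof (rule \<beta>)
  show "l A : {A : X. loc A <= W} \<longleftrightarrow> A : {A : X. loc A <= W}" if "A : X" for A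
   using locl[OF that] lX X' that by blast
 qed blast
 have pre_inj: "pre C = pre D \<longleftrightarrow> C = D" if "C <= X" "D <= X" "!!A. A : X ==> l A : C \<longleftrightarrow> A : C" "!!A. A : X ==> l A : D \<longleftrightarrow> A : D" for C D
  using that X' by blast
 have all: "l A : {A : X. loc A <= W} \<longleftrightarrow> A : {A : X. loc A <= W}" if "A : X" for A W
  using locl[OF that] lX X' that by blast
 have in': "pre {A : X. loc A <= W} : \<C>' \<longleftrightarrow> {A : X. loc A <= W} : \<C>" for W
 proof
  assume "pre {A : X. loc A <= W} : \<C>'"
  then obtain C where C: "C : \<C>" "pre {A : X. loc A <= W} = pre C" unfolding \<C>' by blast
  have "{A : X. loc A <= W} = C"
   by (rule pre_inj[OF _ sub[OF C(1)] all l[OF _ C(1)], THEN iffD1, OF _ _ _ C(2)]) blast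
  then show "{A : X. loc A <= W} : \<C>" using C by simp
 qed (use \<C>' in blast)
 have eq: "pre {A : X. loc A <= W} = pre C \<longleftrightarrow> {A : X. loc A <= W} = C" if C: "C : \<C>" for W C
  by (rule pre_inj[OF _ sub[OF C] all l[OF _ C]]) blast
 have ball: "(\<forall>D\<in>\<C>'. P D) \<longleftrightarrow> (\<forall>C\<in>\<C>. P (pre C))" for P unfolding \<C>' by blast
 show ?thesis
  unfolding costrat_def al \<beta>al locI in' ball using \<beta>C eq by simp
qed

end

end


section \<open>Relative internal homs\<close>

context cg_category
begin

lemma universal_compose:
 assumes F: "is_functor C C F" and G: "is_functor C C G"
  and u: "universal C C F (ob) y g e" and v: "universal C C G (ob) g k d"
 shows "universal C C \<lparr>fO = %x. fO F (fO G x), fM = %f. fM F (fM G f)\<rparr> (ob) y k (e\<cdot>fM F d)"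
proof (rule universalI)
 note Fn = is_functorD[OF F] and Gn = is_functorD[OF G] and u' = universalD[OF u] and v' = universalD[OF v]
 show "k : ob" "e\<cdot>fM F d : Hom C (fO \<lparr>fO = %x. fO F (fO G x), fM = %f. fM F (fM G f)\<rparr> k) y" using u' v' by (simp_all add: Fn)
 have sl: "e\<cdot>fM F d\<cdot>fM F (fM G h) = e\<cdot>fM F (d\<cdot>fM G h)" if "h : Hom C x k" for x h using that u' v' by (simp add: Fn Gn)
 fix x assume x: "x : ob"
 {
  fix f assume "f : Hom C (fO \<lparr>fO = %x. fO F (fO G x), fM = %f. fM F (fM G f)\<rparr> x) y"
  then obtain a where a: "a : Hom C (fO G x) g" "e\<cdot>fM F a = f" using universal_lift[OF u Gn(1)[OF x], of f] by auto
  obtain h where h: "h : Hom C x k" "d\<cdot>fM G h = a" by (rule universal_lift[OF v x a(1)])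
  then show "\<exists>h\<in>Hom C x k. e\<cdot>fM F d\<cdot>fM \<lparr>fO = %x. fO F (fO G x), fM = %f. fM F (fM G f)\<rparr> h = f"
   using sl[OF h(1)] a(2) by (intro bexI[OF _ h(1)]) simp
 next
  fix h h' assume h: "h : Hom C x k" "h' : Hom C x k"
   and "e\<cdot>fM F d\<cdot>fM \<lparr>fO = %x. fO F (fO G x), fM = %f. fM F (fM G f)\<rparr> h = e\<cdot>fM F d\<cdot>fM \<lparr>fO = %x. fO F (fO G x), fM = %f. fM F (fM G f)\<rparr> h'"
  then have eq: "e\<cdot>fM F (d\<cdot>fM G h) = e\<cdot>fM F (d\<cdot>fM G h')" using sl[OF h(1)] sl[OF h(2)] by simp
  have "d\<cdot>fM G h = d\<cdot>fM G h'" by (rule universal_ext[OF u Gn(1)[OF x] _ _ eq]) (use h v' in \<open>simp_all add: Gn\<close>)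
  then show "h = h'" by (rule universal_ext[OF v x h])
 }
qed

lemma universal_natural:
 assumes F: "is_functor C C F" and G: "is_functor C C G" and u: "universal C C F (ob) y g e"
  and th: "!!B. B : ob ==> th B : Hom C (fO F B) (fO G B)" "!!B. B : ob ==> is_iso C (th B)"
  and nat: "!!B B' h. h : Hom C B B' ==> th B'\<cdot>fM F h = fM G h\<cdot>th B"
 shows "\<exists>e'. universal C C G (ob) y g e'"
proof -
 note Fn = is_functorD[OF F] and Gn = is_functorD[OF G] and u' = universalD[OF u]
 have t [simp]: "th B : arr" "dom (th B) = fO F B" "cod (th B) = fO G B" if "B : ob" for B using th(1)[OF that] by simp_all
 obtain s where s: "s : Hom C (fO G g) (fO F g)" "s\<cdot>th g = ide (fO F g)"
  by (rule iso_inverse[OF th(2)[OF u'(1)]]) (use u'(1) in auto)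
 have sl: "e\<cdot>s\<cdot>fM G h\<cdot>th B = e\<cdot>fM F h" if h: "h : Hom C B g" for B h
 proof -
  have B: "B : ob" using h by auto
  have "e\<cdot>s\<cdot>fM G h\<cdot>th B = e\<cdot>(s\<cdot>(th g\<cdot>fM F h))" unfolding nat[OF h] using h s(1) u' B by (simp add: Gn)
  also have "s\<cdot>(th g\<cdot>fM F h) = fM F h" using cmp_reduce[OF s(2), of "fM F h"] h s(1) u' by (simp add: Fn)
  finally show ?thesis .
 qed
 have "universal C C G (ob) y g (e\<cdot>s)"
 proof (rule universalI[OF u'(1)])
  show "e\<cdot>s : Hom C (fO G g) y" using s(1) u' by simp
  fix B assume B: "B : ob"
  {
   fix f assume f: "f : Hom C (fO G B) y"
   obtain r where r: "r : Hom C (fO G B) (fO F B)" "th B\<cdot>r = ide (fO G B)" by (rule iso_inverse[OF th(2)[OF B]]) (use B in auto)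
   obtain h where h: "h : Hom C B g" "e\<cdot>fM F h = f\<cdot>th B" by (rule universal_lift[OF u B, of "f\<cdot>th B"]) (use f B in auto)
   have "e\<cdot>s\<cdot>fM G h = e\<cdot>s\<cdot>fM G h\<cdot>th B\<cdot>r" using r h(1) s(1) u' B by (simp add: Gn)
   also have "... = f" unfolding sl[OF h(1)] h(2) using r f B by simp
   finally show "\<exists>h\<in>Hom C B g. e\<cdot>s\<cdot>fM G h = f" using h(1) by blast
  next
   fix h h' assume h: "h : Hom C B g" "h' : Hom C B g" and eq: "e\<cdot>s\<cdot>fM G h = e\<cdot>s\<cdot>fM G h'"
   show "h = h'" by (rule universal_ext[OF u B h]) (use sl[OF h(1)] sl[OF h(2)] eq in simp)
  }
 qed
 then show ?thesis by blast
qed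

text \<open>
 The values of a right adjoint of \<open>F\<close> being products and cones of values, preimages of colocalizing
 subcategories are colocalizing.
\<close>

lemma preimage_colocalizing:
 assumes F: "is_triangulated_functor C C F \<sigma>" and A: "colocalizing U C A"
  and ex: "!!y. y : ob ==> \<exists>g e. universal C C F A y g e" and D: "colocalizing U C D"
 shows "colocalizing U C {y : ob. \<exists>g\<in>D. \<exists>e. universal C C F A y g e}" (is "colocalizing U C ?P")
 unfolding colocalizing_def
proof (intro conjI allI impI)
 show "triangulated_subcategory C ?P"
  by (rule preimage_triangulated[OF F colocalizingD(1)[OF A] ex colocalizingD(1)[OF D]])
 fix I :: "'u set" and X P pr assume a: "small U I & X ` I <= ?P & is_product C I X P pr"
 then have I: "small U I" and X: "X ` I <= ?P" and P: "is_product C I X P pr" by blast+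
 have "\<exists>g e. g : D & universal C C F A (X i) g e" if "i : I" for i using X that by blast
 then obtain g e where g: "!!i. i : I ==> g i : D" "!!i. i : I ==> universal C C F A (X i) (g i) (e i)" by metis
 have gA: "g i : A" if "i : I" for i by (rule universalD(1)[OF g(2)[OF that]])
 have Ao: "A <= ob" using triangulated_subcategoryD(1)[OF colocalizingD(1)[OF A]] by blast
 obtain R \<rho> where R: "is_product C I g R \<rho>" by (rule product_exists[OF I, of g]) (use gA Ao in auto)
 have RD: "R : D" "R : A" using colocalizingD(2)[OF D I g(1) R] colocalizingD(2)[OF A I gA R] by simp_all
 have "\<exists>e. universal C C F A P R e"
  by (rule universal_product[OF is_triangulated_functorD(1)[OF F] Ao P R RD(2) g(2)])
 then show "P : ?P" using RD(1) is_productD(1)[OF P] by blast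
qed

lemma colocalizing_Ob: "colocalizing U C (ob)"
 unfolding colocalizing_def using triangulated_subcategory_Ob is_productD(1) by blast

lemma colocalizing_zeros: "colocalizing U C {z. is_zero C z}"
 unfolding colocalizing_def
proof (intro conjI allI impI)
 show "triangulated_subcategory C {z. is_zero C z}" by (rule triangulated_subcategory_zeros)
 fix I :: "'u set" and X P pr assume a: "small U I & X ` I <= {z. is_zero C z} & is_product C I X P pr"
 then have X: "!!i. i : I ==> is_zero C (X i)" and P: "is_product C I X P pr" by blast+
 note D = is_productD[OF P]
 have "ide P = zro P P"
 proof (rule is_product_ext[OF P])
  show "pr i\<cdot>ide P = pr i\<cdot>zro P P" if "i : I" for i
   by (rule is_zero_eq_to[OF X[OF that], of _ P]) (use D that in auto)
 qed (use D in auto)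
 then show "P : {z. is_zero C z}" using is_zero_iff D by simp
qed

lemma colocalizing_Int:
 assumes "!!C'. C' : \<D> ==> colocalizing U C C'" "\<D> ~= {}" shows "colocalizing U C (\<Inter>\<D>)"
 unfolding colocalizing_def
proof (intro conjI allI impI)
 show "triangulated_subcategory C (\<Inter>\<D>)"
  by (rule triangulated_subcategory_Int) (use assms colocalizingD(1) in blast)+
 fix I :: "'u set" and X P pr assume a: "small U I & X ` I <= \<Inter>\<D> & is_product C I X P pr"
 show "P : \<Inter>\<D>"
 proof
  fix C' assume C': "C' : \<D>"
  then have "X ` I <= C'" using a by blast
  then show "P : C'" using assms(1)[OF C'] a unfolding colocalizing_def by blast
 qed
qed

end

locale module_setting = tt_module U T K + universe U + T: big_tt_category U T
 for U :: "'u set" and T :: "('a, 'p, 'x) ttcat_scheme"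
  and K :: "('o, 'm, 'a, 'p, 'y) tmod_scheme" (structure)
begin

sublocale cg_category U K ..

lemma act_simps [simp]:
 "X : Ob T ==> A : ob ==> X \<star>o\<^bsub>K\<^esub> A : ob"
 "\<xi> : Arr T ==> f : arr ==> \<xi> \<star>m\<^bsub>K\<^esub> f : arr"
 "\<xi> : Arr T ==> f : arr ==> dom (\<xi> \<star>m\<^bsub>K\<^esub> f) = Dom T \<xi> \<star>o\<^bsub>K\<^esub> dom f"
 "\<xi> : Arr T ==> f : arr ==> cod (\<xi> \<star>m\<^bsub>K\<^esub> f) = Cod T \<xi> \<star>o\<^bsub>K\<^esub> cod f"
 "X : Ob T ==> A : ob ==> Ide T X \<star>m\<^bsub>K\<^esub> ide A = ide (X \<star>o\<^bsub>K\<^esub> A)"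
 using is_functorD(1,5)[OF act_functor, of "(X, A)"] is_functorD(2-4)[OF act_functor, of "(\<xi>, f)"]
 by (simp_all add: prod_cat_def)

lemma act_cmp:
 assumes "\<xi> : Arr T" "\<xi>' : Arr T" "Cod T \<xi> = Dom T \<xi>'" "f : arr" "f' : arr" "cod f = dom f'"
 shows "(\<xi>' \<star>m\<^bsub>K\<^esub> f')\<cdot>(\<xi> \<star>m\<^bsub>K\<^esub> f) = (\<xi>'\<cdot>\<^bsub>T\<^esub>\<xi>) \<star>m\<^bsub>K\<^esub> (f'\<cdot>f)"
 using is_functorD(6)[OF act_functor, of "(\<xi>, f)" "(\<xi>', f')"] assms by (simp add: prod_cat_def)

lemma act_slide:
 assumes "\<xi> : Hom T X X'" "f : Hom K A B"
 shows "(\<xi> \<star>m\<^bsub>K\<^esub> ide B)\<cdot>(Ide T X \<star>m\<^bsub>K\<^esub> f) = (Ide T X' \<star>m\<^bsub>K\<^esub> f)\<cdot>(\<xi> \<star>m\<^bsub>K\<^esub> ide A)"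
proof -
 have "X : Ob T" "X' : Ob T" "A : ob" "B : ob" using assms by auto
 then show ?thesis using assms by (simp add: act_cmp)
qed

lemma act_left_simps [simp]: "fO (act_left T K X) A = X \<star>o\<^bsub>K\<^esub> A" "fM (act_left T K X) f = Ide T X \<star>m\<^bsub>K\<^esub> f"
 by (simp_all add: act_left_def)

lemma act_left_functor: "X : Ob T ==> is_functor K K (act_left T K X)"
 by (rule is_triangulated_functorD(1)[OF act_left_triangulated])

lemma hom_exists:
 assumes X: "X : Ob T" and A: "A : ob" shows "\<exists>g e. universal K K (act_left T K X) (ob) A g e"
proof (rule universal_exists[OF act_left_functor[OF X]])
 note F = is_triangulated_functorD[OF act_left_triangulated[OF X]]
 show "fM (act_left T K X) (pls f g) = pls (fM (act_left T K X) f) (fM (act_left T K X) g)"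
  if "f : arr" "g : arr" "dom g = dom f" "cod g = cod f" for f g
  using F(3)[OF that category_axioms] .
 show "\<exists>c\<in>Hom K (fO (act_left T K X) (cod g)) A. c\<cdot>fM (act_left T K X) g = b"
  if t: "(f, g, h) : tri" and b: "b : Hom K (fO (act_left T K X) (cod f)) A"
   "b\<cdot>fM (act_left T K X) f = zro (fO (act_left T K X) (dom f)) A" for f g h b
 proof -
  note T = triD[OF t]
  obtain c where "c : Hom K (cod (fM (act_left T K X) g)) A" "c\<cdot>fM (act_left T K X) g = b"
   by (rule tri_ext[OF F(7)[OF t], of b A]) (use b T X in auto)
  then show ?thesis using T X by auto
 qed
qed (use act_left_coproducts[OF X] A in auto)

abbreviation hm :: "'a => 'o => 'o" where "hm \<equiv> rel_hom T K"

lemma hom_universal: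
 assumes X: "X : Ob T" and A: "A : ob" obtains e where "universal K K (act_left T K X) (ob) A (hm X A) e"
proof -
 have "right_adjoint K K (act_left T K X) (radj K K (act_left T K X))"
  by (rule radj_universal[OF category_axioms category_axioms act_left_functor[OF X] hom_exists[OF X]])
 then obtain e where "!!y. y : ob ==> universal K K (act_left T K X) (ob) y (fO (radj K K (act_left T K X)) y) (e y)"
  using right_adjoint_universal[OF category_axioms category_axioms act_left_functor[OF X]] by blast
 then show thesis using that A unfolding rel_hom_def by blast
qed

lemma hm_unique:
 assumes X: "X : Ob T" and i: "isomorphic K A B" and u: "universal K K (act_left T K X) (ob) B g e"
 shows "isomorphic K (hm X A) g"
proof -
 obtain e' where "universal K K (act_left T K X) (ob) A (hm X A) e'"
  by (rule hom_universal[OF X]) (use isomorphic_ob[OF i] in blast)+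
 then show ?thesis
  using universal_isomorphic[OF category_axioms category_axioms act_left_functor[OF X] subset_refl _ u i] by blast
qed

lemma hm_ob [simp]: "X : Ob T ==> A : ob ==> hm X A : ob"
 using hom_universal universalD(1) by metis

lemma hm_cong: assumes X: "X : Ob T" and i: "isomorphic K A B" shows "isomorphic K (hm X A) (hm X B)"
proof -
 obtain e where "universal K K (act_left T K X) (ob) B (hm X B) e"
  by (rule hom_universal[OF X]) (use isomorphic_ob[OF i] in blast)+
 then show ?thesis by (rule hm_unique[OF X i])
qed

lemma tens_ob [simp]: "X : Ob T ==> Y : Ob T ==> X \<otimes>o\<^bsub>T\<^esub> Y : Ob T"
 using is_functorD(1)[OF T.tens_functor, of "(X, Y)"] by (simp add: prod_cat_def)

lemma tens_ide [simp]: "X : Ob T ==> Y : Ob T ==> Ide T X \<otimes>m\<^bsub>T\<^esub> Ide T Y = Ide T (X \<otimes>o\<^bsub>T\<^esub> Y)"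
 using is_functorD(5)[OF T.tens_functor, of "(X, Y)"] by (simp add: prod_cat_def)

lemma hm_cong_left: assumes i: "isomorphic T X X'" and A: "A : ob" shows "isomorphic K (hm X A) (hm X' A)"
proof -
 obtain \<xi> \<zeta> where x: "\<xi> : Hom T X X'" "\<zeta> : Hom T X' X" "\<zeta>\<cdot>\<^bsub>T\<^esub>\<xi> = Ide T X" "\<xi>\<cdot>\<^bsub>T\<^esub>\<zeta> = Ide T X'" "X : Ob T" "X' : Ob T"
  using i by (rule T.isomorphicE)
 obtain e where u: "universal K K (act_left T K X') (ob) A (hm X' A) e" by (rule hom_universal[OF x(6) A])
 have "\<exists>e. universal K K (act_left T K X) (ob) A (hm X' A) e"
 proof (rule universal_natural[OF act_left_functor[OF x(6)] act_left_functor[OF x(5)] u])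
  show "\<zeta> \<star>m\<^bsub>K\<^esub> ide B : Hom K (fO (act_left T K X') B) (fO (act_left T K X) B)" "is_iso K (\<zeta> \<star>m\<^bsub>K\<^esub> ide B)" if "B : ob" for B
   using x that by (auto intro!: is_isoI[of _ "\<xi> \<star>m\<^bsub>K\<^esub> ide B"] simp: act_cmp)
  show "(\<zeta> \<star>m\<^bsub>K\<^esub> ide B')\<cdot>fM (act_left T K X') h = fM (act_left T K X) h\<cdot>(\<zeta> \<star>m\<^bsub>K\<^esub> ide B)" if "h : Hom K B B'" for B B' h
   using act_slide[OF x(2) that] by simp
 qed
 then show ?thesis using hm_unique[OF x(5) isomorphic_refl[OF A]] by blast
qed

lemma hm_assoc: assumes X: "X : Ob T" and Y: "Y : Ob T" and A: "A : ob"
 shows "isomorphic K (hm (Y \<otimes>o\<^bsub>T\<^esub> X) A) (hm X (hm Y A))"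
proof -
 let ?F = "\<lparr>fO = %B. fO (act_left T K Y) (fO (act_left T K X) B), fM = %f. fM (act_left T K Y) (fM (act_left T K X) f)\<rparr>"
 note FX = act_left_functor[OF X] and FY = act_left_functor[OF Y] and YX = tens_ob[OF Y X]
 obtain e where u: "universal K K (act_left T K Y) (ob) A (hm Y A) e" by (rule hom_universal[OF Y A])
 obtain d where v: "universal K K (act_left T K X) (ob) (hm Y A) (hm X (hm Y A)) d"
  by (rule hom_universal[OF X, of "hm Y A"]) (use Y A in auto)
 have "\<exists>e. universal K K (act_left T K (Y \<otimes>o\<^bsub>T\<^esub> X)) (ob) A (hm X (hm Y A)) e"
 proof (rule universal_natural[OF _ act_left_functor[OF YX] universal_compose[OF FY FX u v]])
  show "is_functor K K ?F" using is_functorD[OF FX] is_functorD[OF FY] unfolding is_functor_def by simp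
  show "massoc K Y X B : Hom K (fO ?F B) (fO (act_left T K (Y \<otimes>o\<^bsub>T\<^esub> X)) B)" "is_iso K (massoc K Y X B)" if "B : ob" for B
   using massoc_iso[OF Y X that] by simp_all
  show "massoc K Y X B'\<cdot>fM ?F h = fM (act_left T K (Y \<otimes>o\<^bsub>T\<^esub> X)) h\<cdot>massoc K Y X B" if "h : Hom K B B'" for B B' h
   using massoc_natural[of "Ide T Y" "Ide T X" h] X Y that by simp
 qed
 then show ?thesis using hm_unique[OF YX isomorphic_refl[OF A]] by blast
qed

lemma hm_commute: assumes "X : Ob T" "Y : Ob T" "A : ob" shows "isomorphic K (hm X (hm Y A)) (hm Y (hm X A))"
proof -
 have "isomorphic T (Y \<otimes>o\<^bsub>T\<^esub> X) (X \<otimes>o\<^bsub>T\<^esub> Y)"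
  by (rule T.isomorphicI[OF T.braid_hom T.braid_hom T.symmetry T.symmetry]) (use assms in auto)
 then show ?thesis
  using hm_assoc[OF assms] hm_assoc[OF assms(2,1,3)] hm_cong_left assms(3) isomorphic_sym isomorphic_trans by metis
qed

lemma hm_zero_left: assumes X: "is_zero T X" and A: "A : ob" shows "is_zero K (hm X A)"
proof -
 have Xo: "X : Ob T" using X by simp
 obtain e where u: "universal K K (act_left T K X) (ob) A (hm X A) e" by (rule hom_universal[OF Xo A])
 have go: "hm X A : ob" using Xo A by simp
 have "Ide T X \<star>m\<^bsub>K\<^esub> ide (hm X A) = Zro T X X \<star>m\<^bsub>K\<^esub> ide (hm X A)" using X unfolding T.is_zero_iff by simp
 also have "... = fM (act_right K (hm X A)) (Zro T X X)" by (simp add: act_right_def)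
 also have "... = zro (X \<star>o\<^bsub>K\<^esub> hm X A) (X \<star>o\<^bsub>K\<^esub> hm X A)"
  using additive_functor_zro[OF T.additive_category_axioms additive_category_axioms
   is_triangulated_functorD(2)[OF act_right_triangulated[OF go]] Xo Xo] by (simp add: act_right_def)
 finally have "ide (X \<star>o\<^bsub>K\<^esub> hm X A) = zro (X \<star>o\<^bsub>K\<^esub> hm X A) (X \<star>o\<^bsub>K\<^esub> hm X A)" using Xo go by simp
 then have z: "is_zero K (X \<star>o\<^bsub>K\<^esub> hm X A)" unfolding is_zero_iff using Xo go by simp
 have "ide (hm X A) = zro (hm X A) (hm X A)"
 proof (rule universal_ext[OF u go])
  show "e\<cdot>fM (act_left T K X) (ide (hm X A)) = e\<cdot>fM (act_left T K X) (zro (hm X A) (hm X A))"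
   by (rule is_zero_eq_from[OF z, of _ A]) (use universalD[OF u] Xo go in auto)
 qed (use go in auto)
 then show ?thesis unfolding is_zero_iff using go by simp
qed

lemma hm_preimage:
 assumes X: "X : Ob T" and D: "colocalizing U K D" shows "colocalizing U K {A : ob. hm X A : D}"
proof -
 have "{A : ob. hm X A : D} = {y : ob. \<exists>g\<in>D. \<exists>e. universal K K (act_left T K X) (ob) y g e}"
 proof (intro subset_antisym subsetI)
  fix A assume "A : {A : ob. hm X A : D}"
  then show "A : {y : ob. \<exists>g\<in>D. \<exists>e. universal K K (act_left T K X) (ob) y g e}"
   using hom_universal[OF X, of A] by blast
 next
  fix A assume "A : {y : ob. \<exists>g\<in>D. \<exists>e. universal K K (act_left T K X) (ob) y g e}"
  then obtain g e where g: "A : ob" "g : D" "universal K K (act_left T K X) (ob) A g e" by blast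
  have "isomorphic K g (hm X A)" by (rule isomorphic_sym[OF hm_unique[OF X isomorphic_refl[OF g(1)] g(3)]])
  then show "A : {A : ob. hm X A : D}"
   using triangulated_subcategoryD(2)[OF colocalizingD(1)[OF D] g(2)] g(1) by blast
 qed
 then show ?thesis
  using preimage_colocalizing[OF act_left_triangulated[OF X] colocalizing_Ob hom_exists[OF X] D] by simp
qed

abbreviation \<C> :: "'o set set" where "\<C> \<equiv> Coloc_hom U T K"
abbreviation zeros :: "'o set" where "zeros \<equiv> {z. is_zero K z}"

lemma ColocD: assumes "C : \<C>" shows "colocalizing U K C" "X : Ob T ==> A : C ==> hm X A : C"
 "A : C ==> isomorphic K A B ==> B : C" "A : C ==> A : ob"
 using assms triangulated_subcategoryD[OF colocalizingD(1)] unfolding Coloc_hom_def by blast+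

lemma ColocI: "colocalizing U K C ==> (!!X A. X : Ob T ==> A : C ==> hm X A : C) ==> C : \<C>"
 unfolding Coloc_hom_def by blast

lemma Coloc_iso_iff: "C : \<C> ==> isomorphic K A B ==> A : C \<longleftrightarrow> B : C"
 using ColocD(3) isomorphic_sym by blast

lemma Coloc_Ob: "ob : \<C>" by (rule ColocI[OF colocalizing_Ob]) simp

lemma Coloc_zeros: "zeros : \<C>"
proof (rule ColocI[OF colocalizing_zeros])
 fix X A assume X: "X : Ob T" and A: "A : zeros"
 have "A : {A : ob. hm X A : zeros}"
  by (rule triangulated_subcategoryD(3)[OF colocalizingD(1)[OF hm_preimage[OF X colocalizing_zeros]]]) (use A in simp)
 then show "hm X A : zeros" by blast
qed

lemma Coloc_preimage: assumes X: "X : Ob T" and C: "C : \<C>" shows "{A : ob. hm X A : C} : \<C>"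
proof (rule ColocI[OF hm_preimage[OF X ColocD(1)[OF C]]])
 fix Y A assume Y: "Y : Ob T" and A: "A : {A : ob. hm X A : C}"
 have "hm Y (hm X A) : C" using ColocD(2)[OF C Y] A by blast
 then have "hm X (hm Y A) : C" using ColocD(3)[OF C] hm_commute[OF Y X] A by blast
 then show "hm Y A : {A : ob. hm X A : C}" using Y A by simp
qed

lemma Coloc_Int: assumes "\<D> <= \<C>" "\<D> ~= {}" shows "\<Inter>\<D> : \<C>"
proof (rule ColocI)
 show "colocalizing U K (\<Inter>\<D>)" by (rule colocalizing_Int) (use assms ColocD(1) in blast)+
 show "hm X A : \<Inter>\<D>" if "X : Ob T" "A : \<Inter>\<D>" for X A using ColocD(2) assms that by blast
qed

lemma cosupport_model_K:
 assumes G: "good_support_cosupport_pair T S \<Gamma>"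
 shows "cosupport_model (ob) zeros \<C> (%s. hm (\<Gamma> s)) S (BC_cogenerator U K)"
proof
 have \<Gamma>: "\<Gamma> s : Ob T" if "s : S" for s using G that unfolding good_support_cosupport_pair_def by blast
 show "C <= ob" if "C : \<C>" for C using ColocD(4)[OF that] by blast
 show "ob : \<C>" by (rule Coloc_Ob)
 show "zeros : \<C>" by (rule Coloc_zeros)
 show "zeros <= C" if "C : \<C>" for C
  using triangulated_subcategoryD(3)[OF colocalizingD(1)[OF ColocD(1)[OF that]]] by blast
 show "\<Inter>\<D> : \<C>" if "\<D> <= \<C>" "\<D> ~= {}" for \<D> by (rule Coloc_Int[OF that])
 show "hm (\<Gamma> s) A : C" if "s : S" "C : \<C>" "A : C" for s C A by (rule ColocD(2)[OF that(2) \<Gamma>[OF that(1)] that(3)])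
 show "{A : ob. hm (\<Gamma> s) A : C} : \<C>" if "s : S" "C : \<C>" for s C by (rule Coloc_preimage[OF \<Gamma>[OF that(1)] that(2)])
 show "BC_cogenerator U K : ob" by (rule BC_cogenerator_separates(1))
 show "C = ob" if "C : \<C>" "BC_cogenerator U K : C" for C
  by (rule cogeneration[OF ColocD(1)[OF that(1)] that(2) BC_cogenerator_separates(2)])
 show "hm (\<Gamma> r) (hm (\<Gamma> s) A) : zeros" if "s : S" "r : S" "r ~= s" "A : ob" for s r A
 proof -
  have "s ~= r" using that(3) by simp
  then have "is_zero T (\<Gamma> s \<otimes>o\<^bsub>T\<^esub> \<Gamma> r)" using G that(1,2) unfolding good_support_cosupport_pair_def by blast
  then show ?thesis
   using is_zero_iso[OF hm_zero_left[OF _ that(4)] hm_assoc[OF \<Gamma>[OF that(2)] \<Gamma>[OF that(1)] that(4)]] by simp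
 qed
 show "hm (\<Gamma> s) (hm (\<Gamma> s) A) : C \<longleftrightarrow> hm (\<Gamma> s) A : C" if "s : S" "A : ob" "C : \<C>" for s A C
 proof -
  have "isomorphic T (\<Gamma> s \<otimes>o\<^bsub>T\<^esub> \<Gamma> s) (\<Gamma> s)" using G that unfolding good_support_cosupport_pair_def by blast
  from hm_cong_left[OF this that(2)] hm_assoc[OF \<Gamma>[OF that(1)] \<Gamma>[OF that(1)] that(2)]
  have "isomorphic K (hm (\<Gamma> s) (hm (\<Gamma> s) A)) (hm (\<Gamma> s) A)" using isomorphic_trans isomorphic_sym by blast
  then show ?thesis by (rule Coloc_iso_iff[OF that(3)])
 qed
qed

end


section \<open>Quotients by smashing submodules\<close>

locale quotient_setting = module_setting U T K
 for U :: "'u set" and T :: "('a, 'p, 'x) ttcat_scheme"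
  and K :: "('o, 'm, 'a, 'p, 'y) tmod_scheme" (structure) +
 fixes M :: "'o set"
 assumes smashing: "smashing_submodule U T K M"
begin

abbreviation Q :: "('o, ('m \<times> 'm) set, 'a, 'p) tmod" where "Q \<equiv> quotient_module T K M"
abbreviation V :: "('o, ('m \<times> 'm) set) tricat" where "V \<equiv> verdier_quotient K M"

lemmas quotient_unfold = quotient_module_def verdier_quotient_def verdier_pre_def Let_def tricat.extend_def tmod.fields_def

lemma V_fields: "Ob V = Ob Q" "Arr V = Arr Q" "Dom V = Dom Q" "Cod V = Cod Q" "Ide V = Ide Q" "Cmp V = Cmp Q"
 by (simp_all add: quotient_unfold)

lemma Hom_V: "Hom V = Hom Q" by (intro ext) (simp add: Hom_def V_fields)

lemma right_adjoint_V: "right_adjoint K V = right_adjoint K Q" "right_adjoint V K = right_adjoint Q K"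
 by (intro ext, simp add: right_adjoint_def is_functor_def V_fields Hom_V)+

lemma k_eq: "k_functor K M = radj K Q (quotient_functor K M)" and l_eq: "l_functor K M = radj Q K (k_functor K M)"
 by (simp_all add: k_functor_def l_functor_def radj_def right_adjoint_V)

sublocale verdier_localization K M Q
proof
 show "triangulated_subcategory K M" using smashing by (simp add: smashing_submodule_def localizing_def)
qed (simp_all add: quotient_unfold)

definition k0 :: "('o, ('m \<times> 'm) set, 'o, 'm) func" where
 "k0 = (SOME k. right_adjoint K Q (quotient_functor K M) k & preserves_small_coproducts U V K k)"

lemma k0: "right_adjoint K Q (quotient_functor K M) k0" "preserves_small_coproducts U V K k0"
proof -
 have "\<exists>k. right_adjoint K Q (quotient_functor K M) k & preserves_small_coproducts U V K k"
  using smashing unfolding smashing_submodule_def right_adjoint_V by blast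
 from someI_ex[OF this]
 show "right_adjoint K Q (quotient_functor K M) k0" "preserves_small_coproducts U V K k0" unfolding k0_def by blast+
qed

sublocale smashing_localization U K M Q k0
proof
 show "right_adjoint K Q (quotient_functor K M) k0" by (rule k0(1))
 show "preserves_small_coproducts U Q K k0"
  using k0(2) unfolding preserves_small_coproducts_def is_coproduct_def V_fields Hom_V .
qed

lemma k_localization: "localization U K M Q (k_functor K M)"
 by (intro localization.intro localization_axioms.intro cg_category_axioms verdier_localization_axioms)
  (unfold k_eq radj_def, rule someI[of "%G. right_adjoint K Q (quotient_functor K M) G", OF k0(1)])

lemma act_M: "X : Ob T ==> A : M ==> X \<star>o\<^bsub>K\<^esub> A : M"
 using smashing by (simp add: smashing_submodule_def)

lemma act_W: assumes X: "X : Ob T" and s: "s : W" shows "Ide T X \<star>m\<^bsub>K\<^esub> s : W"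
proof -
 obtain g h where t: "(s, g, h) : tri" using tri_cone[OF W_arr[OF s]] by blast
 show ?thesis
  by (rule W_I[OF is_triangulated_functorD(7)[OF act_left_triangulated[OF X] t, unfolded act_left_simps]])
   (use act_M[OF X W_cone[OF s t]] X triD[OF t] in simp)
qed

lemma act_Q_simps: "fO (act_left T Q X) A = X \<star>o\<^bsub>K\<^esub> A"
 "fM (act_left T Q X) R = {r. \<exists>(s, f) \<in> R. req (Ide T (Dom T (Ide T X)) \<star>m\<^bsub>K\<^esub> s, Ide T X \<star>m\<^bsub>K\<^esub> f) r}"
 by (simp_all add: act_left_def quotient_unfold)

lemma act_Q_cls:
 assumes X: "X : Ob T" and s: "s : W" "f : arr" "dom f = dom s"
 shows "fM (act_left T Q X) (cls s f) = cls (Ide T X \<star>m\<^bsub>K\<^esub> s) (Ide T X \<star>m\<^bsub>K\<^esub> f)"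
 using map_cls[OF act_left_functor[OF X], of s f] act_W[OF X] s X by (simp add: act_Q_simps)

lemma act_Q_j: assumes X: "X : Ob T" and f: "f : arr" shows "fM (act_left T Q X) (j f) = j (Ide T X \<star>m\<^bsub>K\<^esub> f)"
 unfolding j_def using act_Q_cls[OF X, of "ide (dom f)" f] X f by simp

lemma act_Q_functor: assumes X: "X : Ob T" shows "is_functor Q Q (act_left T Q X)"
 unfolding is_functor_def
proof (intro conjI ballI impI)
 show "fO (act_left T Q X) x : Ob Q" if "x : Ob Q" for x using that X by (simp add: act_Q_simps Q_Ob)
 show "fM (act_left T Q X) R : Hom Q (fO (act_left T Q X) (Dom Q R)) (fO (act_left T Q X) (Cod Q R))" if R: "R : Arr Q" for R
 proof -
  obtain s f where s: "R = cls s f" "s : W" "f : arr" "dom f = dom s"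
   by (rule Q_homE[of R "Dom Q R" "Cod Q R"]) (use R in auto)
  show ?thesis unfolding s(1) act_Q_cls[OF X s(2-)] using s(2-) X act_W[OF X] by (simp add: act_Q_simps)
 qed
 show "fM (act_left T Q X) (Ide Q x) = Ide Q (fO (act_left T Q X) x)" if "x : Ob Q" for x
  using act_Q_j[OF X, of "ide x"] that X by (simp add: j_ide Q_Ob act_Q_simps)
 show "fM (act_left T Q X) (R'\<cdot>\<^bsub>Q\<^esub>R) = fM (act_left T Q X) R'\<cdot>\<^bsub>Q\<^esub>fM (act_left T Q X) R"
  if R: "R : Arr Q" "R' : Arr Q" "Cod Q R = Dom Q R'" for R R'
 proof -
  obtain s f where s: "R = cls s f" "s : W" "f : arr" "dom f = dom s" "cod f = Cod Q R"
   by (rule Q_homE[of R "Dom Q R" "Cod Q R"]) (use R in auto)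
  obtain t g where t: "R' = cls t g" "t : W" "g : arr" "dom g = dom t" "cod t = Dom Q R'"
   by (rule Q_homE[of R' "Dom Q R'" "Cod Q R'"]) (use R in auto)
  have st: "cod f = cod t" using R(3) s(5) t(5) by simp
  obtain u v where u: "u : W" "v : arr" "cod u = dom f" "dom v = dom u" "cod v = dom t" "f\<cdot>u = t\<cdot>v"
   by (rule W_ore[OF s(3) t(2) st])
  have 1: "cls t g\<cdot>\<^bsub>Q\<^esub>cls s f = cls (s\<cdot>u) (g\<cdot>v)" by (rule Cmp_cls) (use s(2-4) t(2-4) u st in auto)
  let ?F = "%f. Ide T X \<star>m\<^bsub>K\<^esub> f"
  have c: "?F (b\<cdot>a) = ?F b\<cdot>?F a" if "a : arr" "b : arr" "cod a = dom b" for a b using that X by (simp add: act_cmp)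
  have "?F f\<cdot>?F u = ?F t\<cdot>?F v" using c[of u f] c[of v t] u s(3) t(2) by simp
  then have 2: "cls (?F t) (?F g)\<cdot>\<^bsub>Q\<^esub>cls (?F s) (?F f) = cls (?F s\<cdot>?F u) (?F g\<cdot>?F v)"
   by (intro Cmp_cls) (use s(2-4) t(2-4) u(1-5) st X act_W[OF X] in auto)
  have "fM (act_left T Q X) (cls (s\<cdot>u) (g\<cdot>v)) = cls (?F (s\<cdot>u)) (?F (g\<cdot>v))"
   by (rule act_Q_cls[OF X]) (use s(2-4) t(2-4) u(1-5) in auto)
  also have "... = cls (?F s\<cdot>?F u) (?F g\<cdot>?F v)" using c[of u s] c[of v g] s(2-4) t(2-4) u(1-5) by simp
  finally show ?thesis unfolding s(1) t(1) 1 act_Q_cls[OF X s(2-4)] act_Q_cls[OF X t(2-4)] 2 .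
 qed
qed

lemma perp_hm: assumes X: "X : Ob T" and N: "N : perp" shows "hm X N : perp"
proof (rule perpI)
 have No: "N : ob" by (rule perpD(1)[OF N])
 show "hm X N : ob" using X No by simp
 obtain e where u: "universal K K (act_left T K X) (ob) N (hm X N) e" by (rule hom_universal[OF X No])
 note u' = universalD[OF u, simplified]
 fix B m assume B: "B : M" "m : Hom K B (hm X N)"
 have Bo: "B : ob" by (rule M_D(1)[OF B(1)])
 have z: "n = zro (X \<star>o\<^bsub>K\<^esub> B) N" if "n : Hom K (X \<star>o\<^bsub>K\<^esub> B) N" for n by (rule perpD(2)[OF N act_M[OF X B(1)] that])
 have "e\<cdot>(Ide T X \<star>m\<^bsub>K\<^esub> m) = zro (X \<star>o\<^bsub>K\<^esub> B) N" "e\<cdot>(Ide T X \<star>m\<^bsub>K\<^esub> zro B (hm X N)) = zro (X \<star>o\<^bsub>K\<^esub> B) N"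
  by (rule z; use u' B Bo X in simp)+
 then show "m = zro B (hm X N)"
  by (intro universal_ext[OF u Bo B(2)]) (use Bo u' in auto)
qed

lemma colocalizing_perp: "colocalizing U K perp"
 unfolding colocalizing_def using perp_triangulated perp_product by blast

lemma perp_Coloc: "perp : \<C>" by (rule ColocI[OF colocalizing_perp perp_hm])

text \<open>
 \<open>Hom (X * -) A\<close> in the quotient is \<open>Hom (X * -) (lam A)\<close> in \<open>K\<close>, which \<open>hm X (lam A)\<close> represents;
 this object is local, so it represents the functor on the quotient as well.
\<close>

lemma hm_Q: assumes X: "X : Ob T" and A: "A : ob" shows "isomorphic Q (rel_hom T Q X A) (hm X (lam A))"
proof -
 have ex: "\<exists>e. universal Q Q (act_left T Q X) (Ob Q) A (hm X (lam A)) e" if A: "A : ob" for A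
 proof -
  have N: "lam A : perp" "hm X (lam A) : perp" using perp_hm[OF X] lam_perp[OF A] by simp_all
  obtain e where u: "universal K K (act_left T K X) (ob) (lam A) (hm X (lam A)) e" by (rule hom_universal[OF X perpD(1)[OF N(1)]])
  note u' = universalD[OF u, simplified]
  let ?e = "counit A\<cdot>\<^bsub>Q\<^esub>j e"
  have F: "?e\<cdot>\<^bsub>Q\<^esub>fM (act_left T Q X) (j h) = counit A\<cdot>\<^bsub>Q\<^esub>j (e\<cdot>(Ide T X \<star>m\<^bsub>K\<^esub> h))" if "h : Hom K B (hm X (lam A))" for h B
   using that u' A X by (simp add: act_Q_j j_cmp)
  have "universal Q Q (act_left T Q X) (Ob Q) A (hm X (lam A)) ?e"
  proof (rule universalI)
   show "hm X (lam A) : Ob Q" "?e : Hom Q (fO (act_left T Q X) (hm X (lam A))) A" using u' A Q_Ob by (simp_all add: act_Q_simps)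
   fix B R assume B: "B : Ob Q" and R: "R : Hom Q (fO (act_left T Q X) B) A"
   obtain n where n: "n : Hom K (X \<star>o\<^bsub>K\<^esub> B) (lam A)" "counit A\<cdot>\<^bsub>Q\<^esub>j n = R"
    by (rule counit_lift[OF A R[unfolded act_Q_simps(1)]])
   obtain h where h: "h : Hom K B (hm X (lam A))" "e\<cdot>(Ide T X \<star>m\<^bsub>K\<^esub> h) = n"
    using universal_lift[OF u, of B n] n(1) B Q_Ob by auto
   show "\<exists>h\<in>Hom Q B (hm X (lam A)). ?e\<cdot>\<^bsub>Q\<^esub>fM (act_left T Q X) h = R"
    by (rule bexI[of _ "j h"]) (use F[OF h(1)] h n(2) in auto)
  next
   fix B h h' assume B: "B : Ob Q" and h: "h : Hom Q B (hm X (lam A))" "h' : Hom Q B (hm X (lam A))"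
    and eq: "?e\<cdot>\<^bsub>Q\<^esub>fM (act_left T Q X) h = ?e\<cdot>\<^bsub>Q\<^esub>fM (act_left T Q X) h'"
   have Bo: "B : ob" using B Q_Ob by simp
   obtain m where m: "m : Hom K B (hm X (lam A))" "j m = h" by (rule j_sur[OF N(2) h(1)])
   obtain m' where m': "m' : Hom K B (hm X (lam A))" "j m' = h'" by (rule j_sur[OF N(2) h(2)])
   have "counit A\<cdot>\<^bsub>Q\<^esub>j (e\<cdot>(Ide T X \<star>m\<^bsub>K\<^esub> m)) = counit A\<cdot>\<^bsub>Q\<^esub>j (e\<cdot>(Ide T X \<star>m\<^bsub>K\<^esub> m'))"
    using eq F[OF m(1)] F[OF m'(1)] m(2) m'(2) by simp
   then have "e\<cdot>(Ide T X \<star>m\<^bsub>K\<^esub> m) = e\<cdot>(Ide T X \<star>m\<^bsub>K\<^esub> m')"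
    by (intro counit_ext[OF A _ _ , of _ "X \<star>o\<^bsub>K\<^esub> B"]) (use u' X m(1) m'(1) in simp_all)
   then have "m = m'" by (intro universal_ext[OF u Bo m(1) m'(1)]) simp
   then show "h = h'" using m(2) m'(2) by simp
  qed
  then show ?thesis by blast
 qed
 have ra: "right_adjoint Q Q (act_left T Q X) (radj Q Q (act_left T Q X))"
  by (rule radj_universal[OF category_Q category_Q act_Q_functor[OF X]]) (use ex Q_Ob in blast)
 obtain e where "!!y. y : Ob Q ==> universal Q Q (act_left T Q X) (Ob Q) y (fO (radj Q Q (act_left T Q X)) y) (e y)"
  by (rule right_adjoint_universal[OF category_Q category_Q act_Q_functor[OF X] ra]) (erule that)
 then have e: "universal Q Q (act_left T Q X) (Ob Q) y (rel_hom T Q X y) (e y)" if "y : Ob Q" for y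
  using that unfolding rel_hom_def by blast
 obtain e' where e': "universal Q Q (act_left T Q X) (Ob Q) A (hm X (lam A)) e'" using ex[OF A] by blast
 have AQ: "A : Ob Q" using A Q_Ob by simp
 show ?thesis
  by (rule universal_isomorphic[OF category_Q category_Q act_Q_functor[OF X] subset_refl e[OF AQ] e' Q.isomorphic_refl[OF AQ]])
qed

lemma perp_isomorphic: assumes N: "N : perp" "N' : perp" and i: "isomorphic Q N N'" shows "isomorphic K N N'"
proof -
 obtain f g where fg: "f : Hom Q N N'" "g : Hom Q N' N" "g\<cdot>\<^bsub>Q\<^esub>f = Ide Q N" "f\<cdot>\<^bsub>Q\<^esub>g = Ide Q N'"
  using i by (rule Q.isomorphicE)
 obtain a where a: "a : Hom K N N'" "j a = f" by (rule j_sur[OF N(2) fg(1)])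
 obtain b where b: "b : Hom K N' N" "j b = g" by (rule j_sur[OF N(1) fg(2)])
 note No = perpD(1)[OF N(1)] perpD(1)[OF N(2)]
 have "j (b\<cdot>a) = j (ide N)" "j (a\<cdot>b) = j (ide N')" using a b fg No by (simp_all add: j_cmp j_ide)
 then have "b\<cdot>a = ide N" "a\<cdot>b = ide N'"
  using j_inj[OF N(1), of "b\<cdot>a" N "ide N"] j_inj[OF N(2), of "a\<cdot>b" N' "ide N'"] a(1) b(1) No by simp_all
 then show ?thesis using isomorphicI[OF a(1) b(1)] by blast
qed

lemma lam_eq: assumes N: "N : perp" and i: "isomorphic Q A N" shows "isomorphic K (lam A) N"
proof (rule perp_isomorphic[OF _ N])
 have A: "A : ob" using Q.isomorphic_ob[OF i] Q_Ob by simp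
 show "lam A : perp" by (rule lam_perp[OF A])
 show "isomorphic Q (lam A) N" by (rule Q.isomorphic_trans[OF lam_isomorphic[OF A] i])
qed

lemma lam_self: "N : perp ==> isomorphic K (lam N) N"
 using lam_eq Q.isomorphic_refl perpD(1) Q_Ob by metis

lemma lam_cong: assumes "isomorphic Q A B" shows "isomorphic K (lam A) (lam B)"
proof -
 have B: "B : ob" using Q.isomorphic_ob[OF assms] Q_Ob by simp
 show ?thesis
  by (rule lam_eq[OF lam_perp[OF B] Q.isomorphic_trans[OF assms Q.isomorphic_sym[OF lam_isomorphic[OF B]]]])
qed

lemma is_zero_Q_of_K: assumes z: "is_zero K z" shows "is_zero Q z"
proof -
 have zM: "z : M" "z : perp" "z : ob"
  using M_D(3)[OF z] triangulated_subcategoryD(3)[OF perp_triangulated z] z by auto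
 have "\<exists>!f. f : Hom Q z x" "\<exists>!f. f : Hom Q x z" if x: "x : Ob Q" for x
 proof -
  have xo: "x : ob" using x Q_Ob by simp
  have "j (zro z x) : Hom Q z x" using xo zM by simp
  then show "\<exists>!f. f : Hom Q z x" using Q_from_M[OF zM(1)] by blast
  have "R = j (zro x z)" if R: "R : Hom Q x z" for R
  proof -
   obtain a where a: "a : Hom K x z" "j a = R" by (rule j_sur[OF zM(2) R])
   have "a = zro x z" by (rule is_zero_eq_to[OF z a(1)]) (use xo zM in simp)
   then show ?thesis using a(2) by simp
  qed
  moreover have "j (zro x z) : Hom Q x z" using xo zM by simp
  ultimately show "\<exists>!f. f : Hom Q x z" by blast
 qed
 then show ?thesis unfolding is_zero_def using zM(3) Q_Ob by simp
qed

lemma is_zero_Q: assumes A: "A : ob" shows "is_zero Q A \<longleftrightarrow> is_zero K (lam A)"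
proof
 assume "is_zero Q A"
 then have z: "is_zero Q (lam A)" using Q.is_zero_iso Q.isomorphic_sym lam_isomorphic[OF A] by blast
 have "j (ide (lam A)) = j (zro (lam A) (lam A))" by (rule Q.is_zero_eq_to[OF z]) (use A in auto)
 then have "ide (lam A) = zro (lam A) (lam A)" by (intro j_inj[OF lam_perp[OF A]]) (use A in auto)
 then show "is_zero K (lam A)" unfolding is_zero_iff using A by simp
next
 assume "is_zero K (lam A)"
 then show "is_zero Q A" using is_zero_Q_of_K Q.is_zero_iso lam_isomorphic[OF A] by blast
qed

lemma ShO_Q: "ShO Q = shO" by (simp add: quotient_unfold)

lemma ShM_Q_ide: assumes x: "x : ob" shows "ShM Q (Ide Q x) = Ide Q (shO x)"
proof -
 have W_sh: "shM s : W" if s: "s : W" for s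
 proof -
  obtain g h where t: "(s, g, h) : tri" using tri_cone[OF W_arr[OF s]] by blast
  show ?thesis by (rule W_I[OF tri_sh[OF t]]) (use W_cone[OF s t] M_D(1,4) triD[OF t] in simp)
 qed
 have "ShM Q (Ide Q x) = {r. \<exists>(s, f) \<in> cls (ide x) (ide x). req (shM s, shM f) r}"
  unfolding Q_Ide by (simp add: quotient_unfold)
 also have "... = cls (shM (ide x)) (shM (ide x))"
  by (rule map_cls[OF shift_functor W_sh]) (use x in auto)
 finally show ?thesis unfolding Q_Ide using x by simp
qed

lemma Tri_Q: "t : Tri Q \<longleftrightarrow> candidate_triangle Q t & (\<exists>(f, g, h) \<in> tri. triangle_iso Q t (j f, j g, j h))"
proof -
 have "candidate_triangle (verdier_pre K M) t = candidate_triangle Q t" for t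
  unfolding candidate_triangle_def Q_fields by (simp add: quotient_unfold)
 moreover have "Hom (verdier_pre K M) = Hom Q" by (intro ext) (simp add: Hom_def Q_fields)
 then have "triangle_iso (verdier_pre K M) t t' = triangle_iso Q t t'" for t t'
  unfolding triangle_iso_def is_iso_def inverse_arrs_def Q_fields by (simp add: quotient_unfold)
 moreover have "Tri Q = {t. candidate_triangle (verdier_pre K M) t &
   (\<exists>(f, g, h) \<in> tri. triangle_iso (verdier_pre K M) t (fM (quotient_functor K M) f, fM (quotient_functor K M) g, fM (quotient_functor K M) h))}"
  by (simp add: quotient_module_def verdier_quotient_def Let_def tricat.extend_def tmod.fields_def)
 ultimately show ?thesis unfolding j_functor by simp
qed

lemma Tri_Q_j: assumes t: "(f, g, h) : tri" shows "(j f, j g, j h) : Tri Q"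
proof -
 note T = triD[OF t]
 have "candidate_triangle Q (j f, j g, j h)" unfolding candidate_triangle_def using T by (simp add: ShO_Q)
 moreover have "triangle_iso Q (j f, j g, j h) (j f, j g, j h)"
  unfolding triangle_iso_def prod.case
  by (rule bexI[of _ "Ide Q (dom f)"], rule bexI[of _ "Ide Q (cod f)"], rule bexI[of _ "Ide Q (cod g)"])
   (use T in \<open>auto simp: ShM_Q_ide Q_Ob\<close>)
 ultimately show ?thesis unfolding Tri_Q using t by blast
qed

lemma Tri_Q_E:
 assumes "(F, G, H) : Tri Q"
 obtains f g h where "(f, g, h) : tri" "isomorphic Q (Dom Q F) (dom f)" "isomorphic Q (Cod Q F) (cod f)" "isomorphic Q (Cod Q G) (cod g)"
proof -
 obtain f g h where t: "(f, g, h) : tri" and i: "triangle_iso Q (F, G, H) (j f, j g, j h)" and c: "candidate_triangle Q (F, G, H)"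
  using assms unfolding Tri_Q by blast
 note T = triD[OF t]
 have "isomorphic Q (Dom Q F) (dom f)" "isomorphic Q (Dom Q G) (cod f)" "isomorphic Q (Dom Q H) (cod g)"
  using i T unfolding triangle_iso_def isomorphic_def prod.case by auto
 moreover have "Cod Q F = Dom Q G" "Cod Q G = Dom Q H" using c unfolding candidate_triangle_def by auto
 ultimately show thesis using that t by simp
qed

text \<open>The suspension of a unit, and the map that units induce on cones, are again localizations.\<close>

lemma lam_unique:
 assumes c: "c : Hom K A Z" and Z: "Z : perp"
  and sur: "!!N n. N : perp ==> n : Hom K A N ==> \<exists>m\<in>Hom K Z N. m\<cdot>c = n"
  and inj: "!!N m. N : perp ==> m : Hom K Z N ==> m\<cdot>c = zro A N ==> m = zro Z N"
 shows "isomorphic K (lam A) Z"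
proof -
 have A: "A : ob" "Z : ob" using c by auto
 obtain m where m: "m : Hom K (lam A) Z" "m\<cdot>unit A = c" by (rule unit_sur[OF A(1) Z c])
 obtain n where n: "n : Hom K Z (lam A)" "n\<cdot>c = unit A" using sur[OF lam_perp[OF A(1)] unit(1)[OF A(1)]] by blast
 have 1: "n\<cdot>m = ide (lam A)"
  by (rule unit_inj[OF A(1) lam_perp[OF A(1)]]) (use m n A in auto)
 have "sub (m\<cdot>n) (ide Z) = zro Z Z"
  by (rule inj[OF Z]) (use m n c A in auto)
 then have 2: "m\<cdot>n = ide Z" by (rule sub_eq_zro) (use m n A in auto)
 show ?thesis by (rule isomorphicI[OF m(1) n(1) 1 2])
qed

lemma unit_shift:
 assumes A: "A : ob" and N: "N : perp"
 shows "n : Hom K (shO A) N ==> \<exists>m\<in>Hom K (shO (lam A)) N. m\<cdot>shM (unit A) = n"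
  and "m : Hom K (shO (lam A)) N ==> m\<cdot>shM (unit A) = zro (shO A) N ==> m = zro (shO (lam A)) N"
proof -
 obtain D p q where D: "D : perp" "p : Hom K (shO D) N" "q : Hom K N (shO D)" "q\<cdot>p = ide (shO D)" "p\<cdot>q = ide N"
  using triangulated_subcategory_unshift[OF perp_triangulated N] .
 note Do = perpD(1)[OF D(1)]
 {
  assume n: "n : Hom K (shO A) N"
  obtain n' where n': "n' : Hom K A D" "shM n' = q\<cdot>n" by (rule sh_full[of "q\<cdot>n" A D]) (use n D A Do in auto)
  obtain m where m: "m : Hom K (lam A) D" "m\<cdot>unit A = n'" by (rule unit_sur[OF A D(1) n'(1)])
  have "p\<cdot>shM m\<cdot>shM (unit A) = p\<cdot>shM (m\<cdot>unit A)" using m(1) D A by simp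
  also have "... = p\<cdot>(q\<cdot>n)" unfolding m(2) n'(2) ..
  also have "... = n" using cmp_reduce[OF D(5), of n] n D by simp
  finally show "\<exists>m\<in>Hom K (shO (lam A)) N. m\<cdot>shM (unit A) = n" using m(1) D by (intro bexI[of _ "p\<cdot>shM m"]) auto
 next
  assume m: "m : Hom K (shO (lam A)) N" and z: "m\<cdot>shM (unit A) = zro (shO A) N"
  obtain m' where m': "m' : Hom K (lam A) D" "shM m' = q\<cdot>m" by (rule sh_full[of "q\<cdot>m" "lam A" D]) (use m D A Do in auto)
  have "shM (m'\<cdot>unit A) = q\<cdot>m\<cdot>shM (unit A)" using m' A by simp
  also have "... = q\<cdot>(m\<cdot>shM (unit A))" using m D A by simp
  also have "... = zro (shO A) (shO D)" unfolding z using D A by simp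
  finally have "m'\<cdot>unit A = zro A D" by (rule sh_zro_iff) (use m' A in simp)
  then have "m'\<cdot>unit A = zro (lam A) D\<cdot>unit A" using A Do by simp
  then have "m' = zro (lam A) D" by (intro unit_inj[OF A D(1) m'(1)]) (use A Do in simp_all)
  then have z: "q\<cdot>m = zro (shO (lam A)) (shO D)" using m'(2) A Do by simp
  have "m = p\<cdot>(q\<cdot>m)" using cmp_reduce[OF D(5), of m] m D by simp
  then show "m = zro (shO (lam A)) N" unfolding z using D A by simp
 }
qed

lemma lam_shift: assumes A: "A : ob" shows "isomorphic K (lam (shO A)) (shO (lam A))"
proof (rule lam_unique)
 show "shM (unit A) : Hom K (shO A) (shO (lam A))" using A by simp
 show "shO (lam A) : perp" using perp_sh lam_perp[OF A] A by simp
qed (use unit_shift[OF A] in blast)+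

lemma lam_cone:
 assumes t: "(f, g, h) : tri"
 obtains f' g' h' where "(f', g', h') : tri" "dom f' = lam (dom f)" "cod f' = lam (cod f)" "isomorphic K (lam (cod g)) (cod g')"
proof -
 note T = triD[OF t]
 obtain g' h' where t': "(fM L f, g', h') : tri" using tri_cone[of "fM L f"] T by auto
 note T' = triD[OF t']
 obtain c where c: "c : Hom K (cod g) (cod g')" "c\<cdot>g = g'\<cdot>unit (cod f)" "shM (unit (dom f))\<cdot>h = h'\<cdot>c"
  using tri_fill[OF t t', of "unit (dom f)" "unit (cod f)"] L_unit[of f] T by auto
 have Zp: "cod g' : perp"
  by (rule triangulated_subcategoryD(5)[OF perp_triangulated t']) (use T lam_perp in auto)
 note df = ob_dom[OF T(1)] ob_cod[OF T(1)]
 have inj: "m = zro (lam A) N" if "A : ob" "N : perp" "m : Hom K (lam A) N" "m\<cdot>unit A = zro A N" for A N m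
  by (rule unit_inj[OF that(1,2,3)]) (use that perpD(1)[OF that(2)] in auto)
 have sur: "\<exists>m\<in>Hom K (lam A) N. m\<cdot>unit A = n" if "A : ob" "N : perp" "n : Hom K A N" for A N n
  using unit_sur[OF that] by blast
 have d: "dom (fM L f) = lam (dom f)" "cod (fM L f) = lam (cod f)" using T by simp_all
 have a: "unit (dom f) : Hom K (dom f) (dom (fM L f))" "unit (cod f) : Hom K (cod f) (cod (fM L f))"
  "unit (cod f)\<cdot>f = fM L f\<cdot>unit (dom f)" using L_unit[of f] T by simp_all
 note five = five_lemma_contra[OF t t' a(1,2) c(1) a(3) c(2,3)]
 have "isomorphic K (lam (cod g)) (cod g')"
 proof (rule lam_unique[OF c(1) Zp])
  fix N assume N: "N : perp"
  show "\<exists>m\<in>Hom K (cod g') N. m\<cdot>c = n" if n: "n : Hom K (cod g) N" for n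
   by (rule five(1)[OF _ _ _ _ _ _ n]; unfold d; rule inj sur unit_shift[OF _ N]; (assumption | rule df N))
  show "m = zro (cod g') N" if m: "m : Hom K (cod g') N" "m\<cdot>c = zro (cod g) N" for m
   by (rule five(2)[OF _ _ _ _ _ _ m]; unfold d; rule inj sur unit_shift[OF _ N]; (assumption | rule df N))
 qed
 then show thesis using that t' d by blast
qed

end


section \<open>Comparison of the subcategories of a quotient with those of its local objects\<close>

context quotient_setting
begin

lemma ColocQ_D:
 assumes D: "D : Coloc_hom U T Q"
 shows "D <= ob" "A : D ==> isomorphic Q A B ==> B : D" "is_zero Q z ==> z : D"
  "A : ob ==> shO A : D \<longleftrightarrow> A : D"
  "(F, G, H) : Tri Q ==> Dom Q F : D ==> Cod Q F : D ==> Cod Q G : D"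
  "small U (I :: 'u set) ==> X ` I <= D ==> is_product Q I X P pr ==> P : D"
  "Y : Ob T ==> A : D ==> rel_hom T Q Y A : D"
proof -
 have t: "triangulated_subcategory Q D" and c: "colocalizing U Q D" and h: "\<forall>X\<in>Ob T. \<forall>A\<in>D. rel_hom T Q X A : D"
  using D unfolding Coloc_hom_def colocalizing_def by blast+
 show "D <= ob" "is_zero Q z ==> z : D" "A : ob ==> shO A : D \<longleftrightarrow> A : D"
  using t unfolding triangulated_subcategory_def Q_Ob ShO_Q by blast+
 show "B : D" if "A : D" "isomorphic Q A B"
  using t that Q.isomorphic_ob[OF that(2)] unfolding triangulated_subcategory_def by blast
 show "(F, G, H) : Tri Q ==> Dom Q F : D ==> Cod Q F : D ==> Cod Q G : D"
  using t unfolding triangulated_subcategory_def by blast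
 show "small U I ==> X ` I <= D ==> is_product Q I X P pr ==> P : D"
  using c unfolding colocalizing_def by blast
 show "Y : Ob T ==> A : D ==> rel_hom T Q Y A : D" using h by blast
qed

lemma product_Q:
 assumes P: "is_product K I N P pr" and N: "!!i. i : I ==> N i : perp"
 shows "is_product Q I N P (%i. j (pr i))"
proof (rule Q.is_productI)
 note D = is_productD[OF P]
 have Pp: "P : perp" by (rule perp_product[OF P N])
 show "P : Ob Q" using D Q_Ob by simp
 show "N i : Ob Q" "j (pr i) : Hom Q P (N i)" if "i : I" for i using D that Q_Ob by auto
 fix Y f assume Y: "Y : Ob Q" and f: "!!i. i : I ==> f i : Hom Q Y (N i)"
 have Yo: "Y : ob" using Y Q_Ob by simp
 have "\<exists>g. g : Hom K Y (N i) & j g = f i" if "i : I" for i by (rule j_sur[OF N[OF that] f[OF that]]) blast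
 then obtain g where g: "!!i. i : I ==> g i : Hom K Y (N i)" "!!i. i : I ==> j (g i) = f i" by metis
 obtain h where h: "h : Hom K Y P" "!!i. i : I ==> pr i\<cdot>h = g i" by (rule is_product_map[OF P Yo g(1)]) auto
 have "j (pr i)\<cdot>\<^bsub>Q\<^esub>j h = f i" if i: "i : I" for i
  using j_cmp[of h "pr i"] h(1) h(2)[OF i] g(2)[OF i] D i by simp
 then show "\<exists>h. h : Hom Q Y P & (\<forall>i\<in>I. j (pr i)\<cdot>\<^bsub>Q\<^esub>h = f i)" using h(1) by (intro exI[of _ "j h"]) auto
next
 note D = is_productD[OF P]
 have Pp: "P : perp" by (rule perp_product[OF P N])
 fix Y h h' assume h: "h : Hom Q Y P" "h' : Hom Q Y P" and eq: "!!i. i : I ==> j (pr i)\<cdot>\<^bsub>Q\<^esub>h = j (pr i)\<cdot>\<^bsub>Q\<^esub>h'"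
 obtain g where g: "g : Hom K Y P" "j g = h" by (rule j_sur[OF Pp h(1)])
 obtain g' where g': "g' : Hom K Y P" "j g' = h'" by (rule j_sur[OF Pp h(2)])
 have "g = g'"
 proof (rule is_product_ext[OF P g(1) g'(1)])
  fix i assume i: "i : I"
  have "j (pr i\<cdot>g) = j (pr i\<cdot>g')" using j_cmp[of g "pr i"] j_cmp[of g' "pr i"] g g' eq[OF i] D i by simp
  then show "pr i\<cdot>g = pr i\<cdot>g'" by (intro j_inj[OF N[OF i]]) (use g(1) g'(1) D i in auto)
 qed
 then show "h = h'" using g(2) g'(2) by simp
qed

lemma Coloc_restrict:
 assumes D: "D : Coloc_hom U T Q" shows "D \<inter> perp : \<C>"
proof (rule ColocI)
 note QD = ColocQ_D[OF D]
 show "colocalizing U K (D \<inter> perp)"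
  unfolding colocalizing_def
 proof (intro conjI allI impI)
  show "triangulated_subcategory K (D \<inter> perp)"
  proof (rule triangulated_subcategoryI)
   show "D \<inter> perp <= ob" using QD(1) by blast
   show "y : D \<inter> perp" if "x : D \<inter> perp" "isomorphic K x y" for x y
    using that QD(2) j_isomorphic perp_iso by blast
   show "z : D \<inter> perp" if "is_zero K z" for z
    using QD(3)[OF is_zero_Q_of_K[OF that]] triangulated_subcategoryD(3)[OF perp_triangulated that] by blast
   show "shO x : D \<inter> perp \<longleftrightarrow> x : D \<inter> perp" if "x : ob" for x using QD(4)[OF that] perp_sh[OF that] by blast
   show "cod g : D \<inter> perp" if t: "(f, g, h) : tri" and x: "dom f : D \<inter> perp" "cod f : D \<inter> perp" for f g h
   proof -
    note T = triD[OF t]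
    have "Dom Q (j f) : D" "Cod Q (j f) : D"
     unfolding j_arr(2)[OF T(1)] j_arr(3)[OF T(1)] using x by blast+
    then have "Cod Q (j g) : D" by (rule QD(5)[OF Tri_Q_j[OF t]])
    moreover have "cod g : perp" by (rule triangulated_subcategoryD(5)[OF perp_triangulated t]) (use x in blast)+
    ultimately show ?thesis unfolding j_arr(3)[OF T(2)] by blast
   qed
  qed
  fix I :: "'u set" and X P pr assume a: "small U I & X ` I <= D \<inter> perp & is_product K I X P pr"
  then have I: "small U I" and XD: "X ` I <= D" and P: "is_product K I X P pr" by blast+
  have X: "X i : perp" if "i : I" for i using a that by blast
  have "P : D" by (rule QD(6)[OF I XD product_Q[OF P X]])
  moreover have "P : perp" by (rule perp_product[OF P X])
  ultimately show "P : D \<inter> perp" by blast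
 qed
 fix X A assume X: "X : Ob T" and A: "A : D \<inter> perp"
 have Ao: "A : ob" using A QD(1) by blast
 have "isomorphic Q (rel_hom T Q X A) (hm X A)"
  by (rule Q.isomorphic_trans[OF hm_Q[OF X Ao] j_isomorphic[OF hm_cong[OF X lam_self]]]) (use A in blast)
 then show "hm X A : D \<inter> perp" using QD(2)[OF QD(7)[OF X]] perp_hm[OF X] A by blast
qed

lemma Coloc_extend:
 assumes C: "C : \<C>" and Cp: "C <= perp" shows "{A : ob. lam A : C} : Coloc_hom U T Q" (is "?D : _")
proof -
 note TC = triangulated_subcategoryD[OF colocalizingD(1)[OF ColocD(1)[OF C]]]
 have iso: "B : ?D" if "A : ?D" "isomorphic Q A B" for A B
 proof -
  have "B : ob" using Q.isomorphic_ob[OF that(2)] Q_Ob by simp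
  then show ?thesis using ColocD(3)[OF C _ lam_cong[OF that(2)]] that(1) by blast
 qed
 have "triangulated_subcategory Q ?D"
  unfolding triangulated_subcategory_def Q_Ob ShO_Q
 proof (intro conjI ballI allI impI)
  show "y : ?D" if "x : ?D" "isomorphic Q x y" for x y by (rule iso[OF that])
  show "z : ?D" if z: "is_zero Q z" for z
  proof -
   have zo: "z : ob" using Q.zero_in[OF z] Q_Ob by simp
   then have "is_zero K (lam z)" using is_zero_Q z by blast
   then show ?thesis using TC(3) zo by blast
  qed
  show "shO x : ?D \<longleftrightarrow> x : ?D" if x: "x : ob" for x
   using Coloc_iso_iff[OF C lam_shift[OF x]] TC(4)[of "lam x"] x by simp
  show "Cod Q G : ?D" if a: "(F, G, H) : Tri Q & Dom Q F : ?D & Cod Q F : ?D" for F G H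
  proof -
   obtain f g h where t: "(f, g, h) : tri" and i: "isomorphic Q (Dom Q F) (dom f)" "isomorphic Q (Cod Q F) (cod f)" "isomorphic Q (Cod Q G) (cod g)"
    using a by (auto elim: Tri_Q_E)
   obtain f' g' h' where t': "(f', g', h') : tri" "dom f' = lam (dom f)" "cod f' = lam (cod f)" "isomorphic K (lam (cod g)) (cod g')"
    by (rule lam_cone[OF t])
   have "dom f : ?D" "cod f : ?D" using iso i a by blast+
   then have "cod g' : C" using TC(5)[OF t'(1)] t'(2,3) by simp
   then have "lam (cod g) : C" using Coloc_iso_iff[OF C t'(4)] by blast
   then have "cod g : ?D" using triD[OF t] by simp
   then show ?thesis using iso Q.isomorphic_sym[OF i(3)] by blast
  qed
 qed blast
 moreover have "P : ?D" if I: "small U I" and X: "X ` I <= ?D" and P: "is_product Q I X P pr" for I :: "'u set" and X P pr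
 proof -
  have Xo: "X i : ob" "lam (X i) : C" if "i : I" for i using X that by auto
  obtain R \<rho> where R: "is_product K I (%i. lam (X i)) R \<rho>" by (rule product_exists[OF I, of "%i. lam (X i)"]) (use Xo in auto)
  have RC: "R : C" by (rule colocalizingD(2)[OF ColocD(1)[OF C] I _ R]) (use Xo in blast)
  have "isomorphic Q P R"
   by (rule Q.is_product_isomorphic[OF P product_Q[OF R]]) (use Xo lam_perp Q.isomorphic_sym lam_isomorphic in auto)
  then have i: "isomorphic K (lam P) R" by (rule lam_eq[rotated]) (use RC Cp in blast)
  have "P : ob" using Q.is_productD(1)[OF P] Q_Ob by simp
  then show ?thesis using Coloc_iso_iff[OF C i] RC by blast
 qed
 moreover have "rel_hom T Q X A : ?D" if X: "X : Ob T" and A: "A : ?D" for X A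
 proof -
  have Ao: "A : ob" and AC: "hm X (lam A) : C" using A ColocD(2)[OF C X] by auto
  have "isomorphic K (lam (rel_hom T Q X A)) (hm X (lam A))"
   by (rule lam_eq[OF perp_hm[OF X lam_perp[OF Ao]] hm_Q[OF X Ao]])
  then show ?thesis using Coloc_iso_iff[OF C] AC Q.isomorphic_ob[OF hm_Q[OF X Ao]] Q_Ob by auto
 qed
 ultimately show ?thesis unfolding Coloc_hom_def colocalizing_def by blast
qed

text \<open>
 \<open>K/M\<close> is equivalent to the category of local objects, by \<open>lam\<close>, and its submodules correspond to
 the submodules of \<open>K\<close> that consist of local objects.
\<close>

lemma Coloc_Q: "Coloc_hom U T Q = (%C. {A : ob. lam A : C}) ` {C : \<C>. C <= perp}"
proof (intro subset_antisym subsetI)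
 fix D assume D: "D : Coloc_hom U T Q"
 have "D = {A : ob. lam A : D \<inter> perp}"
 proof (intro subset_antisym subsetI)
  fix A assume A: "A : D"
  then have Ao: "A : ob" using ColocQ_D(1)[OF D] by blast
  then show "A : {A : ob. lam A : D \<inter> perp}"
   using ColocQ_D(2)[OF D A Q.isomorphic_sym[OF lam_isomorphic[OF Ao]]] lam_perp[OF Ao] by simp
 next
  fix A assume "A : {A : ob. lam A : D \<inter> perp}"
  then show "A : D" using ColocQ_D(2)[OF D _ lam_isomorphic] by blast
 qed
 then show "D : (%C. {A : ob. lam A : C}) ` {C : \<C>. C <= perp}" using Coloc_restrict[OF D] by blast
qed (use Coloc_extend in auto)

lemma id_func_triangulated: "is_triangulated_functor K K id_func (%x. ide (shO x))"
proof -
 have "ide (shO (dom f))\<cdot>h = h" if "(f, g, h) : tri" for f g h using triD[OF that] by simp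
 then show ?thesis
  unfolding is_triangulated_functor_def is_additive_functor_def is_functor_def by auto
qed

text \<open>
 The objects with coreflection in \<open>C\<close> form a colocalizing subcategory. If it contains a
 cogenerator \<open>A\<close> of \<open>K\<close>, then it is everything, and local objects are their own coreflections.
\<close>

lemma local_cogenerator:
 assumes A: "A : ob"
 obtains R where "R : perp" "isomorphic Q (fO (l_functor K M) A) R"
  "!!C. C : \<C> ==> C <= perp ==> R : C ==> (!!C'. colocalizing U K C' ==> A : C' ==> C' = ob) ==> C = perp"
proof -
 interpret kf: localization U K M Q "k_functor K M" by (rule k_localization)
 obtain R \<epsilon> where R: "R : perp" "universal K K id_func perp A R \<epsilon>" by (rule coreflection[OF A])
 obtain al where al: "universal Q K (k_functor K M) (Ob Q) A R al" using kf.coreflection_universal[OF R] by blast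
 have ra: "right_adjoint Q K (k_functor K M) (l_functor K M)"
  unfolding l_eq
 proof (rule radj_universal[OF category_Q category_axioms kf.k_functor])
  fix y assume "y : ob"
  then show "\<exists>g e. universal Q K (k_functor K M) (Ob Q) y g e" using coreflection kf.coreflection_universal by metis
 qed
 obtain e where e: "!!y. y : ob ==> universal Q K (k_functor K M) (Ob Q) y (fO (l_functor K M) y) (e y)"
  by (rule right_adjoint_universal[OF category_Q category_axioms kf.k_functor ra]) (erule that)
 have "isomorphic Q (fO (l_functor K M) A) R"
  by (rule universal_isomorphic[OF category_Q category_axioms kf.k_functor subset_refl e[OF A] al isomorphic_refl[OF A]])
 moreover have "C = perp" if C: "C : \<C>" "C <= perp" "R : C" and cog: "!!C'. colocalizing U K C' ==> A : C' ==> C' = ob" for C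
 proof (rule subset_antisym[OF C(2) subsetI])
  fix N assume N: "N : perp"
  have ex: "\<exists>g e. universal K K id_func perp y g e" if "y : ob" for y using coreflection[OF that] by metis
  have "{y : ob. \<exists>g\<in>C. \<exists>e. universal K K id_func perp y g e} = ob"
   by (rule cog[OF preimage_colocalizing[OF id_func_triangulated colocalizing_perp ex ColocD(1)[OF C(1)]]]) (use A R(2) C(3) in auto)
  then obtain g e where g: "g : C" "universal K K id_func perp N g e" using perpD(1)[OF N] by blast
  have "universal K K id_func perp N N (ide N)"
   by (rule universalI) (use N perpD(1)[OF N] in auto)
  then have "isomorphic K g N"
   using universal_isomorphic[OF category_axioms category_axioms is_triangulated_functorD(1)[OF id_func_triangulated] _ g(2)]
    perpD(1) isomorphic_refl[OF perpD(1)[OF N]] by blast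
  then show "N : C" by (rule ColocD(3)[OF C(1) g(1)])
 qed
 ultimately show thesis using that R(1) by blast
qed

end

lemma cominimality_comin:
 "cominimality U T N S \<Gamma> I \<longleftrightarrow> comin {A. is_zero N A} (Coloc_hom U T N) (%s. rel_hom T N (\<Gamma> s)) S I"
 unfolding cominimality_def comin_def coloc_hom_def least_containing_def by simp

lemma cosupp_locus: "cosupp T N S \<Gamma> = locus {A. is_zero N A} (%s. rel_hom T N (\<Gamma> s)) S"
 by (intro ext) (simp add: cosupp_def locus_def)

lemma costratified_costrat:
 "costratified U T N S \<Gamma> I \<longleftrightarrow> costrat (Ob N) {A. is_zero N A} (Coloc_hom U T N) (%s. rel_hom T N (\<Gamma> s)) S I"
proof -
 have "al ` Pow W0 <= \<C> & \<beta> ` \<C> <= Pow W0 & (\<forall>W\<in>Pow W0. \<beta> (al W) = W) & (\<forall>C\<in>\<C>. al (\<beta> C) = C) \<longleftrightarrow>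
  (\<forall>W\<subseteq>W0. al W : \<C> & \<beta> (al W) = W) & (\<forall>C\<in>\<C>. \<beta> C <= W0 & al (\<beta> C) = C)"
  for al \<beta> W0 \<C> by blast
 then show ?thesis unfolding costratified_def costrat_def Let_def cosupp_locus .
qed

context quotient_setting
begin

text \<open>The conditions for \<open>K/M\<close> are those for the lattice of submodules of \<open>K\<close> that consist of
 local objects, with the coreflection of the cogenerator as the cogenerator.\<close>

lemma conditions_in_quotient:
 assumes G: "!!s. s : S ==> \<Gamma> s : Ob T" and m: "cosupport_model perp zeros {C : \<C>. C <= perp} (%s. hm (\<Gamma> s)) S R"
  and R: "isomorphic Q I R"
 shows "cominimality U T Q S \<Gamma> I \<longleftrightarrow> comin zeros {C : \<C>. C <= perp} (%s. hm (\<Gamma> s)) S R"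
  and "costratified U T Q S \<Gamma> I \<longleftrightarrow> costrat perp zeros {C : \<C>. C <= perp} (%s. hm (\<Gamma> s)) S R"
proof -
 interpret m: cosupport_model perp zeros "{C : \<C>. C <= perp}" "%s. hm (\<Gamma> s)" S R by (rule m)
 have Io: "I : ob" using Q.isomorphic_ob[OF R] Q_Ob by simp
 have Rl: "isomorphic K (lam I) R" by (rule lam_eq[OF m.I_in R])
 have 1: "perp <= ob" using perpD(1) by blast
 have 2: "{A. is_zero Q A} = {A : ob. lam A : zeros}"
  using is_zero_Q Q.zero_in Q_Ob by auto
 have 3: "lam A : C \<longleftrightarrow> A : C" if "A : perp" "C : {C : \<C>. C <= perp}" for A C
  using Coloc_iso_iff[OF _ lam_self[OF that(1)]] that(2) by blast
 have 4: "rel_hom T Q (\<Gamma> s) A : ob & (lam (rel_hom T Q (\<Gamma> s) A) : C \<longleftrightarrow> hm (\<Gamma> s) (lam A) : C)"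
  if "s : S" "A : ob" "C : {C : \<C>. C <= perp}" for s A C
 proof -
  have i: "isomorphic Q (rel_hom T Q (\<Gamma> s) A) (hm (\<Gamma> s) (lam A))" by (rule hm_Q[OF G[OF that(1)] that(2)])
  have "isomorphic K (lam (rel_hom T Q (\<Gamma> s) A)) (hm (\<Gamma> s) (lam A))"
   by (rule lam_eq[OF perp_hm[OF G[OF that(1)] lam_perp[OF that(2)]] i])
  then show ?thesis using Coloc_iso_iff that(3) Q.isomorphic_ob[OF i] Q_Ob by blast
 qed
 have 5: "hm (\<Gamma> s) (lam I) : C \<longleftrightarrow> hm (\<Gamma> s) R : C" if "s : S" "C : {C : \<C>. C <= perp}" for s C
  using Coloc_iso_iff[OF _ hm_cong[OF G[OF that(1)] Rl]] that(2) by blast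
 have 6: "hm (\<Gamma> s) (lam A) : C \<longleftrightarrow> hm (\<Gamma> s) A : C" if "s : S" "A : perp" "C : {C : \<C>. C <= perp}" for s A C
  using Coloc_iso_iff[OF _ hm_cong[OF G[OF that(1)] lam_self[OF that(2)]]] that(3) by blast
 show "cominimality U T Q S \<Gamma> I \<longleftrightarrow> comin zeros {C : \<C>. C <= perp} (%s. hm (\<Gamma> s)) S R"
  unfolding cominimality_comin by (rule m.comin_transport[OF 1 Coloc_Q 2 3 4 lam_perp Io 5 6])
 show "costratified U T Q S \<Gamma> I \<longleftrightarrow> costrat perp zeros {C : \<C>. C <= perp} (%s. hm (\<Gamma> s)) S R"
  unfolding costratified_costrat Q_Ob by (rule m.costrat_transport[OF 1 Coloc_Q 2 3 4 lam_perp Io 5 6])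
qed

end

theorem theorem5p4:
  fixes U :: "'u set"
    and T :: "('a, 'p) ttcat"
    and K :: "('o, 'm, 'a, 'p) tmod"
    and S :: "'s topology"
    and \<Gamma> :: "'s \<Rightarrow> 'a"
    and M :: "'s \<Rightarrow> 'o set"
  assumes "grothendieck_universe U"
    and "big_tt_category U T"
    and "small U (topspace S)"
    and "good_support_cosupport_pair T (topspace S) \<Gamma>"
    and "tt_module U T K"
    and "\<forall>s\<in>topspace S. smashing_submodule U T K (M s)"
    and "\<forall>s\<in>topspace S. s \<in> S_sub U T K (topspace S) \<Gamma> (M s)"
  shows "(cominimality U T K (topspace S) \<Gamma> (BC_cogenerator U K) \<longleftrightarrow>
            (\<forall>s\<in>topspace S.
               cominimality U T (quotient_module T K (M s)) (topspace S) \<Gamma>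
                 (fO (l_functor K (M s)) (BC_cogenerator U K)))) \<and>
         (colocal_to_global U T K (topspace S) \<Gamma> \<longrightarrow>
            (costratified U T K (topspace S) \<Gamma> (BC_cogenerator U K) \<longleftrightarrow>
            (\<forall>s\<in>topspace S.
               costratified U T (quotient_module T K (M s)) (topspace S) \<Gamma>
                 (fO (l_functor K (M s)) (BC_cogenerator U K)))))"
proof -
 interpret module_setting U T K
  by (intro module_setting.intro universe.intro assms(1,2,5))
 let ?S = "topspace S" and ?I = "BC_cogenerator U K" and ?h = "%s. hm (\<Gamma> s)" and ?P = "%s. right_perp K (M s)"
 have G: "\<Gamma> s : Ob T" if "s : ?S" for s using assms(4) that unfolding good_support_cosupport_pair_def by blast
 interpret m: cosupport_model "Ob K" zeros \<C> ?h ?S ?I by (rule cosupport_model_K[OF assms(4)])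
 have q: "quotient_setting U T K (M s)" if "s : ?S" for s
  by (intro quotient_setting.intro quotient_setting_axioms.intro module_setting_axioms) (use assms(6) that in blast)
 have "\<exists>R. R : ?P s & isomorphic (quotient_module T K (M s)) (fO (l_functor K (M s)) ?I) R &
   (\<forall>C. C : \<C> --> C <= ?P s --> R : C --> C = ?P s)" if s: "s : ?S" for s
 proof -
  interpret q: quotient_setting U T K "M s" by (rule q[OF s])
  have cog: "C' = Ob K" if "colocalizing U K C'" "?I : C'" for C'
   by (rule cogeneration[OF that BC_cogenerator_separates(2)])
  show ?thesis by (rule q.local_cogenerator[OF m.I_in]) (use cog in blast)
 qed
 then obtain R where R: "!!s. s : ?S ==> R s : ?P s"
  "!!s. s : ?S ==> isomorphic (quotient_module T K (M s)) (fO (l_functor K (M s)) ?I) (R s)"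
  "!!s C. s : ?S ==> C : \<C> ==> C <= ?P s ==> R s : C ==> C = ?P s" by metis
 have P: "?P s : \<C>" if s: "s : ?S" for s
 proof -
  interpret q: quotient_setting U T K "M s" by (rule q[OF s])
  show ?thesis by (rule q.perp_Coloc)
 qed
 have loc: "?h s ?I : ?P s" if "s : ?S" for s using assms(7) that unfolding S_sub_def by blast
 have eq: "cominimality U T (quotient_module T K (M s)) ?S \<Gamma> (fO (l_functor K (M s)) ?I) \<longleftrightarrow>
    comin zeros {C : \<C>. C <= ?P s} ?h ?S (R s)"
  "costratified U T (quotient_module T K (M s)) ?S \<Gamma> (fO (l_functor K (M s)) ?I) \<longleftrightarrow>
    costrat (?P s) zeros {C : \<C>. C <= ?P s} ?h ?S (R s)" if s: "s : ?S" for s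
 proof -
  interpret q: quotient_setting U T K "M s" by (rule q[OF s])
  have sm: "cosupport_model (?P s) zeros {C : \<C>. C <= ?P s} ?h ?S (R s)"
   by (rule m.submodel[of ?P R, OF P R(1) R(3) s])
  show "cominimality U T (quotient_module T K (M s)) ?S \<Gamma> (fO (l_functor K (M s)) ?I) \<longleftrightarrow>
    comin zeros {C : \<C>. C <= ?P s} ?h ?S (R s)"
   "costratified U T (quotient_module T K (M s)) ?S \<Gamma> (fO (l_functor K (M s)) ?I) \<longleftrightarrow>
    costrat (?P s) zeros {C : \<C>. C <= ?P s} ?h ?S (R s)"
   by (rule q.conditions_in_quotient[OF G sm R(2)[OF s]]; assumption)+
 qed
 have ctg: "least_containing \<C> {A} = least_containing \<C> {?h s A | s. s : ?S}"
  if "colocal_to_global U T K ?S \<Gamma>" "A : Ob K" for A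
  using that unfolding colocal_to_global_def coloc_hom_def least_containing_def by blast
 show ?thesis
 proof (intro conjI impI)
  show "cominimality U T K ?S \<Gamma> ?I \<longleftrightarrow> (\<forall>s\<in>?S. cominimality U T (quotient_module T K (M s)) ?S \<Gamma> (fO (l_functor K (M s)) ?I))"
   unfolding cominimality_comin[of U T K] using m.comin_iff_local[OF P R(1) R(3) loc] eq(1) by simp
  assume c: "colocal_to_global U T K ?S \<Gamma>"
  show "costratified U T K ?S \<Gamma> ?I \<longleftrightarrow> (\<forall>s\<in>?S. costratified U T (quotient_module T K (M s)) ?S \<Gamma> (fO (l_functor K (M s)) ?I))"
   unfolding costratified_costrat[of U T K] using m.costrat_iff_local[OF P R(1) R(3) loc ctg[OF c]] eq(2) by simp
 qed
qed

end
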